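(* There is an absolute constant $C>0$ such that for any integers $n\ge1$, $m\ge2$ and any $\delta\in(0,1)$, there is an efficient (polynomial-time) tester that uses $m'\le C\,m(\log m)^2\log(m/\delta)$ i.i.d. samples from an unknown distribution $\mathbf{p}$ supported on $[n]$ and satisfies: (completeness) if $\mathbf{p}=\mathbf{u}$, it outputs accept with probability at least $1-\delta$; (soundness) if $\mathbf{p}\neq\mathbf{u}$ and $\mathrm{opt}(\mathbf{p})\le m$, it outputs reject with probability at least $1-\delta$.
   Context: $\mathbf{u}$ is the uniform distribution on $[n]=\{1,\dots,n\}$. For a distribution $\mathbf{p}$ on $[n]$, $\mathcal{P}(\mathbf{p})$ is the set of distributions obtained from $\mathbf{p}$ by relabeling (permuting) the elements of $[n]$, and $\mathrm{opt}(\mathbf{p})$ is the minimum $t\in\mathbb{N}$ such that there exists a (possibly randomized) algorithm which, given $t$ i.i.d. samples, accepts $\mathbf{u}$ with probability at least $9/10$ and rejects every $\tilde{\mathbf{p}}\in\mathcal{P}(\mathbf{p})$ with probability at least $9/10$. *)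

theory Defs
  imports
    "HOL-Probability.Probability"
    "HOL-Combinatorics.Permutations"
    "HOL-Computational_Algebra.Polynomial"
    "HOL-Library.Extended_Nat"
    "HOL-Library.Log_Nat"
begin

section \<open>Distributions on \<open>{1..n}\<close> and the benchmark \<open>opt\<close>\<close>

definition dists :: "nat \<Rightarrow> nat pmf set" where
  "dists n = {p. set_pmf p \<subseteq> {1..n}}"

definition unif :: "nat \<Rightarrow> nat pmf" where
  "unif n = pmf_of_set {1..n}"

definition relabelings :: "nat \<Rightarrow> nat pmf \<Rightarrow> nat pmf set" where
  "relabelings n p = {map_pmf \<pi> p |\<pi>. \<pi> permutes {1..n}}"

text \<open>A randomized algorithm without any computational restriction is a kernel from samples
  to verdicts, with \<open>True\<close> meaning accept.\<close>

definition verdict :: "(nat list \<Rightarrow> bool pmf) \<Rightarrow> nat \<Rightarrow> nat pmf \<Rightarrow> bool pmf" where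
  "verdict A t p = bind_pmf (replicate_pmf t p) A"

text \<open>The infimum in \<^typ>\<open>enat\<close> is attained when some \<open>t\<close> qualifies, and is \<open>\<infinity>\<close> otherwise
  (which happens for \<open>p = unif n\<close>).\<close>

definition opt :: "nat \<Rightarrow> nat pmf \<Rightarrow> enat" where
  "opt n p = Inf {enat t |t. \<exists>A. pmf (verdict A t (unif n)) True \<ge> 9/10 \<and>
                              (\<forall>q\<in>relabelings n p. pmf (verdict A t q) False \<ge> 9/10)}"


section \<open>A randomized random-access machine with logarithmic cost\<close>

text \<open>Registers are indexed by \<^typ>\<open>nat\<close> and hold natural numbers. Besides its registers, the
  machine has three one-way input tapes: the samples, fair coin flips, and the binary expansion
  of the real parameter \<open>\<delta>\<close>. The last one is how a real number is handed to a discrete machine;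
  each digit read is paid for.\<close>

datatype com =
    Skip
  | Const nat nat
  | Add nat nat nat
  | Sub nat nat nat
  | Mul nat nat nat
  | Div nat nat nat
  | Load nat nat
  | Store nat nat
  | Sample nat
  | Flip nat
  | Digit nat
  | Seq com com
  | If nat com com
  | While nat com

text \<open>Registers, remaining samples, remaining coins, number of digits of \<open>\<delta>\<close> read so far.\<close>

type_synonym state = "(nat \<Rightarrow> nat) \<times> nat list \<times> bool list \<times> nat"

definition digit :: "real \<Rightarrow> nat \<Rightarrow> nat" where
  "digit \<delta> k = nat (\<lfloor>2 ^ k * \<delta>\<rfloor> mod 2)"

abbreviation len :: "nat \<Rightarrow> nat" where
  "len x \<equiv> floorlog 2 x"

text \<open>\<open>exec \<delta> c s t s'\<close>: started in \<open>s\<close>, the program \<open>c\<close> terminates in \<open>s'\<close> at cost \<open>t\<close>. Every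
  instruction costs one plus the bit lengths of the numbers it handles, including addresses
  obtained indirectly; this is what makes polynomial cost agree with polynomial time on a Turing
  machine although multiplication and division are primitive. Subtraction is truncated and
  division by zero gives zero. Reading beyond the end of the sample or coin tape blocks.\<close>

inductive exec :: "real \<Rightarrow> com \<Rightarrow> state \<Rightarrow> nat \<Rightarrow> state \<Rightarrow> bool" for \<delta> :: real where
  Skip: "exec \<delta> Skip s 1 s"
| Const: "exec \<delta> (Const i a) (R, xs, bs, k) (1 + len a) (R(i := a), xs, bs, k)"
| Add: "exec \<delta> (Add i j l) (R, xs, bs, k) (1 + len (R j) + len (R l))
          (R(i := R j + R l), xs, bs, k)"
| Sub: "exec \<delta> (Sub i j l) (R, xs, bs, k) (1 + len (R j) + len (R l))
          (R(i := R j - R l), xs, bs, k)"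
| Mul: "exec \<delta> (Mul i j l) (R, xs, bs, k) (1 + len (R j) + len (R l))
          (R(i := R j * R l), xs, bs, k)"
| Div: "exec \<delta> (Div i j l) (R, xs, bs, k) (1 + len (R j) + len (R l))
          (R(i := R j div R l), xs, bs, k)"
| Load: "exec \<delta> (Load i j) (R, xs, bs, k) (1 + len (R j) + len (R (R j)))
          (R(i := R (R j)), xs, bs, k)"
| Store: "exec \<delta> (Store i j) (R, xs, bs, k) (1 + len (R i) + len (R j))
          (R(R i := R j), xs, bs, k)"
| Sample: "exec \<delta> (Sample i) (R, x # xs, bs, k) (1 + len x) (R(i := x), xs, bs, k)"
| Flip: "exec \<delta> (Flip i) (R, xs, b # bs, k) 1 (R(i := of_bool b), xs, bs, k)"
| Digit: "exec \<delta> (Digit i) (R, xs, bs, k) 1 (R(i := digit \<delta> (Suc k)), xs, bs, Suc k)"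
| Seq: "exec \<delta> c s t s' \<Longrightarrow> exec \<delta> d s' t' s'' \<Longrightarrow> exec \<delta> (Seq c d) s (t + t') s''"
| IfTrue: "R i \<noteq> 0 \<Longrightarrow> exec \<delta> c (R, xs, bs, k) t s' \<Longrightarrow>
          exec \<delta> (If i c d) (R, xs, bs, k) (1 + len (R i) + t) s'"
| IfFalse: "R i = 0 \<Longrightarrow> exec \<delta> d (R, xs, bs, k) t s' \<Longrightarrow>
          exec \<delta> (If i c d) (R, xs, bs, k) (1 + t) s'"
| WhileTrue: "R i \<noteq> 0 \<Longrightarrow> exec \<delta> c (R, xs, bs, k) t s' \<Longrightarrow> exec \<delta> (While i c) s' t' s'' \<Longrightarrow>
          exec \<delta> (While i c) (R, xs, bs, k) (1 + len (R i) + t + t') s''"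
| WhileFalse: "R i = 0 \<Longrightarrow> exec \<delta> (While i c) (R, xs, bs, k) 1 (R, xs, bs, k)"

inductive_cases exec_cases:
  "exec \<delta> Skip s t s'"
  "exec \<delta> (Const i a) s t s'"
  "exec \<delta> (Add i j l) s t s'"
  "exec \<delta> (Sub i j l) s t s'"
  "exec \<delta> (Mul i j l) s t s'"
  "exec \<delta> (Div i j l) s t s'"
  "exec \<delta> (Load i j) s t s'"
  "exec \<delta> (Store i j) s t s'"
  "exec \<delta> (Sample i) s t s'"
  "exec \<delta> (Flip i) s t s'"
  "exec \<delta> (Digit i) s t s'"
  "exec \<delta> (Seq c d) s t s'"
  "exec \<delta> (If i c d) s t s'"
  "exec \<delta> (While i c) s t s'"

lemma exec_deterministic:
  "exec \<delta> c s t s' \<Longrightarrow> exec \<delta> c s u s'' \<Longrightarrow> u = t \<and> s'' = s'"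
proof (induction arbitrary: u s'' rule: exec.induct)
  case (Seq c s t s' d t' s2)
  from Seq.prems obtain v v' r where r: "exec \<delta> c s v r" "exec \<delta> d r v' s''" "u = v + v'"
    by (elim exec_cases)
  from Seq.IH(1)[OF r(1)] have v: "v = t" "r = s'" by simp_all
  from Seq.IH(2)[OF r(2)[unfolded v]] show ?case using r(3) v by simp
next
  case (IfTrue R i c xs bs k t s' d)
  from IfTrue.prems IfTrue.hyps(1) obtain v where "exec \<delta> c (R, xs, bs, k) v s''"
    "u = 1 + len (R i) + v"
    by (elim exec_cases) simp_all
  with IfTrue.IH show ?case by simp
next
  case (IfFalse R i d xs bs k t s' c)
  from IfFalse.prems IfFalse.hyps(1) obtain v where "exec \<delta> d (R, xs, bs, k) v s''" "u = 1 + v"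
    by (elim exec_cases) simp_all
  with IfFalse.IH show ?case by simp
next
  case (WhileTrue R i c xs bs k t s' t' s2)
  from WhileTrue.prems obtain v v' r where r:
    "exec \<delta> c (R, xs, bs, k) v r" "exec \<delta> (While i c) r v' s''" "u = 1 + len (R i) + v + v'"
    by (rule exec_cases(14)) (use WhileTrue.hyps(1) in simp_all)
  from WhileTrue.IH(1)[OF r(1)] have v: "v = t" "r = s'" by simp_all
  from WhileTrue.IH(2)[OF r(2)[unfolded v]] show ?case using r(3) v by simp
next
  case (WhileFalse R i c xs bs k)
  from WhileFalse.prems show ?case
    by (rule exec_cases(14)) (use WhileFalse.hyps in simp_all)
qed (erule exec_cases; simp)+

text \<open>The integers \<open>n\<close> and \<open>m\<close> are supplied in registers 0 and 1, all other registers are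
  initially zero. The verdict is left in register 0, a nonzero value meaning accept.\<close>

definition run :: "com \<Rightarrow> nat \<Rightarrow> nat \<Rightarrow> real \<Rightarrow> nat list \<Rightarrow> bool list \<Rightarrow> nat \<Rightarrow> bool \<Rightarrow> bool" where
  "run c n m \<delta> xs bs t b \<longleftrightarrow>
     (\<exists>s'. exec \<delta> c ((\<lambda>_. 0)(0 := n, 1 := m), xs, bs, 0) t s' \<and> b = (fst s' 0 \<noteq> 0))"

text \<open>On all \<open>m'\<close>-tuples of samples from \<open>{1..n}\<close> and all sequences of \<open>r\<close> coin flips the program
  halts within cost \<open>T\<close>. Since empty tapes block, it then draws at most \<open>m'\<close> samples.\<close>

definition halts_within :: "com \<Rightarrow> nat \<Rightarrow> nat \<Rightarrow> real \<Rightarrow> nat \<Rightarrow> nat \<Rightarrow> real \<Rightarrow> bool" where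
  "halts_within c n m \<delta> m' r T \<longleftrightarrow>
     (\<forall>xs bs. length xs = m' \<and> set xs \<subseteq> {1..n} \<and> length bs = r \<longrightarrow>
        (\<exists>t b. run c n m \<delta> xs bs t b \<and> real t \<le> T))"

definition prob_output :: "com \<Rightarrow> nat \<Rightarrow> nat \<Rightarrow> real \<Rightarrow> nat \<Rightarrow> nat \<Rightarrow> nat pmf \<Rightarrow> bool \<Rightarrow> real" where
  "prob_output c n m \<delta> m' r p b =
     measure_pmf.prob (pair_pmf (replicate_pmf m' p) (replicate_pmf r (bernoulli_pmf (1/2))))
       {(xs, bs). \<exists>t. run c n m \<delta> xs bs t b}"

end

theory Submission
  imports Defs
begin

text \<open>
  Put \<open>\<mu> = 8 m\<close>, \<open>lam = \<mu> / n\<close> and \<open>\<alpha> i = \<mu> p i - lam\<close>.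

  Lower bound. A distinguisher with at most \<open>m\<close> samples also works on a Poisson(\<open>\<mu>\<close>) number of
  samples. Restricted to samples in which every element occurs fewer than \<open>K\<close> times,
  Cauchy-Schwarz bounds its power by the average over random permutations \<open>\<pi>\<close> of a product over
  \<open>i\<close> of a kernel in \<open>\<alpha> i\<close> and \<open>\<alpha> (\<pi> i)\<close>. Random permutations are negatively associated, so this
  average is controlled by the row averages of the kernel, in which the linear terms cancel because
  \<open>\<alpha>\<close> sums to zero. What remains are the quantities \<open>(\<Sum>i. \<alpha> i ^ k)\<^sup>2 / (n lam ^ k k!)\<close>.

  Tester. With \<open>O(m log m)\<close> samples a large \<open>\<alpha> i\<close> shows in the number of occurrences of \<open>i\<close>, and a
  large \<open>k\<close>-th moment shows in the number of \<open>k\<close>-fold collisions. Both are compared with their exact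
  mean under the uniform distribution by Chebyshev's inequality. Each of the polynomially many tests
  is amplified by a majority vote over \<open>O(log (m / \<delta>))\<close> blocks of samples. For \<open>n\<close> beyond
  \<open>512 m\<^sup>2\<close> pairwise collisions suffice, so only polynomially many elements are ever inspected.
\<close>

section \<open>Averages over permutations\<close>

text \<open>The obstacle is a sparse alphabet: for \<open>lam\<close> far below 1 the untruncated
  kernel \<open>exp (a * b / lam)\<close> is enormous at a few heavy elements. Discarding samples
  with \<open>K\<close> equal entries turns it into a polynomial of degree below \<open>K\<close>,
  at the price of the expected number of \<open>K\<close>-fold collisions. So \<open>K\<close> is
  the first order at which collisions are rare under the uniform distribution. It is at most of
  order \<open>log m\<close>, and for \<open>k < K\<close> the quantity \<open>n * lam ^ k\<close>
  exceeds \<open>2 ^ -k / 4\<close>, which keeps the denominators above from being small. Separating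
  increasing from decreasing rows costs Young exponents \<open>N / (N - 1)\<close> and
  \<open>N\<close> with \<open>N\<close> of order \<open>log m\<close>. They demand
  \<open>\<alpha> i \<le> 1 / N\<close>, and the factorials are paid by
  \<open>fact k \<le> N ^ k\<close>; both force blocks of \<open>2 ^ 28 * N * 8 m\<close> samples,
  which is where the \<open>log m\<close> in the block size comes from. This concerns
  \<open>lam < 1 / N\<close>. For larger \<open>lam\<close> the element tests bound every
  \<open>\<alpha> i * \<alpha> j / lam\<close>, and the exponents 2 and 2 do. For
  \<open>n \<ge> 512 m^2\<close> already \<open>K = 2\<close> works, where the kernel is linear and
  increasing in every row.\<close>

lemma sum_Chebyshev_opposite:
  fixes f h :: "'a \<Rightarrow> real"
  assumes "\<And>j k. j \<in> S \<Longrightarrow> k \<in> S \<Longrightarrow> (f j - f k) * (h j - h k) \<le> 0"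
  shows "real (card S) * (\<Sum>j\<in>S. f j * h j) \<le> (\<Sum>j\<in>S. f j) * (\<Sum>j\<in>S. h j)"
proof -
  have "(\<Sum>j\<in>S. \<Sum>k\<in>S. (f j - f k) * (h j - h k)) \<le> 0"
    using assms by (intro sum_nonpos) auto
  also have "(\<Sum>j\<in>S. \<Sum>k\<in>S. (f j - f k) * (h j - h k)) =
      (\<Sum>j\<in>S. \<Sum>k\<in>S. f j * h j) + (\<Sum>j\<in>S. \<Sum>k\<in>S. f k * h k)
      - (\<Sum>j\<in>S. \<Sum>k\<in>S. f j * h k) - (\<Sum>j\<in>S. \<Sum>k\<in>S. f k * h j)"
    by (simp add: algebra_simps sum.distrib sum_subtractf)
  also have "(\<Sum>j\<in>S. \<Sum>k\<in>S. f j * h j) = real (card S) * (\<Sum>j\<in>S. f j * h j)"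
    by (simp add: sum_distrib_left)
  also have "(\<Sum>j\<in>S. \<Sum>k\<in>S. f k * h k) = real (card S) * (\<Sum>j\<in>S. f j * h j)"
    by simp
  also have "(\<Sum>j\<in>S. \<Sum>k\<in>S. f j * h k) = (\<Sum>j\<in>S. f j) * (\<Sum>j\<in>S. h j)"
    by (simp add: sum_product)
  also have "(\<Sum>j\<in>S. \<Sum>k\<in>S. f k * h j) = (\<Sum>j\<in>S. f j) * (\<Sum>j\<in>S. h j)"
    by (subst sum.swap) (simp add: sum_product)
  finally show ?thesis by simp
qed

text \<open>Negative association of the entries of a random permutation. The conditional expectation of the
  remaining rows, given the value \<open>j\<close> of one row, is decreasing in \<open>w j\<close>, as the transposition of two
  values shows; hence Chebyshev's sum inequality splits off that row.\<close>

lemma sum_permutations_prod_le: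
  fixes f :: "'a \<Rightarrow> 'a \<Rightarrow> real" and w :: "'a \<Rightarrow> real"
  assumes fin: "finite S" and ne: "S \<noteq> {}" and I: "I \<subseteq> S"
    and nonneg: "\<And>i j. i \<in> I \<Longrightarrow> j \<in> S \<Longrightarrow> 0 \<le> f i j"
    and mono: "\<And>i j k. i \<in> I \<Longrightarrow> j \<in> S \<Longrightarrow> k \<in> S \<Longrightarrow> w j \<le> w k \<Longrightarrow> f i j \<le> f i k"
  shows "(\<Sum>\<pi> | \<pi> permutes S. \<Prod>i\<in>I. f i (\<pi> i)) \<le>
           fact (card S) * (\<Prod>i\<in>I. (\<Sum>j\<in>S. f i j) / real (card S))"
proof -
  have "finite I" using I fin finite_subset by blast
  then show ?thesis using I nonneg mono
  proof (induction I)
    case empty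
    have "card {\<pi>. \<pi> permutes S} = fact (card S)"
      by (rule card_permutations) (use fin in auto)
    then have "real (card {\<pi>. \<pi> permutes S}) = fact (card S)" by simp
    then show ?case by simp
  next
    case (insert i0 I)
    define P where "P = {\<pi>. \<pi> permutes S}"
    define H where "H j = (\<Sum>\<pi> | \<pi> \<in> P \<and> \<pi> i0 = j. \<Prod>i\<in>I. f i (\<pi> i))" for j
    have finP: "finite P" unfolding P_def using fin by (rule finite_permutations)
    have i0: "i0 \<in> S" using insert.prems by auto
    have split: "(\<Sum>\<pi>\<in>P. g \<pi>) = (\<Sum>j\<in>S. \<Sum>\<pi> | \<pi> \<in> P \<and> \<pi> i0 = j. g \<pi>)" for g :: "_ \<Rightarrow> real"
      using i0 by (intro sum.group[symmetric] finP fin) (auto simp: P_def permutes_in_image)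
    have H_anti: "H k \<le> H j" if "j \<in> S" "k \<in> S" "w j \<le> w k" for j k
    proof -
      let ?t = "Transposition.transpose j k"
      have t: "?t permutes S" using that by (intro permutes_swap_id)
      have "H k = (\<Sum>\<pi> | \<pi> \<in> P \<and> \<pi> i0 = k. \<Prod>i\<in>I. f i (\<pi> i))"
        by (simp add: H_def)
      \<comment> \<open>By injectivity \<open>\<pi> i \<noteq> k\<close> for
        \<open>i \<noteq> i0\<close>, so the swap either fixes \<open>\<pi> i\<close> or turns
        \<open>j\<close> into \<open>k\<close>, which can only increase the row.\<close>
      also have "\<dots> \<le> (\<Sum>\<pi> | \<pi> \<in> P \<and> \<pi> i0 = k. \<Prod>i\<in>I. f i ((?t \<circ> \<pi>) i))"
      proof (intro sum_mono prod_mono conjI)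
        fix \<pi> i assume pi: "\<pi> \<in> {\<pi> \<in> P. \<pi> i0 = k}" and i: "i \<in> I"
        have perm: "\<pi> permutes S" using pi by (simp add: P_def)
        have iS: "i \<in> S" using i insert.prems(1) by auto
        have piS: "\<pi> i \<in> S" using permutes_in_image[OF perm] iS by blast
        show "0 \<le> f i (\<pi> i)" using i piS insert.prems by auto
        have "\<pi> i \<noteq> k"
        proof
          assume "\<pi> i = k"
          then have "\<pi> i = \<pi> i0" using pi by simp
          then have "i = i0" using permutes_inj[OF perm] by (simp add: inj_eq)
          then show False using i insert.hyps by simp
        qed
        then show "f i (\<pi> i) \<le> f i ((?t \<circ> \<pi>) i)"
          using insert.prems(3)[of i "\<pi> i" "?t (\<pi> i)"] i that piS
          by (auto simp: Transposition.transpose_def)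
      qed
      also have "\<dots> = (\<Sum>\<pi> | \<pi> \<in> P \<and> \<pi> i0 = j. \<Prod>i\<in>I. f i (\<pi> i))"
        by (rule sum.reindex_bij_witness[where i="\<lambda>\<pi>. ?t \<circ> \<pi>" and j="\<lambda>\<pi>. ?t \<circ> \<pi>"])
           (auto simp: P_def permutes_compose[OF _ t] comp_assoc[symmetric] simp flip: o_assoc)
      finally show ?thesis by (simp add: H_def)
    qed
    have cheb: "real (card S) * (\<Sum>j\<in>S. f i0 j * H j) \<le> (\<Sum>j\<in>S. f i0 j) * (\<Sum>j\<in>S. H j)"
    proof (rule sum_Chebyshev_opposite)
      fix j k assume jk: "j \<in> S" "k \<in> S"
      show "(f i0 j - f i0 k) * (H j - H k) \<le> 0"
      proof (cases "w j \<le> w k")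
        case True
        then show ?thesis using H_anti[of j k] insert.prems(3)[of i0 j k] jk
          by (intro mult_nonpos_nonneg) auto
      next
        case False
        then show ?thesis using H_anti[of k j] insert.prems(3)[of i0 k j] jk
          by (intro mult_nonneg_nonpos) auto
      qed
    qed
    have cpos: "real (card S) > 0" using fin ne by (simp add: card_gt_0_iff)
    have "(\<Sum>\<pi>\<in>P. \<Prod>i\<in>insert i0 I. f i (\<pi> i)) = (\<Sum>\<pi>\<in>P. f i0 (\<pi> i0) * (\<Prod>i\<in>I. f i (\<pi> i)))"
      using insert.hyps by simp
    also have "\<dots> = (\<Sum>j\<in>S. f i0 j * H j)"
      unfolding split H_def by (auto simp: sum_distrib_left intro!: sum.cong)
    also have "\<dots> \<le> (\<Sum>j\<in>S. f i0 j) / real (card S) * (\<Sum>j\<in>S. H j)"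
      using cheb cpos by (simp add: field_simps)
    also have "(\<Sum>j\<in>S. H j) = (\<Sum>\<pi>\<in>P. \<Prod>i\<in>I. f i (\<pi> i))"
      unfolding split H_def by simp
    also have "(\<Sum>j\<in>S. f i0 j) / real (card S) * (\<Sum>\<pi>\<in>P. \<Prod>i\<in>I. f i (\<pi> i)) \<le>
       (\<Sum>j\<in>S. f i0 j) / real (card S) * (fact (card S) * (\<Prod>i\<in>I. (\<Sum>j\<in>S. f i j) / real (card S)))"
      using insert.IH insert.prems unfolding P_def
      by (intro mult_left_mono divide_nonneg_nonneg sum_nonneg) auto
    finally show ?case using insert.hyps by (simp add: P_def mult_ac)
  qed
qed

text \<open>Young's inequality separates the rows increasing in \<open>w\<close> from those decreasing in \<open>w\<close>. Exponents
  other than \<open>q = q' = 2\<close> are needed below because squaring a truncated exponential doubles its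
  degree, and the moments of higher degree are not controlled.\<close>

lemma sum_permutations_prod_le_exp:
  fixes F :: "'a \<Rightarrow> 'a \<Rightarrow> real" and w :: "'a \<Rightarrow> real" and q q' :: real
  assumes fin: "finite S" and ne: "S \<noteq> {}" and S: "S = P \<union> M" and disj: "P \<inter> M = {}"
    and pos: "\<And>i j. i \<in> S \<Longrightarrow> j \<in> S \<Longrightarrow> 0 < F i j"
    and incr: "\<And>i j k. i \<in> P \<Longrightarrow> j \<in> S \<Longrightarrow> k \<in> S \<Longrightarrow> w j \<le> w k \<Longrightarrow> F i j \<le> F i k"
    and decr: "\<And>i j k. i \<in> M \<Longrightarrow> j \<in> S \<Longrightarrow> k \<in> S \<Longrightarrow> w j \<le> w k \<Longrightarrow> F i k \<le> F i j"
    and q: "q > 1" "q' > 1" "1 / q + 1 / q' = 1"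
    and P: "(\<Sum>i\<in>P. (\<Sum>j\<in>S. F i j powr q) / real (card S) - 1) \<le> 1"
    and M: "(\<Sum>i\<in>M. (\<Sum>j\<in>S. F i j powr q') / real (card S) - 1) \<le> 1"
  shows "(\<Sum>\<pi> | \<pi> permutes S. \<Prod>i\<in>S. F i (\<pi> i)) \<le> fact (card S) * exp 1"
proof -
  have finPM: "finite P" "finite M" using fin S by auto
  have bound: "(\<Sum>\<pi> | \<pi> permutes S. \<Prod>i\<in>I. f i (\<pi> i)) \<le> fact (card S) * exp 1"
    if "I \<subseteq> S" and f0: "\<And>i j. i \<in> I \<Longrightarrow> j \<in> S \<Longrightarrow> 0 \<le> f i j"
      and m: "\<And>i j k. i \<in> I \<Longrightarrow> j \<in> S \<Longrightarrow> k \<in> S \<Longrightarrow> v j \<le> v k \<Longrightarrow> f i j \<le> f i k"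
      and le: "(\<Sum>i\<in>I. (\<Sum>j\<in>S. f i j) / real (card S) - 1) \<le> 1"
    for I and f :: "'a \<Rightarrow> 'a \<Rightarrow> real" and v :: "'a \<Rightarrow> real"
  proof -
    have finI: "finite I" using that(1) fin finite_subset by blast
    have "(\<Sum>\<pi> | \<pi> permutes S. \<Prod>i\<in>I. f i (\<pi> i)) \<le>
           fact (card S) * (\<Prod>i\<in>I. (\<Sum>j\<in>S. f i j) / real (card S))"
      by (rule sum_permutations_prod_le[of S I f v]) (use that fin ne in auto)
    \<comment> \<open>Each row average is 1 plus an excess, so the product is at most the
      exponential of the total excess; this is why the hypotheses bound sums of averages minus
      1.\<close>
    also have "(\<Prod>i\<in>I. (\<Sum>j\<in>S. f i j) / real (card S)) \<le>
          (\<Prod>i\<in>I. exp ((\<Sum>j\<in>S. f i j) / real (card S) - 1))"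
    proof (intro prod_mono conjI)
      fix i assume "i \<in> I"
      then show "0 \<le> (\<Sum>j\<in>S. f i j) / real (card S)"
        by (intro divide_nonneg_nonneg sum_nonneg f0) auto
      show "(\<Sum>j\<in>S. f i j) / real (card S) \<le> exp ((\<Sum>j\<in>S. f i j) / real (card S) - 1)"
        using exp_ge_add_one_self[of "(\<Sum>j\<in>S. f i j) / real (card S) - 1"] by simp
    qed
    also have "\<dots> = exp (\<Sum>i\<in>I. (\<Sum>j\<in>S. f i j) / real (card S) - 1)"
      by (simp add: exp_sum finI)
    also have "\<dots> \<le> exp 1" using le by simp
    finally show ?thesis by simp
  qed
  have "(\<Sum>\<pi> | \<pi> permutes S. \<Prod>i\<in>S. F i (\<pi> i)) \<le>
      (\<Sum>\<pi> | \<pi> permutes S. (\<Prod>i\<in>P. F i (\<pi> i) powr q) / q + (\<Prod>i\<in>M. F i (\<pi> i) powr q') / q')"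
  proof (intro sum_mono)
    fix \<pi> assume "\<pi> \<in> {\<pi>. \<pi> permutes S}"
    then have perm: "\<pi> permutes S" by simp
    have p0: "0 < F i (\<pi> i)" if "i \<in> S" for i
      using pos permutes_in_image[OF perm] that by auto
    have "(\<Prod>i\<in>S. F i (\<pi> i)) = (\<Prod>i\<in>P. F i (\<pi> i)) * (\<Prod>i\<in>M. F i (\<pi> i))"
      unfolding S by (rule prod.union_disjoint) (use finPM disj in auto)
    also have "\<dots> \<le> (\<Prod>i\<in>P. F i (\<pi> i)) powr q / q + (\<Prod>i\<in>M. F i (\<pi> i)) powr q' / q'"
      using q p0 S by (intro Youngs_inequality prod_nonneg) (auto intro: less_imp_le)
    also have "(\<Prod>i\<in>P. F i (\<pi> i)) powr q = (\<Prod>i\<in>P. F i (\<pi> i) powr q)"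
      using p0 S by (subst prod_powr_distrib) (auto intro: less_imp_le)
    also have "(\<Prod>i\<in>M. F i (\<pi> i)) powr q' = (\<Prod>i\<in>M. F i (\<pi> i) powr q')"
      using p0 S by (subst prod_powr_distrib) (auto intro: less_imp_le)
    finally show "(\<Prod>i\<in>S. F i (\<pi> i)) \<le> (\<Prod>i\<in>P. F i (\<pi> i) powr q) / q + (\<Prod>i\<in>M. F i (\<pi> i) powr q') / q'" .
  qed
  also have "\<dots> = (\<Sum>\<pi> | \<pi> permutes S. \<Prod>i\<in>P. F i (\<pi> i) powr q) / q
      + (\<Sum>\<pi> | \<pi> permutes S. \<Prod>i\<in>M. F i (\<pi> i) powr q') / q'"
    by (simp add: sum.distrib sum_divide_distrib)
  also have "\<dots> \<le> fact (card S) * exp 1 / q + fact (card S) * exp 1 / q'"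
  proof (intro add_mono divide_right_mono)
    show "(\<Sum>\<pi> | \<pi> permutes S. \<Prod>i\<in>P. F i (\<pi> i) powr q) \<le> fact (card S) * exp 1"
      using q P S by (intro bound[where v=w]) (auto intro!: powr_mono2 incr less_imp_le[OF pos])
    show "(\<Sum>\<pi> | \<pi> permutes S. \<Prod>i\<in>M. F i (\<pi> i) powr q') \<le> fact (card S) * exp 1"
      using q M S by (intro bound[where v="\<lambda>j. - w j"]) (auto intro!: powr_mono2 decr less_imp_le[OF pos])
  qed (use q in auto)
  also have "\<dots> = fact (card S) * exp 1 * (1 / q + 1 / q')" by (simp add: algebra_simps)
  finally show ?thesis using q by simp
qed

section \<open>Lists with bounded multiplicities\<close>

lemma finite_lists_counts_less:
  assumes "finite S"
  shows "finite {x. set x \<subseteq> S \<and> (\<forall>v\<in>S. count_list x v < K)}"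
proof (rule finite_subset)
  show "{x. set x \<subseteq> S \<and> (\<forall>v\<in>S. count_list x v < K)} \<subseteq> {x. set x \<subseteq> S \<and> length x \<le> card S * K}"
  proof safe
    fix x assume x: "set x \<subseteq> S" "\<forall>v\<in>S. count_list x v < K"
    have "length x = (\<Sum>v\<in>S. count_list x v)" using x assms
      by (simp add: sum_count_set)
    also have "\<dots> \<le> (\<Sum>v\<in>S. K)" using x by (intro sum_mono) (auto intro: less_imp_le)
    finally show "length x \<le> card S * K" by simp
  qed
  show "finite {x. set x \<subseteq> S \<and> length x \<le> card S * K}" using assms by (rule finite_lists_length_le)
qed

text \<open>Group the lists by their vector \<open>c\<close> of counts. A vector is realized by a
  multinomial number of lists, whose numerator cancels \<open>fact (length x)\<close> and whose
  denominator supplies the factorials on the right. This is the finite form of the independence of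
  Poissonized counts: a bound on every count truncates every factor separately.\<close>

lemma sum_lists_counts_less:
  fixes b :: "'a \<Rightarrow> real"
  assumes fin: "finite S"
  shows "(\<Sum>x | set x \<subseteq> S \<and> (\<forall>v\<in>S. count_list x v < K). (\<Prod>v\<in>S. b v ^ count_list x v) / fact (length x))
          = (\<Prod>v\<in>S. \<Sum>c<K. b v ^ c / fact c)"
proof -
  define X where "X = {x. set x \<subseteq> S \<and> (\<forall>v\<in>S. count_list x v < K)}"
  have finX: "finite X" unfolding X_def using fin by (rule finite_lists_counts_less)
  have inner: "(\<Sum>x | x \<in> X \<and> restrict (count_list x) S = c. (\<Prod>v\<in>S. b v ^ count_list x v) / fact (length x))
     = (\<Prod>v\<in>S. b v ^ c v / fact (c v))" if c: "c \<in> S \<rightarrow>\<^sub>E {..<K}" for c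
  proof -
    define M where "M = (\<Sum>v\<in>S. replicate_mset (c v) v)"
    have cM: "count M v = (if v \<in> S then c v else 0)" for v
      unfolding M_def using fin by (simp add: count_sum sum.delta' if_distrib cong: if_cong)
    have M: "set_mset M \<subseteq> S" using cM by (metis count_eq_zero_iff subsetI)
    have size: "size M = (\<Sum>v\<in>S. c v)" by (simp add: M_def size_multiset_sum)
    have "{x. x \<in> X \<and> restrict (count_list x) S = c} = permutations_of_multiset M"
    proof (intro set_eqI iffI)
      fix x assume x: "x \<in> {x. x \<in> X \<and> restrict (count_list x) S = c}"
      have "mset x = M"
      proof (rule multiset_eqI)
        fix v show "count (mset x) v = count M v"
          using x by (auto simp: X_def cM count_mset count_list_0_iff)
      qed
      then show "x \<in> permutations_of_multiset M" by (simp add: permutations_of_multiset_def)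
    next
      fix x assume "x \<in> permutations_of_multiset M"
      then have x: "mset x = M" by (simp add: permutations_of_multiset_def)
      then have cx: "count_list x v = (if v \<in> S then c v else 0)" for v
        using cM[of v] by (metis count_mset)
      have "set x \<subseteq> S" using x M by (metis set_mset_mset)
      moreover have "restrict (count_list x) S = c"
        using c cx by (auto simp: restrict_def PiE_def extensional_def)
      ultimately show "x \<in> {x. x \<in> X \<and> restrict (count_list x) S = c}"
        using cx c by (auto simp: X_def PiE_def Pi_def)
    qed
    moreover have "(\<Prod>v\<in>S. b v ^ count_list x v) / fact (length x) = (\<Prod>v\<in>S. b v ^ c v) / fact (size M)"
      if "x \<in> permutations_of_multiset M" for x
    proof -
      have x: "mset x = M" using that by (simp add: permutations_of_multiset_def)
      then have "count_list x v = c v" if "v \<in> S" for v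
        using cM[of v] that by (metis count_mset)
      then show ?thesis using x by (metis (no_types, lifting) prod.cong size_mset)
    qed
    ultimately have eq: "(\<Sum>x | x \<in> X \<and> restrict (count_list x) S = c. (\<Prod>v\<in>S. b v ^ count_list x v) / fact (length x))
       = real (card (permutations_of_multiset M)) * ((\<Prod>v\<in>S. b v ^ c v) / fact (size M))"
      by simp
    have "real (card (permutations_of_multiset M)) * (\<Prod>v\<in>set_mset M. fact (count M v)) = fact (size M)"
    proof -
      have "real (card (permutations_of_multiset M) * (\<Prod>v\<in>set_mset M. fact (count M v))) = real (fact (size M))"
        by (rule arg_cong[OF card_permutations_of_multiset_aux])
      then show ?thesis by (simp only: of_nat_mult of_nat_prod of_nat_fact)
    qed
    moreover have "(\<Prod>v\<in>set_mset M. fact (count M v)) = (\<Prod>v\<in>S. fact (c v) :: real)"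
      by (rule prod.mono_neutral_cong_left) (use M fin cM in \<open>auto simp: not_in_iff\<close>)
    ultimately have "real (card (permutations_of_multiset M)) * (\<Prod>v\<in>S. fact (c v)) = fact (size M)"
      by simp
    moreover have "(\<Prod>v\<in>S. fact (c v) :: real) > 0" by (intro prod_pos) auto
    ultimately have "real (card (permutations_of_multiset M)) = fact (size M) / (\<Prod>v\<in>S. fact (c v))"
      by (simp add: field_simps)
    then show ?thesis by (simp add: eq prod_dividef)
  qed
  have "(\<Sum>x\<in>X. (\<Prod>v\<in>S. b v ^ count_list x v) / fact (length x)) =
     (\<Sum>c\<in>S \<rightarrow>\<^sub>E {..<K}. \<Sum>x | x \<in> X \<and> restrict (count_list x) S = c. (\<Prod>v\<in>S. b v ^ count_list x v) / fact (length x))"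
    by (intro sum.group[symmetric] finX finite_PiE fin) (auto simp: X_def)
  also have "\<dots> = (\<Sum>c\<in>S \<rightarrow>\<^sub>E {..<K}. \<Prod>v\<in>S. b v ^ c v / fact (c v))"
    using inner by (intro sum.cong) auto
  also have "\<dots> = (\<Prod>v\<in>S. \<Sum>c<K. b v ^ c / fact c)"
    using fin by (subst prod_sum_PiE) auto
  finally show ?thesis by (simp add: X_def)
qed

section \<open>Moments of sample counts\<close>

abbreviation expect :: "'a pmf \<Rightarrow> ('a \<Rightarrow> real) \<Rightarrow> real" where
  "expect \<equiv> measure_pmf.expectation"

lemma finite_set_replicate_pmf:
  assumes "finite (set_pmf p)" shows "finite (set_pmf (replicate_pmf s p))"
  unfolding set_replicate_pmf using finite_lists_length_eq[OF assms, of s]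
  by (auto simp: lists_eq_set elim: rev_finite_subset)

lemma integrable_finite_pmf [simp]:
  "finite (set_pmf p) \<Longrightarrow> integrable (measure_pmf p) (f :: _ \<Rightarrow> real)"
  by (rule integrable_measure_pmf_finite)

lemma integrable_replicate_pmf [simp]:
  "finite (set_pmf p) \<Longrightarrow> integrable (measure_pmf (replicate_pmf s p)) (f :: _ \<Rightarrow> real)"
  by (intro integrable_measure_pmf_finite finite_set_replicate_pmf)

lemma expect_replicate_Suc:
  assumes "finite A" "set_pmf p \<subseteq> A"
  shows "expect (replicate_pmf (Suc s) p) f =
         (\<Sum>x\<in>A. pmf p x * expect (replicate_pmf s p) (\<lambda>xs. f (x # xs)))"
proof -
  have fin: "finite (set_pmf p)" using assms finite_subset by blast
  have "expect (replicate_pmf (Suc s) p) f =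
     (\<Sum>x\<in>A. pmf p x *\<^sub>R expect (replicate_pmf s p \<bind> (\<lambda>xs. return_pmf (x # xs))) f)"
    unfolding replicate_pmf.simps
    by (rule pmf_expectation_bind) (use assms fin in \<open>auto simp: finite_set_replicate_pmf\<close>)
  also have "\<dots> = (\<Sum>x\<in>A. pmf p x * expect (replicate_pmf s p) (\<lambda>xs. f (x # xs)))"
    by (simp flip: map_pmf_def)
  finally show ?thesis .
qed

lemma expect_replicate_add:
  assumes "finite (set_pmf p)"
  shows "expect (replicate_pmf (s + t) p) f =
         expect (replicate_pmf s p) (\<lambda>xs. expect (replicate_pmf t p) (\<lambda>ys. f (xs @ ys)))"
proof (induction s arbitrary: f)
  case (Suc s)
  have "expect (replicate_pmf (Suc (s + t)) p) f =
      (\<Sum>x\<in>set_pmf p. pmf p x * expect (replicate_pmf (s + t) p) (\<lambda>xs. f (x # xs)))"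
    by (rule expect_replicate_Suc) (use assms in auto)
  then show ?case by (simp add: Suc.IH expect_replicate_Suc[OF assms] del: replicate_pmf.simps)
qed simp

lemma pmf_replicate_pmf:
  assumes "finite S" "set x \<subseteq> S"
  shows "pmf (replicate_pmf (length x) p) x = (\<Prod>v\<in>S. pmf p v ^ count_list x v)"
  using assms(2)
proof (induction x)
  case (Cons y x)
  have "pmf (replicate_pmf (length (y # x)) p) (y # x) =
        pmf (map_pmf (\<lambda>(a, b). a # b) (pair_pmf p (replicate_pmf (length x) p))) ((\<lambda>(a, b). a # b) (y, x))"
    by (simp add: map_pmf_def pair_pmf_def bind_assoc_pmf bind_return_pmf)
  also have "\<dots> = pmf (pair_pmf p (replicate_pmf (length x) p)) (y, x)"
    by (rule pmf_map_inj') (auto simp: inj_def)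
  also have "\<dots> = pmf p y * (\<Prod>v\<in>S. pmf p v ^ count_list x v)"
    using Cons by (simp add: pmf_pair)
  also have "\<dots> = (\<Prod>v\<in>S. (if v = y then pmf p v else 1)) * (\<Prod>v\<in>S. pmf p v ^ count_list x v)"
    using Cons assms(1) by simp
  also have "\<dots> = (\<Prod>v\<in>S. pmf p v ^ count_list (y # x) v)"
    by (subst prod.distrib[symmetric]) (auto intro!: prod.cong)
  finally show ?case .
qed simp

text \<open>Pascal's rule for ordered pairs of disjoint sets of positions with \<open>Suc a\<close>
  and \<open>Suc b\<close> elements: the first position lies in neither set, in the first or in the
  second.\<close>

lemma binomial_two_step:
  "(Suc s choose (Suc a + Suc b)) * ((Suc a + Suc b) choose Suc a) =
   (s choose (Suc a + Suc b)) * ((Suc a + Suc b) choose Suc a)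
   + (s choose (a + Suc b)) * ((a + Suc b) choose a)
   + (s choose (Suc a + b)) * ((Suc a + b) choose Suc a)"
  by (simp add: algebra_simps)

text \<open>Joint factorial moments of a multinomial vector: each disjoint pair of an
  \<open>a\<close>-set and a \<open>b\<close>-set of positions shows only \<open>i\<close> and only
  \<open>j\<close> with probability \<open>pmf p i ^ a * pmf p j ^ b\<close>. The induction
  conditions on the first sample.\<close>

lemma expect_binomial_counts:
  assumes "finite A" "set_pmf p \<subseteq> A" "i \<in> A" "j \<in> A" "i \<noteq> j"
  shows "expect (replicate_pmf s p)
          (\<lambda>xs. real (count_list xs i choose a) * real (count_list xs j choose b)) =
         real ((s choose (a + b)) * ((a + b) choose a)) * pmf p i ^ a * pmf p j ^ b"
proof (induction s arbitrary: a b)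
  case 0
  then show ?case by (cases a; cases b) auto
next
  case (Suc s)
  note fin = finite_subset[OF assms(2,1)]
  define E where "E a b = expect (replicate_pmf s p)
     (\<lambda>xs. real (count_list xs i choose a) * real (count_list xs j choose b))" for a b
  have one: "(\<Sum>x\<in>A. pmf p x) = 1" using assms by (intro sum_pmf_eq_1) auto
  have E': "expect (replicate_pmf (Suc s) p)
       (\<lambda>xs. real (count_list xs i choose a) * real (count_list xs j choose b))
      = E a b + pmf p i * (if a = 0 then 0 else E (a - 1) b)
        + pmf p j * (if b = 0 then 0 else E a (b - 1))" (is "?L = ?R")
  proof -
    have "?L = (\<Sum>x\<in>A. pmf p x * expect (replicate_pmf s p) (\<lambda>xs.
        real (count_list (x # xs) i choose a) * real (count_list (x # xs) j choose b)))"
      by (rule expect_replicate_Suc[OF assms(1,2)])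
    also have "\<dots> = (\<Sum>x\<in>A. pmf p x * (E a b + (if x = i then (if a = 0 then 0 else E (a - 1) b) else 0)
         + (if x = j then (if b = 0 then 0 else E a (b - 1)) else 0)))"
    proof (intro sum.cong refl arg_cong2[of _ _ _ _ "(*)"])
      fix x
      show "expect (replicate_pmf s p) (\<lambda>xs.
        real (count_list (x # xs) i choose a) * real (count_list (x # xs) j choose b)) =
        (E a b + (if x = i then (if a = 0 then 0 else E (a - 1) b) else 0)
         + (if x = j then (if b = 0 then 0 else E a (b - 1)) else 0))"
        using assms(5) fin
        by (cases a; cases b) (auto simp: E_def algebra_simps simp flip: Bochner_Integration.integral_add)
    qed
    also have "\<dots> = (\<Sum>x\<in>A. pmf p x * E a b) + (\<Sum>x\<in>A. if x = i then pmf p i * (if a = 0 then 0 else E (a - 1) b) else 0)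
         + (\<Sum>x\<in>A. if x = j then pmf p j * (if b = 0 then 0 else E a (b - 1)) else 0)"
      unfolding sum.distrib[symmetric] by (intro sum.cong refl) (auto simp: algebra_simps)
    also have "\<dots> = ?R"
      using assms one by (simp flip: sum_distrib_right)
    finally show ?thesis .
  qed
  have IH: "E a b = real ((s choose (a + b)) * ((a + b) choose a)) * pmf p i ^ a * pmf p j ^ b" for a b
    unfolding E_def by (rule Suc.IH)
  show ?case unfolding E' IH
  proof (cases a; cases b)
    fix a' b' assume ab: "a = Suc a'" "b = Suc b'"
    show "real ((s choose (a + b)) * ((a + b) choose a)) * pmf p i ^ a * pmf p j ^ b
       + pmf p i * (if a = 0 then 0 else real ((s choose (a - 1 + b)) * ((a - 1 + b) choose (a - 1))) * pmf p i ^ (a - 1) * pmf p j ^ b)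
       + pmf p j * (if b = 0 then 0 else real ((s choose (a + (b - 1))) * ((a + (b - 1)) choose a)) * pmf p i ^ a * pmf p j ^ (b - 1))
       = real ((Suc s choose (a + b)) * ((a + b) choose a)) * pmf p i ^ a * pmf p j ^ b"
      unfolding ab binomial_two_step of_nat_add diff_Suc_1 by (simp add: algebra_simps)
  qed (auto simp: algebra_simps)
qed

lemma expect_binomial_count:
  assumes "finite A" "set_pmf p \<subseteq> A" "i \<in> A"
  shows "expect (replicate_pmf s p) (\<lambda>xs. real (count_list xs i choose a)) =
         real (s choose a) * pmf p i ^ a"
proof (induction s arbitrary: a)
  case 0
  then show ?case by (cases a) auto
next
  case (Suc s)
  note fin = finite_subset[OF assms(2,1)]
  have one: "(\<Sum>x\<in>A. pmf p x) = 1" using assms by (intro sum_pmf_eq_1) auto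
  show ?case
  proof (cases a)
    case (Suc b)
    have "expect (replicate_pmf (Suc s) p) (\<lambda>xs. real (count_list xs i choose a)) =
       (\<Sum>x\<in>A. pmf p x * expect (replicate_pmf s p) (\<lambda>xs. real (count_list (x # xs) i choose a)))"
      by (rule expect_replicate_Suc[OF assms(1,2)])
    also have "\<dots> = (\<Sum>x\<in>A. pmf p x * (real (s choose a) * pmf p i ^ a) + (if x = i then pmf p i * (real (s choose b) * pmf p i ^ b) else 0))"
      using fin by (intro sum.cong refl) (auto simp: Suc Suc.IH algebra_simps)
    also have "\<dots> = real (s choose a) * pmf p i ^ a + pmf p i * (real (s choose b) * pmf p i ^ b)"
      using assms one by (simp add: sum.distrib flip: sum_distrib_right)
    finally show ?thesis by (simp add: Suc algebra_simps)
  qed simp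
qed

section \<open>Indistinguishability of relabelings\<close>

definition truncexp :: "nat \<Rightarrow> real \<Rightarrow> real" where
  "truncexp K x = (\<Sum>c<K. x ^ c / fact c)"

lemma expect_take:
  assumes "finite (set_pmf p)" "t \<le> s"
  shows "expect (replicate_pmf s p) (\<lambda>x. g (take t x)) = expect (replicate_pmf t p) g"
proof -
  have "expect (replicate_pmf (t + (s - t)) p) (\<lambda>x. g (take t x)) =
     expect (replicate_pmf t p) (\<lambda>xs. expect (replicate_pmf (s - t) p) (\<lambda>ys. g (take t (xs @ ys))))"
    by (rule expect_replicate_add[OF assms(1)])
  also have "\<dots> = expect (replicate_pmf t p) g"
    by (intro integral_cong_AE AE_pmfI) (auto simp: set_replicate_pmf AE_measure_pmf_iff)
  finally show ?thesis using assms(2) by simp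
qed

text \<open>A discarded sample contains some element at least \<open>K\<close> times and so
  contributes at least 1 to the number of \<open>K\<close>-fold collisions, whose mean is the
  subtracted sum.\<close>

lemma expect_counts_less_ge:
  fixes g :: "nat list \<Rightarrow> real"
  assumes S: "finite S" "set_pmf q \<subseteq> S" and g: "\<And>x. 0 \<le> g x" "\<And>x. g x \<le> 1"
  shows "(\<Sum>x | set x \<subseteq> S \<and> length x = s \<and> (\<forall>v\<in>S. count_list x v < K).
            pmf (replicate_pmf s q) x * g x)
         \<ge> expect (replicate_pmf s q) g - (\<Sum>i\<in>S. real (s choose K) * pmf q i ^ K)"
proof -
  define X where "X = {x. set x \<subseteq> S \<and> length x = s \<and> (\<forall>v\<in>S. count_list x v < K)}"
  have finX: "finite X" using finite_lists_length_eq[OF S(1), of s]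
    by (auto simp: X_def elim: rev_finite_subset)
  have fin: "finite (set_pmf q)" using S finite_subset by blast
  have "expect (replicate_pmf s q) g \<le> expect (replicate_pmf s q)
      (\<lambda>x. indicator X x * g x + (\<Sum>i\<in>S. real (count_list x i choose K)))"
  proof (rule integral_mono_AE)
    show "AE x in measure_pmf (replicate_pmf s q). g x \<le> indicator X x * g x + (\<Sum>i\<in>S. real (count_list x i choose K))"
    proof (rule AE_pmfI)
      fix x assume "x \<in> set_pmf (replicate_pmf s q)"
      then have x: "set x \<subseteq> S" "length x = s" using S by (auto simp: set_replicate_pmf)
      show "g x \<le> indicator X x * g x + (\<Sum>i\<in>S. real (count_list x i choose K))"
      proof (cases "x \<in> X")
        case False
        then obtain v where v: "v \<in> S" "K \<le> count_list x v" using x by (auto simp: X_def not_less)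
        then have "1 \<le> count_list x v choose K" by (simp add: Suc_leI zero_less_binomial)
        then have "1 \<le> real (count_list x v choose K)" by simp
        also have "\<dots> \<le> (\<Sum>i\<in>S. real (count_list x i choose K))"
          by (rule member_le_sum) (use v S in auto)
        finally show ?thesis using g(2)[of x] False by simp
      qed (auto intro: sum_nonneg)
    qed
  qed (use fin in auto)
  also have "\<dots> = expect (replicate_pmf s q) (\<lambda>x. indicator X x * g x)
      + (\<Sum>i\<in>S. expect (replicate_pmf s q) (\<lambda>x. real (count_list x i choose K)))"
    using fin by (simp add: Bochner_Integration.integral_sum)
  also have "(\<Sum>i\<in>S. expect (replicate_pmf s q) (\<lambda>x. real (count_list x i choose K)))
      = (\<Sum>i\<in>S. real (s choose K) * pmf q i ^ K)"
    using S by (intro sum.cong refl expect_binomial_count)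
  also have "expect (replicate_pmf s q) (\<lambda>x. indicator X x * g x) =
      (\<Sum>x\<in>X. (indicator X x * g x) * pmf (replicate_pmf s q) x)"
    by (rule integral_measure_pmf_real[OF finX]) (auto split: split_indicator_asm)
  also have "\<dots> = (\<Sum>x\<in>X. pmf (replicate_pmf s q) x * g x)"
    by (intro sum.cong) auto
  finally show ?thesis by (simp add: X_def)
qed

section \<open>Poisson weights and Poissonized samples\<close>

definition pois :: "real \<Rightarrow> nat \<Rightarrow> real" where
  "pois \<mu> s = exp (- \<mu>) * \<mu> ^ s / fact s"

lemma pois_nonneg: "0 \<le> \<mu> \<Longrightarrow> 0 \<le> pois \<mu> s"
  by (simp add: pois_def)

lemma pois_sums: "pois \<mu> sums 1"
proof -
  have "(\<lambda>s. exp (- \<mu>) * (\<mu> ^ s /\<^sub>R fact s)) sums (exp (- \<mu>) * exp \<mu>)"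
    by (intro sums_mult exp_converges)
  then show ?thesis by (simp add: pois_def[abs_def] exp_minus divide_inverse mult_ac)
qed

lemma sum_pois_le_1: "0 \<le> \<mu> \<Longrightarrow> finite A \<Longrightarrow> sum (pois \<mu>) A \<le> 1"
  using sum_le_suminf[OF sums_summable[OF pois_sums], of A \<mu>] sums_unique[OF pois_sums, of \<mu>]
  by (auto simp: pois_nonneg)

text \<open>The \<open>K\<close>-th factorial moment of a Poisson variable: shifting the index by
  \<open>K\<close> turns \<open>pois \<mu> s * (s choose K)\<close> into
  \<open>\<mu> ^ K / fact K\<close> times a Poisson weight.\<close>

lemma sum_pois_binomial_le:
  assumes "0 \<le> \<mu>"
  shows "(\<Sum>s\<in>{t..Z}. pois \<mu> s * real (s choose K)) \<le> \<mu> ^ K / fact K"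
proof -
  have "(\<Sum>s\<in>{t..Z}. pois \<mu> s * real (s choose K)) \<le> (\<Sum>s\<in>{..K+Z}. pois \<mu> s * real (s choose K))"
    by (rule sum_mono2) (use assms in \<open>auto simp: pois_nonneg\<close>)
  also have "\<dots> = (\<Sum>s\<in>{K..K+Z}. pois \<mu> s * real (s choose K))"
    by (rule sum.mono_neutral_right) auto
  also have "\<dots> = (\<Sum>s\<in>{..Z}. pois \<mu> (s + K) * real ((s + K) choose K))"
    by (rule sum.reindex_bij_witness[where i="\<lambda>s. s + K" and j="\<lambda>s. s - K"]) auto
  also have "\<dots> = (\<Sum>s\<in>{..Z}. \<mu> ^ K / fact K * pois \<mu> s)"
    by (intro sum.cong refl)
       (simp add: pois_def binomial_fact power_add field_simps)
  also have "\<dots> = \<mu> ^ K / fact K * (\<Sum>s\<in>{..Z}. pois \<mu> s)" by (simp add: sum_distrib_left)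
  also have "\<dots> \<le> \<mu> ^ K / fact K * 1"
    using assms by (intro mult_left_mono sum_pois_le_1) auto
  finally show ?thesis by simp
qed

text \<open>Change of parameter from \<open>8 m\<close> to \<open>m\<close>: below \<open>m\<close>
  this costs at most \<open>8 ^ (m - 1)\<close>, and the normalizations leave
  \<open>exp (- 7 m)\<close>, where \<open>exp 7 \<ge> 2 ^ 7 = 128\<close>.\<close>

lemma sum_pois_small_le:
  assumes "m \<ge> 1" "t \<le> m"
  shows "(\<Sum>s<t. pois (8 * real m) s) \<le> 1 / 128"
proof -
  have "(\<Sum>s<t. pois (8 * real m) s) \<le> (\<Sum>s<t. exp (- 8 * real m) * 8 ^ (m - 1) * (real m ^ s / fact s))"
  proof (rule sum_mono)
    fix s assume "s \<in> {..<t}"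
    then have "(8::real) ^ s \<le> 8 ^ (m - 1)" using assms by (intro power_increasing) auto
    then show "pois (8 * real m) s \<le> exp (- 8 * real m) * 8 ^ (m - 1) * (real m ^ s / fact s)"
      by (simp add: pois_def power_mult_distrib divide_right_mono mult_right_mono)
  qed
  also have "\<dots> = exp (- 8 * real m) * 8 ^ (m - 1) * exp (real m) * (\<Sum>s<t. pois (real m) s)"
    by (simp add: pois_def sum_distrib_left exp_minus field_simps)
  also have "\<dots> \<le> exp (- 8 * real m) * 8 ^ (m - 1) * exp (real m) * 1"
    by (intro mult_left_mono sum_pois_le_1) auto
  also have "\<dots> = exp (- 7 * real m) * 8 ^ (m - 1)" by (simp flip: exp_add)
  also have "exp (- 7 * real m) = (exp (- 7)) ^ m" by (simp flip: exp_of_nat_mult add: mult.commute)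
  also have "\<dots> \<le> (1 / 128) ^ m"
  proof (rule power_mono)
    have "(2::real) ^ 7 \<le> exp 1 ^ 7" using exp_ge_add_one_self[of 1] by (intro power_mono) auto
    then have "128 \<le> exp (7::real)" by (simp flip: exp_of_nat_mult)
    then show "exp (- 7) \<le> (1 / 128 :: real)" by (simp add: exp_minus field_simps)
  qed auto
  also have "(1 / 128 :: real) ^ m * 8 ^ (m - 1) = 1 / 128 * (8 / 128) ^ (m - 1)"
  proof -
    have "(128::real) ^ k = 8 ^ k * 16 ^ k" for k by (simp flip: power_mult_distrib)
    then show ?thesis using assms by (cases m) (auto simp: power_divide)
  qed
  also have "\<dots> \<le> 1 / 128 * 1" by (intro mult_left_mono power_le_one) auto
  finally show ?thesis by simp
qed

text \<open>Relabeling by the inverse makes the new mass at \<open>v\<close> equal to the old mass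
  at \<open>\<pi> v\<close>, so that no inverse enters the products over \<open>v\<close>.\<close>

lemma pmf_map_permutes:
  assumes "\<pi> permutes S"
  shows "pmf (map_pmf (inv \<pi>) p) v = pmf p (\<pi> v)"
proof -
  have "pmf (map_pmf (inv \<pi>) p) (inv \<pi> (\<pi> v)) = pmf p (\<pi> v)"
    by (rule pmf_map_inj') (use permutes_inj[OF permutes_inv[OF assms]] in auto)
  then show ?thesis using permutes_inverses(2)[OF assms] by simp
qed

lemma relabelings_inv_permutes:
  assumes "\<pi> permutes {1..n}"
  shows "map_pmf (inv \<pi>) p \<in> relabelings n p"
  using permutes_inv[OF assms] by (auto simp: relabelings_def)

text \<open>Only the relative permutation matters: reindex the product by \<open>\<pi>\<close>, then
  replace \<open>\<sigma>\<close> by \<open>\<sigma> \<circ> \<pi>\<close>. The square of an average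
  over relabelings thereby becomes a single average.\<close>

lemma sum_permutations_pair:
  fixes G :: "'b \<Rightarrow> 'b \<Rightarrow> real"
  assumes "finite S"
  shows "(\<Sum>\<pi> | \<pi> permutes S. \<Sum>\<sigma> | \<sigma> permutes S. \<Prod>v\<in>S. G (a (\<pi> v)) (a (\<sigma> v))) =
         fact (card S) * (\<Sum>\<sigma> | \<sigma> permutes S. \<Prod>v\<in>S. G (a v) (a (\<sigma> v)))"
proof -
  have "(\<Sum>\<sigma> | \<sigma> permutes S. \<Prod>v\<in>S. G (a (\<pi> v)) (a (\<sigma> v))) =
        (\<Sum>\<sigma> | \<sigma> permutes S. \<Prod>v\<in>S. G (a v) (a (\<sigma> v)))" if p: "\<pi> permutes S" for \<pi>
  proof -
    have "(\<Sum>\<sigma> | \<sigma> permutes S. \<Prod>v\<in>S. G (a v) (a (\<sigma> v))) =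
          (\<Sum>\<sigma> | \<sigma> permutes S. \<Prod>v\<in>S. G (a (\<pi> v)) (a (\<sigma> (\<pi> v))))"
      by (intro sum.cong refl prod.permute[OF p, unfolded o_def])
    also have "\<dots> = (\<Sum>\<sigma> | \<sigma> permutes S. \<Prod>v\<in>S. G (a (\<pi> v)) (a (\<sigma> v)))"
      by (rule sum.reindex_bij_witness[where i="\<lambda>\<sigma>. \<sigma> \<circ> inv \<pi>" and j="\<lambda>\<sigma>. \<sigma> \<circ> \<pi>"])
         (use p in \<open>auto intro: permutes_compose permutes_inv simp: o_assoc[symmetric]
            permutes_inv_o[OF p]\<close>)
    finally show ?thesis by simp
  qed
  then have "(\<Sum>\<pi> | \<pi> permutes S. \<Sum>\<sigma> | \<sigma> permutes S. \<Prod>v\<in>S. G (a (\<pi> v)) (a (\<sigma> v))) =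
     real (card {\<pi>. \<pi> permutes S}) * (\<Sum>\<sigma> | \<sigma> permutes S. \<Prod>v\<in>S. G (a v) (a (\<sigma> v)))"
    by simp
  also have "card {\<pi>. \<pi> permutes S} = fact (card S)" using assms by (intro card_permutations) auto
  finally show ?thesis by simp
qed

text \<open>The distinguisher reads the first \<open>t\<close> of a Poisson number of samples. From
  \<open>9 / 10\<close> to \<open>89 / 100\<close> the loss pays for lengths below \<open>t\<close>,
  of mass at most \<open>1 / 128\<close>, and for a cut-off of the very long ones; the subtracted
  sum pays for the truncation at multiplicity \<open>K\<close>.\<close>

lemma poissonized_sum_ge:
  fixes g :: "nat list \<Rightarrow> real"
  assumes S: "finite S" "set_pmf q \<subseteq> S" and g: "\<And>x. 0 \<le> g x" "\<And>x. g x \<le> 1"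
    and m: "m \<ge> 1" "t \<le> m" and \<mu>: "\<mu> = 8 * real m"
    and ge: "expect (replicate_pmf t q) g \<ge> 9 / 10"
  shows "89 / 100 - (\<Sum>i\<in>S. (\<mu> * pmf q i) ^ K / fact K) \<le>
     (\<Sum>x | set x \<subseteq> S \<and> (\<forall>v\<in>S. count_list x v < K) \<and> t \<le> length x.
        exp (- \<mu>) * (\<Prod>v\<in>S. (\<mu> * pmf q v) ^ count_list x v) / fact (length x) * g (take t x))"
proof -
  define X where "X = {x. set x \<subseteq> S \<and> (\<forall>v\<in>S. count_list x v < K) \<and> t \<le> length x}"
  define \<omega> where "\<omega> x = exp (- \<mu>) * (\<Prod>v\<in>S. (\<mu> * pmf q v) ^ count_list x v) / fact (length x)" for x
  define Xs where "Xs s = {x. set x \<subseteq> S \<and> length x = s \<and> (\<forall>v\<in>S. count_list x v < K)}" for s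
  have \<mu>0: "\<mu> \<ge> 0" using \<mu> by simp
  have finX: "finite X" unfolding X_def
    using finite_lists_counts_less[OF S(1), of K] by (rule rev_finite_subset) auto
  have finq: "finite (set_pmf q)" using S finite_subset by blast
  \<comment> \<open>Lengths beyond a finite \<open>Z\<close> are dropped so that all sums are
    finite; they carry less than \<open>1 / 1000\<close> of the Poisson mass.\<close>
  have "(\<lambda>Z. sum (pois \<mu>) {..<Z}) \<longlonglongrightarrow> 1" using pois_sums[of \<mu>] by (simp add: sums_def)
  then have "eventually (\<lambda>Z. sum (pois \<mu>) {..<Z} > 999 / 1000) sequentially"
    by (rule order_tendstoD) simp
  then obtain Z0 where Z0: "\<And>Z. Z \<ge> Z0 \<Longrightarrow> sum (pois \<mu>) {..<Z} > 999 / 1000"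
    by (auto simp: eventually_sequentially)
  define Z where "Z = max Z0 t"
  have "sum (pois \<mu>) {..<Suc Z} = sum (pois \<mu>) {..<t} + sum (pois \<mu>) {t..Z}"
  proof -
    have "{..<Suc Z} = {..<t} \<union> {t..Z}" by (auto simp: Z_def)
    then show ?thesis using sum.union_disjoint[of "{..<t}" "{t..Z}" "pois \<mu>"] by force
  qed
  moreover have "sum (pois \<mu>) {..<t} \<le> 1 / 128" unfolding \<mu> by (rule sum_pois_small_le) (use m in auto)
  moreover have "sum (pois \<mu>) {..<Suc Z} > 999 / 1000" by (rule Z0) (auto simp: Z_def)
  ultimately have W: "sum (pois \<mu>) {t..Z} \<ge> 99 / 100" by simp
  have \<omega>: "\<omega> x = pois \<mu> s * pmf (replicate_pmf s q) x" if "x \<in> Xs s" for x s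
  proof -
    have x: "set x \<subseteq> S" "length x = s" using that by (auto simp: Xs_def)
    have "(\<Prod>v\<in>S. \<mu> ^ count_list x v) = \<mu> ^ s"
      using x S by (simp flip: power_sum add: sum_count_set)
    then show ?thesis using x pmf_replicate_pmf[OF S(1) x(1), of q]
      by (simp add: \<omega>_def pois_def power_mult_distrib prod.distrib)
  qed
  have eps: "(\<Sum>s\<in>{t..Z}. pois \<mu> s * (\<Sum>i\<in>S. real (s choose K) * pmf q i ^ K))
       \<le> (\<Sum>i\<in>S. (\<mu> * pmf q i) ^ K / fact K)"
  proof -
    have "(\<Sum>s\<in>{t..Z}. pois \<mu> s * (\<Sum>i\<in>S. real (s choose K) * pmf q i ^ K)) =
       (\<Sum>s\<in>{t..Z}. pois \<mu> s * real (s choose K)) * (\<Sum>i\<in>S. pmf q i ^ K)"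
      by (simp add: sum_distrib_left sum_distrib_right mult_ac)
    also have "\<dots> \<le> \<mu> ^ K / fact K * (\<Sum>i\<in>S. pmf q i ^ K)"
      by (intro mult_right_mono sum_pois_binomial_le \<mu>0 sum_nonneg) auto
    also have "\<dots> = (\<Sum>i\<in>S. (\<mu> * pmf q i) ^ K / fact K)"
      by (simp add: sum_distrib_left power_mult_distrib)
    finally show ?thesis .
  qed
  have "89 / 100 - (\<Sum>i\<in>S. (\<mu> * pmf q i) ^ K / fact K) \<le> 9 / 10 * sum (pois \<mu>) {t..Z}
      - (\<Sum>s\<in>{t..Z}. pois \<mu> s * (\<Sum>i\<in>S. real (s choose K) * pmf q i ^ K))"
    using W eps by simp
  also have "\<dots> = (\<Sum>s\<in>{t..Z}. pois \<mu> s * (9 / 10 - (\<Sum>i\<in>S. real (s choose K) * pmf q i ^ K)))"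
    by (simp add: algebra_simps sum_subtractf sum_distrib_left)
  also have "\<dots> \<le> (\<Sum>s\<in>{t..Z}. pois \<mu> s * (\<Sum>x\<in>Xs s. pmf (replicate_pmf s q) x * g (take t x)))"
  proof (intro sum_mono mult_left_mono pois_nonneg \<mu>0)
    fix s assume s: "s \<in> {t..Z}"
    have "9 / 10 - (\<Sum>i\<in>S. real (s choose K) * pmf q i ^ K) \<le>
       expect (replicate_pmf s q) (\<lambda>x. g (take t x)) - (\<Sum>i\<in>S. real (s choose K) * pmf q i ^ K)"
      using ge s finq by (simp add: expect_take)
    also have "\<dots> \<le> (\<Sum>x\<in>Xs s. pmf (replicate_pmf s q) x * g (take t x))"
      unfolding Xs_def by (rule expect_counts_less_ge) (use S g in auto)
    finally show "9 / 10 - (\<Sum>i\<in>S. real (s choose K) * pmf q i ^ K) \<le>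
       (\<Sum>x\<in>Xs s. pmf (replicate_pmf s q) x * g (take t x))" .
  qed
  also have "\<dots> = (\<Sum>s\<in>{t..Z}. \<Sum>x\<in>Xs s. \<omega> x * g (take t x))"
    by (simp add: sum_distrib_left \<omega> mult_ac)
  also have "\<dots> = (\<Sum>x\<in>(\<Union>s\<in>{t..Z}. Xs s). \<omega> x * g (take t x))"
  proof (rule sum.UNION_disjoint[symmetric])
    show "\<forall>s\<in>{t..Z}. finite (Xs s)"
      by (auto simp: Xs_def intro: finite_subset[OF _ finite_lists_length_eq[OF S(1)]])
  qed (auto simp: Xs_def)
  also have "\<dots> \<le> (\<Sum>x\<in>X. \<omega> x * g (take t x))"
    by (rule sum_mono2[OF finX])
       (use g \<mu>0 in \<open>auto simp: X_def Xs_def \<omega>_def intro!: mult_nonneg_nonneg divide_nonneg_nonneg prod_nonneg\<close>)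
  finally show ?thesis by (simp add: X_def \<omega>_def)
qed

text \<open>For an upper bound discarding samples is free, as all summands are nonnegative, and the
  Poisson weights sum to at most 1.\<close>

lemma poissonized_sum_le:
  fixes g :: "nat list \<Rightarrow> real"
  assumes S: "finite S" "set_pmf q \<subseteq> S" and g: "\<And>x. 0 \<le> g x" "\<And>x. g x \<le> 1"
    and \<mu>: "\<mu> \<ge> 0"
    and le: "expect (replicate_pmf t q) g \<le> c" and c: "c \<ge> 0"
  shows "(\<Sum>x | set x \<subseteq> S \<and> (\<forall>v\<in>S. count_list x v < K) \<and> t \<le> length x.
        exp (- \<mu>) * (\<Prod>v\<in>S. (\<mu> * pmf q v) ^ count_list x v) / fact (length x) * g (take t x)) \<le> c"
proof -
  define X where "X = {x. set x \<subseteq> S \<and> (\<forall>v\<in>S. count_list x v < K) \<and> t \<le> length x}"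
  define \<omega> where "\<omega> x = exp (- \<mu>) * (\<Prod>v\<in>S. (\<mu> * pmf q v) ^ count_list x v) / fact (length x)" for x
  define Xs where "Xs s = {x. set x \<subseteq> S \<and> length x = s}" for s
  have finX: "finite X" unfolding X_def
    using finite_lists_counts_less[OF S(1), of K] by (rule rev_finite_subset) auto
  have finXs: "finite (Xs s)" for s
    using finite_lists_length_eq[OF S(1)] by (auto simp: Xs_def)
  have finq: "finite (set_pmf q)" using S finite_subset by blast
  have \<omega>: "\<omega> x = pois \<mu> s * pmf (replicate_pmf s q) x" if "x \<in> Xs s" for x s
  proof -
    have x: "set x \<subseteq> S" "length x = s" using that by (auto simp: Xs_def)
    have "(\<Prod>v\<in>S. \<mu> ^ count_list x v) = \<mu> ^ s"
      using x S by (simp flip: power_sum add: sum_count_set)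
    then show ?thesis using x pmf_replicate_pmf[OF S(1) x(1), of q]
      by (simp add: \<omega>_def pois_def power_mult_distrib prod.distrib)
  qed
  define Z where "Z = Max (insert t (length ` X))"
  have Z: "length x \<le> Z" if "x \<in> X" for x
    unfolding Z_def using finX that by (intro Max_ge) auto
  have "(\<Sum>x\<in>X. \<omega> x * g (take t x)) \<le> (\<Sum>x\<in>(\<Union>s\<in>{t..Z}. Xs s). \<omega> x * g (take t x))"
    by (rule sum_mono2)
       (use g \<mu> finXs Z in \<open>auto simp: X_def Xs_def \<omega>_def intro!: mult_nonneg_nonneg divide_nonneg_nonneg prod_nonneg\<close>)
  also have "\<dots> = (\<Sum>s\<in>{t..Z}. \<Sum>x\<in>Xs s. \<omega> x * g (take t x))"
    by (rule sum.UNION_disjoint) (use finXs in \<open>auto simp: Xs_def\<close>)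
  also have "\<dots> = (\<Sum>s\<in>{t..Z}. pois \<mu> s * (\<Sum>x\<in>Xs s. g (take t x) * pmf (replicate_pmf s q) x))"
    by (simp add: sum_distrib_left \<omega> mult_ac)
  also have "\<dots> = (\<Sum>s\<in>{t..Z}. pois \<mu> s * expect (replicate_pmf t q) g)"
  proof (intro sum.cong refl arg_cong2[of _ _ _ _ "(*)"])
    fix s assume "s \<in> {t..Z}"
    have "(\<Sum>x\<in>Xs s. g (take t x) * pmf (replicate_pmf s q) x) = expect (replicate_pmf s q) (\<lambda>x. g (take t x))"
      by (rule integral_measure_pmf_real[OF finXs, symmetric])
         (use S in \<open>auto simp: set_replicate_pmf Xs_def\<close>)
    then show "(\<Sum>x\<in>Xs s. g (take t x) * pmf (replicate_pmf s q) x) = expect (replicate_pmf t q) g"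
      using \<open>s \<in> {t..Z}\<close> finq by (simp add: expect_take)
  qed
  also have "\<dots> \<le> (\<Sum>s\<in>{t..Z}. pois \<mu> s * c)"
    by (intro sum_mono mult_left_mono le pois_nonneg \<mu>)
  also have "\<dots> = sum (pois \<mu>) {t..Z} * c" by (simp add: sum_distrib_right)
  also have "\<dots> \<le> 1 * c" by (intro mult_right_mono sum_pois_le_1 \<mu> c) auto
  finally show ?thesis by (simp add: X_def \<omega>_def)
qed

text \<open>Cauchy-Schwarz for the average \<open>P\<close> of the relabeled weights against the
  uniform weight \<open>Q\<close>. The factor \<open>1 / 10\<close> survives because
  \<open>g\<close> lies in \<open>[0, 1]\<close>: its second moment under \<open>Q\<close> is at
  most its mean, the probability of wrongly rejecting.\<close>

lemma distinguisher_chi2_bound: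
  fixes g :: "nat list \<Rightarrow> real" and p :: "nat pmf"
  assumes n: "n \<ge> 1" and p: "p \<in> dists n" and g: "\<And>x. 0 \<le> g x" "\<And>x. g x \<le> 1"
    and m: "m \<ge> 1" "t \<le> m" and \<mu>: "\<mu> = 8 * real m" and lam: "lam = \<mu> / real n"
    and a: "\<And>i. a i = \<mu> * pmf p i"
    and unif: "expect (replicate_pmf t (unif n)) g \<le> 1 / 10"
    and far: "\<And>q. q \<in> relabelings n p \<Longrightarrow> expect (replicate_pmf t q) g \<ge> 9 / 10"
    and eps: "(\<Sum>i\<in>{1..n}. a i ^ K / fact K) \<le> \<epsilon>" "\<epsilon> \<le> 89 / 100"
  shows "(89 / 100 - \<epsilon>)\<^sup>2 \<le> exp (- \<mu>) / fact n *
     (\<Sum>\<pi> | \<pi> permutes {1..n}. \<Prod>i\<in>{1..n}. truncexp K (a i * a (\<pi> i) / lam)) / 10"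
proof -
  define S where "S = {1..n}"
  have S: "finite S" "card S = n" by (auto simp: S_def)
  define X where "X = {x. set x \<subseteq> S \<and> (\<forall>v\<in>S. count_list x v < K) \<and> t \<le> length x}"
  define Y where "Y = {x. set x \<subseteq> S \<and> (\<forall>v\<in>S. count_list x v < K)}"
  define w where "w b x = exp (- \<mu>) * (\<Prod>v\<in>S. b v ^ count_list x v) / fact (length x)" for b x
  define P where "P x = (\<Sum>\<pi> | \<pi> permutes S. w (\<lambda>v. a (\<pi> v)) x) / fact n" for x
  define Q where "Q x = w (\<lambda>v. lam) x" for x
  have \<mu>0: "\<mu> > 0" using \<mu> m by simp
  have lam0: "lam > 0" using lam \<mu>0 n by simp
  have finY: "finite Y" unfolding Y_def by (rule finite_lists_counts_less[OF S(1)])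
  have XY: "X \<subseteq> Y" by (auto simp: X_def Y_def)
  have finX: "finite X" using finite_subset[OF XY finY] .
  have Q0: "Q x > 0" for x unfolding Q_def w_def using lam0 by (intro divide_pos_pos mult_pos_pos prod_pos) auto
  have cardP: "real (card {\<pi>. \<pi> permutes S}) = fact n"
  proof -
    have "card {\<pi>. \<pi> permutes S} = fact n" by (rule card_permutations) (use S in auto)
    then show ?thesis by simp
  qed
  have low: "89 / 100 - \<epsilon> \<le> (\<Sum>x\<in>X. P x * g (take t x))"
  proof -
    have one: "89 / 100 - \<epsilon> \<le> (\<Sum>x\<in>X. w (\<lambda>v. a (\<pi> v)) x * g (take t x))" if pi: "\<pi> permutes S" for \<pi>
    proof -
      define q where "q = map_pmf (inv \<pi>) p"
      have q: "pmf q v = pmf p (\<pi> v)" for v unfolding q_def by (rule pmf_map_permutes[OF pi])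
      have "(\<Sum>i\<in>S. (\<mu> * pmf q i) ^ K / fact K) = (\<Sum>i\<in>S. a i ^ K / fact K)"
        unfolding q a[symmetric] by (rule sum.permute[OF pi, unfolded o_def, symmetric])
      then have "89 / 100 - \<epsilon> \<le> 89 / 100 - (\<Sum>i\<in>S. (\<mu> * pmf q i) ^ K / fact K)"
        using eps by (simp add: S_def)
      also have "\<dots> \<le> (\<Sum>x\<in>X. exp (- \<mu>) * (\<Prod>v\<in>S. (\<mu> * pmf q v) ^ count_list x v) / fact (length x) * g (take t x))"
        unfolding X_def
      proof (rule poissonized_sum_ge[OF S(1) _ g m \<mu>])
        show "set_pmf q \<subseteq> S"
        proof
          fix v assume "v \<in> set_pmf q"
          then obtain y where "v = inv \<pi> y" "y \<in> set_pmf p" by (auto simp: q_def)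
          moreover have "y \<in> S" using calculation p by (auto simp: dists_def S_def)
          ultimately show "v \<in> S" using permutes_in_image[OF permutes_inv[OF pi]] by auto
        qed
        show "9 / 10 \<le> expect (replicate_pmf t q) g"
          by (rule far) (use relabelings_inv_permutes pi in \<open>auto simp: q_def S_def\<close>)
      qed
      finally show ?thesis by (simp add: w_def q a)
    qed
    have "fact n * (89 / 100 - \<epsilon>) = (\<Sum>\<pi> | \<pi> permutes S. 89 / 100 - \<epsilon>)"
      using cardP by simp
    also have "\<dots> \<le> (\<Sum>\<pi> | \<pi> permutes S. \<Sum>x\<in>X. w (\<lambda>v. a (\<pi> v)) x * g (take t x))"
      using one by (intro sum_mono) auto
    also have "\<dots> = (\<Sum>x\<in>X. fact n * (P x * g (take t x)))"
      by (subst sum.swap) (simp add: P_def sum_distrib_right)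
    also have "\<dots> = fact n * (\<Sum>x\<in>X. P x * g (take t x))" by (simp add: sum_distrib_left)
    finally show ?thesis by simp
  qed
  have Qg: "(\<Sum>x\<in>X. Q x * (g (take t x))\<^sup>2) \<le> 1 / 10"
  proof -
    have "(\<Sum>x\<in>X. Q x * (g (take t x))\<^sup>2) \<le> (\<Sum>x\<in>X. Q x * g (take t x))"
      using g Q0 by (intro sum_mono mult_left_mono) (auto simp: power2_eq_square mult_left_le less_imp_le)
    also have "\<dots> = (\<Sum>x\<in>X. exp (- \<mu>) * (\<Prod>v\<in>S. (\<mu> * pmf (unif n) v) ^ count_list x v) / fact (length x) * g (take t x))"
      unfolding Q_def w_def using n
      by (intro sum.cong refl arg_cong2[of _ _ _ _ "(*)"] arg_cong2[of _ _ _ _ "(/)"] prod.cong)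
         (auto simp: lam unif_def S_def)
    also have "\<dots> \<le> 1 / 10" unfolding X_def
      by (rule poissonized_sum_le) (use S g \<mu>0 n unif in \<open>auto simp: S_def unif_def\<close>)
    finally show ?thesis .
  qed
  have chi: "(\<Sum>x\<in>X. (P x)\<^sup>2 / Q x) \<le> exp (- \<mu>) / fact n *
     (\<Sum>\<pi> | \<pi> permutes S. \<Prod>i\<in>S. truncexp K (a i * a (\<pi> i) / lam))"
  proof -
    \<comment> \<open>The quotient of weights is again a weight, with intensity
      \<open>b v * c v / lam\<close> at \<open>v\<close>, so its sum over lists factorizes.\<close>
    have ww: "w b x * w c x / Q x = exp (- \<mu>) * ((\<Prod>v\<in>S. (b v * c v / lam) ^ count_list x v) / fact (length x))" for b c x
    proof -
      have "(\<Prod>v\<in>S. (b v * c v / lam) ^ count_list x v) =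
         (\<Prod>v\<in>S. b v ^ count_list x v) * (\<Prod>v\<in>S. c v ^ count_list x v) / (\<Prod>v\<in>S. lam ^ count_list x v)"
        by (simp add: power_divide power_mult_distrib prod.distrib prod_dividef)
      moreover have "(\<Prod>v\<in>S. lam ^ count_list x v) > 0" using lam0 by (intro prod_pos) auto
      ultimately show ?thesis by (simp add: w_def Q_def field_simps)
    qed
    \<comment> \<open>Short lists are put back, since the product formula needs the sum over all
      lengths.\<close>
    have "(\<Sum>x\<in>X. (P x)\<^sup>2 / Q x) \<le> (\<Sum>x\<in>Y. (P x)\<^sup>2 / Q x)"
      by (rule sum_mono2[OF finY XY]) (use Q0 in \<open>auto simp: less_imp_le\<close>)
    also have "\<dots> = (\<Sum>x\<in>Y. \<Sum>\<pi> | \<pi> permutes S. \<Sum>\<sigma> | \<sigma> permutes S.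
         w (\<lambda>v. a (\<pi> v)) x * w (\<lambda>v. a (\<sigma> v)) x / Q x) / (fact n * fact n)"
    proof -
      have "(P x)\<^sup>2 / Q x = (\<Sum>\<pi> | \<pi> permutes S. \<Sum>\<sigma> | \<sigma> permutes S.
         w (\<lambda>v. a (\<pi> v)) x * w (\<lambda>v. a (\<sigma> v)) x / Q x) / (fact n * fact n)" for x
        by (simp add: P_def power2_eq_square sum_product flip: sum_divide_distrib)
      then show ?thesis by (simp only: sum_divide_distrib[symmetric])
    qed
    also have "(\<Sum>x\<in>Y. \<Sum>\<pi> | \<pi> permutes S. \<Sum>\<sigma> | \<sigma> permutes S.
         w (\<lambda>v. a (\<pi> v)) x * w (\<lambda>v. a (\<sigma> v)) x / Q x) =
       (\<Sum>\<pi> | \<pi> permutes S. \<Sum>\<sigma> | \<sigma> permutes S. \<Sum>x\<in>Y.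
         w (\<lambda>v. a (\<pi> v)) x * w (\<lambda>v. a (\<sigma> v)) x / Q x)"
      by (subst sum.swap, rule sum.cong[OF refl], subst sum.swap) simp
    also have "\<dots> = (\<Sum>\<pi> | \<pi> permutes S. \<Sum>\<sigma> | \<sigma> permutes S.
         exp (- \<mu>) * (\<Prod>v\<in>S. truncexp K (a (\<pi> v) * a (\<sigma> v) / lam)))"
      unfolding ww sum_distrib_left[symmetric] truncexp_def sum_lists_counts_less[OF S(1), symmetric]
      by (simp add: Y_def)
    also have "\<dots> = exp (- \<mu>) * (fact n * (\<Sum>\<sigma> | \<sigma> permutes S. \<Prod>v\<in>S. truncexp K (a v * a (\<sigma> v) / lam)))"
      using sum_permutations_pair[OF S(1), of "\<lambda>b c. truncexp K (b * c / lam)" a] S(2)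
      by (simp flip: sum_distrib_left)
    finally show ?thesis by simp
  qed
  have "(89 / 100 - \<epsilon>)\<^sup>2 \<le> (\<Sum>x\<in>X. P x * g (take t x))\<^sup>2"
    using low eps by (intro power_mono) auto
  also have "\<dots> = (\<Sum>x\<in>X. (P x / sqrt (Q x)) * (sqrt (Q x) * g (take t x)))\<^sup>2"
    using Q0 by (intro arg_cong[of _ _ "\<lambda>z. z\<^sup>2"] sum.cong refl) (simp add: less_imp_neq[symmetric])
  also have "\<dots> \<le> (\<Sum>x\<in>X. (P x / sqrt (Q x))\<^sup>2) * (\<Sum>x\<in>X. (sqrt (Q x) * g (take t x))\<^sup>2)"
    by (rule Cauchy_Schwarz_ineq_sum)
  also have "\<dots> = (\<Sum>x\<in>X. (P x)\<^sup>2 / Q x) * (\<Sum>x\<in>X. Q x * (g (take t x))\<^sup>2)"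
    using Q0 by (simp add: power_divide power_mult_distrib less_imp_le)
  also have "\<dots> \<le> (\<Sum>x\<in>X. (P x)\<^sup>2 / Q x) * (1 / 10)"
    using Q0 by (intro mult_left_mono Qg sum_nonneg) (auto simp: less_imp_le)
  also have "\<dots> \<le> exp (- \<mu>) / fact n *
     (\<Sum>\<pi> | \<pi> permutes S. \<Prod>i\<in>S. truncexp K (a i * a (\<pi> i) / lam)) * (1 / 10)"
    by (intro mult_right_mono chi) auto
  finally show ?thesis by (simp add: S_def)
qed

text \<open>An infimum at most \<open>m\<close> in \<open>enat\<close> is witnessed by a member at
  most \<open>m\<close>, since otherwise \<open>Suc m\<close> would be a lower bound. The function
  \<open>g\<close> is the probability of rejecting a given sample.\<close>

lemma opt_leD:
  assumes "opt n p \<le> enat m"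
  obtains t g where "t \<le> m" "\<And>x. 0 \<le> g x" "\<And>x. g x \<le> (1::real)"
    "expect (replicate_pmf t (unif n)) g \<le> 1 / 10"
    "\<And>q. q \<in> relabelings n p \<Longrightarrow> expect (replicate_pmf t q) g \<ge> 9 / 10"
proof -
  define T where "T = {enat t |t. \<exists>A. pmf (verdict A t (unif n)) True \<ge> 9/10 \<and>
                              (\<forall>q\<in>relabelings n p. pmf (verdict A t q) False \<ge> 9/10)}"
  have "\<exists>x\<in>T. x \<le> enat m"
  proof (rule ccontr)
    assume "\<not> (\<exists>x\<in>T. x \<le> enat m)"
    then have "enat (Suc m) \<le> Inf T" by (intro Inf_greatest) (auto simp: Suc_ile_eq not_le)
    moreover have "Inf T \<le> enat m" using assms unfolding opt_def T_def .
    ultimately have "enat (Suc m) \<le> enat m" by (rule order_trans)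
    then show False by simp
  qed
  then obtain t A where t: "t \<le> m" and A: "pmf (verdict A t (unif n)) True \<ge> 9/10"
    "\<And>q. q \<in> relabelings n p \<Longrightarrow> pmf (verdict A t q) False \<ge> 9/10"
    by (auto simp: T_def)
  have eq: "pmf (verdict A t q) False = expect (replicate_pmf t q) (\<lambda>x. pmf (A x) False)" for q
    by (simp add: verdict_def pmf_bind)
  have "pmf (verdict A t (unif n)) False = 1 - pmf (verdict A t (unif n)) True"
    by (simp add: pmf_False_conv_True)
  then show thesis
    using t A that[of t "\<lambda>x. pmf (A x) False"] by (auto simp: eq pmf_le_1)
qed

section \<open>Truncated exponentials and the centred kernel\<close>

lemma truncexp_le_exp: "0 \<le> x \<Longrightarrow> truncexp K x \<le> exp x"
  using sum_le_suminf[OF summable_exp[of x], of "{..<K}"]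
  by (simp add: truncexp_def exp_def divide_inverse mult.commute)

lemma truncexp_ge_1: "0 \<le> x \<Longrightarrow> K \<ge> 1 \<Longrightarrow> 1 \<le> truncexp K x"
  unfolding truncexp_def by (rule order_trans[OF _ member_le_sum[of 0]]) auto

lemma truncexp_mono: "0 \<le> x \<Longrightarrow> x \<le> y \<Longrightarrow> truncexp K x \<le> truncexp K y"
  unfolding truncexp_def by (intro sum_mono divide_right_mono power_mono) auto

text \<open>In the expansion of the left side the pairs of exponents fill the triangle
  \<open>k + j < K\<close>, which lies in the square that belongs to the product of the two
  truncated series.\<close>

lemma truncexp_add_le:
  assumes "0 \<le> x" "0 \<le> y"
  shows "truncexp K (x + y) \<le> exp x * truncexp K y"
proof -
  have "(x + y) ^ c / fact c = (\<Sum>k\<le>c. (y ^ k / fact k) * (x ^ (c - k) / fact (c - k)))" for c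
    by (subst add.commute, subst binomial_ring)
       (simp add: sum_divide_distrib binomial_fact divide_simps)
  then have "truncexp K (x + y) = (\<Sum>c<K. \<Sum>k\<le>c. (y ^ k / fact k) * (x ^ (c - k) / fact (c - k)))"
    by (simp add: truncexp_def)
  also have "\<dots> = (\<Sum>(k, j) | k + j < K. (y ^ k / fact k) * (x ^ j / fact j))"
    by (rule sum.triangle_reindex[symmetric])
  also have "\<dots> \<le> (\<Sum>(k, j)\<in>{..<K} \<times> {..<K}. (y ^ k / fact k) * (x ^ j / fact j))"
    by (rule sum_mono2) (use assms in auto)
  also have "\<dots> = truncexp K y * truncexp K x"
    by (simp add: truncexp_def sum_product sum.cartesian_product)
  also have "\<dots> \<le> truncexp K y * exp x"
    using assms by (intro mult_left_mono truncexp_le_exp) (auto simp: truncexp_def intro!: sum_nonneg)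
  finally show ?thesis by (simp add: mult.commute)
qed

lemma truncexp_le_cubic:
  assumes "0 \<le> x"
  shows "truncexp K x \<le> 1 + x + x\<^sup>2 / 2 + (\<Sum>k\<in>{3..<K}. x ^ k / fact k)"
proof -
  have "truncexp K x \<le> (\<Sum>k\<in>{0, 1, 2} \<union> {3..<K}. x ^ k / fact k)"
    unfolding truncexp_def by (rule sum_mono2) (use assms in auto)
  also have "\<dots> = (\<Sum>k\<in>{0, 1, 2}. x ^ k / fact k) + (\<Sum>k\<in>{3..<K}. x ^ k / fact k)"
    by (rule sum.union_disjoint) auto
  finally show ?thesis by (simp add: fact_numeral)
qed

lemma exp_le_quadratic: "\<bar>y\<bar> \<le> 1 \<Longrightarrow> exp y \<le> 1 + y + (y::real)\<^sup>2"
proof (cases "y \<ge> 0")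
  case False
  have "1 \<le> (1 - y) * (1 + y + y\<^sup>2)"
    using False by (simp add: algebra_simps power2_eq_square mult_nonpos_nonneg)
  then have "inverse (1 - y) \<le> 1 + y + y\<^sup>2" using False by (simp add: field_simps)
  moreover have "inverse (exp (- y)) \<le> inverse (1 - y)"
    using exp_ge_add_one_self[of "-y"] False by (intro le_imp_inverse_le) auto
  ultimately show ?thesis by (simp add: exp_minus)
qed (use exp_bound[of y] in auto)

text \<open>For \<open>K = 2\<close> all factors \<open>1 + a i * a j / lam\<close> are increasing
  in \<open>a j\<close>, so negative association applies without separating rows. The row averages
  \<open>1 + a i\<close> multiply to at most \<open>exp \<mu>\<close>, which the prefactor cancels
  exactly.\<close>

lemma chi2_two_le_1:
  fixes a :: "nat \<Rightarrow> real"
  assumes n: "n \<ge> 1" and a: "\<And>i. 0 \<le> a i" and sum: "(\<Sum>i\<in>{1..n}. a i) = \<mu>" and \<mu>: "\<mu> > 0"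
    and lam: "lam = \<mu> / real n"
  shows "exp (- \<mu>) / fact n * (\<Sum>\<pi> | \<pi> permutes {1..n}. \<Prod>i\<in>{1..n}. truncexp 2 (a i * a (\<pi> i) / lam)) \<le> 1"
proof -
  have lam0: "lam > 0" using n \<mu> lam by simp
  have te: "truncexp 2 x = 1 + x" for x by (simp add: truncexp_def numeral_2_eq_2)
  have "(\<Sum>\<pi> | \<pi> permutes {1..n}. \<Prod>i\<in>{1..n}. truncexp 2 (a i * a (\<pi> i) / lam))
     \<le> fact (card {1..n}) * (\<Prod>i\<in>{1..n}. (\<Sum>j\<in>{1..n}. truncexp 2 (a i * a j / lam)) / real (card {1..n}))"
    by (rule sum_permutations_prod_le[where w=a])
       (use n a lam0 in \<open>auto simp: te divide_right_mono mult_left_mono\<close>)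
  also have "(\<Prod>i\<in>{1..n}. (\<Sum>j\<in>{1..n}. truncexp 2 (a i * a j / lam)) / real (card {1..n})) \<le> (\<Prod>i\<in>{1..n}. exp (a i))"
  proof (intro prod_mono conjI)
    fix i
    show "0 \<le> (\<Sum>j\<in>{1..n}. truncexp 2 (a i * a j / lam)) / real (card {1..n})"
      using a lam0 by (intro divide_nonneg_nonneg sum_nonneg) (auto simp: te)
    have "(\<Sum>j\<in>{1..n}. truncexp 2 (a i * a j / lam)) = real n + a i * \<mu> / lam"
      by (simp add: te sum.distrib sum[simplified] flip: sum_distrib_left sum_divide_distrib)
    then have "(\<Sum>j\<in>{1..n}. truncexp 2 (a i * a j / lam)) / real (card {1..n}) = 1 + a i"
      using n \<mu> by (simp add: lam field_simps)
    then show "(\<Sum>j\<in>{1..n}. truncexp 2 (a i * a j / lam)) / real (card {1..n}) \<le> exp (a i)"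
      using exp_ge_add_one_self[of "a i"] by simp
  qed
  also have "(\<Prod>i\<in>{1..n}. exp (a i)) = exp \<mu>" by (simp add: sum[simplified] flip: exp_sum)
  finally show ?thesis by (simp add: exp_minus field_simps)
qed

text \<open>The kernel that arises directly, \<open>exp (lam - a - b) * truncexp K (a * b / lam)\<close>, is not monotone in
  \<open>b\<close>; this majorant of it is, in either direction according to the sign of \<open>x\<close>.\<close>

definition kernel :: "nat \<Rightarrow> real \<Rightarrow> real \<Rightarrow> real \<Rightarrow> real" where
  "kernel K lam x y = (if 0 \<le> x \<and> 0 \<le> y then truncexp K (x * y / lam) else exp (x * y / lam))"

text \<open>Centring: \<open>a * b / lam\<close> is \<open>a + b - lam\<close> plus the product of
  the deviations over \<open>lam\<close>. The first part leaves as an exponential. The truncation is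
  kept only where both deviations are nonnegative, the one place where the second part can be
  large.\<close>

lemma truncexp_le_kernel:
  assumes "lam > 0" "0 \<le> a" "0 \<le> b"
  shows "truncexp K (a * b / lam) \<le> exp (a + b - lam) * kernel K lam (a - lam) (b - lam)"
proof -
  have eq: "a * b / lam = (a + b - lam) + (a - lam) * (b - lam) / lam"
    using assms by (simp add: field_simps)
  show ?thesis
  proof (cases "0 \<le> a - lam \<and> 0 \<le> b - lam")
    case True
    have "truncexp K (a * b / lam) \<le> exp (a + b - lam) * truncexp K ((a - lam) * (b - lam) / lam)"
      unfolding eq by (rule truncexp_add_le) (use True assms in auto)
    then show ?thesis using True by (simp add: kernel_def)
  next
    case False
    have "truncexp K (a * b / lam) \<le> exp (a * b / lam)" using assms by (intro truncexp_le_exp) auto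
    also have "\<dots> = exp (a + b - lam) * exp ((a - lam) * (b - lam) / lam)"
      unfolding eq exp_add ..
    finally show ?thesis using False by (auto simp: kernel_def)
  qed
qed

text \<open>For every permutation the factors \<open>exp (a i + a (\<pi> i) - lam)\<close> multiply
  to \<open>exp (2 \<mu> - n * lam) = exp \<mu>\<close>, against the prefactor
  \<open>exp (- \<mu>)\<close>.\<close>

lemma chi2_le_kernel_sum:
  fixes a :: "nat \<Rightarrow> real"
  assumes n: "n \<ge> 1" and a: "\<And>i. 0 \<le> a i" and sum: "(\<Sum>i\<in>{1..n}. a i) = \<mu>" and \<mu>: "\<mu> > 0"
    and lam: "lam = \<mu> / real n" and \<alpha>: "\<And>i. \<alpha> i = a i - lam"
  shows "exp (- \<mu>) / fact n * (\<Sum>\<pi> | \<pi> permutes {1..n}. \<Prod>i\<in>{1..n}. truncexp K (a i * a (\<pi> i) / lam))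
    \<le> (\<Sum>\<pi> | \<pi> permutes {1..n}. \<Prod>i\<in>{1..n}. kernel K lam (\<alpha> i) (\<alpha> (\<pi> i))) / fact n"
proof -
  have lam0: "lam > 0" using n \<mu> lam by simp
  have "(\<Sum>\<pi> | \<pi> permutes {1..n}. \<Prod>i\<in>{1..n}. truncexp K (a i * a (\<pi> i) / lam)) \<le>
     (\<Sum>\<pi> | \<pi> permutes {1..n}. exp \<mu> * (\<Prod>i\<in>{1..n}. kernel K lam (\<alpha> i) (\<alpha> (\<pi> i))))"
  proof (intro sum_mono)
    fix \<pi> assume "\<pi> \<in> {\<pi>. \<pi> permutes {1..n}}"
    then have pi: "\<pi> permutes {1..n}" by simp
    have "(\<Prod>i\<in>{1..n}. truncexp K (a i * a (\<pi> i) / lam)) \<le>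
       (\<Prod>i\<in>{1..n}. exp (a i + a (\<pi> i) - lam) * kernel K lam (\<alpha> i) (\<alpha> (\<pi> i)))"
      unfolding \<alpha> using a lam0
      by (intro prod_mono conjI truncexp_le_kernel) (auto simp: truncexp_def intro!: sum_nonneg)
    also have "\<dots> = exp (\<Sum>i\<in>{1..n}. a i + a (\<pi> i) - lam) * (\<Prod>i\<in>{1..n}. kernel K lam (\<alpha> i) (\<alpha> (\<pi> i)))"
      by (simp add: prod.distrib exp_sum)
    also have "(\<Sum>i\<in>{1..n}. a i + a (\<pi> i) - lam) = \<mu>"
      using sum.permute[OF pi, of a] sum n lam by (simp add: sum.distrib sum_subtractf o_def)
    finally show "(\<Prod>i\<in>{1..n}. truncexp K (a i * a (\<pi> i) / lam)) \<le>
       exp \<mu> * (\<Prod>i\<in>{1..n}. kernel K lam (\<alpha> i) (\<alpha> (\<pi> i)))" .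
  qed
  also have "\<dots> = exp \<mu> * (\<Sum>\<pi> | \<pi> permutes {1..n}. \<Prod>i\<in>{1..n}. kernel K lam (\<alpha> i) (\<alpha> (\<pi> i)))"
    by (simp add: sum_distrib_left)
  finally show ?thesis by (simp add: exp_minus field_simps)
qed

section \<open>Bounding the permutation average of the kernel\<close>

text \<open>Rows with \<open>\<alpha> i \<ge> 0\<close> increase in \<open>\<alpha> j\<close> and
  the others decrease. An increasing row switches from exponential to truncated exponential at
  \<open>\<alpha> j = 0\<close>; monotonicity survives because the former is at most 1 before the
  switch and the latter at least 1 after it.\<close>

lemma kernel_sum_le:
  fixes \<alpha> :: "nat \<Rightarrow> real"
  assumes n: "n \<ge> 1" and K: "K \<ge> 1" and lam: "lam > 0" and q: "q > 1" "q' > 1" "1 / q + 1 / q' = 1"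
    and P: "(\<Sum>i | i \<in> {1..n} \<and> 0 \<le> \<alpha> i. (\<Sum>j\<in>{1..n}. kernel K lam (\<alpha> i) (\<alpha> j) powr q) / real n - 1) \<le> 1"
    and M: "(\<Sum>i | i \<in> {1..n} \<and> \<alpha> i < 0. (\<Sum>j\<in>{1..n}. kernel K lam (\<alpha> i) (\<alpha> j) powr q') / real n - 1) \<le> 1"
  shows "(\<Sum>\<pi> | \<pi> permutes {1..n}. \<Prod>i\<in>{1..n}. kernel K lam (\<alpha> i) (\<alpha> (\<pi> i))) / fact n \<le> exp 1"
proof -
  have "(\<Sum>\<pi> | \<pi> permutes {1..n}. \<Prod>i\<in>{1..n}. kernel K lam (\<alpha> i) (\<alpha> (\<pi> i)))
     \<le> fact (card {1..n}) * exp 1"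
  proof (rule sum_permutations_prod_le_exp[where w=\<alpha> and P="{i \<in> {1..n}. 0 \<le> \<alpha> i}" and M="{i \<in> {1..n}. \<alpha> i < 0}", OF _ _ _ _ _ _ _ q])
    show "0 < kernel K lam (\<alpha> i) (\<alpha> j)" for i j
      using truncexp_ge_1[of "\<alpha> i * \<alpha> j / lam" K] K lam by (auto simp: kernel_def)
    show "kernel K lam (\<alpha> i) (\<alpha> j) \<le> kernel K lam (\<alpha> i) (\<alpha> k)"
      if "i \<in> {i \<in> {1..n}. 0 \<le> \<alpha> i}" "\<alpha> j \<le> \<alpha> k" for i j k
    proof -
      have i: "0 \<le> \<alpha> i" using that by auto
      consider "0 \<le> \<alpha> j" | "\<alpha> j < 0" "0 \<le> \<alpha> k" | "\<alpha> k < 0" using that by linarith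
      then show ?thesis
      proof cases
        case 1
        then show ?thesis using i that lam unfolding kernel_def
          by (auto intro!: truncexp_mono divide_right_mono mult_left_mono)
      next
        case 2
        have "exp (\<alpha> i * \<alpha> j / lam) \<le> 1"
          using 2 i lam by (simp add: divide_nonpos_pos mult_nonneg_nonpos)
        also have "1 \<le> truncexp K (\<alpha> i * \<alpha> k / lam)"
          using 2 i lam K by (intro truncexp_ge_1) auto
        finally show ?thesis using 2 i by (simp add: kernel_def)
      next
        case 3
        then show ?thesis using i that lam unfolding kernel_def
          by (auto intro!: divide_right_mono mult_left_mono)
      qed
    qed
    show "kernel K lam (\<alpha> i) (\<alpha> k) \<le> kernel K lam (\<alpha> i) (\<alpha> j)"
      if "i \<in> {i \<in> {1..n}. \<alpha> i < 0}" "\<alpha> j \<le> \<alpha> k" for i j k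
      using that lam unfolding kernel_def by (auto intro!: divide_right_mono mult_left_mono_neg)
  qed (use n P M in auto)
  then show ?thesis by (simp add: field_simps)
qed

lemma row_sum_le:
  fixes \<alpha> :: "nat \<Rightarrow> real"
  assumes n: "n \<ge> 1" and sum0: "(\<Sum>j\<in>{1..n}. \<alpha> j) = 0"
    and le: "\<And>j. j \<in> {1..n} \<Longrightarrow> F j \<le> 1 + c * (x * \<alpha> j / lam) + B j"
  shows "(\<Sum>j\<in>{1..n}. F j) / real n - 1 \<le> (\<Sum>j\<in>{1..n}. B j) / real n"
proof -
  have "(\<Sum>j\<in>{1..n}. F j) \<le> (\<Sum>j\<in>{1..n}. 1 + c * (x * \<alpha> j / lam) + B j)"
    using le by (intro sum_mono) auto
  also have "\<dots> = real n + c * (x * (\<Sum>j\<in>{1..n}. \<alpha> j) / lam) + (\<Sum>j\<in>{1..n}. B j)"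
    by (simp add: sum.distrib sum_distrib_left sum_divide_distrib)
  finally have "((\<Sum>j\<in>{1..n}. F j) - real n) / real n \<le> (\<Sum>j\<in>{1..n}. B j) / real n"
    using sum0 by (intro divide_right_mono) auto
  then show ?thesis using n by (simp add: diff_divide_distrib)
qed

text \<open>If all arguments lie in \<open>[-1/2, 1/2]\<close>, squaring keeps the exponents in
  \<open>[-1, 1]\<close>, where \<open>exp\<close> is bounded by its quadratic majorant; then only
  the second moment enters.\<close>

lemma kernel_sum_le_bounded:
  fixes \<alpha> :: "nat \<Rightarrow> real"
  assumes n: "n \<ge> 1" and K: "K \<ge> 1" and lam: "lam > 0" and sum0: "(\<Sum>j\<in>{1..n}. \<alpha> j) = 0"
    and small: "\<And>i j. i \<in> {1..n} \<Longrightarrow> j \<in> {1..n} \<Longrightarrow> \<bar>\<alpha> i * \<alpha> j / lam\<bar> \<le> 1 / 2"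
    and M2: "4 * (\<Sum>j\<in>{1..n}. (\<alpha> j)\<^sup>2)\<^sup>2 \<le> real n * lam\<^sup>2"
  shows "(\<Sum>\<pi> | \<pi> permutes {1..n}. \<Prod>i\<in>{1..n}. kernel K lam (\<alpha> i) (\<alpha> (\<pi> i))) / fact n \<le> exp 1"
proof -
  have row: "(\<Sum>j\<in>{1..n}. kernel K lam (\<alpha> i) (\<alpha> j) powr 2) / real n - 1 \<le>
      4 * (\<alpha> i)\<^sup>2 * (\<Sum>j\<in>{1..n}. (\<alpha> j)\<^sup>2) / (lam\<^sup>2 * real n)" if i: "i \<in> {1..n}" for i
  proof -
    have "(\<Sum>j\<in>{1..n}. kernel K lam (\<alpha> i) (\<alpha> j) powr 2) / real n - 1 \<le>
       (\<Sum>j\<in>{1..n}. 4 * (\<alpha> i * \<alpha> j / lam)\<^sup>2) / real n"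
    proof (rule row_sum_le[OF n sum0, where c=2])
      fix j assume j: "j \<in> {1..n}"
      let ?x = "\<alpha> i * \<alpha> j / lam"
      have "kernel K lam (\<alpha> i) (\<alpha> j) \<le> exp ?x"
        using lam by (auto simp: kernel_def intro!: truncexp_le_exp)
      moreover have "0 \<le> kernel K lam (\<alpha> i) (\<alpha> j)"
        using truncexp_ge_1[of ?x K] K lam by (auto simp: kernel_def)
      ultimately have "kernel K lam (\<alpha> i) (\<alpha> j) powr 2 \<le> exp ?x powr 2" by (intro powr_mono2) auto
      also have "\<dots> = exp (2 * ?x)" by (simp add: powr_def)
      also have "\<dots> \<le> 1 + 2 * ?x + (2 * ?x)\<^sup>2"
      proof (rule exp_le_quadratic)
        show "\<bar>2 * ?x\<bar> \<le> 1" using small[OF i j] by linarith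
      qed
      also have "(2 * ?x)\<^sup>2 = 4 * ?x\<^sup>2" by (subst power_mult_distrib) simp
      finally show "kernel K lam (\<alpha> i) (\<alpha> j) powr 2 \<le> 1 + 2 * ?x + 4 * ?x\<^sup>2" .
    qed
    also have "\<dots> = 4 * (\<alpha> i)\<^sup>2 * (\<Sum>j\<in>{1..n}. (\<alpha> j)\<^sup>2) / (lam\<^sup>2 * real n)"
      by (simp add: power_mult_distrib power_divide sum_distrib_left sum_divide_distrib mult_ac)
    finally show ?thesis .
  qed
  have all: "(\<Sum>i\<in>I. (\<Sum>j\<in>{1..n}. kernel K lam (\<alpha> i) (\<alpha> j) powr 2) / real n - 1) \<le> 1"
    if I: "I \<subseteq> {1..n}" for I
  proof -
    have "(\<Sum>i\<in>I. (\<Sum>j\<in>{1..n}. kernel K lam (\<alpha> i) (\<alpha> j) powr 2) / real n - 1) \<le>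
       (\<Sum>i\<in>I. 4 * (\<alpha> i)\<^sup>2 * (\<Sum>j\<in>{1..n}. (\<alpha> j)\<^sup>2) / (lam\<^sup>2 * real n))"
      using I by (intro sum_mono row) auto
    also have "\<dots> \<le> (\<Sum>i\<in>{1..n}. 4 * (\<alpha> i)\<^sup>2 * (\<Sum>j\<in>{1..n}. (\<alpha> j)\<^sup>2) / (lam\<^sup>2 * real n))"
      using I by (intro sum_mono2) (auto intro!: mult_nonneg_nonneg divide_nonneg_nonneg sum_nonneg)
    also have "\<dots> = 4 * (\<Sum>j\<in>{1..n}. (\<alpha> j)\<^sup>2)\<^sup>2 / (lam\<^sup>2 * real n)"
      by (simp add: power2_eq_square sum_distrib_left sum_distrib_right sum_divide_distrib mult_ac)
    also have "\<dots> \<le> 1" using M2 lam n by (simp add: mult.commute)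
    finally show ?thesis .
  qed
  show ?thesis by (rule kernel_sum_le[OF n K lam, of 2 2]; (rule all)?) auto
qed

text \<open>The exponent exceeds 1 by \<open>1 / (N - 1)\<close> only, and \<open>truncexp\<close>
  is at most \<open>2 powr (N - 1)\<close>, so the power at most doubles it and keeps the degree
  below \<open>K\<close>. Doubling is too crude near 0, where the expansion must begin with 1 and a
  linear term that cancels over the row; there the quadratic bound for \<open>exp\<close> is
  used.\<close>

lemma kernel_powr_le:
  assumes lam: "0 < lam" "lam \<le> 1 / N" and N: "N \<ge> 2" and K: "K \<ge> 1"
    and x: "0 \<le> x" "x \<le> 1 / N" and y: "- lam \<le> y" "y \<le> 1 / N"
    and tr: "truncexp K (1 / lam) \<le> 2 powr (N - 1)"
  shows "kernel K lam x y powr (N / (N - 1)) \<le> 1 + N / (N - 1) * (x * y / lam)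
     + (7 * (x * y / lam)\<^sup>2 + 2 * (if 0 \<le> y then (\<Sum>k\<in>{3..<K}. (x * y / lam) ^ k / fact k) else 0))"
proof -
  let ?x = "x * y / lam" and ?q = "N / (N - 1)"
  have q: "1 \<le> ?q" "?q \<le> 2" "0 \<le> ?q" using N by (auto simp: field_simps)
  have N1: "1 / N \<le> 1 / 2" using N by (simp add: field_simps)
  have sq: "(?q * ?x)\<^sup>2 \<le> 4 * ?x\<^sup>2"
    using mult_right_mono[OF power_mono[OF q(2,3), of 2], of "?x\<^sup>2"]
    unfolding power_mult_distrib by simp
  show ?thesis
  proof (cases "0 \<le> y")
    case False
    have "\<bar>y\<bar> \<le> lam" using False y by auto
    then have "x * \<bar>y\<bar> / lam \<le> x * lam / lam" using x lam
      by (intro divide_right_mono mult_left_mono) auto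
    then have "\<bar>?x\<bar> \<le> x * lam / lam" using x lam by (simp only: abs_divide abs_mult abs_of_nonneg abs_of_pos)
    also have "\<dots> = x" using lam by simp
    finally have "\<bar>?x\<bar> \<le> 1 / 2" using x N1 by linarith
    moreover have "\<bar>?q\<bar> \<le> 2" using q by linarith
    ultimately have "\<bar>?q * ?x\<bar> \<le> 2 * (1 / 2)" unfolding abs_mult[of ?q] by (intro mult_mono) auto
    then have "exp (?q * ?x) \<le> 1 + ?q * ?x + (?q * ?x)\<^sup>2" by (intro exp_le_quadratic) auto
    then have "exp (?q * ?x) \<le> 1 + ?q * ?x + 7 * ?x\<^sup>2" using sq zero_le_power2[of ?x] by linarith
    then show ?thesis using False by (simp add: kernel_def powr_def)
  next
    case True
    have x0: "0 \<le> ?x" using True x lam by simp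
    have s0: "0 \<le> (\<Sum>k\<in>{3..<K}. ?x ^ k / fact k)" using x0 by (intro sum_nonneg) auto
    have ge1: "1 \<le> truncexp K ?x" using x0 K by (rule truncexp_ge_1)
    show ?thesis
    proof (cases "?x \<le> 1 / 2")
      case le: True
      have "\<bar>?q\<bar> \<le> 2" "\<bar>?x\<bar> \<le> 1 / 2" using q le x0 by linarith+
      then have "\<bar>?q * ?x\<bar> \<le> 2 * (1 / 2)" unfolding abs_mult[of ?q] by (intro mult_mono) auto
      then have "exp (?q * ?x) \<le> 1 + ?q * ?x + (?q * ?x)\<^sup>2" by (intro exp_le_quadratic) auto
      moreover have "truncexp K ?x powr ?q \<le> exp ?x powr ?q"
        using q x0 ge1 by (intro powr_mono2 truncexp_le_exp) auto
      ultimately have "truncexp K ?x powr ?q \<le> 1 + ?q * ?x + 4 * ?x\<^sup>2"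
        using sq by (simp add: powr_def)
      then have "truncexp K ?x powr ?q \<le> 1 + ?q * ?x + (7 * ?x\<^sup>2 + 2 * (\<Sum>k\<in>{3..<K}. ?x ^ k / fact k))"
        using zero_le_power2[of ?x] s0 by linarith
      moreover have "kernel K lam x y = truncexp K ?x" using True x by (simp add: kernel_def)
      ultimately show ?thesis using True by simp
    next
      case gt: False
      have q1: "?q = 1 + 1 / (N - 1)" using N by (simp add: field_simps)
      have "x * y \<le> 1 * 1" using x y True N1 by (intro mult_mono) auto
      then have "?x \<le> 1 / lam" using lam by (intro divide_right_mono) auto
      then have "truncexp K ?x \<le> 2 powr (N - 1)"
        using truncexp_mono[OF x0, of "1 / lam" K] tr by linarith
      then have "truncexp K ?x powr (1 / (N - 1)) \<le> (2 powr (N - 1)) powr (1 / (N - 1))"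
        using N ge1 by (intro powr_mono2) auto
      also have "\<dots> = 2" using N by (simp add: powr_powr)
      finally have "truncexp K ?x powr ?q \<le> truncexp K ?x * 2"
        unfolding q1 powr_add using ge1 by (intro mult_mono) auto
      also have "\<dots> \<le> 2 * (1 + ?x + ?x\<^sup>2 / 2 + (\<Sum>k\<in>{3..<K}. ?x ^ k / fact k))"
        using truncexp_le_cubic[OF x0, of K] by simp
      also have "\<dots> \<le> 1 + ?q * ?x + (7 * ?x\<^sup>2 + 2 * (\<Sum>k\<in>{3..<K}. ?x ^ k / fact k))"
      proof -
        \<comment> \<open>The constant 7: for \<open>z \<ge> 1 / 2\<close> the surplus
          \<open>1 + z\<close> is at most \<open>4 z\<^sup>2 + 2 z\<^sup>2\<close>, next to the
          \<open>z\<^sup>2\<close> already present.\<close>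
        have key: "2 * (1 + z + z\<^sup>2 / 2 + s) \<le> 1 + c * z + (7 * z\<^sup>2 + 2 * s)"
          if "1 \<le> c" "1 / 2 \<le> z" for z c s :: real
        proof -
          have "1 * z \<le> c * z" using that by (intro mult_right_mono) auto
          moreover have "1 / 2 * z \<le> z * z" using that by (intro mult_right_mono) auto
          moreover have "1 / 2 * (1 / 2) \<le> z * z" using that by (intro mult_mono) auto
          moreover have "2 * (1 + z + w / 2 + s) \<le> 1 + u + (7 * w + 2 * s)"
            if "1 * z \<le> u" "1 / 2 * z \<le> w" "1 / 2 * (1 / 2) \<le> w" for u w :: real
            using that by simp
          ultimately show ?thesis unfolding power2_eq_square by blast
        qed
        show ?thesis by (rule key) (use q gt in linarith)+
      qed
      finally show ?thesis using True x by (simp add: kernel_def)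
    qed
  qed
qed

text \<open>A negative deviation is at most \<open>lam\<close> in absolute value, so in such a row
  \<open>N * \<alpha> i * \<alpha> j / lam\<close> stays in \<open>[-1, 1]\<close> and the large
  exponent \<open>N\<close> is harmless. Nonnegative rows have no such bound and receive the
  exponent close to 1. Their budget of 1 is split into \<open>7 / 14\<close> for the second moment
  and twice \<open>1 / 4\<close> for the higher ones.\<close>

lemma kernel_sum_le_sparse:
  fixes \<alpha> :: "nat \<Rightarrow> real"
  assumes n: "n \<ge> 1" and K: "K \<ge> 1" and lam: "lam > 0" "lam \<le> 1 / N" and N: "N \<ge> 2"
    and sum0: "(\<Sum>j\<in>{1..n}. \<alpha> j) = 0"
    and small: "\<And>i. i \<in> {1..n} \<Longrightarrow> - lam \<le> \<alpha> i \<and> \<alpha> i \<le> 1 / N"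
    and M2: "N\<^sup>2 * (\<Sum>j\<in>{1..n}. (\<alpha> j)\<^sup>2)\<^sup>2 \<le> real n * lam\<^sup>2 / 14"
    and Mk: "(\<Sum>k\<in>{3..<K}. (\<Sum>j | j \<in> {1..n} \<and> 0 \<le> \<alpha> j. \<alpha> j ^ k)\<^sup>2 / (real n * lam ^ k * fact k)) \<le> 1 / 4"
    and tr: "truncexp K (1 / lam) \<le> 2 powr (N - 1)"
  shows "(\<Sum>\<pi> | \<pi> permutes {1..n}. \<Prod>i\<in>{1..n}. kernel K lam (\<alpha> i) (\<alpha> (\<pi> i))) / fact n \<le> exp 1"
proof -
  define q where "q = N / (N - 1)"
  define S2 where "S2 = (\<Sum>j\<in>{1..n}. (\<alpha> j)\<^sup>2)"
  define P where "P = {i \<in> {1..n}. 0 \<le> \<alpha> i}"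
  define M where "M = {i \<in> {1..n}. \<alpha> i < 0}"
  define m where "m k = (\<Sum>j\<in>P. \<alpha> j ^ k)" for k
  have S2: "0 \<le> S2" unfolding S2_def by (intro sum_nonneg) auto
  have fin: "finite P" "finite M" by (auto simp: P_def M_def)
  have sub: "(\<Sum>i\<in>I. (\<alpha> i)\<^sup>2) \<le> S2" if "I \<subseteq> {1..n}" for I
    unfolding S2_def using that by (intro sum_mono2) auto
  have subP: "P \<subseteq> {1..n}" and subM: "M \<subseteq> {1..n}" by (auto simp: P_def M_def)
  have m2: "S2\<^sup>2 / (real n * lam\<^sup>2) \<le> 1 / (14 * N\<^sup>2)"
    using M2 n lam N by (simp add: S2_def field_simps)
  have N2: "1 \<le> N\<^sup>2" using N by simp
  have rowP: "(\<Sum>j\<in>{1..n}. kernel K lam (\<alpha> i) (\<alpha> j) powr q) / real n - 1 \<le>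
      7 * (\<alpha> i)\<^sup>2 * S2 / (lam\<^sup>2 * real n) + (\<Sum>k\<in>{3..<K}. 2 * \<alpha> i ^ k * m k / (real n * lam ^ k * fact k))"
    if i: "i \<in> P" for i
  proof -
    have "(\<Sum>j\<in>{1..n}. kernel K lam (\<alpha> i) (\<alpha> j) powr q) / real n - 1 \<le>
       (\<Sum>j\<in>{1..n}. (7 * (\<alpha> i * \<alpha> j / lam)\<^sup>2 + 2 * (if 0 \<le> \<alpha> j then (\<Sum>k\<in>{3..<K}. (\<alpha> i * \<alpha> j / lam) ^ k / fact k) else 0))) / real n"
      unfolding q_def by (rule row_sum_le[OF n sum0], rule kernel_powr_le[OF lam N K _ _ _ _ tr])
        (use i small in \<open>auto simp: P_def\<close>)
    also have "(\<Sum>j\<in>{1..n}. (7 * (\<alpha> i * \<alpha> j / lam)\<^sup>2 + 2 * (if 0 \<le> \<alpha> j then (\<Sum>k\<in>{3..<K}. (\<alpha> i * \<alpha> j / lam) ^ k / fact k) else 0)))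
       = 7 * (\<alpha> i)\<^sup>2 * S2 / lam\<^sup>2 + 2 * (\<Sum>j\<in>P. \<Sum>k\<in>{3..<K}. (\<alpha> i * \<alpha> j / lam) ^ k / fact k)"
    proof -
      have "(\<Sum>j\<in>{1..n}. if 0 \<le> \<alpha> j then (\<Sum>k\<in>{3..<K}. (\<alpha> i * \<alpha> j / lam) ^ k / fact k) else 0) =
        (\<Sum>j\<in>P. \<Sum>k\<in>{3..<K}. (\<alpha> i * \<alpha> j / lam) ^ k / fact k)"
        unfolding P_def by (rule sum.inter_filter[symmetric]) simp
      moreover have "(\<Sum>j\<in>{1..n}. 7 * (\<alpha> i * \<alpha> j / lam)\<^sup>2) = 7 * (\<alpha> i)\<^sup>2 * S2 / lam\<^sup>2"
        by (simp add: S2_def power_mult_distrib power_divide sum_distrib_left sum_divide_distrib mult_ac)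
      ultimately show ?thesis by (simp only: sum.distrib sum_distrib_left[symmetric])
    qed
    also have "(\<Sum>j\<in>P. \<Sum>k\<in>{3..<K}. (\<alpha> i * \<alpha> j / lam) ^ k / fact k) = (\<Sum>k\<in>{3..<K}. \<alpha> i ^ k * m k / (lam ^ k * fact k))"
      by (subst sum.swap) (simp add: m_def power_mult_distrib power_divide sum_distrib_left sum_divide_distrib)
    finally show ?thesis
      by (simp add: add_divide_distrib sum_distrib_left sum_divide_distrib mult_ac)
  qed
  have "(\<Sum>i\<in>P. (\<Sum>j\<in>{1..n}. kernel K lam (\<alpha> i) (\<alpha> j) powr q) / real n - 1) \<le>
     (\<Sum>i\<in>P. 7 * (\<alpha> i)\<^sup>2 * S2 / (lam\<^sup>2 * real n) + (\<Sum>k\<in>{3..<K}. 2 * \<alpha> i ^ k * m k / (real n * lam ^ k * fact k)))"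
    by (intro sum_mono rowP)
  also have "\<dots> = 7 * (\<Sum>i\<in>P. (\<alpha> i)\<^sup>2) * S2 / (lam\<^sup>2 * real n) + 2 * (\<Sum>k\<in>{3..<K}. (m k)\<^sup>2 / (real n * lam ^ k * fact k))"
  proof -
    have "(\<Sum>i\<in>P. \<Sum>k\<in>{3..<K}. 2 * \<alpha> i ^ k * m k / (real n * lam ^ k * fact k)) =
       2 * (\<Sum>k\<in>{3..<K}. (m k)\<^sup>2 / (real n * lam ^ k * fact k))"
      by (subst sum.swap) (simp add: m_def power2_eq_square sum_distrib_left sum_distrib_right sum_divide_distrib mult_ac)
    moreover have "(\<Sum>i\<in>P. 7 * (\<alpha> i)\<^sup>2 * S2 / (lam\<^sup>2 * real n)) = 7 * (\<Sum>i\<in>P. (\<alpha> i)\<^sup>2) * S2 / (lam\<^sup>2 * real n)"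
      by (simp add: sum_distrib_left sum_distrib_right sum_divide_distrib)
    ultimately show ?thesis by (simp add: sum.distrib)
  qed
  also have "\<dots> \<le> 7 * S2 * S2 / (lam\<^sup>2 * real n) + 2 * (1 / 4)"
    using Mk[folded P_def m_def] S2 sub[OF subP] lam n
    by (intro add_mono mult_left_mono divide_right_mono mult_right_mono) auto
  also have "\<dots> = 7 * (S2\<^sup>2 / (real n * lam\<^sup>2)) + 1 / 2" by (simp add: power2_eq_square mult_ac)
  also have "\<dots> \<le> 7 * (1 / (14 * N\<^sup>2)) + 1 / 2" using m2 by simp
  also have "\<dots> \<le> 1" 
  proof -
    have "inverse (N\<^sup>2) \<le> 1" using N2 by (simp add: inverse_le_1_iff)
    moreover have "7 * (1 / (14 * N\<^sup>2)) = inverse (N\<^sup>2) / 2" using N2 by (simp add: field_simps)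
    ultimately show ?thesis by linarith
  qed
  finally have 1: "(\<Sum>i\<in>P. (\<Sum>j\<in>{1..n}. kernel K lam (\<alpha> i) (\<alpha> j) powr q) / real n - 1) \<le> 1" .
  have rowM: "(\<Sum>j\<in>{1..n}. kernel K lam (\<alpha> i) (\<alpha> j) powr N) / real n - 1 \<le>
      N\<^sup>2 * (\<alpha> i)\<^sup>2 * S2 / (lam\<^sup>2 * real n)" if i: "i \<in> M" for i
  proof -
    have "(\<Sum>j\<in>{1..n}. kernel K lam (\<alpha> i) (\<alpha> j) powr N) / real n - 1 \<le>
      (\<Sum>j\<in>{1..n}. (N * (\<alpha> i * \<alpha> j / lam))\<^sup>2) / real n"
    proof (rule row_sum_le[OF n sum0, where c=N])
      fix j assume j: "j \<in> {1..n}"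
      let ?x = "\<alpha> i * \<alpha> j / lam"
      have i': "\<alpha> i < 0" "\<bar>\<alpha> i\<bar> \<le> lam" using i small[of i] by (auto simp: M_def)
      have "\<bar>\<alpha> j\<bar> \<le> 1 / N" using small[OF j] lam by auto
      then have "\<bar>\<alpha> i\<bar> * \<bar>\<alpha> j\<bar> \<le> lam * (1 / N)" using i' lam by (intro mult_mono) auto
      then have "\<bar>N * ?x\<bar> \<le> 1" using lam N by (simp add: abs_mult field_simps)
      then have "exp (N * ?x) \<le> 1 + N * ?x + (N * ?x)\<^sup>2" by (rule exp_le_quadratic)
      then show "kernel K lam (\<alpha> i) (\<alpha> j) powr N \<le> 1 + N * ?x + (N * ?x)\<^sup>2"
        using i' by (simp add: kernel_def powr_def)
    qed
    also have "\<dots> = N\<^sup>2 * (\<alpha> i)\<^sup>2 * S2 / (lam\<^sup>2 * real n)"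
      by (simp add: S2_def power_mult_distrib power_divide sum_distrib_left sum_divide_distrib mult_ac)
    finally show ?thesis .
  qed
  have "(\<Sum>i\<in>M. (\<Sum>j\<in>{1..n}. kernel K lam (\<alpha> i) (\<alpha> j) powr N) / real n - 1) \<le>
     (\<Sum>i\<in>M. N\<^sup>2 * (\<alpha> i)\<^sup>2 * S2 / (lam\<^sup>2 * real n))" by (intro sum_mono rowM)
  also have "\<dots> = N\<^sup>2 * (\<Sum>i\<in>M. (\<alpha> i)\<^sup>2) * S2 / (lam\<^sup>2 * real n)"
    by (simp add: sum_distrib_left sum_distrib_right sum_divide_distrib)
  also have "\<dots> \<le> N\<^sup>2 * S2 * S2 / (lam\<^sup>2 * real n)"
    using S2 sub[OF subM] lam n
    by (intro mult_left_mono divide_right_mono mult_right_mono) auto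
  also have "\<dots> = N\<^sup>2 * (S2\<^sup>2 / (real n * lam\<^sup>2))" by (simp add: power2_eq_square mult_ac)
  also have "\<dots> \<le> N\<^sup>2 * (1 / (14 * N\<^sup>2))" using m2 by (intro mult_left_mono) auto
  also have "\<dots> \<le> 1" using N2 by simp
  finally have 2: "(\<Sum>i\<in>M. (\<Sum>j\<in>{1..n}. kernel K lam (\<alpha> i) (\<alpha> j) powr N) / real n - 1) \<le> 1" .
  show ?thesis
    by (rule kernel_sum_le[OF n K lam(1), of q N])
       (use 1 2 N in \<open>auto simp: P_def M_def q_def field_simps\<close>)
qed

section \<open>Collision statistics\<close>

lemma binomial_mult_diff: "(s choose k) * ((s - k) choose j) = (s choose (k + j)) * ((k + j) choose k)"
proof (cases "k + j \<le> s")
  case True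
  then show ?thesis using choose_mult[of k "k + j" s] by simp
next
  case False
  then have 1: "(s choose k) = 0 \<or> ((s - k) choose j) = 0"
    by (cases "k \<le> s") (simp_all add: binomial_eq_0)
  have 2: "(s choose (k + j)) = 0" using False by (simp add: binomial_eq_0)
  show ?thesis using 1 unfolding 2 by (elim disjE) (simp_all only: mult_zero_left mult_zero_right)
qed

text \<open>Vandermonde, classifying the second \<open>k\<close>-set by the number \<open>j\<close>
  of its elements outside the first.\<close>

lemma binomial_square:
  "(N choose k) * (N choose k) = (\<Sum>j\<le>k. (k choose j) * ((k + j) choose k) * (N choose (k + j)))"
proof (cases "k \<le> N")
  case True
  have "(N choose k) = ((N - k) + k choose k)" using True by simp
  also have "\<dots> = (\<Sum>j\<le>k. ((N - k) choose j) * (k choose (k - j)))" by (rule vandermonde[symmetric])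
  finally have "(N choose k) = (\<Sum>j\<le>k. ((N - k) choose j) * (k choose (k - j)))" .
  from arg_cong[OF this, of "\<lambda>z. (N choose k) * z"]
  have "(N choose k) * (N choose k) = (\<Sum>j\<le>k. (N choose k) * (((N - k) choose j) * (k choose (k - j))))"
    by (simp only: sum_distrib_left)
  also have "\<dots> = (\<Sum>j\<le>k. (k choose j) * ((k + j) choose k) * (N choose (k + j)))"
  proof (intro sum.cong refl)
    fix j assume j: "j \<in> {..k}"
    have sym: "(k choose (k - j)) = (k choose j)" using binomial_symmetric[of j k] j by auto
    show "(N choose k) * (((N - k) choose j) * (k choose (k - j))) =
       (k choose j) * ((k + j) choose k) * (N choose (k + j))"
    proof -
      have "(N choose k) * (((N - k) choose j) * (k choose (k - j))) = ((N choose k) * ((N - k) choose j)) * (k choose j)"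
        unfolding sym by (rule mult.assoc[symmetric])
      also have "\<dots> = (N choose (k + j)) * ((k + j) choose k) * (k choose j)"
        by (simp only: binomial_mult_diff)
      also have "\<dots> = (k choose j) * ((k + j) choose k) * (N choose (k + j))"
        by (simp only: mult_ac)
      finally show ?thesis .
    qed
  qed
  finally show ?thesis .
next
  case False
  then have "(N choose k) = 0" "\<And>j. (N choose (k + j)) = 0" by (auto simp: binomial_eq_0)
  then show ?thesis by (simp only: mult_zero_left mult_zero_right sum.neutral_const)
qed

text \<open>The number of pairs of \<open>k\<close>-subsets of \<open>s\<close> positions whose union has \<open>k + j\<close> elements.\<close>

definition overlap :: "nat \<Rightarrow> nat \<Rightarrow> nat \<Rightarrow> real" where
  "overlap s k j = real ((s choose k) * (k choose j) * ((s - k) choose j))"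

lemma overlap_alt: "overlap s k j = real ((k choose j) * ((k + j) choose k) * (s choose (k + j)))"
proof -
  have "(s choose k) * (k choose j) * ((s - k) choose j) = (k choose j) * ((s choose k) * ((s - k) choose j))"
    by (simp only: mult_ac)
  also have "\<dots> = (k choose j) * ((k + j) choose k) * (s choose (k + j))"
    by (simp only: binomial_mult_diff mult_ac)
  finally show ?thesis unfolding overlap_def by (rule arg_cong)
qed

lemma sum_overlap: "(\<Sum>j\<le>k. overlap s k j) = real (s choose k) ^ 2"
  unfolding overlap_alt of_nat_sum[symmetric] binomial_square[symmetric] by (simp add: power2_eq_square)

lemma overlap_nonneg: "0 \<le> overlap s k j" by (simp add: overlap_def)

lemma overlap_le: "overlap s k j \<le> real (s choose k) * real (k choose j) * real s ^ j"
proof -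
  have "(s - k) choose j \<le> s ^ j"
  proof (cases "j \<le> s - k")
    case True
    then have "(s - k) choose j \<le> (s - k) ^ j" by (rule binomial_le_pow)
    also have "\<dots> \<le> s ^ j" by (intro power_mono) auto
    finally show ?thesis .
  qed (simp add: binomial_eq_0)
  then have "real ((s - k) choose j) \<le> real s ^ j" by (simp only: flip: of_nat_power of_nat_le_iff)
  then show ?thesis unfolding overlap_def of_nat_mult by (intro mult_left_mono) auto
qed

definition coll :: "'a set \<Rightarrow> nat \<Rightarrow> 'a list \<Rightarrow> nat" where
  "coll S k xs = (\<Sum>x\<in>S. count_list xs x choose k)"

lemma expect_binomial_count_square:
  assumes "finite S" "set_pmf p \<subseteq> S" "i \<in> S"
  shows "expect (replicate_pmf s p) (\<lambda>xs. (real (count_list xs i choose k))\<^sup>2) = (\<Sum>j\<le>k. overlap s k j * pmf p i ^ (k + j))"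
proof -
  have fin: "finite (set_pmf p)" using assms finite_subset by blast
  have "expect (replicate_pmf s p) (\<lambda>xs. (real (count_list xs i choose k))\<^sup>2) =
     expect (replicate_pmf s p) (\<lambda>xs. \<Sum>j\<le>k. real ((k choose j) * ((k + j) choose k)) * real (count_list xs i choose (k + j)))"
    unfolding power2_eq_square of_nat_mult[symmetric] binomial_square by simp
  also have "\<dots> = (\<Sum>j\<le>k. real ((k choose j) * ((k + j) choose k)) * (real (s choose (k + j)) * pmf p i ^ (k + j)))"
    using fin by (simp add: Bochner_Integration.integral_sum expect_binomial_count[OF assms] del: of_nat_mult)
  finally show ?thesis by (simp add: overlap_alt mult_ac)
qed

lemma expect_coll:
  assumes "finite S" "set_pmf p \<subseteq> S"
  shows "expect (replicate_pmf s p) (\<lambda>xs. real (coll S k xs)) = real (s choose k) * (\<Sum>i\<in>S. pmf p i ^ k)"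
proof -
  have fin: "finite (set_pmf p)" using assms finite_subset by blast
  show ?thesis using fin
    by (simp add: coll_def Bochner_Integration.integral_sum expect_binomial_count[OF assms] sum_distrib_left)
qed

text \<open>The second moment runs over pairs of \<open>k\<close>-sets of positions. Pairs that
  overlap show a single element, giving \<open>\<sigma> (k + j)\<close>; two different elements
  occur only for disjoint pairs, and the disjoint pairs, \<open>j = k\<close>, are
  uncorrelated.\<close>

lemma variance_coll:
  assumes "finite S" "set_pmf p \<subseteq> S"
  defines "\<sigma> \<equiv> \<lambda>r. \<Sum>i\<in>S. pmf p i ^ r"
  shows "measure_pmf.variance (replicate_pmf s p) (\<lambda>xs. real (coll S k xs)) =
         (\<Sum>j<k. overlap s k j * (\<sigma> (k + j) - (\<sigma> k)\<^sup>2))"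
proof -
  have fin: "finite (set_pmf p)" using assms finite_subset by blast
  have ne: "expect (replicate_pmf s p) (\<lambda>xs. real (count_list xs i choose k) * real (count_list xs l choose k)) =
     overlap s k k * pmf p i ^ k * pmf p l ^ k" if "i \<in> S" "l \<in> S" "i \<noteq> l" for i l
    using expect_binomial_counts[OF assms(1,2) that, of s k k] by (simp add: overlap_alt mult_ac)
  have row: "(\<Sum>l\<in>S. expect (replicate_pmf s p) (\<lambda>xs. real (count_list xs i choose k) * real (count_list xs l choose k)))
     = (\<Sum>j<k. overlap s k j * pmf p i ^ (k + j)) + overlap s k k * pmf p i ^ k * \<sigma> k" if i: "i \<in> S" for i
  proof -
    have "(\<Sum>l\<in>S. expect (replicate_pmf s p) (\<lambda>xs. real (count_list xs i choose k) * real (count_list xs l choose k)))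
      = expect (replicate_pmf s p) (\<lambda>xs. (real (count_list xs i choose k))\<^sup>2)
        + (\<Sum>l\<in>S - {i}. overlap s k k * pmf p i ^ k * pmf p l ^ k)"
      using i assms(1) ne by (subst sum.remove[OF _ i]) (auto simp: power2_eq_square intro!: sum.cong)
    also have "(\<Sum>l\<in>S - {i}. overlap s k k * pmf p i ^ k * pmf p l ^ k) =
       overlap s k k * pmf p i ^ k * \<sigma> k - overlap s k k * pmf p i ^ (k + k)"
    proof -
      have "(\<Sum>l\<in>S - {i}. pmf p l ^ k) = \<sigma> k - pmf p i ^ k"
        using i assms(1) by (simp add: sum_diff1 \<sigma>_def)
      then show ?thesis
        unfolding sum_distrib_left[symmetric] by (simp add: power_add right_diff_distrib)
    qed
    also have "expect (replicate_pmf s p) (\<lambda>xs. (real (count_list xs i choose k))\<^sup>2) =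
       (\<Sum>j<k. overlap s k j * pmf p i ^ (k + j)) + overlap s k k * pmf p i ^ (k + k)"
      by (simp add: expect_binomial_count_square[OF assms(1,2) i] flip: lessThan_Suc_atMost)
    finally show ?thesis by simp
  qed
  have "expect (replicate_pmf s p) (\<lambda>xs. (real (coll S k xs))\<^sup>2) =
     (\<Sum>i\<in>S. \<Sum>l\<in>S. expect (replicate_pmf s p) (\<lambda>xs. real (count_list xs i choose k) * real (count_list xs l choose k)))"
    using fin by (simp add: coll_def power2_eq_square sum_product Bochner_Integration.integral_sum)
  also have "\<dots> = (\<Sum>i\<in>S. (\<Sum>j<k. overlap s k j * pmf p i ^ (k + j)) + overlap s k k * pmf p i ^ k * \<sigma> k)"
    by (intro sum.cong refl row)
  also have "\<dots> = (\<Sum>j<k. overlap s k j * \<sigma> (k + j)) + overlap s k k * (\<sigma> k)\<^sup>2"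
  proof -
    have "(\<Sum>i\<in>S. \<Sum>j<k. overlap s k j * pmf p i ^ (k + j)) = (\<Sum>j<k. overlap s k j * \<sigma> (k + j))"
      by (subst sum.swap) (simp add: \<sigma>_def sum_distrib_left)
    moreover have "(\<Sum>i\<in>S. overlap s k k * pmf p i ^ k * \<sigma> k) = overlap s k k * (\<sigma> k)\<^sup>2"
      by (simp add: \<sigma>_def power2_eq_square mult.assoc flip: sum_distrib_left sum_distrib_right)
    ultimately show ?thesis by (simp add: sum.distrib)
  qed
  finally have E2: "expect (replicate_pmf s p) (\<lambda>xs. (real (coll S k xs))\<^sup>2) =
     (\<Sum>j<k. overlap s k j * \<sigma> (k + j)) + overlap s k k * (\<sigma> k)\<^sup>2" .
  have "measure_pmf.variance (replicate_pmf s p) (\<lambda>xs. real (coll S k xs)) =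
     (\<Sum>j<k. overlap s k j * \<sigma> (k + j)) + overlap s k k * (\<sigma> k)\<^sup>2 - (real (s choose k) * \<sigma> k)\<^sup>2"
    using fin by (subst measure_pmf.variance_eq) (auto simp: E2 expect_coll[OF assms(1,2)] \<sigma>_def)
  \<comment> \<open>The squared mean is distributed over the overlap classes by
    \<open>sum_overlap\<close>, so that the class of disjoint pairs cancels.\<close>
  also have "(real (s choose k) * \<sigma> k)\<^sup>2 = (\<Sum>j<k. overlap s k j * (\<sigma> k)\<^sup>2) + overlap s k k * (\<sigma> k)\<^sup>2"
    by (simp add: power_mult_distrib sum_distrib_right flip: sum_overlap lessThan_Suc_atMost)
      (simp add: algebra_simps sum_distrib_right)
  finally show ?thesis by (simp add: algebra_simps sum_subtractf)
qed

lemma expect_count: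
  assumes "finite S" "set_pmf p \<subseteq> S" "i \<in> S"
  shows "expect (replicate_pmf s p) (\<lambda>xs. real (count_list xs i)) = real s * pmf p i"
  using expect_binomial_count[OF assms, of s 1] by simp

lemma variance_count_le:
  assumes "finite S" "set_pmf p \<subseteq> S" "i \<in> S"
  shows "measure_pmf.variance (replicate_pmf s p) (\<lambda>xs. real (count_list xs i)) \<le> real s * pmf p i"
proof -
  have fin: "finite (set_pmf p)" using assms finite_subset by blast
  have "expect (replicate_pmf s p) (\<lambda>xs. (real (count_list xs i))\<^sup>2) = real s * pmf p i + real s * real (s - 1) * (pmf p i)\<^sup>2"
    using expect_binomial_count_square[OF assms, of s 1]
    by (simp add: overlap_def power2_eq_square)
  then have "measure_pmf.variance (replicate_pmf s p) (\<lambda>xs. real (count_list xs i)) =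
     real s * pmf p i + real s * real (s - 1) * (pmf p i)\<^sup>2 - (real s * pmf p i)\<^sup>2"
    using fin by (subst measure_pmf.variance_eq) (auto simp: expect_count[OF assms])
  also have "real s * real (s - 1) * (pmf p i)\<^sup>2 \<le> real s * real s * (pmf p i)\<^sup>2"
    by (intro mult_right_mono mult_left_mono) auto
  finally show ?thesis by (simp add: power2_eq_square algebra_simps)
qed

section \<open>Threshold tests and their error probabilities\<close>

text \<open>With \<open>c / v\<close> the mean under the uniform distribution this says that
  \<open>x\<close> is further than \<open>sqrt f / v\<close> from it. Cleared of denominators, the
  comparison is exact in natural numbers.\<close>

definition rejects :: "nat \<Rightarrow> nat \<Rightarrow> nat \<Rightarrow> nat \<Rightarrow> bool" where
  "rejects v c f x \<longleftrightarrow> real f < (real v * real x - real c)\<^sup>2"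

text \<open>Chebyshev at four standard deviations; the resulting error \<open>1 / 16\<close> is what
  the majority vote needs.\<close>

lemma prob_rejects_le:
  fixes X :: "'a \<Rightarrow> nat"
  assumes int: "integrable (measure_pmf M) (\<lambda>x. (real (X x))\<^sup>2)"
    and v: "v > 0" and mean: "real v * expect M (\<lambda>x. real (X x)) = real c"
    and var: "measure_pmf.variance M (\<lambda>x. real (X x)) \<le> V" and V: "V > 0"
    and f: "real f = 16 * (real v)\<^sup>2 * V"
  shows "measure_pmf.prob M {x. rejects v c f (X x)} \<le> 1 / 16"
proof -
  let ?E = "expect M (\<lambda>x. real (X x))"
  have "measure_pmf.prob M {x. rejects v c f (X x)} \<le>
      measure_pmf.prob M {x \<in> space (measure_pmf M). 4 * sqrt V \<le> \<bar>real (X x) - ?E\<bar>}"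
  proof (rule measure_pmf.finite_measure_mono)
    show "{x. rejects v c f (X x)} \<subseteq> {x \<in> space (measure_pmf M). 4 * sqrt V \<le> \<bar>real (X x) - ?E\<bar>}"
    proof safe
      fix x assume "rejects v c f (X x)"
      then have "16 * (real v)\<^sup>2 * V < (real v * (real (X x) - ?E))\<^sup>2"
        using mean f by (simp add: rejects_def right_diff_distrib)
      then have "(4 * sqrt V)\<^sup>2 < (\<bar>real (X x) - ?E\<bar>)\<^sup>2"
        using v V by (simp add: power_mult_distrib mult.commute)
      then show "4 * sqrt V \<le> \<bar>real (X x) - ?E\<bar>" by (meson abs_ge_zero less_imp_le power2_less_imp_less)
    qed simp
  qed simp
  also have "\<dots> \<le> measure_pmf.variance M (\<lambda>x. real (X x)) / (4 * sqrt V)\<^sup>2"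
    by (rule measure_pmf.Chebyshev_inequality) (use int V in auto)
  also have "\<dots> \<le> V / (4 * sqrt V)\<^sup>2" using var by (intro divide_right_mono) auto
  also have "\<dots> = 1 / 16" using V by (simp add: power_mult_distrib)
  finally show ?thesis .
qed

lemma prob_rejects_ge:
  fixes X :: "'a \<Rightarrow> nat"
  assumes int: "integrable (measure_pmf M) (\<lambda>x. (real (X x))\<^sup>2)"
    and v: "v > 0"
    and var: "measure_pmf.variance M (\<lambda>x. real (X x)) \<le> \<sigma>\<^sup>2" and \<sigma>: "\<sigma> > 0"
    and f: "real f = 16 * (real v)\<^sup>2 * V" and V: "V \<ge> 0"
    and dev: "\<bar>expect M (\<lambda>x. real (X x)) - real c / real v\<bar> \<ge> 4 * sqrt V + 4 * \<sigma>"
  shows "measure_pmf.prob M {x. rejects v c f (X x)} \<ge> 15 / 16"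
proof -
  let ?E = "expect M (\<lambda>x. real (X x))"
  let ?B = "{x \<in> space (measure_pmf M). 4 * \<sigma> \<le> \<bar>real (X x) - ?E\<bar>}"
  have "measure_pmf.prob M ?B \<le> measure_pmf.variance M (\<lambda>x. real (X x)) / (4 * \<sigma>)\<^sup>2"
    by (rule measure_pmf.Chebyshev_inequality) (use int \<sigma> in auto)
  also have "\<dots> \<le> \<sigma>\<^sup>2 / (4 * \<sigma>)\<^sup>2" using var by (intro divide_right_mono) auto
  also have "\<dots> = 1 / 16" using \<sigma> by (simp add: power_mult_distrib)
  finally have "measure_pmf.prob M (- ?B) \<ge> 15 / 16"
    using measure_pmf.prob_compl[of ?B M] by (simp add: Compl_eq_Diff_UNIV)
  also have "measure_pmf.prob M (- ?B) \<le> measure_pmf.prob M {x. rejects v c f (X x)}"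
  proof (rule measure_pmf.finite_measure_mono)
    show "- ?B \<subseteq> {x. rejects v c f (X x)}"
    proof
      fix x assume "x \<in> - ?B"
      then have "\<bar>real (X x) - ?E\<bar> < 4 * \<sigma>" by simp
      then have "\<bar>real (X x) - real c / real v\<bar> > 4 * sqrt V" using dev by linarith
      then have "(4 * sqrt V)\<^sup>2 < \<bar>real (X x) - real c / real v\<bar>\<^sup>2" using V by (intro power_strict_mono) auto
      then have "(real v)\<^sup>2 * (4 * sqrt V)\<^sup>2 < (real v)\<^sup>2 * (real (X x) - real c / real v)\<^sup>2"
        using v by (intro mult_strict_left_mono) auto
      also have "(real v)\<^sup>2 * (real (X x) - real c / real v)\<^sup>2 = (real v * real (X x) - real c)\<^sup>2"
        using v by (simp add: power_mult_distrib[symmetric] right_diff_distrib)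
      finally show "x \<in> {x. rejects v c f (X x)}" using V f by (simp add: rejects_def power_mult_distrib mult_ac)
    qed
  qed simp
  finally show ?thesis .
qed

text \<open>The variance may grow linearly with the deviation \<open>D\<close> itself, so a large
  \<open>D\<close> outruns its own standard deviation. Beyond the stated bound the threshold takes
  at most \<open>\<bar>D\<bar> / 4\<close> and the noise, four standard deviations, at most
  \<open>\<bar>D\<bar> / 2\<close>; the test would then reject.\<close>

lemma deviation_small:
  fixes X :: "'a \<Rightarrow> nat" and D :: real
  assumes int: "integrable (measure_pmf M) (\<lambda>x. (real (X x))\<^sup>2)"
    and v: "v > 0" and f: "real f = 16 * (real v)\<^sup>2 * V" and V: "0 \<le> V" "V \<le> W * e"
    and W: "W \<ge> 1" and e: "e \<ge> 0"
    and mean: "D = expect M (\<lambda>x. real (X x)) - real c / real v"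
    and var: "measure_pmf.variance M (\<lambda>x. real (X x)) \<le> W * (e + \<bar>D\<bar>)"
    and not: "measure_pmf.prob M {x. rejects v c f (X x)} < 15 / 16"
  shows "\<bar>D\<bar> \<le> 16 * sqrt (W * e) + 256 * W"
proof (rule ccontr)
  assume "\<not> ?thesis"
  then have D: "\<bar>D\<bar> > 16 * sqrt (W * e)" "\<bar>D\<bar> > 256 * W" using W e by (auto simp: not_le intro: le_less_trans[rotated])
  have D0: "\<bar>D\<bar> > 0" using D(2) W by linarith
  have "4 * sqrt V \<le> 4 * sqrt (W * e)" using V by simp
  then have 1: "4 * sqrt V \<le> \<bar>D\<bar> / 4" using D by linarith
  have "sqrt (W * (e + \<bar>D\<bar>)) \<le> sqrt (W * e) + sqrt (W * \<bar>D\<bar>)"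
    using W e by (simp add: distrib_left sqrt_add_le_add_sqrt)
  moreover have "sqrt (W * \<bar>D\<bar>) \<le> \<bar>D\<bar> / 16"
  proof (rule real_le_lsqrt)
    have "256 * W * \<bar>D\<bar> \<le> \<bar>D\<bar> * \<bar>D\<bar>" using D by (intro mult_right_mono) auto
    then show "W * \<bar>D\<bar> \<le> (\<bar>D\<bar> / 16)\<^sup>2" by (simp add: power2_eq_square)
  qed (use W in auto)
  ultimately have 2: "4 * sqrt (W * (e + \<bar>D\<bar>)) \<le> \<bar>D\<bar> / 2" using D by linarith
  have pos: "W * (e + \<bar>D\<bar>) > 0" using W e D0 by (intro mult_pos_pos) auto
  have "measure_pmf.prob M {x. rejects v c f (X x)} \<ge> 15 / 16"
  proof (rule prob_rejects_ge[OF int v _ _ f V(1)])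
    show "measure_pmf.variance M (\<lambda>x. real (X x)) \<le> (sqrt (W * (e + \<bar>D\<bar>)))\<^sup>2"
      using var pos by simp
    show "0 < sqrt (W * (e + \<bar>D\<bar>))" using pos by simp
    show "4 * sqrt V + 4 * sqrt (W * (e + \<bar>D\<bar>)) \<le> \<bar>expect M (\<lambda>x. real (X x)) - real c / real v\<bar>"
      using 1 2 D0 mean by linarith
  qed
  then show False using not by simp
qed

text \<open>The thresholds are 16 times a bound for the variance under the uniform distribution, scaled by
  \<open>v\<^sup>2\<close>. For \<open>k\<close>-fold collisions that bound is \<open>2 ^ k * (s choose k) * n / n ^ k * (1 + s / n) ^ (k - 2)\<close>.\<close>

definition elem_test :: "nat \<Rightarrow> nat \<Rightarrow> nat \<Rightarrow> nat list \<Rightarrow> bool" where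
  "elem_test n s i xs = rejects n s (16 * n * s) (count_list xs i)"

definition coll_test :: "nat \<Rightarrow> nat \<Rightarrow> nat \<Rightarrow> nat list \<Rightarrow> bool" where
  "coll_test n s k xs = rejects (n ^ (k - 1)) (s choose k)
     (64 * n * (2 * (n + s)) ^ (k - 2) * (s choose k)) (coll {1..n} k xs)"

lemma finite_set_dists: "p \<in> dists n \<Longrightarrow> finite (set_pmf p)"
  by (auto simp: dists_def intro: finite_subset)

lemma unif_in_dists: "n \<ge> 1 \<Longrightarrow> unif n \<in> dists n"
  by (simp add: dists_def unif_def)

lemma pmf_unif: "n \<ge> 1 \<Longrightarrow> i \<in> {1..n} \<Longrightarrow> pmf (unif n) i = 1 / real n"
  by (simp add: unif_def)

lemma sum_pmf_dists: "p \<in> dists n \<Longrightarrow> (\<Sum>i\<in>{1..n}. pmf p i) = 1"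
  by (intro sum_pmf_eq_1) (auto simp: dists_def)

lemma elem_test_unif:
  assumes "n \<ge> 1" "s \<ge> 1" "i \<in> {1..n}"
  shows "measure_pmf.prob (replicate_pmf s (unif n)) {xs. elem_test n s i xs} \<le> 1 / 16"
  unfolding elem_test_def
proof (rule prob_rejects_le)
  have d: "set_pmf (unif n) \<subseteq> {1..n}" using unif_in_dists[OF assms(1)] by (simp add: dists_def)
  have fin: "finite (set_pmf (unif n))" using d finite_subset by blast
  show "integrable (measure_pmf (replicate_pmf s (unif n))) (\<lambda>xs. (real (count_list xs i))\<^sup>2)"
    using fin by simp
  show "real n * expect (replicate_pmf s (unif n)) (\<lambda>xs. real (count_list xs i)) = real s"
    using assms by (simp add: expect_count[OF _ d] pmf_unif)
  show "measure_pmf.variance (replicate_pmf s (unif n)) (\<lambda>xs. real (count_list xs i)) \<le> real s / real n"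
    using variance_count_le[OF _ d assms(3), of s] assms by (simp add: pmf_unif)
qed (use assms in \<open>auto simp: power2_eq_square\<close>)

lemma sum_power_le_binomial:
  assumes "0 \<le> (y::real)"
  shows "(\<Sum>j\<le>m. y ^ j) \<le> (1 + y) ^ m"
proof -
  have "(\<Sum>j\<le>m. y ^ j) \<le> (\<Sum>j\<le>m. real (m choose j) * y ^ j)"
  proof (intro sum_mono)
    fix j assume "j \<in> {..m}"
    then have "1 \<le> m choose j" by (simp add: Suc_leI zero_less_binomial)
    then have "1 \<le> real (m choose j)" by simp
    then show "y ^ j \<le> real (m choose j) * y ^ j"
      using mult_right_mono[of 1 "real (m choose j)" "y ^ j"] assms by simp
  qed
  also have "\<dots> = (y + 1) ^ m" by (subst binomial_ring) simp
  finally show ?thesis by (simp add: add.commute)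
qed

lemma coll_threshold:
  assumes "n \<ge> 1" "k \<ge> 2"
  shows "real (64 * n * (2 * (n + s)) ^ (k - 2) * (s choose k)) =
     16 * (real (n ^ (k - 1)))\<^sup>2 *
       (2 ^ k * (real (s choose k) * (real n / real n ^ k)) * (1 + real s / real n) ^ (k - 2))"
proof -
  obtain l where l: "k = Suc (Suc l)" using assms(2) by (metis add_2_eq_Suc le_Suc_ex)
  have n0: "real n > 0" using assms by simp
  define z where "z = (real n + real s) ^ l"
  have 1: "real ((2 * (n + s)) ^ l) = 2 ^ l * z"
    by (simp only: of_nat_power of_nat_mult of_nat_add of_nat_numeral power_mult_distrib z_def)
  have "1 + real s / real n = (real n + real s) / real n" using n0 by (simp add: field_simps)
  then have 2: "(1 + real s / real n) ^ l = z / real n ^ l" by (simp only: power_divide z_def)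
  have kl: "k - 2 = l" "k - 1 = Suc l" by (auto simp: l)
  show ?thesis unfolding kl of_nat_mult 1 2 unfolding l
    using n0 by (simp add: power2_eq_square)
qed

lemma coll_test_unif:
  assumes n: "n \<ge> 1" and k: "2 \<le> k" "k \<le> s"
  shows "measure_pmf.prob (replicate_pmf s (unif n)) {xs. coll_test n s k xs} \<le> 1 / 16"
  unfolding coll_test_def
proof (rule prob_rejects_le[OF _ _ _ _ _ coll_threshold[OF n k(1), of s]])
  have d: "set_pmf (unif n) \<subseteq> {1..n}" using unif_in_dists[OF n] by (simp add: dists_def)
  have fin: "finite (set_pmf (unif n))" using d finite_subset by blast
  have n0: "real n > 0" using n by simp
  have sig: "(\<Sum>i\<in>{1..n}. pmf (unif n) i ^ r) = real n / real n ^ r" for r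
    using n by (simp add: pmf_unif power_divide)
  obtain l where l: "k = Suc (Suc l)" using k(1) by (metis add_2_eq_Suc le_Suc_ex)
  show "integrable (measure_pmf (replicate_pmf s (unif n))) (\<lambda>xs. (real (coll {1..n} k xs))\<^sup>2)"
    using fin by simp
  show "0 < n ^ (k - 1)" using n by simp
  show "real (n ^ (k - 1)) * expect (replicate_pmf s (unif n)) (\<lambda>xs. real (coll {1..n} k xs)) = real (s choose k)"
    using n0 unfolding expect_coll[OF finite_atLeastAtMost d] sig by (simp add: l)
  show "0 < 2 ^ k * (real (s choose k) * (real n / real n ^ k)) * (1 + real s / real n) ^ (k - 2)"
    using n0 k by (intro mult_pos_pos divide_pos_pos zero_less_power) (auto simp: add_pos_nonneg)
  have "measure_pmf.variance (replicate_pmf s (unif n)) (\<lambda>xs. real (coll {1..n} k xs)) =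
     (\<Sum>j<k. overlap s k j * (real n / real n ^ (k + j) - (real n / real n ^ k)\<^sup>2))"
    by (subst variance_coll[OF _ d]) (auto simp only: sig finite_atLeastAtMost)
  also have "\<dots> = (\<Sum>j\<le>l. overlap s k j * (real n / real n ^ (k + j) - (real n / real n ^ k)\<^sup>2))"
  proof -
    \<comment> \<open>The class \<open>j = k - 1\<close>: under the uniform distribution even
      \<open>k\<close>-sets that share exactly one position are uncorrelated. This is why the
      threshold carries the exponent \<open>k - 2\<close>, and why for \<open>k = 2\<close> it
      contains no power of \<open>1 + s / n\<close>.\<close>
    have "real n / real n ^ (k + Suc l) - (real n / real n ^ k)\<^sup>2 = 0"
      using n0 by (simp add: l power_add power2_eq_square)
    then show ?thesis by (simp add: l lessThan_Suc_atMost del: power_Suc)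
  qed
  also have "\<dots> \<le> (\<Sum>j\<le>l. (real (s choose k) * 2 ^ k * real s ^ j) * (real n / real n ^ (k + j)))"
  proof (intro sum_mono)
    fix j
    have "real (k choose j) \<le> 2 ^ k" using binomial_le_pow2[of k j] by (simp flip: of_nat_le_iff)
    then have "real (s choose k) * real (k choose j) * real s ^ j \<le> real (s choose k) * 2 ^ k * real s ^ j"
      by (intro mult_right_mono mult_left_mono) auto
    then have "overlap s k j \<le> real (s choose k) * 2 ^ k * real s ^ j"
      using overlap_le[of s k j] by linarith
    then have "overlap s k j * (real n / real n ^ (k + j)) \<le> (real (s choose k) * 2 ^ k * real s ^ j) * (real n / real n ^ (k + j))"
      by (intro mult_right_mono) auto
    moreover have "overlap s k j * (real n / real n ^ (k + j) - (real n / real n ^ k)\<^sup>2) \<le> overlap s k j * (real n / real n ^ (k + j))"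
      by (intro mult_left_mono overlap_nonneg) auto
    ultimately show "overlap s k j * (real n / real n ^ (k + j) - (real n / real n ^ k)\<^sup>2) \<le>
       (real (s choose k) * 2 ^ k * real s ^ j) * (real n / real n ^ (k + j))" by linarith
  qed
  also have "\<dots> = 2 ^ k * (real (s choose k) * (real n / real n ^ k)) * (\<Sum>j\<le>l. (real s / real n) ^ j)"
    unfolding sum_distrib_left by (intro sum.cong refl) (simp add: power_add power_divide)
  also have "\<dots> \<le> 2 ^ k * (real (s choose k) * (real n / real n ^ k)) * (1 + real s / real n) ^ l"
    by (intro mult_left_mono sum_power_le_binomial) auto
  also have "l = k - 2" by (simp add: l)
  finally show "measure_pmf.variance (replicate_pmf s (unif n)) (\<lambda>xs. real (coll {1..n} k xs)) \<le>
     2 ^ k * (real (s choose k) * (real n / real n ^ k)) * (1 + real s / real n) ^ (k - 2)" .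
qed

lemma elem_test_small:
  assumes n: "n \<ge> 1" and p: "p \<in> dists n" and i: "i \<in> {1..n}"
    and not: "measure_pmf.prob (replicate_pmf s p) {xs. elem_test n s i xs} < 15 / 16"
  shows "\<bar>real s * pmf p i - real s / real n\<bar> \<le> 16 * sqrt (real s / real n) + 256"
proof -
  have d: "set_pmf p \<subseteq> {1..n}" using p by (simp add: dists_def)
  note fin = finite_set_dists[OF p]
  have "\<bar>real s * pmf p i - real s / real n\<bar> \<le> 16 * sqrt (1 * (real s / real n)) + 256 * 1"
  proof (rule deviation_small[where V="real s / real n" and X="\<lambda>xs. count_list xs i" and v=n and c=s])
    show "integrable (measure_pmf (replicate_pmf s p)) (\<lambda>xs. (real (count_list xs i))\<^sup>2)"
      using fin by simp
    show "real s * pmf p i - real s / real n = expect (replicate_pmf s p) (\<lambda>xs. real (count_list xs i)) - real s / real n"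
      using i by (simp add: expect_count[OF _ d])
    show "measure_pmf.variance (replicate_pmf s p) (\<lambda>xs. real (count_list xs i)) \<le>
       1 * (real s / real n + \<bar>real s * pmf p i - real s / real n\<bar>)"
      using variance_count_le[OF _ d i, of s] by simp
    show "measure_pmf.prob (replicate_pmf s p) {xs. rejects n s (16 * n * s) (count_list xs i)} < 15 / 16"
      using not by (simp add: elem_test_def)
  qed (use n in \<open>auto simp: power2_eq_square\<close>)
  then show ?thesis by simp
qed

text \<open>Here \<open>w\<close> bounds the expected number of occurrences of each element in a
  block. Summing over the overlaps gives \<open>(1 + s * pmf p i) ^ k \<le> (2 + 2 * w) ^ k\<close>,
  so the variance is at most \<open>(2 + 2 * w) ^ k\<close> times the mean \<open>e + D\<close>, the
  form that \<open>deviation_small\<close> requires.\<close>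

lemma coll_test_small:
  assumes n: "n \<ge> 1" and p: "p \<in> dists n" and k: "k \<ge> 2"
    and w: "\<And>i. i \<in> {1..n} \<Longrightarrow> real s * pmf p i \<le> w" "real s / real n \<le> w"
    and not: "measure_pmf.prob (replicate_pmf s p) {xs. coll_test n s k xs} < 15 / 16"
  defines "e \<equiv> real (s choose k) * (real n / real n ^ k)"
  shows "real (s choose k) * (\<Sum>i\<in>{1..n}. pmf p i ^ k) - e \<le> 16 * sqrt ((2 + 2 * w) ^ k * e) + 256 * (2 + 2 * w) ^ k"
proof -
  have d: "set_pmf p \<subseteq> {1..n}" using p by (simp add: dists_def)
  note fin = finite_set_dists[OF p]
  have n0: "real n > 0" using n by simp
  have w0: "w \<ge> 0" using w(2) by (rule order_trans[rotated]) simp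
  have e0: "e \<ge> 0" by (simp add: e_def)
  define \<sigma> where "\<sigma> r = (\<Sum>i\<in>{1..n}. pmf p i ^ r)" for r
  define D where "D = real (s choose k) * \<sigma> k - e"
  have \<sigma>0: "\<sigma> r \<ge> 0" for r unfolding \<sigma>_def by (intro sum_nonneg) auto
  have "\<bar>D\<bar> \<le> 16 * sqrt ((2 + 2 * w) ^ k * e) + 256 * (2 + 2 * w) ^ k"
  proof (rule deviation_small[where X="coll {1..n} k" and v="n ^ (k - 1)" and c="s choose k", OF _ _ coll_threshold[OF n k, of s]])
    show "integrable (measure_pmf (replicate_pmf s p)) (\<lambda>xs. (real (coll {1..n} k xs))\<^sup>2)"
      using fin by simp
    show "0 < n ^ (k - 1)" using n by simp
    show "0 \<le> 2 ^ k * (real (s choose k) * (real n / real n ^ k)) * (1 + real s / real n) ^ (k - 2)"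
      by simp
    have "(1 + real s / real n) ^ (k - 2) \<le> (1 + w) ^ (k - 2)"
      using w(2) by (intro power_mono) auto
    also have "\<dots> \<le> (1 + w) ^ k" using w0 by (intro power_increasing) auto
    finally have "2 ^ k * e * (1 + real s / real n) ^ (k - 2) \<le> 2 ^ k * e * (1 + w) ^ k"
      using e0 by (intro mult_left_mono) auto
    also have "\<dots> = (2 + 2 * w) ^ k * e"
      by (simp add: mult_ac flip: power_mult_distrib)
    finally show "2 ^ k * (real (s choose k) * (real n / real n ^ k)) * (1 + real s / real n) ^ (k - 2) \<le> (2 + 2 * w) ^ k * e"
      by (simp add: e_def)
    show "1 \<le> (2 + 2 * w) ^ k" using w0 by (intro one_le_power) auto
    show "D = expect (replicate_pmf s p) (\<lambda>xs. real (coll {1..n} k xs)) - real (s choose k) / real (n ^ (k - 1))"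
    proof -
      have "real n / real n ^ k = 1 / real n ^ (k - 1)"
        using n0 k by (cases k) auto
      then show ?thesis unfolding expect_coll[OF finite_atLeastAtMost d] D_def e_def \<sigma>_def by simp
    qed
    show "measure_pmf.variance (replicate_pmf s p) (\<lambda>xs. real (coll {1..n} k xs)) \<le> (2 + 2 * w) ^ k * (e + \<bar>D\<bar>)"
    proof -
      have "measure_pmf.variance (replicate_pmf s p) (\<lambda>xs. real (coll {1..n} k xs)) =
        (\<Sum>j<k. overlap s k j * (\<sigma> (k + j) - (\<sigma> k)\<^sup>2))"
        unfolding variance_coll[OF finite_atLeastAtMost d] \<sigma>_def ..
      also have "\<dots> \<le> (\<Sum>j<k. (real (s choose k) * real (k choose j) * real s ^ j) * \<sigma> (k + j))"
      proof (intro sum_mono)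
        fix j
        have "overlap s k j * (\<sigma> (k + j) - (\<sigma> k)\<^sup>2) \<le> overlap s k j * \<sigma> (k + j)"
          by (intro mult_left_mono overlap_nonneg) auto
        also have "\<dots> \<le> (real (s choose k) * real (k choose j) * real s ^ j) * \<sigma> (k + j)"
          by (intro mult_right_mono overlap_le \<sigma>0)
        finally show "overlap s k j * (\<sigma> (k + j) - (\<sigma> k)\<^sup>2) \<le> (real (s choose k) * real (k choose j) * real s ^ j) * \<sigma> (k + j)" .
      qed
      also have "\<dots> \<le> (\<Sum>j\<le>k. (real (s choose k) * real (k choose j) * real s ^ j) * \<sigma> (k + j))"
        by (rule sum_mono2) (auto simp: \<sigma>0)
      also have "\<dots> = real (s choose k) * (\<Sum>i\<in>{1..n}. pmf p i ^ k * (\<Sum>j\<le>k. real (k choose j) * (real s * pmf p i) ^ j))"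
        unfolding \<sigma>_def sum_distrib_left by (subst sum.swap) (simp add: power_add power_mult_distrib mult_ac)
      also have "\<dots> = real (s choose k) * (\<Sum>i\<in>{1..n}. pmf p i ^ k * (real s * pmf p i + 1) ^ k)"
        unfolding binomial_ring by simp
      also have "\<dots> \<le> real (s choose k) * (\<Sum>i\<in>{1..n}. pmf p i ^ k * (2 + 2 * w) ^ k)"
      proof (intro mult_left_mono sum_mono power_mono)
        fix i assume "i \<in> {1..n}"
        then show "real s * pmf p i + 1 \<le> 2 + 2 * w" using w(1)[of i] w0 by simp
      qed auto
      also have "\<dots> = (2 + 2 * w) ^ k * (e + D)"
        by (simp add: D_def \<sigma>_def sum_distrib_right[symmetric])
      also have "\<dots> \<le> (2 + 2 * w) ^ k * (e + \<bar>D\<bar>)" using w0 by (intro mult_left_mono) auto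
      finally show ?thesis .
    qed
    show "measure_pmf.prob (replicate_pmf s p) {x. rejects (n ^ (k - 1)) (s choose k)
        (64 * n * (2 * (n + s)) ^ (k - 2) * (s choose k)) (coll {1..n} k x)} < 15 / 16"
      using not by (simp only: coll_test_def)
  qed (use e0 in auto)
  then show ?thesis by (simp add: D_def \<sigma>_def)
qed

section \<open>Pairwise collisions as a test of the distance to uniform\<close>

lemma choose_two_real: "real (s choose 2) = real s * (real s - 1) / 2"
  by (induction s) (auto simp: numeral_2_eq_2 field_simps)

lemma sum_square_deviation:
  assumes n: "n \<ge> 1" and p: "p \<in> dists n"
  shows "(\<Sum>i\<in>{1..n}. (pmf p i - 1 / real n)\<^sup>2) = (\<Sum>i\<in>{1..n}. pmf p i ^ 2) - 1 / real n"
proof -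
  have "(\<Sum>i\<in>{1..n}. (pmf p i - 1 / real n)\<^sup>2) =
     (\<Sum>i\<in>{1..n}. pmf p i ^ 2) - 2 / real n * (\<Sum>i\<in>{1..n}. pmf p i) + (\<Sum>i\<in>{1..n}. (1 / real n)\<^sup>2)"
    by (simp add: power2_diff sum.distrib sum_subtractf sum_distrib_left mult_ac)
  then show ?thesis using n by (simp add: sum_pmf_dists[OF p, simplified] power2_eq_square field_simps)
qed

text \<open>The left side is the variance of \<open>pmf p i\<close> for \<open>i\<close> drawn from
  \<open>p\<close>, hence at most the mean squared distance of \<open>pmf p i\<close> from
  \<open>1 / n\<close>; and no mass exceeds \<open>1 / n + sqrt Q\<close>.\<close>

lemma third_moment_le:
  assumes n: "n \<ge> 1" and p: "p \<in> dists n"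
  defines "Q \<equiv> \<Sum>i\<in>{1..n}. (pmf p i - 1 / real n)\<^sup>2"
  shows "(\<Sum>i\<in>{1..n}. pmf p i ^ 3) - (\<Sum>i\<in>{1..n}. pmf p i ^ 2)\<^sup>2 \<le> (1 / real n + sqrt Q) * Q"
proof -
  define u where "u = 1 / real n"
  define S2 where "S2 = (\<Sum>i\<in>{1..n}. pmf p i ^ 2)"
  have "(\<Sum>i\<in>{1..n}. pmf p i * (pmf p i - u)\<^sup>2) =
     (\<Sum>i\<in>{1..n}. pmf p i ^ 3) - 2 * u * S2 + u\<^sup>2 * (\<Sum>i\<in>{1..n}. pmf p i)"
    by (simp add: S2_def power2_eq_square power3_eq_cube algebra_simps sum.distrib sum_subtractf sum_distrib_left)
  then have "(\<Sum>i\<in>{1..n}. pmf p i ^ 3) - S2\<^sup>2 = (\<Sum>i\<in>{1..n}. pmf p i * (pmf p i - u)\<^sup>2) - (S2 - u)\<^sup>2"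
    by (simp add: sum_pmf_dists[OF p, simplified] power2_eq_square algebra_simps)
  also have "\<dots> \<le> (\<Sum>i\<in>{1..n}. pmf p i * (pmf p i - u)\<^sup>2)" by simp
  also have "\<dots> \<le> (\<Sum>i\<in>{1..n}. (u + sqrt Q) * (pmf p i - u)\<^sup>2)"
  proof (intro sum_mono mult_right_mono)
    fix i assume i: "i \<in> {1..n}"
    have "(pmf p i - u)\<^sup>2 \<le> Q" unfolding Q_def u_def using i by (intro member_le_sum) auto
    then have "\<bar>pmf p i - u\<bar> \<le> sqrt Q" by (rule real_le_rsqrt[of "\<bar>pmf p i - u\<bar>", unfolded power2_abs])
    then show "pmf p i \<le> u + sqrt Q" by linarith
  qed auto
  also have "\<dots> = (u + sqrt Q) * Q" by (simp add: Q_def u_def sum_distrib_left)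
  finally show ?thesis by (simp add: u_def S2_def)
qed

text \<open>The shift of the mean is of order \<open>y\<^sup>2\<close>, so a variance of degree
  below 4 in \<open>y\<close> is what makes a large distance detectable.\<close>

lemma collision_variance_le:
  assumes n: "n \<ge> 1" and p: "p \<in> dists n" and s: "s \<ge> 2"
  defines "y \<equiv> real s * sqrt (\<Sum>i\<in>{1..n}. (pmf p i - 1 / real n)\<^sup>2)" and "z \<equiv> real s / sqrt (real n)"
  shows "measure_pmf.variance (replicate_pmf s p) (\<lambda>xs. real (coll {1..n} 2 xs)) \<le>
      z\<^sup>2 / 2 + y\<^sup>2 / 2 + z * y\<^sup>2 + y ^ 3"
proof -
  have d: "set_pmf p \<subseteq> {1..n}" using p by (simp add: dists_def)
  have n0: "real n > 0" using n by simp
  define Q where "Q = (\<Sum>i\<in>{1..n}. (pmf p i - 1 / real n)\<^sup>2)"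
  have Q0: "Q \<ge> 0" unfolding Q_def by (intro sum_nonneg) auto
  have yQ: "y = real s * sqrt Q" by (simp only: y_def Q_def)
  define \<sigma> where "\<sigma> r = (\<Sum>i\<in>{1..n}. pmf p i ^ r)" for r
  have s2: "\<sigma> 2 = 1 / real n + Q" using sum_square_deviation[OF n p] by (simp add: \<sigma>_def Q_def)
  have s3: "\<sigma> 3 - (\<sigma> 2)\<^sup>2 \<le> (1 / real n + sqrt Q) * Q"
    using third_moment_le[OF n p] by (simp add: \<sigma>_def Q_def)
  have c: "real (s choose 2) \<le> real s ^ 2 / 2"
    by (simp add: choose_two_real power2_eq_square field_simps)
  have o: "overlap s 2 (Suc 0) \<le> real s ^ 3"
  proof -
    have "overlap s 2 (Suc 0) = real (s choose 2) * 2 * real (s - 2)" by (simp add: overlap_def)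
    also have "\<dots> \<le> (real s ^ 2 / 2) * 2 * real s" by (intro mult_mono c) auto
    finally show ?thesis by (simp add: power2_eq_square power3_eq_cube)
  qed
  have "measure_pmf.variance (replicate_pmf s p) (\<lambda>xs. real (coll {1..n} 2 xs)) =
     overlap s 2 0 * (\<sigma> 2 - (\<sigma> 2)\<^sup>2) + overlap s 2 (Suc 0) * (\<sigma> 3 - (\<sigma> 2)\<^sup>2)"
    unfolding variance_coll[OF finite_atLeastAtMost d] \<sigma>_def
    by (simp add: numeral_2_eq_2 numeral_3_eq_3)
  also have "\<dots> \<le> real s ^ 2 / 2 * \<sigma> 2 + real s ^ 3 * ((1 / real n + sqrt Q) * Q)"
  proof (intro add_mono)
    have "overlap s 2 0 * (\<sigma> 2 - (\<sigma> 2)\<^sup>2) \<le> overlap s 2 0 * \<sigma> 2"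
      by (intro mult_left_mono overlap_nonneg) auto
    also have "\<dots> \<le> real s ^ 2 / 2 * \<sigma> 2" using c Q0 s2 by (intro mult_right_mono) (auto simp: overlap_def)
    finally show "overlap s 2 0 * (\<sigma> 2 - (\<sigma> 2)\<^sup>2) \<le> real s ^ 2 / 2 * \<sigma> 2" .
    have "overlap s 2 (Suc 0) * (\<sigma> 3 - (\<sigma> 2)\<^sup>2) \<le> overlap s 2 (Suc 0) * ((1 / real n + sqrt Q) * Q)"
      by (intro mult_left_mono overlap_nonneg s3)
    also have "\<dots> \<le> real s ^ 3 * ((1 / real n + sqrt Q) * Q)"
      using Q0 by (intro mult_right_mono o) auto
    finally show "overlap s 2 (Suc 0) * (\<sigma> 3 - (\<sigma> 2)\<^sup>2) \<le> real s ^ 3 * ((1 / real n + sqrt Q) * Q)" .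
  qed
  also have "\<dots> = z\<^sup>2 / 2 + y\<^sup>2 / 2 + real s / real n * y\<^sup>2 + y ^ 3"
  proof -
    have "z\<^sup>2 = real s ^ 2 / real n" "y\<^sup>2 = real s ^ 2 * Q"
      using Q0 by (simp_all add: z_def y_def power_divide power_mult_distrib Q_def)
    moreover have "y ^ 3 = real s ^ 3 * (sqrt Q * Q)"
      using Q0 unfolding yQ by (simp add: power3_eq_cube algebra_simps)
    moreover have "real s ^ 3 * ((1 / real n + sqrt Q) * Q) = real s / real n * (real s ^ 2 * Q) + real s ^ 3 * (sqrt Q * Q)"
      by (simp add: power3_eq_cube power2_eq_square algebra_simps)
    ultimately show ?thesis
      by (simp add: s2 distrib_left add_divide_distrib)
  qed
  also have "real s / real n \<le> z"
    unfolding z_def using n by (intro divide_left_mono) (auto simp: real_le_lsqrt power2_eq_square)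
  finally show ?thesis by (simp add: mult_right_mono)
qed

text \<open>Individual masses may be arbitrarily large here, so the bound of
  \<open>coll_test_small\<close> through \<open>w\<close> is replaced by the finer variance in terms
  of \<open>y\<close> and \<open>z\<close>.\<close>

lemma collision_test_small:
  assumes n: "n \<ge> 1" and p: "p \<in> dists n" and s: "s \<ge> 2"
    and not: "measure_pmf.prob (replicate_pmf s p) {xs. coll_test n s 2 xs} < 15 / 16"
  shows "(real s)\<^sup>2 * (\<Sum>i\<in>{1..n}. (pmf p i - 1 / real n)\<^sup>2) \<le> 2 ^ 24 * (1 + real s / sqrt (real n))"
proof (rule ccontr)
  assume con: "\<not> ?thesis"
  have d: "set_pmf p \<subseteq> {1..n}" using p by (simp add: dists_def)
  note fin = finite_set_dists[OF p]
  have n0: "real n > 0" using n by simp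
  define Q where "Q = (\<Sum>i\<in>{1..n}. (pmf p i - 1 / real n)\<^sup>2)"
  have Q0: "Q \<ge> 0" unfolding Q_def by (intro sum_nonneg) auto
  define y where "y = real s * sqrt Q"
  define z where "z = real s / sqrt (real n)"
  have y2: "y\<^sup>2 = (real s)\<^sup>2 * Q" using Q0 by (simp add: y_def power_mult_distrib)
  have y0: "y \<ge> 0" using Q0 by (simp add: y_def)
  have z0: "z \<ge> 0" by (simp add: z_def)
  have big: "y\<^sup>2 > 2 ^ 24 * (1 + z)" using con by (simp add: y2 Q_def z_def)
  have yy: "y\<^sup>2 > 2 ^ 24" "y\<^sup>2 > 2 ^ 24 * z" using big z0 by (auto simp: algebra_simps)
  have "(2 ^ 12)\<^sup>2 < y\<^sup>2" using yy by simp
  then have y12: "2 ^ 12 < y" using y0 by (rule power2_less_imp_less)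
  have ypos: "y > 0" using y12 by (rule less_trans[rotated]) simp
  define q where "q = y\<^sup>2"
  have q0: "q > 0" using ypos by (simp add: q_def)
  \<comment> \<open>Since \<open>q\<close> exceeds \<open>2 ^ 24 * (1 + z)\<close>, each variance
    term is at most \<open>q\<^sup>2 / 4096\<close>. The standard deviation is then at most
    \<open>q / 36\<close>, against a shift of the mean by at least \<open>q / 4\<close>.\<close>
  have "z\<^sup>2 \<le> (q / 64)\<^sup>2" using yy z0 q0 by (intro power_mono) (auto simp: q_def)
  then have t1: "z\<^sup>2 \<le> q\<^sup>2 / 4096" by (simp add: power_divide)
  have "4096 * q \<le> q * q" using yy q0 by (intro mult_right_mono) (auto simp: q_def)
  then have t2: "q \<le> q\<^sup>2 / 4096" by (simp add: power2_eq_square)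
  have "4096 * z * q \<le> q * q" using yy q0 z0 by (intro mult_right_mono) (auto simp: q_def)
  then have t3: "z * q \<le> q\<^sup>2 / 4096" by (simp add: power2_eq_square)
  have "4096 * y ^ 3 \<le> y * y ^ 3" using y12 y0 by (intro mult_right_mono) auto
  then have t4: "y ^ 3 \<le> q\<^sup>2 / 4096" by (simp add: q_def power2_eq_square power3_eq_cube mult_ac)
  have var: "measure_pmf.variance (replicate_pmf s p) (\<lambda>xs. real (coll {1..n} 2 xs)) \<le> (q / 36)\<^sup>2"
  proof -
    have "measure_pmf.variance (replicate_pmf s p) (\<lambda>xs. real (coll {1..n} 2 xs)) \<le> z\<^sup>2 / 2 + q / 2 + z * q + y ^ 3"
      using collision_variance_le[OF n p s] by (simp add: y_def z_def Q_def q_def)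
    also have "\<dots> \<le> q\<^sup>2 / 1296" using t1 t2 t3 t4 zero_le_power2[of q] by linarith
    finally show ?thesis by (simp add: power_divide)
  qed
  define V where "V = 4 * (real (s choose 2) * (1 / real n))"
  have th: "real (64 * n * (2 * (n + s)) ^ (2 - 2) * (s choose 2)) = 16 * (real (n ^ (2 - 1)))\<^sup>2 * V"
    using n0 by (simp add: V_def power2_eq_square)
  have c1: "real (s choose 2) \<le> real s ^ 2 / 2"
    by (simp add: choose_two_real power2_eq_square field_simps)
  have c2: "real (s choose 2) \<ge> real s ^ 2 / 4"
  proof -
    have "real s * (real s - 2) \<ge> 0" using s by simp
    then show ?thesis using s
      by (simp add: choose_two_real power2_eq_square field_simps)
  qed
  have "measure_pmf.prob (replicate_pmf s p) {xs. coll_test n s 2 xs} \<ge> 15 / 16"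
    unfolding coll_test_def
  proof (rule prob_rejects_ge[OF _ _ var _ th])
    show "integrable (measure_pmf (replicate_pmf s p)) (\<lambda>xs. (real (coll {1..n} 2 xs))\<^sup>2)"
      using fin by simp
    show "0 < n ^ (2 - 1)" using n by simp
    show "0 < q / 36" using q0 by simp
    show "0 \<le> V" by (simp add: V_def)
    have "V \<le> 4 * (real s ^ 2 / 2 * (1 / real n))" unfolding V_def by (intro mult_left_mono mult_right_mono c1) auto
    also have "\<dots> = 2 * z\<^sup>2" by (simp add: z_def power_divide)
    also have "\<dots> \<le> (2 * z)\<^sup>2" by (simp add: power_mult_distrib)
    finally have V: "sqrt V \<le> 2 * z" using z0 by (intro real_le_lsqrt) auto
    have "expect (replicate_pmf s p) (\<lambda>xs. real (coll {1..n} 2 xs)) - real (s choose 2) / real (n ^ (2 - 1))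
       = real (s choose 2) * Q"
      unfolding expect_coll[OF finite_atLeastAtMost d] Q_def sum_square_deviation[OF n p]
      by (simp add: right_diff_distrib)
    moreover have "real (s choose 2) * Q \<ge> q / 4"
      using mult_right_mono[OF c2 Q0] by (simp add: q_def y2)
    moreover have "16777216 * z < q" using yy(2) by (simp add: q_def)
    ultimately show "4 * sqrt V + 4 * (q / 36) \<le>
       \<bar>expect (replicate_pmf s p) (\<lambda>xs. real (coll {1..n} 2 xs)) - real (s choose 2) / real (n ^ (2 - 1))\<bar>"
      using V q0 by linarith
  qed
  then show False using not by simp
qed

section \<open>Some test sees every distinguishable distribution\<close>

text \<open>The numbers decide: \<open>(89 / 100 - 1 / 4)\<^sup>2 = 0.4096\<close>, whereas
  \<open>exp 1 / 10\<close> is below \<open>0.3\<close>.\<close>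

lemma opt_chi2_contradiction:
  fixes p :: "nat pmf"
  assumes n: "n \<ge> 1" and p: "p \<in> dists n" and m: "m \<ge> 1" and opt: "opt n p \<le> enat m"
    and \<mu>: "\<mu> = 8 * real m" and lam: "lam = \<mu> / real n" and a: "\<And>i. a i = \<mu> * pmf p i"
    and eps: "(\<Sum>i\<in>{1..n}. a i ^ K / fact K) \<le> 1 / 4"
    and chi: "exp (- \<mu>) / fact n *
       (\<Sum>\<pi> | \<pi> permutes {1..n}. \<Prod>i\<in>{1..n}. truncexp K (a i * a (\<pi> i) / lam)) \<le> exp 1"
  shows False
proof -
  obtain t g where tg: "t \<le> m" "\<And>x. 0 \<le> g x" "\<And>x. g x \<le> (1::real)"
    "expect (replicate_pmf t (unif n)) g \<le> 1 / 10"
    "\<And>q. q \<in> relabelings n p \<Longrightarrow> expect (replicate_pmf t q) g \<ge> 9 / 10"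
    using opt_leD[OF opt] by blast
  have "(89 / 100 - 1 / 4 :: real)\<^sup>2 \<le> exp (- \<mu>) / fact n *
     (\<Sum>\<pi> | \<pi> permutes {1..n}. \<Prod>i\<in>{1..n}. truncexp K (a i * a (\<pi> i) / lam)) / 10"
    by (rule distinguisher_chi2_bound[OF n p tg(2,3) m tg(1) \<mu> lam a tg(4,5) eps]) auto
  also have "\<dots> \<le> exp 1 / 10" using chi by (intro divide_right_mono) auto
  also have "\<dots> \<le> 3 / 10" using e_less_272 by simp
  finally show False by (simp add: power2_eq_square)
qed

text \<open>Convexity alone gives the tangent line at \<open>u\<close>; for a positive increment its
  own power fits in addition. The linear term is kept exact because it sums to zero over the
  elements.\<close>

lemma power_ge_tangent:
  fixes u d :: real
  assumes "0 \<le> u" "0 \<le> u + d" "k \<ge> 2"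
  shows "(u + d) ^ k \<ge> u ^ k + real k * u ^ (k - 1) * d + (if 0 \<le> d then d ^ k else 0)"
  using assms(3)
proof (induction k rule: nat_induct_at_least)
  case base
  have "(u + d)\<^sup>2 = u\<^sup>2 + 2 * u * d + d\<^sup>2" by (simp add: power2_sum)
  then show ?case by simp
next
  case (Suc k)
  obtain l where l: "k = Suc l" using Suc.hyps by (cases k) auto
  have dd: "0 \<le> real k * u ^ (k - 1) * (d * d)" using assms by (intro mult_nonneg_nonneg[OF _ zero_le_square]) auto
  have "(u ^ k + real k * u ^ (k - 1) * d + (if 0 \<le> d then d ^ k else 0)) * (u + d) \<le> (u + d) ^ k * (u + d)"
    using assms(2) Suc.IH by (intro mult_right_mono) auto
  moreover have "(u ^ k + real k * u ^ (k - 1) * d + (if 0 \<le> d then d ^ k else 0)) * (u + d) =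
     u ^ Suc k + real (Suc k) * u ^ k * d + real k * u ^ (k - 1) * (d * d)
       + (if 0 \<le> d then d ^ k * u + d ^ Suc k else 0)"
    unfolding l by (simp add: algebra_simps)
  moreover have "0 \<le> d ^ k * u" if "0 \<le> d" using assms(1) that by (intro mult_nonneg_nonneg) auto
  ultimately show ?case using dd unfolding power_Suc2[of "u + d" k] by (simp split: if_splits)
qed

text \<open>Converts an excess of \<open>k\<close>-fold collisions over the uniform value into a
  bound on the \<open>k\<close>-th moment of the positive deviations, the only ones that enter the
  truncated kernel.\<close>

lemma moment_excess_ge:
  assumes n: "n \<ge> 1" and p: "p \<in> dists n" and k: "k \<ge> 2"
  shows "(\<Sum>i\<in>{1..n}. pmf p i ^ k) - real n / real n ^ k \<ge>
         (\<Sum>i | i \<in> {1..n} \<and> 0 \<le> pmf p i - 1 / real n. (pmf p i - 1 / real n) ^ k)"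
proof -
  define u where "u = 1 / real n"
  have u: "0 \<le> u" by (simp add: u_def)
  have z: "(\<Sum>i\<in>{1..n}. pmf p i - u) = 0"
    using n by (simp add: sum_subtractf sum_pmf_dists[OF p, simplified] u_def)
  have "(\<Sum>i\<in>{1..n}. u ^ k + real k * u ^ (k - 1) * (pmf p i - u) + (if 0 \<le> pmf p i - u then (pmf p i - u) ^ k else 0))
     \<le> (\<Sum>i\<in>{1..n}. (u + (pmf p i - u)) ^ k)"
    using u k by (intro sum_mono power_ge_tangent) auto
  moreover have "(\<Sum>i\<in>{1..n}. u ^ k + real k * u ^ (k - 1) * (pmf p i - u) + (if 0 \<le> pmf p i - u then (pmf p i - u) ^ k else 0))
     = real n * u ^ k + real k * u ^ (k - 1) * (\<Sum>i\<in>{1..n}. pmf p i - u)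
        + (\<Sum>i\<in>{1..n}. if 0 \<le> pmf p i - u then (pmf p i - u) ^ k else 0)"
    by (simp only: sum.distrib sum_distrib_left) simp
  moreover have "(\<Sum>i\<in>{1..n}. if 0 \<le> pmf p i - u then (pmf p i - u) ^ k else 0) =
     (\<Sum>i | i \<in> {1..n} \<and> 0 \<le> pmf p i - u. (pmf p i - u) ^ k)"
    by (rule sum.inter_filter[symmetric]) simp
  ultimately show ?thesis unfolding z by (simp add: u_def power_divide)
qed

lemma binomial_Suc_times: "(s choose Suc k) * Suc k = (s choose k) * (s - k)"
  using binomial_absorption[of k s] binomial_absorb_comp[of s k] by (simp only: mult.commute)

lemma binomial_fact_ge:
  assumes "2 * k \<le> s"
  shows "(real s / 2) ^ k \<le> real (s choose k) * fact k"
  using assms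
proof (induction k)
  case (Suc k)
  have "(real s / 2) ^ Suc k \<le> (real (s choose k) * fact k) * real (s - k)"
    unfolding power_Suc2 using Suc by (intro mult_mono) auto
  also have "\<dots> = real ((s choose k) * (s - k)) * fact k" by simp
  also have "\<dots> = real (s choose Suc k) * fact (Suc k)"
    unfolding binomial_Suc_times[symmetric] by (simp add: algebra_simps)
  finally show ?case .
qed simp

lemma fact_le_power: "k \<le> N \<Longrightarrow> fact k \<le> real N ^ k"
proof (induction k)
  case (Suc k)
  have "fact (Suc k) = real (Suc k) * fact k" by simp
  also have "\<dots> \<le> real N * real N ^ k" using Suc by (intro mult_mono) auto
  finally show ?case by simp
qed simp

section \<open>Three regimes of \<open>lam\<close>\<close>

text \<open>Repeated elements are rare in this regime, so samples with any repetition may be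
  discarded: their cost is at most \<open>1 / 8\<close> from the distance to uniform plus
  \<open>32 / 512 = 1 / 16\<close> from the birthday term.\<close>

lemma regime_C:
  fixes p :: "nat pmf"
  assumes n: "n \<ge> 1" and p: "p \<in> dists n" and m: "m \<ge> 1" and opt: "opt n p \<le> enat m"
    and large: "512 * real m ^ 2 \<le> real n"
    and M2: "(8 * real m) ^ 2 * (\<Sum>i\<in>{1..n}. (pmf p i - 1 / real n)\<^sup>2) \<le> 1 / 4"
  shows False
proof (rule opt_chi2_contradiction[OF n p m opt refl refl refl, of 2])
  have "(\<Sum>i\<in>{1..n}. (8 * real m * pmf p i) ^ 2 / fact 2) = (8 * real m) ^ 2 / 2 * (\<Sum>i\<in>{1..n}. pmf p i ^ 2)"
    by (simp add: power_mult_distrib sum_distrib_left mult_ac)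
  also have "(\<Sum>i\<in>{1..n}. pmf p i ^ 2) = (\<Sum>i\<in>{1..n}. (pmf p i - 1 / real n)\<^sup>2) + 1 / real n"
    using sum_square_deviation[OF n p] by simp
  also have "(8 * real m) ^ 2 / 2 * \<dots> = ((8 * real m) ^ 2 * (\<Sum>i\<in>{1..n}. (pmf p i - 1 / real n)\<^sup>2)) / 2 + 32 * (real m ^ 2 / real n)"
    by (simp add: algebra_simps power_mult_distrib add_divide_distrib)
  also have "\<dots> \<le> (1 / 4) / 2 + 32 * (1 / 512)"
  proof (intro add_mono divide_right_mono M2 mult_left_mono)
    show "real m ^ 2 / real n \<le> 1 / 512" using large n by (simp add: field_simps)
  qed auto
  finally show "(\<Sum>i\<in>{1..n}. (8 * real m * pmf p i) ^ 2 / fact 2) \<le> 1 / 4" by simp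
  have "exp (- (8 * real m)) / fact n * (\<Sum>\<pi> | \<pi> permutes {1..n}. \<Prod>i\<in>{1..n}.
       truncexp 2 (8 * real m * pmf p i * (8 * real m * pmf p (\<pi> i)) / (8 * real m / real n))) \<le> 1"
    by (rule chi2_two_le_1[OF n _ _ _ refl]) (use m sum_pmf_dists[OF p, simplified] in \<open>auto simp flip: sum_distrib_left\<close>)
  also have "1 \<le> exp (1::real)" by simp
  finally show "exp (- (8 * real m)) / fact n * (\<Sum>\<pi> | \<pi> permutes {1..n}. \<Prod>i\<in>{1..n}.
       truncexp 2 (8 * real m * pmf p i * (8 * real m * pmf p (\<pi> i)) / (8 * real m / real n))) \<le> exp 1" .
qed

lemma regime_dense:
  fixes p :: "nat pmf"
  assumes n: "n \<ge> 1" and p: "p \<in> dists n" and m: "m \<ge> 1" and opt: "opt n p \<le> enat m"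
    and lam: "lam = 8 * real m / real n" and \<alpha>: "\<And>i. \<alpha> i = 8 * real m * pmf p i - lam"
    and small: "\<And>i. i \<in> {1..n} \<Longrightarrow> (\<alpha> i)\<^sup>2 \<le> lam / 2"
    and M2: "4 * (\<Sum>j\<in>{1..n}. (\<alpha> j)\<^sup>2)\<^sup>2 \<le> real n * lam\<^sup>2"
  shows False
proof -
  define a where "a i = 8 * real m * pmf p i" for i
  have lam0: "lam > 0" using lam n m by simp
  \<comment> \<open>The kernel bound of this regime is uniform in \<open>K\<close>, so
    \<open>K\<close> is merely taken large enough for \<open>K\<close>-fold collisions to be
    rare.\<close>
  have "(\<lambda>K. \<Sum>i\<in>{1..n}. a i ^ K / fact K) \<longlonglongrightarrow> (\<Sum>i\<in>{1..n}. 0)"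
  proof (intro tendsto_sum)
    fix i
    show "(\<lambda>K. a i ^ K / fact K) \<longlonglongrightarrow> 0"
      using summable_LIMSEQ_zero[OF summable_exp[of "a i"]] by (simp add: divide_inverse mult.commute)
  qed
  then have "eventually (\<lambda>K. (\<Sum>i\<in>{1..n}. a i ^ K / fact K) < 1 / 4) sequentially"
    by (rule order_tendstoD) simp
  then obtain K0 where "\<And>K. K \<ge> K0 \<Longrightarrow> (\<Sum>i\<in>{1..n}. a i ^ K / fact K) < 1 / 4"
    by (auto simp: eventually_sequentially)
  then have eps: "(\<Sum>i\<in>{1..n}. a i ^ Suc K0 / fact (Suc K0)) \<le> 1 / 4" by (meson le_SucI less_imp_le order_refl)
  have suma: "(\<Sum>i\<in>{1..n}. a i) = 8 * real m"
    by (simp add: a_def sum_pmf_dists[OF p, simplified] flip: sum_distrib_left)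
  have "\<And>i. \<alpha> i = a i - lam" by (simp add: \<alpha> a_def)
  have "exp (- (8 * real m)) / fact n * (\<Sum>\<pi> | \<pi> permutes {1..n}. \<Prod>i\<in>{1..n}. truncexp (Suc K0) (a i * a (\<pi> i) / lam))
    \<le> (\<Sum>\<pi> | \<pi> permutes {1..n}. \<Prod>i\<in>{1..n}. kernel (Suc K0) lam (\<alpha> i) (\<alpha> (\<pi> i))) / fact n"
    by (rule chi2_le_kernel_sum[OF n _ suma _ lam]) (use m in \<open>auto simp: a_def \<alpha>\<close>)
  also have "\<dots> \<le> exp 1"
  proof (rule kernel_sum_le_bounded[OF n _ lam0 _ _ M2])
    show "(\<Sum>j\<in>{1..n}. \<alpha> j) = 0"
      using suma n lam by (simp add: \<alpha> a_def sum_subtractf)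
    fix i j assume ij: "i \<in> {1..n}" "j \<in> {1..n}"
    have "2 * \<bar>\<alpha> i * \<alpha> j\<bar> \<le> (\<alpha> i)\<^sup>2 + (\<alpha> j)\<^sup>2"
      using sum_squares_bound[of "\<bar>\<alpha> i\<bar>" "\<bar>\<alpha> j\<bar>"] by (simp add: abs_mult mult.assoc)
    also have "\<dots> \<le> lam / 2 + lam / 2" by (intro add_mono small ij)
    finally show "\<bar>\<alpha> i * \<alpha> j / lam\<bar> \<le> 1 / 2" using lam0 by (simp add: field_simps)
  qed simp
  finally show False
    using opt_chi2_contradiction[OF n p m opt refl lam, of a "Suc K0"] eps by (simp add: a_def)
qed

lemma truncexp_le_power:
  assumes "1 \<le> x" "K \<ge> 1"
  shows "truncexp K x \<le> real K * x ^ (K - 1)"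
proof -
  have "truncexp K x \<le> (\<Sum>c<K. x ^ (K - 1))"
    unfolding truncexp_def
  proof (intro sum_mono)
    fix c assume "c \<in> {..<K}"
    then have "x ^ c \<le> x ^ (K - 1)" using assms by (intro power_increasing) auto
    moreover have "x ^ c / fact c \<le> x ^ c" using assms by (simp add: divide_le_eq mult_ge1_I fact_ge_1)
    ultimately show "x ^ c / fact c \<le> x ^ (K - 1)" by linarith
  qed
  then show ?thesis by simp
qed

lemma sum_half_powers_le: "(\<Sum>k\<in>{3..<K}. (1 / 2 :: real) ^ k) \<le> 1 / 4"
proof -
  \<comment> \<open>Strengthened by the missing tail of the geometric series, so that the induction
    closes.\<close>
  have "(\<Sum>k\<in>{3..<K}. (1 / 2 :: real) ^ k) \<le> 1 / 4 - (if K \<ge> 3 then 2 * (1 / 2) ^ K else 0)"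
  proof (induction K)
    case (Suc K)
    consider "K \<ge> 3" | "K = 2" | "Suc K < 3" by linarith
    then show ?case
      by cases (use Suc in \<open>auto simp: eval_nat_numeral\<close>)
  qed simp
  then show ?thesis by (smt (verit) zero_le_power zero_le_divide_1_iff)
qed

text \<open>Passing the collision test of order \<open>k\<close> bounds \<open>M k / fact k\<close>
  by a noise term and a term \<open>W ^ k\<close>. After rescaling by \<open>(2 / L) ^ k\<close>
  both are governed by \<open>W / L = 8 / N\<close>. When the moment is squared, a factorial and a
  division by \<open>n * lam ^ k\<close> remain; the former costs \<open>N ^ k\<close> and the
  latter, by the choice of \<open>K\<close>, at most \<open>4 * 2 ^ k\<close>.\<close>

lemma regime_sparse:
  fixes p :: "nat pmf" and \<alpha> :: "nat \<Rightarrow> real"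
  assumes n: "n \<ge> 1" and p: "p \<in> dists n" and m: "m \<ge> 1" and opt: "opt n p \<le> enat m"
    and lam: "lam = 8 * real m / real n" and \<alpha>: "\<And>i. \<alpha> i = 8 * real m * pmf p i - lam"
    and N: "N \<ge> 2 ^ 17" "N \<ge> 8 * l" and l: "real n < 2 ^ (9 + 2 * l)" "l \<ge> 1"
    and small_n: "real n < 512 * real m ^ 2"
    and lamN: "lam < 1 / real N" and L: "L = 2 ^ 28 * real N" and s: "real s = L * (8 * real m)"
    and small: "\<And>i. i \<in> {1..n} \<Longrightarrow> \<alpha> i \<le> 1 / real N"
    and M2: "(real N)\<^sup>2 * (\<Sum>j\<in>{1..n}. (\<alpha> j)\<^sup>2)\<^sup>2 \<le> real n * lam\<^sup>2 / 14"
    and tests: "\<And>k. 2 \<le> k \<Longrightarrow> k \<le> 2 * l + 11 \<Longrightarrow>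
       measure_pmf.prob (replicate_pmf s p) {xs. coll_test n s k xs} < 15 / 16"
  shows False
proof -
  define a where "a i = 8 * real m * pmf p i" for i
  define P where "P = {i \<in> {1..n}. 0 \<le> \<alpha> i}"
  define M where "M k = (\<Sum>i\<in>P. \<alpha> i ^ k)" for k
  define W :: real where "W = 2 ^ 31"
  have \<alpha>a: "\<alpha> i = a i - lam" for i by (simp add: \<alpha> a_def)
  have n0: "real n > 0" using n by simp
  have m0: "real m \<ge> 1" using m by simp
  have N0: "real N \<ge> 2 ^ 17" using N by (simp flip: of_nat_le_iff)
  have Npos: "real N > 0" by (rule less_le_trans[OF _ N0]) simp
  have lam0: "lam > 0" using lam n m by simp
  have Lpos: "L > 0" using L Npos by simp
  have nlam: "real n * lam = 8 * real m" using lam n0 by simp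
  have M0: "M k \<ge> 0" for k unfolding M_def P_def by (intro sum_nonneg) auto
  have suma: "(\<Sum>i\<in>{1..n}. a i) = 8 * real m"
    by (simp add: a_def sum_pmf_dists[OF p, simplified] flip: sum_distrib_left)
  have a0: "a i \<ge> 0" for i by (simp add: a_def)

  text \<open>The order from which on collisions are rare under the uniform distribution.\<close>
  define K where "K = (LEAST K. real n * (2 * lam) ^ K \<le> 1 / 4)"
  have ex: "real n * (2 * lam) ^ (2 * l + 11) \<le> 1 / 4"
  proof -
    have "1 / real N \<le> 1 / 4" using N0 Npos by (simp add: field_simps)
    then have "lam \<le> 1 / 4" using lamN by linarith
    then have "(2 * lam) ^ (2 * l + 11) \<le> (1 / 2) ^ (2 * l + 11)" using lam0 by (intro power_mono) auto
    then have "real n * (2 * lam) ^ (2 * l + 11) \<le> 2 ^ (9 + 2 * l) * (1 / 2) ^ (2 * l + 11)"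
      using l lam0 by (intro mult_mono) auto
    also have "\<dots> = 1 / 4" by (simp add: power_add power_divide)
    finally show ?thesis .
  qed
  have Kle: "real n * (2 * lam) ^ K \<le> 1 / 4" unfolding K_def by (rule LeastI) (rule ex)
  have Klt: "real n * (2 * lam) ^ k > 1 / 4" if "k < K" for k
    using not_less_Least[OF that[unfolded K_def]] by simp
  have K11: "K \<le> 2 * l + 11" unfolding K_def by (rule Least_le) (rule ex)
  \<comment> \<open>Below \<open>512 m^2\<close> elements pairwise collisions are still common:
    \<open>n * (2 * lam)^2 = 256 m^2 / n\<close> is at least \<open>1 / 2\<close>.\<close>
  have K3: "K \<ge> 3"
  proof (rule ccontr)
    assume "\<not> K \<ge> 3"
    then consider "K = 0" | "K = 1" | "K = 2" by linarith
    then show False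
    proof cases
      case 1
      then show False using Kle n by simp
    next
      case 2
      then show False using Kle nlam m0 by simp
    next
      case 3
      have "real n * (2 * lam) ^ 2 = 4 * (8 * real m) * lam"
        using nlam by (simp add: power2_eq_square algebra_simps)
      also have "\<dots> = 256 * real m ^ 2 / real n" by (simp add: lam power2_eq_square)
      also have "\<dots> \<ge> 256 * real m ^ 2 / (512 * real m ^ 2)"
        using small_n m0 n0 by (intro divide_left_mono) auto
      also have "256 * real m ^ 2 / (512 * real m ^ 2) = 1 / 2" using m0 by simp
      finally show False using Kle 3 by simp
    qed
  qed
  have N17: "131072 \<le> N" using N(1) by simp
  have KN: "K \<le> N" using K11 N(2) N17 l by linarith

  have moment: "M k / fact k \<le> (2 / L) ^ k * (16 * sqrt (W ^ k * (real n * (L * lam) ^ k / fact k)) + 256 * W ^ k)"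
    if k: "2 \<le> k" "k \<le> K" for k
  proof -
    define e where "e = real (s choose k) * (real n / real n ^ k)"
    \<comment> \<open>Both \<open>L * lam\<close> and \<open>L * \<alpha> i\<close> are at most
      \<open>2 ^ 28\<close>, so a block shows each element at most \<open>2 ^ 29\<close> times on
      average; \<open>W = 2 ^ 31\<close> dominates \<open>2 + 2 * 2 ^ 29\<close>.\<close>
    define c :: real where "c = 2 + 2 * 2 ^ 29"
    have sn: "real s / real n = L * lam" by (simp add: s lam)
    have Llam: "L * lam \<le> 2 ^ 28" using lamN Npos by (simp add: L field_simps)
    have excess: "real (s choose k) * (\<Sum>i\<in>{1..n}. pmf p i ^ k) - e \<le>
        16 * sqrt (c ^ k * e) + 256 * c ^ k"
      unfolding e_def c_def
    proof (rule coll_test_small[OF n p k(1)])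
      fix i assume i: "i \<in> {1..n}"
      have "real s * pmf p i = L * a i" by (simp add: s a_def)
      also have "\<dots> = L * lam + L * \<alpha> i" by (simp add: \<alpha>a algebra_simps)
      also have "L * \<alpha> i \<le> L * (1 / real N)" using small[OF i] Lpos by (intro mult_left_mono) auto
      also have "L * (1 / real N) = 2 ^ 28" using Npos by (simp add: L)
      finally show "real s * pmf p i \<le> 2 ^ 29" using Llam by simp
    next
      show "real s / real n \<le> 2 ^ 29" using Llam sn by simp
      show "measure_pmf.prob (replicate_pmf s p) {xs. coll_test n s k xs} < 15 / 16"
        using tests k K11 by simp
    qed
    have e0: "e \<ge> 0" by (simp add: e_def)
    have eb: "e \<le> real n * (L * lam) ^ k / fact k"
    proof -
      have "real ((s choose k) * fact k) \<le> real (s ^ k)" by (rule of_nat_mono[OF binomial_fact_pow])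
      then have "real (s choose k) \<le> real s ^ k / fact k" by (simp add: field_simps)
      then have "e \<le> (real s ^ k / fact k) * (real n / real n ^ k)" unfolding e_def by (intro mult_right_mono) auto
      also have "\<dots> = real n * (real s / real n) ^ k / fact k" by (simp add: power_divide mult_ac)
      finally show ?thesis by (simp add: sn)
    qed
    have Wk: "c ^ k \<le> W ^ k" unfolding W_def c_def by (intro power_mono) auto
    have "c ^ k * e \<le> W ^ k * (real n * (L * lam) ^ k / fact k)"
      using Wk eb e0 by (intro mult_mono) (auto simp: W_def)
    then have "sqrt (c ^ k * e) \<le> sqrt (W ^ k * (real n * (L * lam) ^ k / fact k))"
      by (rule real_sqrt_le_mono)
    then have up: "real (s choose k) * ((\<Sum>i\<in>{1..n}. pmf p i ^ k) - real n / real n ^ k) \<le>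
        16 * sqrt (W ^ k * (real n * (L * lam) ^ k / fact k)) + 256 * W ^ k"
      using excess Wk unfolding right_diff_distrib e_def by linarith
    have "M k = (8 * real m) ^ k * (\<Sum>i | i \<in> {1..n} \<and> 0 \<le> pmf p i - 1 / real n. (pmf p i - 1 / real n) ^ k)"
    proof -
      have al: "\<alpha> i = 8 * real m * (pmf p i - 1 / real n)" for i by (simp add: \<alpha> lam right_diff_distrib)
      have "P = {i. i \<in> {1..n} \<and> 0 \<le> pmf p i - 1 / real n}"
        using m0 by (auto simp: P_def al zero_le_mult_iff)
      then show ?thesis by (simp add: M_def al power_mult_distrib sum_distrib_left)
    qed
    also have "\<dots> \<le> (8 * real m) ^ k * ((\<Sum>i\<in>{1..n}. pmf p i ^ k) - real n / real n ^ k)"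
      by (intro mult_left_mono moment_excess_ge[OF n p k(1)]) auto
    finally have Mk: "M k \<le> (8 * real m) ^ k * ((\<Sum>i\<in>{1..n}. pmf p i ^ k) - real n / real n ^ k)" .
    have "2 * k \<le> s"
    proof -
      have "real (2 * k) \<le> 2 * real N" using k KN by simp
      also have "\<dots> \<le> L * (8 * real m)" using m0 Npos by (simp add: L mult_le_cancel_right1)
      finally show ?thesis by (simp flip: s)
    qed
    then have "(real s / 2) ^ k \<le> real (s choose k) * fact k" by (rule binomial_fact_ge)
    moreover have "real s / 2 = L / 2 * (8 * real m)" by (simp add: s)
    ultimately have bin: "(L / 2) ^ k * (8 * real m) ^ k \<le> real (s choose k) * fact k"
      by (simp only: power_mult_distrib)
    have mk0: "(8 * real m) ^ k > 0" using m0 by simp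
    define X where "X = (\<Sum>i\<in>{1..n}. pmf p i ^ k) - real n / real n ^ k"
    have X0: "X \<ge> 0"
    proof -
      have "0 \<le> M k" by (rule M0)
      then have "0 \<le> (8 * real m) ^ k * X" using Mk unfolding X_def by linarith
      then show ?thesis using mk0 by (simp add: zero_le_mult_iff)
    qed
    have "(L / 2) ^ k * M k \<le> (L / 2) ^ k * ((8 * real m) ^ k * X)"
      using Mk Lpos unfolding X_def by (intro mult_left_mono) auto
    also have "\<dots> \<le> (real (s choose k) * fact k) * X"
      unfolding mult.assoc[symmetric] by (intro mult_right_mono bin X0)
    also have "\<dots> = fact k * (real (s choose k) * X)" by simp
    also have "\<dots> \<le> fact k * (16 * sqrt (W ^ k * (real n * (L * lam) ^ k / fact k)) + 256 * W ^ k)"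
      using up unfolding X_def by (intro mult_left_mono) auto
    finally show ?thesis using Lpos by (simp add: power_divide field_simps)
  qed
  have WL: "W / L = 8 / real N" using Npos by (simp add: W_def L)
  have N32: "32 / real N \<le> 1 / 4096" "512 / real N \<le> 1 / 256"
    using N0 Npos by (simp_all add: field_simps)
  have W0: "W > 0" by (simp add: W_def)

  have bound: "(M k)\<^sup>2 / (real n * lam ^ k * fact k) \<le> (1 / 2) ^ k" if k: "k \<in> {3..<K}" for k
  proof -
    define A where "A = W ^ k * (real n * (L * lam) ^ k / fact k)"
    define B where "B = W ^ k"
    define f :: real where "f = fact k"
    define D where "D = real n * lam ^ k"
    have f0: "f > 0" by (simp add: f_def)
    have D0: "D > 0" using n0 lam0 by (simp add: D_def)
    have A0: "A \<ge> 0" using W0 n0 Lpos lam0 by (simp add: A_def)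
    have "M k \<le> f * ((2 / L) ^ k * (16 * sqrt A + 256 * B))"
      using moment[of k] k f0 by (simp add: A_def B_def f_def field_simps)
    then have "(M k)\<^sup>2 \<le> (f * ((2 / L) ^ k * (16 * sqrt A + 256 * B)))\<^sup>2"
      using M0 by (intro power_mono) auto
    also have "\<dots> = f\<^sup>2 * ((2 / L) ^ k)\<^sup>2 * (16 * sqrt A + 256 * B)\<^sup>2"
      by (simp add: power_mult_distrib)
    also have "(16 * sqrt A + 256 * B)\<^sup>2 \<le> 512 * A + 2 ^ 17 * B\<^sup>2"
    proof -
      have "(x + y)\<^sup>2 \<le> 2 * x\<^sup>2 + 2 * y\<^sup>2" for x y :: real
        using sum_squares_bound[of x y] by (simp add: power2_sum)
      from this[of "16 * sqrt A" "256 * B"] show ?thesis using A0 by (simp add: power_mult_distrib)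
    qed
    also have "f\<^sup>2 * ((2 / L) ^ k)\<^sup>2 * (512 * A + 2 ^ 17 * B\<^sup>2) =
        D * f * (512 * (4 * (W / L)) ^ k + 2 ^ 17 * f * (4 * (W / L) ^ 2) ^ k / D)"
    proof -
      have e1: "f * ((2 / L) ^ k)\<^sup>2 * A = D * (4 * (W / L)) ^ k"
      proof -
        have "f * ((2 / L) ^ k)\<^sup>2 * A = D * (((2 / L) ^ k) * ((2 / L) ^ k) * W ^ k * L ^ k)"
          using f0 by (simp add: A_def D_def f_def power_mult_distrib power2_eq_square)
        also have "((2 / L) ^ k) * ((2 / L) ^ k) * W ^ k * L ^ k = ((2 / L) * (2 / L) * W * L) ^ k"
          by (simp only: power_mult_distrib)
        also have "(2 / L) * (2 / L) * W * L = 4 * (W / L)" using Lpos by simp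
        finally show ?thesis .
      qed
      have e2: "((2 / L) ^ k)\<^sup>2 * B\<^sup>2 = (4 * (W / L) ^ 2) ^ k"
        by (simp add: B_def power2_eq_square flip: power_mult_distrib)
      have "f\<^sup>2 * ((2 / L) ^ k)\<^sup>2 * (512 * A + 2 ^ 17 * B\<^sup>2) =
        f * (512 * (f * ((2 / L) ^ k)\<^sup>2 * A) + 2 ^ 17 * f * (((2 / L) ^ k)\<^sup>2 * B\<^sup>2))"
        by (simp add: power2_eq_square algebra_simps)
      then show ?thesis unfolding e1 e2 using D0 by (simp add: field_simps)
    qed
    finally have "(M k)\<^sup>2 \<le> D * f * (512 * (4 * (W / L)) ^ k + 2 ^ 17 * f * (4 * (W / L) ^ 2) ^ k / D)"
      using f0 by (simp add: mult_left_mono)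
    then have "(M k)\<^sup>2 / (D * f) \<le> 512 * (4 * (W / L)) ^ k + 2 ^ 17 * f * (4 * (W / L) ^ 2) ^ k / D"
      using D0 f0 by (simp add: divide_le_eq mult.commute)
    also have "512 * (4 * (W / L)) ^ k = 512 * (32 / real N) ^ k" by (simp add: WL)
    also have "2 ^ 17 * f * (4 * (W / L) ^ 2) ^ k / D \<le> 2 ^ 19 * (512 / real N) ^ k"
    proof -
      \<comment> \<open>Minimality of \<open>K\<close>: an order below it still satisfies
        \<open>n * (2 * lam) ^ k > 1 / 4\<close>.\<close>
      have "1 / D \<le> 4 * 2 ^ k"
      proof -
        have "1 / 4 < 2 ^ k * D" using Klt[of k] k by (simp add: D_def power_mult_distrib mult_ac)
        then show ?thesis using D0 by (simp add: field_simps)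
      qed
      moreover have "f \<le> real N ^ k" unfolding f_def by (rule fact_le_power) (use k KN in auto)
      ultimately have "2 ^ 17 * (f * (1 / D)) * (4 * (W / L) ^ 2) ^ k \<le> 2 ^ 17 * (real N ^ k * (4 * 2 ^ k)) * (4 * (W / L) ^ 2) ^ k"
        using f0 D0 by (intro mult_right_mono mult_left_mono mult_mono) auto
      also have "\<dots> = 2 ^ 19 * (real N * 2 * (4 * (8 / real N) ^ 2)) ^ k"
      proof -
        have "2 ^ 17 * (x ^ k * (4 * 2 ^ k)) * y ^ k = 2 ^ 19 * (x * 2 * y) ^ k" for x y :: real
          unfolding power_mult_distrib by simp
        then show ?thesis by (simp only: WL)
      qed
      also have "real N * 2 * (4 * (8 / real N) ^ 2) = 512 / real N"
        using Npos by (simp add: power2_eq_square)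
      finally show ?thesis by simp
    qed
    also have "512 * (32 / real N) ^ k + 2 ^ 19 * (512 / real N) ^ k \<le> 512 * (1 / 4096) ^ k + 2 ^ 19 * (1 / 256) ^ k"
      using N32 Npos by (intro add_mono mult_left_mono power_mono) auto
    also have "\<dots> = (1 / 2) ^ k * (512 * (1 / 2048) ^ k + 2 ^ 19 * (1 / 128) ^ k)"
    proof -
      have "(1 / 4096 :: real) ^ k = (1 / 2) ^ k * (1 / 2048) ^ k" "(1 / 256 :: real) ^ k = (1 / 2) ^ k * (1 / 128) ^ k"
        by (simp_all flip: power_mult_distrib)
      then show ?thesis by (simp add: algebra_simps)
    qed
    also have "\<dots> \<le> (1 / 2) ^ k * (512 * (1 / 2048) ^ 3 + 2 ^ 19 * (1 / 128) ^ 3)"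
      using k by (intro mult_left_mono add_mono power_decreasing) auto
    also have "\<dots> \<le> (1 / 2) ^ k * 1" by (intro mult_left_mono) (simp_all add: power3_eq_cube)
    finally show ?thesis by (simp add: D_def f_def)
  qed

  have eps: "(\<Sum>i\<in>{1..n}. a i ^ K / fact K) \<le> 1 / 4"
  proof -
    have K1: "K \<ge> 1" using K3 by simp
    \<comment> \<open>\<open>a i = lam + \<alpha> i\<close> is at most twice the larger summand; the
      first alternative is rare by the choice of \<open>K\<close>, the second by the collision test
      of order \<open>K\<close> itself.\<close>
    have "a i ^ K \<le> (2 * lam) ^ K + (if 0 \<le> \<alpha> i then (2 * \<alpha> i) ^ K else 0)" for i
    proof (cases "\<alpha> i \<le> lam")
      case True
      then have "a i ^ K \<le> (2 * lam) ^ K" using a0[of i] by (intro power_mono) (auto simp: \<alpha>a)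
      moreover have "0 \<le> (if 0 \<le> \<alpha> i then (2 * \<alpha> i) ^ K else 0)" by simp
      ultimately show ?thesis by linarith
    next
      case False
      then have "a i ^ K \<le> (2 * \<alpha> i) ^ K" using a0[of i] by (intro power_mono) (auto simp: \<alpha>a)
      moreover have "0 \<le> (2 * lam) ^ K" using lam0 by simp
      moreover have "0 \<le> \<alpha> i" using False lam0 by linarith
      ultimately show ?thesis by (simp only: if_True)
    qed
    then have "(\<Sum>i\<in>{1..n}. a i ^ K / fact K) \<le> (\<Sum>i\<in>{1..n}. ((2 * lam) ^ K + (if 0 \<le> \<alpha> i then (2 * \<alpha> i) ^ K else 0)) / fact K)"
      by (intro sum_mono divide_right_mono) auto
    also have "\<dots> = (real n * (2 * lam) ^ K + (\<Sum>i\<in>{1..n}. if 0 \<le> \<alpha> i then (2 * \<alpha> i) ^ K else 0)) / fact K"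
      by (simp add: sum.distrib flip: sum_divide_distrib)
    also have "(\<Sum>i\<in>{1..n}. if 0 \<le> \<alpha> i then (2 * \<alpha> i) ^ K else 0) = (\<Sum>i\<in>P. (2 * \<alpha> i) ^ K)"
      unfolding P_def by (rule sum.inter_filter[symmetric]) simp
    also have "\<dots> = 2 ^ K * M K" by (simp add: M_def power_mult_distrib sum_distrib_left)
    also have "(real n * (2 * lam) ^ K + 2 ^ K * M K) / fact K = real n * (2 * lam) ^ K / fact K + 2 ^ K * (M K / fact K)"
      by (simp add: add_divide_distrib)
    also have "\<dots> \<le> 1 / 6 + 1 / 12"
    proof (intro add_mono)
      have "(1::real) \<le> fact K" by (rule fact_ge_1)
      have "fact 3 \<le> (fact K :: real)" using K3 by (rule fact_mono)
      then have "real n * (2 * lam) ^ K / fact K \<le> (1 / 4) / fact 3"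
        using Kle n0 lam0 by (intro frac_le) auto
      moreover have "(1 / 4) / fact 3 \<le> (1 / 6 :: real)" by (simp add: fact_numeral)
      ultimately show "real n * (2 * lam) ^ K / fact K \<le> 1 / 6" by linarith
      have E: "real n * (L * lam) ^ K / fact K \<le> L ^ K"
      proof -
        have "real n * lam ^ K \<le> real n * (2 * lam) ^ K" using n0 lam0 by (intro mult_left_mono power_mono) auto
        then have "real n * lam ^ K \<le> 1" using Kle by linarith
        then have "L ^ K * (real n * lam ^ K) \<le> L ^ K * 1" using Lpos by (intro mult_left_mono) auto
        moreover have "real n * (L * lam) ^ K / fact K \<le> real n * (L * lam) ^ K / 1"
          using n0 Lpos lam0 by (intro divide_left_mono fact_ge_1) auto
        ultimately show ?thesis by (simp add: power_mult_distrib mult_ac)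
      qed
      have "sqrt (W ^ K * (real n * (L * lam) ^ K / fact K)) \<le> sqrt (W ^ K * L ^ K)"
        using E W0 by (intro real_sqrt_le_mono mult_left_mono) auto
      also have "\<dots> = sqrt (W * L) ^ K"
        using W0 Lpos by (simp add: real_sqrt_power flip: power_mult_distrib)
      finally have sq: "sqrt (W ^ K * (real n * (L * lam) ^ K / fact K)) \<le> sqrt (W * L) ^ K" .
      have "2 ^ K * (M K / fact K) \<le> 2 ^ K * ((2 / L) ^ K * (16 * sqrt (W * L) ^ K + 256 * W ^ K))"
      proof -
        have "M K / fact K \<le> (2 / L) ^ K * (16 * sqrt (W ^ K * (real n * (L * lam) ^ K / fact K)) + 256 * W ^ K)"
          using K3 by (intro moment) auto
        also have "\<dots> \<le> (2 / L) ^ K * (16 * sqrt (W * L) ^ K + 256 * W ^ K)"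
          using sq Lpos by (intro mult_left_mono) auto
        finally show ?thesis by (intro mult_left_mono) auto
      qed
      also have "\<dots> = 16 * (4 * sqrt (W * L) / L) ^ K + 256 * (4 * (W / L)) ^ K"
      proof -
        have "4 * sqrt (W * L) / L = 2 * (2 / L) * sqrt (W * L)" "4 * (W / L) = 2 * (2 / L) * W" by simp_all
        then show ?thesis by (simp only: power_mult_distrib) (simp add: algebra_simps)
      qed
      also have "4 * sqrt (W * L) / L = 4 * (sqrt (W * L) / L)" by simp
      also have "sqrt (W * L) / L = sqrt (8 / real N)"
      proof -
        have "sqrt (W * L) / L = sqrt (W * L) / sqrt (L * L)" using Lpos by simp
        also have "\<dots> = sqrt (W * L / (L * L))" by (simp only: real_sqrt_divide)
        also have "W * L / (L * L) = W / L" using Lpos by simp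
        finally show ?thesis by (simp add: WL)
      qed
      also have "4 * (W / L) = 32 / real N" by (simp add: WL)
      also have "16 * (4 * sqrt (8 / real N)) ^ K + 256 * (32 / real N) ^ K \<le> 16 * (1 / 32) ^ K + 256 * (1 / 4096) ^ K"
      proof -
        have "sqrt (8 / real N) \<le> 1 / 128"
          using N0 Npos by (intro real_le_lsqrt) (auto simp: field_simps power2_eq_square)
        then show ?thesis using N32 Npos by (intro add_mono mult_left_mono power_mono) auto
      qed
      also have "\<dots> \<le> 16 * (1 / 32) ^ 3 + 256 * (1 / 4096) ^ 3"
        using K3 by (intro mult_left_mono add_mono power_decreasing) auto
      also have "\<dots> \<le> 1 / 12" by (simp add: power3_eq_cube)
      finally show "2 ^ K * (M K / fact K) \<le> 1 / 12" .
    qed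
    finally show ?thesis by simp
  qed

  have tr: "truncexp K (1 / lam) \<le> 2 powr (real N - 1)"
  proof -
    have lam1: "1 \<le> 1 / lam"
    proof -
      have "1 / real N \<le> 1" using N0 Npos by (simp add: field_simps)
      then show ?thesis using lamN lam0 by (simp add: field_simps)
    qed
    have "truncexp K (1 / lam) \<le> real K * (1 / lam) ^ (K - 1)"
      using lam1 K3 by (intro truncexp_le_power) auto
    \<comment> \<open>Minimality again, at \<open>K - 1\<close>: the power of \<open>1 / lam\<close>
      is at most of order \<open>2 ^ K * n\<close>. This is polynomial in \<open>m\<close>, hence
      below \<open>2 powr (N - 1)\<close> for \<open>N\<close> a large multiple of
      \<open>log m\<close>.\<close>
    also have "(1 / lam) ^ (K - 1) \<le> 4 * 2 ^ (K - 1) * real n"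
    proof -
      have "1 / 4 < real n * (2 * lam) ^ (K - 1)" using K3 by (intro Klt) auto
      then have "1 / 4 < (2 ^ (K - 1) * real n) * lam ^ (K - 1)" by (simp add: power_mult_distrib mult_ac)
      then show ?thesis using lam0 by (simp add: power_divide field_simps)
    qed
    also have "real K * (4 * 2 ^ (K - 1) * real n) \<le> 2 ^ K * (4 * 2 ^ K * 2 ^ (9 + 2 * l))"
    proof -
      have 1: "real K \<le> 2 ^ K" using of_nat_less_two_power[of K] by (rule less_imp_le)
      have 2: "(2::real) ^ (K - 1) \<le> 2 ^ K" by (intro power_increasing) auto
      have 3: "real n \<le> 2 ^ (9 + 2 * l)" using l(1) by (rule less_imp_le)
      have "4 * 2 ^ (K - 1) * real n \<le> 4 * 2 ^ K * 2 ^ (9 + 2 * l)"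
        by (rule mult_mono[OF mult_left_mono[OF 2] 3]) simp_all
      then show ?thesis by (rule mult_mono[OF 1]) simp_all
    qed
    also have "\<dots> = 2 ^ (2 * K + 11 + 2 * l)"
    proof -
      have e: "2 * K + 11 + 2 * l = K + (2 + K + (9 + 2 * l))" by simp
      have "(2::real) ^ 2 = 4" by simp
      then show ?thesis unfolding e power_add by (simp only: mult.assoc)
    qed
    also have "\<dots> \<le> 2 ^ (N - 1)" using K11 N(2) N17 by (intro power_increasing) linarith+
    also have "\<dots> = 2 powr (real N - 1)"
    proof -
      have "real (N - 1) = real N - 1" using N17 by (simp add: of_nat_diff)
      then show ?thesis using powr_realpow[of 2 "N - 1"] by simp
    qed
    finally show ?thesis by (simp only: mult_left_mono)
  qed

  have "exp (- (8 * real m)) / fact n * (\<Sum>\<pi> | \<pi> permutes {1..n}. \<Prod>i\<in>{1..n}. truncexp K (a i * a (\<pi> i) / lam))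
    \<le> (\<Sum>\<pi> | \<pi> permutes {1..n}. \<Prod>i\<in>{1..n}. kernel K lam (\<alpha> i) (\<alpha> (\<pi> i))) / fact n"
    by (rule chi2_le_kernel_sum[OF n a0 suma _ lam \<alpha>a]) (use m in auto)
  also have "\<dots> \<le> exp 1"
  proof (rule kernel_sum_le_sparse[OF n _ lam0 less_imp_le[OF lamN] _ _ _ M2 _ tr])
    show "(\<Sum>j\<in>{1..n}. \<alpha> j) = 0" using suma nlam by (simp add: \<alpha>a sum_subtractf)
    show "- lam \<le> \<alpha> i \<and> \<alpha> i \<le> 1 / real N" if "i \<in> {1..n}" for i
      using small[OF that] a0[of i] by (simp add: \<alpha>a)
    have "(\<Sum>k\<in>{3..<K}. (M k)\<^sup>2 / (real n * lam ^ k * fact k)) \<le> (\<Sum>k\<in>{3..<K}. (1 / 2) ^ k)"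
      by (intro sum_mono bound)
    also have "\<dots> \<le> 1 / 4" by (rule sum_half_powers_le)
    finally show "(\<Sum>k\<in>{3..<K}. (\<Sum>j | j \<in> {1..n} \<and> 0 \<le> \<alpha> j. \<alpha> j ^ k)\<^sup>2 / (real n * lam ^ k * fact k)) \<le> 1 / 4"
      by (simp add: M_def P_def)
  qed (use K3 N in auto)
  finally show False
    using opt_chi2_contradiction[OF n p m opt refl lam, of a K] eps by (simp add: a_def)
qed

lemma len_bounds: "m \<ge> 1 \<Longrightarrow> 2 ^ (len m - 1) \<le> m" "m \<ge> 1 \<Longrightarrow> m < 2 ^ len m"
  using floorlog_bounds[of m 2] by auto

lemma len_ge_2: "m \<ge> 2 \<Longrightarrow> len m \<ge> 2"
  using len_bounds(2)[of m] by (cases "len m"; cases "len m - 1") auto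

text \<open>The block size is \<open>L * 8 m\<close> with \<open>L = 2 ^ 28 * N\<close> and
  \<open>N = 2 ^ 16 * len m\<close>. If no test rejects reliably, the test of order 2 bounds
  \<open>S2\<close>, the element tests bound each \<open>\<alpha> i\<close>, and one of the three
  regimes contradicts \<open>opt n p \<le> m\<close>.\<close>

lemma some_test_rejects:
  fixes p :: "nat pmf"
  assumes n: "n \<ge> 1" and p: "p \<in> dists n" and m: "m \<ge> 2" and opt: "opt n p \<le> enat m"
    and s: "s = 2 ^ 47 * m * len m"
  shows "(\<exists>i\<in>{1..min n (512 * m ^ 2)}. measure_pmf.prob (replicate_pmf s p) {xs. elem_test n s i xs} \<ge> 15 / 16)
    \<or> (\<exists>k\<in>{2..16 * len m}. measure_pmf.prob (replicate_pmf s p) {xs. coll_test n s k xs} \<ge> 15 / 16)"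
proof (rule ccontr)
  assume "\<not> ?thesis"
  then have elem: "\<And>i. i \<in> {1..n} \<Longrightarrow> i \<le> 512 * m ^ 2 \<Longrightarrow>
        measure_pmf.prob (replicate_pmf s p) {xs. elem_test n s i xs} < 15 / 16"
    and coll: "\<And>k. 2 \<le> k \<Longrightarrow> k \<le> 16 * len m \<Longrightarrow>
        measure_pmf.prob (replicate_pmf s p) {xs. coll_test n s k xs} < 15 / 16"
    by (auto simp: not_le)
  define l where "l = len m"
  define N where "N = 2 ^ 16 * l"
  define L where "L = 2 ^ 28 * real N"
  define lam where "lam = 8 * real m / real n"
  define \<alpha> where "\<alpha> i = 8 * real m * pmf p i - lam" for i
  define Q where "Q = (\<Sum>i\<in>{1..n}. (pmf p i - 1 / real n)\<^sup>2)"
  define S2 where "S2 = (\<Sum>i\<in>{1..n}. (\<alpha> i)\<^sup>2)"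
  have l2: "l \<ge> 2" using len_ge_2[OF m] by (simp add: l_def)
  have m1: "m \<ge> 1" using m by simp
  have m0: "real m > 0" using m by simp
  have n0: "real n > 0" using n by simp
  have lam0: "lam > 0" using m0 n0 by (simp add: lam_def)
  have N17: "131072 \<le> N" using l2 by (simp add: N_def)
  then have N0: "131072 \<le> real N" by (simp flip: of_nat_le_iff)
  have L0: "L \<ge> 2 ^ 45" using N0 by (simp add: L_def)
  have Lpos: "L > 0" using L0 by (rule less_le_trans[rotated]) simp
  have sL: "real s = L * (8 * real m)" by (simp add: s L_def N_def l_def)
  have s2: "s \<ge> 2"
  proof -
    have "2 * 1 * 1 \<le> 2 ^ 47 * m * len m" using m len_ge_2[OF m] by (intro mult_le_mono) auto
    then show ?thesis by (simp add: s)
  qed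
  have \<alpha>': "\<alpha> i = 8 * real m * (pmf p i - 1 / real n)" for i
    by (simp add: \<alpha>_def lam_def right_diff_distrib)
  have S2: "S2 = (8 * real m)\<^sup>2 * Q"
    by (simp add: S2_def \<alpha>' Q_def power_mult_distrib sum_distrib_left)
  have S20: "S2 \<ge> 0" unfolding S2_def by (intro sum_nonneg) auto
  \<comment> \<open>The scale for \<open>S2\<close>: the second-moment conditions compare
    \<open>S2\<close> with \<open>r\<close>, because
    \<open>r\<^sup>2 = n * lam\<^sup>2\<close>.\<close>
  define r where "r = 8 * real m / sqrt (real n)"
  have r0: "r > 0" using m0 n0 by (simp add: r_def)
  have "(real s)\<^sup>2 * Q \<le> 2 ^ 24 * (1 + real s / sqrt (real n))"
    unfolding Q_def using collision_test_small[OF n p s2] coll[of 2] l2 by (simp add: l_def)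
  then have LS2: "L\<^sup>2 * S2 \<le> 2 ^ 24 * (1 + L * r)"
    by (simp add: S2 sL r_def power_mult_distrib mult_ac)
  show False
  proof (cases "512 * real m ^ 2 \<le> real n")
    case True
    have "r \<le> 1"
    proof -
      have "(8 * real m)\<^sup>2 \<le> real n" using True by (simp add: power_mult_distrib)
      then have "8 * real m \<le> sqrt (real n)" by (rule real_le_rsqrt)
      then show ?thesis using n0 by (simp add: r_def)
    qed
    then have "1 + L * r \<le> L + L * 1" using Lpos L0 by (intro add_mono mult_left_mono) auto
    then have "L\<^sup>2 * S2 \<le> 2 ^ 24 * (2 * L)" using LS2 by simp
    then have "L * (L * S2) \<le> L * 2 ^ 25" by (simp add: power2_eq_square mult_ac)
    then have a: "L * S2 \<le> 2 ^ 25" using Lpos by (simp only: mult_le_cancel_left_pos)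
    have "2 ^ 45 * S2 \<le> L * S2" using L0 S20 by (rule mult_right_mono)
    then have "S2 \<le> 1 / 4" using a by simp
    then show False using regime_C[OF n p m1 opt True] by (simp add: S2 Q_def)
  next
    case False
    have rn: "r \<ge> 1 / 3"
    proof -
      have "real n \<le> (24 * real m)\<^sup>2" using False m0 by (simp add: power_mult_distrib)
      then have "sqrt (real n) \<le> 24 * real m" using m0 by (intro real_le_lsqrt) auto
      then show ?thesis using n0 by (simp add: r_def field_simps)
    qed
    have nl: "real n * lam\<^sup>2 = r\<^sup>2" using n0 by (simp add: lam_def r_def power_divide power2_eq_square)
    have "1 \<le> 3 * r" using rn by simp
    also have "\<dots> \<le> L * r" using r0 L0 by (intro mult_right_mono) auto
    finally have "2 ^ 24 * (1 + L * r) \<le> 2 ^ 24 * (L * r + L * r)" by (intro mult_left_mono) auto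
    with LS2 have "L\<^sup>2 * S2 \<le> 2 ^ 24 * (L * r + L * r)" by (rule order_trans)
    then have "L * (L * S2) \<le> L * (2 ^ 25 * r)" by (simp add: power2_eq_square algebra_simps)
    then have "L * S2 \<le> 2 ^ 25 * r" using Lpos by (simp only: mult_le_cancel_left_pos)
    then have NS: "real N * S2 \<le> r / 8" by (simp add: L_def mult_ac)
    have elem': "L * \<bar>\<alpha> i\<bar> \<le> 16 * sqrt (L * lam) + 256" if i: "i \<in> {1..n}" for i
    proof -
      \<comment> \<open>Below \<open>512 m^2\<close> elements every element has its own
        test.\<close>
      have "i \<le> 512 * m ^ 2"
      proof -
        have "real n \<le> real (512 * m ^ 2)" using False by simp
        then show ?thesis using i by (simp only: of_nat_le_iff) simp
      qed
      then have "\<bar>real s * pmf p i - real s / real n\<bar> \<le> 16 * sqrt (real s / real n) + 256"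
        using elem[OF i] by (intro elem_test_small[OF n p i])
      moreover have "real s * pmf p i - real s / real n = L * \<alpha> i"
        by (simp add: sL \<alpha>' right_diff_distrib)
      moreover have "real s / real n = L * lam" by (simp add: sL lam_def)
      ultimately show ?thesis using Lpos by (simp add: abs_mult)
    qed
    show False
    proof (cases "lam < 1 / real N")
      case True
      show False
      proof (rule regime_sparse[OF n p m1 opt lam_def \<alpha>_def, of N l L s])
        show "2 ^ 17 \<le> N" using N17 by simp
        show "8 * l \<le> N" by (simp add: N_def)
        show "1 \<le> l" using l2 by simp
        show "real n < 2 ^ (9 + 2 * l)"
        proof -
          have "real m < 2 ^ l" using len_bounds(2)[OF m1] by (simp add: l_def flip: of_nat_less_iff)
          then have "real m ^ 2 \<le> (2 ^ l) ^ 2" using m0 by (intro power_mono) auto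
          then have "512 * real m ^ 2 \<le> 2 ^ (9 + 2 * l)" by (simp add: power_add power_mult mult.commute flip: power_mult)
          then show ?thesis using False by linarith
        qed
        show "real n < 512 * real m ^ 2" using False by simp
        show "lam < 1 / real N" by (rule True)
        show "L = 2 ^ 28 * real N" by (rule L_def)
        show "real s = L * (8 * real m)" by (rule sL)
        show "\<alpha> i \<le> 1 / real N" if i: "i \<in> {1..n}" for i
        proof -
          \<comment> \<open>Small \<open>lam\<close>: the bound on
            \<open>L * \<bar>\<alpha> i\<bar>\<close> is at most \<open>2 ^ 18 + 2 ^ 8\<close>, well
            within \<open>2 ^ 28 = L / N\<close>.\<close>
          have "L * lam \<le> 2 ^ 28" using True N0 by (simp add: L_def field_simps)
          then have "sqrt (L * lam) \<le> sqrt ((2 ^ 14)\<^sup>2)" by (intro real_sqrt_le_mono) simp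
          then have "sqrt (L * lam) \<le> 2 ^ 14" by (simp only: real_sqrt_abs) simp
          then have "L * \<bar>\<alpha> i\<bar> \<le> 2 ^ 28" using elem'[OF i] by simp
          then have "\<bar>\<alpha> i\<bar> \<le> 1 / real N" using N0 by (simp add: L_def field_simps)
          then show ?thesis by linarith
        qed
        have "(real N * S2)\<^sup>2 \<le> (r / 8)\<^sup>2" using NS S20 by (intro power_mono) auto
        then show "(real N)\<^sup>2 * (\<Sum>j\<in>{1..n}. (\<alpha> j)\<^sup>2)\<^sup>2 \<le> real n * lam\<^sup>2 / 14"
          unfolding nl S2_def[symmetric] power_mult_distrib power_divide
        proof -
          have "r\<^sup>2 / 8\<^sup>2 \<le> r\<^sup>2 / 14" by (intro divide_left_mono) auto
          then show "(real N)\<^sup>2 * S2\<^sup>2 \<le> r\<^sup>2 / 8\<^sup>2 \<Longrightarrow> (real N)\<^sup>2 * S2\<^sup>2 \<le> r\<^sup>2 / 14"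
            by (rule order_trans[rotated])
        qed
        show "measure_pmf.prob (replicate_pmf s p) {xs. coll_test n s k xs} < 15 / 16"
          if "2 \<le> k" "k \<le> 2 * l + 11" for k
          using coll that l2 by (simp add: l_def)
      qed
    next
      case lamN: False
      show False
      proof (rule regime_dense[OF n p m1 opt lam_def \<alpha>_def])
        fix i assume i: "i \<in> {1..n}"
        \<comment> \<open>Large \<open>lam\<close>: the square root absorbs the constant 256, so
          \<open>(\<alpha> i)\<^sup>2\<close> is at most \<open>289 * lam / L\<close>, and
          \<open>L \<ge> 578\<close>.\<close>
        have "2 ^ 28 \<le> L * lam" using lamN N0 by (simp add: L_def field_simps)
        then have "sqrt ((2 ^ 14)\<^sup>2) \<le> sqrt (L * lam)" by (intro real_sqrt_le_mono) simp
        then have "2 ^ 14 \<le> sqrt (L * lam)" by (simp only: real_sqrt_abs)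
        then have "L * \<bar>\<alpha> i\<bar> \<le> 17 * sqrt (L * lam)" using elem'[OF i] by simp
        then have "(L * \<bar>\<alpha> i\<bar>)\<^sup>2 \<le> (17 * sqrt (L * lam))\<^sup>2" using Lpos by (intro power_mono) auto
        moreover have "(L * \<bar>\<alpha> i\<bar>)\<^sup>2 = L * (L * (\<alpha> i)\<^sup>2)"
          by (simp add: power_mult_distrib) (simp add: power2_eq_square)
        moreover have "(17 * sqrt (L * lam))\<^sup>2 = L * (289 * lam)"
          using Lpos lam0 by (simp add: power_mult_distrib)
        ultimately have "L * (L * (\<alpha> i)\<^sup>2) \<le> L * (289 * lam)" by simp
        then have a: "L * (\<alpha> i)\<^sup>2 \<le> 289 * lam" using Lpos by (simp only: mult_le_cancel_left_pos)
        have "578 * (\<alpha> i)\<^sup>2 \<le> L * (\<alpha> i)\<^sup>2" using L0 by (intro mult_right_mono) auto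
        then show "(\<alpha> i)\<^sup>2 \<le> lam / 2" using a by linarith
      next
        have "1 * S2 \<le> real N * S2" using N0 S20 by (intro mult_right_mono) auto
        then have "S2\<^sup>2 \<le> (r / 8)\<^sup>2" using NS S20 by (intro power_mono) auto
        then have "S2\<^sup>2 * 64 \<le> r\<^sup>2" by (simp add: power_divide)
        then have "4 * S2\<^sup>2 \<le> r\<^sup>2" using zero_le_power2[of S2] by linarith
        then show "4 * (\<Sum>j\<in>{1..n}. (\<alpha> j)\<^sup>2)\<^sup>2 \<le> real n * lam\<^sup>2"
          unfolding nl S2_def[symmetric] .
      qed
    qed
  qed
qed

section \<open>Amplification\<close>

definition block :: "nat \<Rightarrow> nat \<Rightarrow> 'a list \<Rightarrow> 'a list" where
  "block s r xs = take s (drop (r * s) xs)"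

lemma block_append:
  assumes "length xs = s"
  shows "block s 0 (xs @ ys) = xs" "block s (Suc r) (xs @ ys) = block s r ys"
  using assms by (simp_all add: block_def)

lemma expect_prod_blocks:
  fixes w :: "'a list \<Rightarrow> real"
  assumes fin: "finite (set_pmf p)"
  shows "expect (replicate_pmf (R * s) p) (\<lambda>xs. \<Prod>r<R. w (block s r xs)) = expect (replicate_pmf s p) w ^ R"
proof (induction R)
  case (Suc R)
  have "expect (replicate_pmf (Suc R * s) p) (\<lambda>xs. \<Prod>r<Suc R. w (block s r xs)) =
    expect (replicate_pmf s p) (\<lambda>xs. expect (replicate_pmf (R * s) p) (\<lambda>ys. \<Prod>r<Suc R. w (block s r (xs @ ys))))"
    by (simp add: expect_replicate_add[OF fin])
  also have "\<dots> = expect (replicate_pmf s p) (\<lambda>xs. w xs * expect (replicate_pmf s p) w ^ R)"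
  proof (intro integral_cong_AE AE_pmfI)
    fix xs assume "xs \<in> set_pmf (replicate_pmf s p)"
    then have "length xs = s" by (simp add: set_replicate_pmf)
    then have "(\<Prod>r<Suc R. w (block s r (xs @ ys))) = w xs * (\<Prod>r<R. w (block s r ys))" for ys
      by (subst prod.lessThan_Suc_shift) (simp add: block_append)
    then show "expect (replicate_pmf (R * s) p) (\<lambda>ys. \<Prod>r<Suc R. w (block s r (xs @ ys))) =
       w xs * expect (replicate_pmf s p) w ^ R"
      using fin by (simp add: Suc.IH)
  qed auto
  also have "\<dots> = expect (replicate_pmf s p) w ^ Suc R" using fin by (simp add: mult.commute)
  finally show ?case .
qed simp

text \<open>Markov's inequality for 16 to the number of bad blocks: a block contributes a mean of at
  most \<open>1 + 15 / 16 \<le> 2\<close>, while half of the blocks being bad forces the product up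
  to \<open>16 ^ (R / 2) = 4 ^ R\<close>.\<close>

lemma prob_majority_le:
  assumes fin: "finite (set_pmf p)" and q: "measure_pmf.prob (replicate_pmf s p) {xs. B xs} \<le> 1 / 16"
  shows "measure_pmf.prob (replicate_pmf (R * s) p) {xs. R \<le> 2 * card {r. r < R \<and> B (block s r xs)}} \<le> (1 / 2) ^ R"
proof -
  define w where "w xs = (if B xs then 16 else 1 :: real)" for xs
  let ?M = "replicate_pmf (R * s) p"
  have pw: "(\<Prod>r<R. w (block s r xs)) = 16 ^ card {r. r < R \<and> B (block s r xs)}" for xs
  proof -
    have "{r. r < R \<and> B (block s r xs)} = {r \<in> {..<R}. B (block s r xs)}" by auto
    then show ?thesis unfolding w_def by (simp add: prod.inter_filter[symmetric])
  qed
  have "4 ^ R * measure_pmf.prob ?M {xs. R \<le> 2 * card {r. r < R \<and> B (block s r xs)}}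
     = expect ?M (\<lambda>xs. 4 ^ R * indicator {xs. R \<le> 2 * card {r. r < R \<and> B (block s r xs)}} xs)"
    by simp
  also have "\<dots> \<le> expect ?M (\<lambda>xs. \<Prod>r<R. w (block s r xs))"
  proof (rule integral_mono)
    fix xs
    show "4 ^ R * indicator {xs. R \<le> 2 * card {r. r < R \<and> B (block s r xs)}} xs \<le> (\<Prod>r<R. w (block s r xs))"
    proof (cases "R \<le> 2 * card {r. r < R \<and> B (block s r xs)}")
      case True
      then have "(4::real) ^ R \<le> 4 ^ (2 * card {r. r < R \<and> B (block s r xs)})"
        by (intro power_increasing) auto
      then show ?thesis using True by (simp add: pw power_mult)
    qed (simp add: pw)
  qed (use fin in auto)
  also have "\<dots> = expect (replicate_pmf s p) w ^ R" by (rule expect_prod_blocks[OF fin])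
  also have "expect (replicate_pmf s p) w = expect (replicate_pmf s p) (\<lambda>xs. 1 + 15 * indicator {xs. B xs} xs)"
    unfolding w_def by (intro arg_cong[where f="expect _"] ext) auto
  also have "\<dots> = 1 + 15 * measure_pmf.prob (replicate_pmf s p) {xs. B xs}"
    using fin by simp
  also have "\<dots> ^ R \<le> 2 ^ R" using q by (intro power_mono) (auto intro: add_nonneg_nonneg)
  finally have "4 ^ R * measure_pmf.prob ?M {xs. R \<le> 2 * card {r. r < R \<and> B (block s r xs)}} \<le> 2 ^ R" .
  moreover have "(4::real) ^ R = 2 ^ R * 2 ^ R" by (simp flip: power_mult_distrib)
  ultimately show ?thesis by (simp add: power_divide field_simps)
qed

definition accepts :: "nat \<Rightarrow> nat \<Rightarrow> nat \<Rightarrow> nat \<Rightarrow> nat \<Rightarrow> nat list \<Rightarrow> bool" where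
  "accepts n m s R J xs \<longleftrightarrow>
     (\<forall>i\<in>{1..min n (512 * m ^ 2)}. 2 * card {r. r < R \<and> elem_test n s i (block s r xs)} < R) \<and>
     (\<forall>k\<in>{2..J}. 2 * card {r. r < R \<and> coll_test n s k (block s r xs)} < R)"

text \<open>Union bound. Of the \<open>R\<close> blocks, \<open>2 * len m + 10\<close> pay for the
  at most \<open>2 ^ (2 * len m + 10)\<close> tests and the remaining \<open>d\<close> for the
  confidence.\<close>

lemma prob_accepts_unif:
  assumes n: "n \<ge> 1" and m: "m \<ge> 2" and s: "s = 2 ^ 47 * m * len m" and J: "J = 16 * len m"
    and R: "R = 2 * len m + d + 10"
  shows "measure_pmf.prob (replicate_pmf (R * s) (unif n)) {xs. accepts n m s R J xs} \<ge> 1 - (1 / 2) ^ d"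
proof -
  let ?M = "replicate_pmf (R * s) (unif n)"
  note fin = finite_set_dists[OF unif_in_dists[OF n]]
  have l2: "len m \<ge> 2" by (rule len_ge_2[OF m])
  define E where "E i = {xs. R \<le> 2 * card {r. r < R \<and> elem_test n s i (block s r xs)}}" for i
  define F where "F k = {xs. R \<le> 2 * card {r. r < R \<and> coll_test n s k (block s r xs)}}" for k
  have "1 * 1 \<le> m * len m" using m l2 by (intro mult_le_mono) auto
  then have s1: "s \<ge> 1" by (simp add: s)
  have Js: "J \<le> s"
  proof -
    have "16 * len m \<le> 2 ^ 47 * (m * len m)" using m by simp
    then show ?thesis by (simp add: s J mult.assoc)
  qed
  have "- {xs. accepts n m s R J xs} = (\<Union>i\<in>{1..min n (512 * m ^ 2)}. E i) \<union> (\<Union>k\<in>{2..J}. F k)"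
    by (auto simp: accepts_def E_def F_def not_less)
  then have "measure_pmf.prob ?M (- {xs. accepts n m s R J xs}) \<le>
      measure_pmf.prob ?M (\<Union>i\<in>{1..min n (512 * m ^ 2)}. E i) + measure_pmf.prob ?M (\<Union>k\<in>{2..J}. F k)"
    by (simp add: measure_Un_le)
  also have "\<dots> \<le> (\<Sum>i\<in>{1..min n (512 * m ^ 2)}. measure_pmf.prob ?M (E i)) + (\<Sum>k\<in>{2..J}. measure_pmf.prob ?M (F k))"
    by (intro add_mono measure_pmf.finite_measure_subadditive_finite) auto
  also have "\<dots> \<le> (\<Sum>i\<in>{1..min n (512 * m ^ 2)}. (1 / 2) ^ R) + (\<Sum>k\<in>{2..J}. (1 / 2) ^ R)"
  proof (intro add_mono sum_mono)
    fix i assume "i \<in> {1..min n (512 * m ^ 2)}"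
    then show "measure_pmf.prob ?M (E i) \<le> (1 / 2) ^ R"
      unfolding E_def by (intro prob_majority_le fin elem_test_unif n s1) auto
  next
    fix k assume "k \<in> {2..J}"
    then show "measure_pmf.prob ?M (F k) \<le> (1 / 2) ^ R"
      unfolding F_def using Js by (intro prob_majority_le fin coll_test_unif n) auto
  qed
  also have "\<dots> = real (min n (512 * m ^ 2) + (J - 1)) * (1 / 2) ^ R" by (simp add: algebra_simps)
  also have "\<dots> \<le> 2 ^ (2 * len m + 10) * (1 / 2) ^ R"
  proof (intro mult_right_mono)
    have "m ^ 2 \<le> (2 ^ len m) ^ 2" using len_bounds(2)[of m] m by (intro power_mono) auto
    then have 1: "512 * m ^ 2 \<le> 2 ^ (2 * len m + 9)" by (simp add: power_add mult.commute flip: power_mult)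
    have "len m < 2 ^ len m" by (rule less_exp)
    moreover have "16 * (2::nat) ^ len m \<le> 2 ^ (2 * len m + 9)"
      using power_increasing[of "len m + 4" "2 * len m + 9" "2::nat"] by (simp add: power_add)
    moreover have "(2::nat) ^ (2 * len m + 10) = 2 * 2 ^ (2 * len m + 9)"
    proof -
      have "2 * len m + 10 = Suc (2 * len m + 9)" by simp
      then show ?thesis by (simp only: power_Suc)
    qed
    moreover have "J - 1 \<le> 16 * len m" "min n (512 * m ^ 2) \<le> 512 * m ^ 2" by (auto simp: J)
    ultimately have "min n (512 * m ^ 2) + (J - 1) \<le> 2 ^ (2 * len m + 10)" using 1 by linarith
    then have "real (min n (512 * m ^ 2) + (J - 1)) \<le> real (2 ^ (2 * len m + 10))" by (rule of_nat_mono)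
    then show "real (min n (512 * m ^ 2) + (J - 1)) \<le> 2 ^ (2 * len m + 10)"
      by (simp only: of_nat_power of_nat_numeral)
  qed simp
  also have "\<dots> = (1 / 2) ^ d"
  proof -
    have e: "R = (2 * len m + 10) + d" by (simp add: R)
    have "(2::real) ^ a * ((1 / 2) ^ a * (1 / 2) ^ d) = (1 / 2) ^ d" for a
      unfolding mult.assoc[symmetric] power_mult_distrib[symmetric] by simp
    from this[of "2 * len m + 10"] show ?thesis
      unfolding e by (simp only: power_add[of "1 / 2" "2 * len m + 10" d])
  qed
  finally show ?thesis using measure_pmf.prob_compl[of "{xs. accepts n m s R J xs}" ?M]
    by (simp add: Compl_eq_Diff_UNIV)
qed

text \<open>One reliable test suffices, and its complement is amplified: if the test does not win
  its vote, at least half of the blocks fail to reject.\<close>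

lemma prob_accepts_far:
  assumes n: "n \<ge> 1" and m: "m \<ge> 2" and p: "p \<in> dists n" and opt: "opt n p \<le> enat m"
    and s: "s = 2 ^ 47 * m * len m" and J: "J = 16 * len m" and R: "R = 2 * len m + d + 10"
  shows "measure_pmf.prob (replicate_pmf (R * s) p) {xs. \<not> accepts n m s R J xs} \<ge> 1 - (1 / 2) ^ d"
proof -
  let ?M = "replicate_pmf (R * s) p"
  note fin = finite_set_dists[OF p]
  have aux: "measure_pmf.prob ?M {xs. \<not> accepts n m s R J xs} \<ge> 1 - (1 / 2) ^ d"
    if B: "measure_pmf.prob (replicate_pmf s p) {xs. B xs} \<ge> 15 / 16"
      and acc: "\<And>xs. accepts n m s R J xs \<Longrightarrow> 2 * card {r. r < R \<and> B (block s r xs)} < R" for B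
  proof -
    have "measure_pmf.prob (replicate_pmf s p) {xs. \<not> B xs} \<le> 1 / 16"
      using B measure_pmf.prob_compl[of "{xs. B xs}" "replicate_pmf s p"]
      by (simp add: Compl_eq_Diff_UNIV[symmetric] Collect_neg_eq)
    then have "measure_pmf.prob ?M {xs. R \<le> 2 * card {r. r < R \<and> \<not> B (block s r xs)}} \<le> (1 / 2) ^ R"
      by (rule prob_majority_le[OF fin])
    also have "\<dots> \<le> (1 / 2) ^ d" by (intro power_decreasing) (auto simp: R)
    finally have 1: "measure_pmf.prob ?M {xs. R \<le> 2 * card {r. r < R \<and> \<not> B (block s r xs)}} \<le> (1 / 2) ^ d" .
    have "measure_pmf.prob ?M {xs. accepts n m s R J xs} \<le>
       measure_pmf.prob ?M {xs. R \<le> 2 * card {r. r < R \<and> \<not> B (block s r xs)}}"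
    proof (rule measure_pmf.finite_measure_mono)
      show "{xs. accepts n m s R J xs} \<subseteq> {xs. R \<le> 2 * card {r. r < R \<and> \<not> B (block s r xs)}}"
      proof safe
        fix xs assume "accepts n m s R J xs"
        then have "2 * card {r. r < R \<and> B (block s r xs)} < R" by (rule acc)
        moreover have "card {r. r < R \<and> B (block s r xs)} + card {r. r < R \<and> \<not> B (block s r xs)} = R"
        proof -
          have "{..<R} = {r. r < R \<and> B (block s r xs)} \<union> {r. r < R \<and> \<not> B (block s r xs)}" by auto
          then show ?thesis by (subst card_Un_disjoint[symmetric]) (auto simp flip: \<open>{..<R} = _\<close>)
        qed
        ultimately show "R \<le> 2 * card {r. r < R \<and> \<not> B (block s r xs)}" by linarith
      qed
    qed simp
    with 1 show ?thesis using measure_pmf.prob_compl[of "{xs. accepts n m s R J xs}" ?M]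
      by (simp add: Compl_eq_Diff_UNIV[symmetric] Collect_neg_eq)
  qed
  from some_test_rejects[OF n p m opt s] show ?thesis
  proof (elim disjE bexE)
    fix i assume "i \<in> {1..min n (512 * m ^ 2)}"
      "measure_pmf.prob (replicate_pmf s p) {xs. elem_test n s i xs} \<ge> 15 / 16"
    then show ?thesis by (intro aux[of "elem_test n s i"]) (auto simp: accepts_def)
  next
    fix k assume "k \<in> {2..16 * len m}"
      "measure_pmf.prob (replicate_pmf s p) {xs. coll_test n s k xs} \<ge> 15 / 16"
    then show ?thesis by (intro aux[of "coll_test n s k"]) (auto simp: accepts_def J)
  qed
qed

section \<open>Cost-bounded execution\<close>

text \<open>Total-correctness weakest precondition with a cost budget. \<open>S\<close> counts
  instructions and \<open>B\<close> bounds bit lengths; an instruction handles at most two numbers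
  and so costs at most \<open>2 * B + 1\<close>. With \<open>B\<close> fixed for the whole program,
  budgets simply add.\<close>

definition wp :: "real \<Rightarrow> nat \<Rightarrow> com \<Rightarrow> nat \<Rightarrow> (state \<Rightarrow> bool) \<Rightarrow> state \<Rightarrow> bool" where
  "wp \<delta> B c S Q \<sigma> \<longleftrightarrow> (\<exists>t \<sigma>'. exec \<delta> c \<sigma> t \<sigma>' \<and> t \<le> S * (2 * B + 1) \<and> Q \<sigma>')"

lemma len_le: "x < 2 ^ B \<Longrightarrow> len x \<le> B"
  by (rule floorlog_leI) auto

lemma wpI: "exec \<delta> c \<sigma> t \<sigma>' \<Longrightarrow> t \<le> S * (2 * B + 1) \<Longrightarrow> Q \<sigma>' \<Longrightarrow> wp \<delta> B c S Q \<sigma>"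
  unfolding wp_def by blast

lemma wp_mono: "wp \<delta> B c S Q \<sigma> \<Longrightarrow> S \<le> S' \<Longrightarrow> (\<And>\<tau>. Q \<tau> \<Longrightarrow> Q' \<tau>) \<Longrightarrow> wp \<delta> B c S' Q' \<sigma>"
  unfolding wp_def by (meson le_trans mult_le_mono1)

lemma wp_Skip: "Q \<sigma> \<Longrightarrow> wp \<delta> B Skip 1 Q \<sigma>"
  by (rule wpI[OF exec.Skip]) auto

lemma wp_Seq:
  assumes "wp \<delta> B c S (wp \<delta> B d S' Q) \<sigma>"
  shows "wp \<delta> B (Seq c d) (S + S') Q \<sigma>"
proof -
  from assms obtain t \<tau> t' \<tau>' where e: "exec \<delta> c \<sigma> t \<tau>" "t \<le> S * (2 * B + 1)"
    "exec \<delta> d \<tau> t' \<tau>'" "t' \<le> S' * (2 * B + 1)" "Q \<tau>'"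
    unfolding wp_def by blast
  have "exec \<delta> (Seq c d) \<sigma> (t + t') \<tau>'" by (rule exec.Seq[OF e(1,3)])
  moreover have "t + t' \<le> (S + S') * (2 * B + 1)" using e(2,4) by (simp add: distrib_right)
  ultimately show ?thesis using e(5) unfolding wp_def by blast
qed

lemma wp_Sample:
  assumes "x < 2 ^ B" "Q (R(i := x), xs, bs, k)"
  shows "wp \<delta> B (Sample i) 1 Q (R, x # xs, bs, k)"
  by (rule wpI[OF exec.Sample]) (use assms len_le[of x B] in auto)

lemma wp_Digit:
  assumes "Q (R(i := digit \<delta> (Suc k)), xs, bs, Suc k)"
  shows "wp \<delta> B (Digit i) 1 Q (R, xs, bs, k)"
  by (rule wpI[OF exec.Digit]) (use assms in auto)

lemma wp_If:
  assumes "R i < 2 ^ B" "wp \<delta> B (if R i \<noteq> 0 then c else d) S Q (R, xs, bs, k)"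
  shows "wp \<delta> B (If i c d) (Suc S) Q (R, xs, bs, k)"
proof -
  have l: "len (R i) \<le> B" using assms(1) by (rule len_le)
  obtain t \<tau> where e: "exec \<delta> (if R i \<noteq> 0 then c else d) (R, xs, bs, k) t \<tau>" "t \<le> S * (2 * B + 1)" "Q \<tau>"
    using assms(2) unfolding wp_def by blast
  show ?thesis
  proof (cases "R i = 0")
    case True
    then have "exec \<delta> (If i c d) (R, xs, bs, k) (1 + t) \<tau>" using e by (intro exec.IfFalse) auto
    then show ?thesis unfolding wp_def using e by (intro exI conjI) auto
  next
    case False
    then have "exec \<delta> (If i c d) (R, xs, bs, k) (1 + len (R i) + t) \<tau>" using e by (intro exec.IfTrue) auto
    then show ?thesis unfolding wp_def using e l by (intro exI conjI) auto
  qed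
qed

lemma wp_While_step:
  assumes "R i \<noteq> 0" "R i < 2 ^ B" "wp \<delta> B c S (wp \<delta> B (While i c) S' Q) (R, xs, bs, k)"
  shows "wp \<delta> B (While i c) (Suc S + S') Q (R, xs, bs, k)"
proof -
  have l: "len (R i) \<le> B" using assms(2) by (rule len_le)
  from assms(3) obtain t \<tau> t' \<tau>' where e: "exec \<delta> c (R, xs, bs, k) t \<tau>" "t \<le> S * (2 * B + 1)"
    "exec \<delta> (While i c) \<tau> t' \<tau>'" "t' \<le> S' * (2 * B + 1)" "Q \<tau>'"
    unfolding wp_def by blast
  have "exec \<delta> (While i c) (R, xs, bs, k) (1 + len (R i) + t + t') \<tau>'"
    by (rule exec.WhileTrue[OF assms(1) e(1,3)])
  moreover have "1 + len (R i) + t + t' \<le> (Suc S + S') * (2 * B + 1)"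
    using l e(2,4) by (simp add: distrib_right)
  ultimately show ?thesis using e(5) unfolding wp_def by blast
qed

lemma wp_While_end: "R i = 0 \<Longrightarrow> Q (R, xs, bs, k) \<Longrightarrow> wp \<delta> B (While i c) 1 Q (R, xs, bs, k)"
  by (rule wpI[OF exec.WhileFalse]) auto

text \<open>The invariant is indexed by the round, so the number of rounds is exact; each round pays
  one extra unit for the guard and the exit a last one.\<close>

lemma wp_loop:
  assumes step: "\<And>j R xs bs k. j < N \<Longrightarrow> I j (R, xs, bs, k) \<Longrightarrow> wp \<delta> B c S (I (Suc j)) (R, xs, bs, k)"
    and nz: "\<And>j R xs bs k. j < N \<Longrightarrow> I j (R, xs, bs, k) \<Longrightarrow> R x \<noteq> 0 \<and> R x < 2 ^ B"
    and z: "\<And>R xs bs k. I N (R, xs, bs, k) \<Longrightarrow> R x = 0"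
    and init: "I 0 \<sigma>"
  shows "wp \<delta> B (While x c) (N * Suc S + 1) (I N) \<sigma>"
proof -
  have "wp \<delta> B (While x c) ((N - j) * Suc S + 1) (I N) \<tau>" if "j \<le> N" "I j \<tau>" for j \<tau>
    using that
  proof (induction "N - j" arbitrary: j \<tau>)
    case 0
    obtain R xs bs k where \<tau>: "\<tau> = (R, xs, bs, k)" by (cases \<tau>)
    show ?case using 0 z unfolding \<tau> by (auto intro: wp_While_end[unfolded One_nat_def])
  next
    case (Suc l)
    obtain R xs bs k where \<tau>: "\<tau> = (R, xs, bs, k)" by (cases \<tau>)
    have j: "j < N" "N - Suc j = l" using Suc.hyps(2) by auto
    have "wp \<delta> B c S (wp \<delta> B (While x c) (l * Suc S + 1) (I N)) (R, xs, bs, k)"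
    proof (rule wp_mono[OF step[OF j(1)]])
      show "I j (R, xs, bs, k)" using Suc.prems \<tau> by simp
      show "wp \<delta> B (While x c) (l * Suc S + 1) (I N) \<tau>'" if "I (Suc j) \<tau>'" for \<tau>'
        using Suc.hyps(1)[of "Suc j" \<tau>'] j that by simp
    qed simp
    then have "wp \<delta> B (While x c) (Suc S + (l * Suc S + 1)) (I N) (R, xs, bs, k)"
      using nz[OF j(1)] Suc.prems \<tau> by (intro wp_While_step) auto
    then show ?case unfolding \<tau> Suc.hyps(2)[symmetric] by (simp add: ac_simps)
  qed
  from this[of 0] init show ?thesis by simp
qed

section \<open>Straight-line code as functions on registers\<close>

text \<open>The identity is a default for commands that touch the tapes or the control flow;
  \<open>fits\<close> is False for these.\<close>

fun ev :: "com \<Rightarrow> (nat \<Rightarrow> nat) \<Rightarrow> nat \<Rightarrow> nat" where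
  "ev (Const i a) R = R(i := a)"
| "ev (Add i j l) R = R(i := R j + R l)"
| "ev (Sub i j l) R = R(i := R j - R l)"
| "ev (Mul i j l) R = R(i := R j * R l)"
| "ev (Div i j l) R = R(i := R j div R l)"
| "ev (Load i j) R = R(i := R (R j))"
| "ev (Store i j) R = R(R i := R j)"
| "ev _ R = R"

fun fits :: "nat \<Rightarrow> com \<Rightarrow> (nat \<Rightarrow> nat) \<Rightarrow> bool" where
  "fits B (Const i a) R \<longleftrightarrow> a < 2 ^ B"
| "fits B (Add i j l) R \<longleftrightarrow> R j < 2 ^ B \<and> R l < 2 ^ B"
| "fits B (Sub i j l) R \<longleftrightarrow> R j < 2 ^ B \<and> R l < 2 ^ B"
| "fits B (Mul i j l) R \<longleftrightarrow> R j < 2 ^ B \<and> R l < 2 ^ B"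
| "fits B (Div i j l) R \<longleftrightarrow> R j < 2 ^ B \<and> R l < 2 ^ B"
| "fits B (Load i j) R \<longleftrightarrow> R j < 2 ^ B \<and> R (R j) < 2 ^ B"
| "fits B (Store i j) R \<longleftrightarrow> R i < 2 ^ B \<and> R j < 2 ^ B"
| "fits B _ R \<longleftrightarrow> False"

fun evs :: "com list \<Rightarrow> (nat \<Rightarrow> nat) \<Rightarrow> nat \<Rightarrow> nat" where
  "evs [] R = R"
| "evs (c # cs) R = evs cs (ev c R)"

fun all_fit :: "nat \<Rightarrow> com list \<Rightarrow> (nat \<Rightarrow> nat) \<Rightarrow> bool" where
  "all_fit B [] R \<longleftrightarrow> True"
| "all_fit B (c # cs) R \<longleftrightarrow> fits B c R \<and> all_fit B cs (ev c R)"

lemma wp_arith: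
  assumes "fits B c R" "Q (ev c R, xs, bs, k)"
  shows "wp \<delta> B c 1 Q (R, xs, bs, k)"
proof -
  have l: "len x + len y \<le> 2 * B" if "x < 2 ^ B" "y < 2 ^ B" for x y
    using len_le[OF that(1)] len_le[OF that(2)] by simp
  show ?thesis
  proof (cases c)
    case (Const i a)
    then show ?thesis using assms len_le[of a B] unfolding wp_def by (auto intro!: exI exec.Const)
  next
    case (Add i j m)
    then show ?thesis using assms l[of "R j" "R m"] unfolding wp_def by (auto intro!: exI exec.Add)
  next
    case (Sub i j m)
    then show ?thesis using assms l[of "R j" "R m"] unfolding wp_def by (auto intro!: exI exec.Sub)
  next
    case (Mul i j m)
    then show ?thesis using assms l[of "R j" "R m"] unfolding wp_def by (auto intro!: exI exec.Mul)
  next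
    case (Div i j m)
    then show ?thesis using assms l[of "R j" "R m"] unfolding wp_def by (auto intro!: exI exec.Div)
  next
    case (Load i j)
    then show ?thesis using assms l[of "R j" "R (R j)"] unfolding wp_def by (auto intro!: exI exec.Load)
  next
    case (Store i j)
    then show ?thesis using assms l[of "R i" "R j"] unfolding wp_def by (auto intro!: exI exec.Store)
  qed (use assms in auto)
qed

fun seqs :: "com list \<Rightarrow> com" where
  "seqs [] = Skip"
| "seqs (c # cs) = Seq c (seqs cs)"

lemma wp_seqs:
  assumes "all_fit B cs R" "Q (evs cs R, xs, bs, k)"
  shows "wp \<delta> B (seqs cs) (Suc (length cs)) Q (R, xs, bs, k)"
  using assms
proof (induction cs arbitrary: R)
  case Nil
  then show ?case by (auto intro: wp_Skip[unfolded One_nat_def])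
next
  case (Cons c cs)
  then have "wp \<delta> B (Seq c (seqs cs)) (1 + Suc (length cs)) Q (R, xs, bs, k)"
    by (intro wp_Seq wp_arith) auto
  then show ?case by simp
qed

lemma run_wpI:
  assumes "wp \<delta> B c S (\<lambda>(R, _). (R 0 \<noteq> 0) = b) ((\<lambda>_. 0)(0 := n, 1 := m), xs, bs, 0)"
  shows "\<exists>t. run c n m \<delta> xs bs t b \<and> t \<le> S * (2 * B + 1)"
  using assms unfolding wp_def run_def by (force simp: case_prod_unfold)

section \<open>The program\<close>

lemma wp_seqsI:
  "all_fit B cs R \<Longrightarrow> Q (evs cs R, xs, bs, k) \<Longrightarrow> Suc (length cs) = S \<Longrightarrow> wp \<delta> B (seqs cs) S Q (R, xs, bs, k)"
  using wp_seqs by blast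

section \<open>Filling the table of statistics\<close>

text \<open>The layout of a row: cells up to \<open>n\<close> hold the counts, cell
  \<open>n + k\<close> holds the collisions of order \<open>k\<close>. Order 1 is stored as well, so
  that one update loop serves all orders.\<close>

definition stat :: "nat \<Rightarrow> nat list \<Rightarrow> nat \<Rightarrow> nat" where
  "stat n zs y = (if y \<le> n then count_list zs y else coll {1..n} (y - n) zs)"

lemma stat_Nil: "0 < y \<Longrightarrow> stat n [] y = 0"
  by (auto simp: stat_def coll_def)

text \<open>Pascal's rule. The count before the new sample enters, so the collisions are updated
  ahead of the count.\<close>

lemma coll_snoc:
  assumes "x \<in> S" "finite S" "k > 0"
  shows "coll S k (zs @ [x]) = coll S k zs + (count_list zs x choose (k - 1))"
proof -
  obtain l where l: "k = Suc l" using assms(3) by (cases k) auto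
  have "coll S k (zs @ [x]) = (\<Sum>y\<in>S. (count_list zs y choose k) + (if y = x then count_list zs x choose l else 0))"
    unfolding coll_def by (intro sum.cong) (auto simp: l)
  also have "\<dots> = coll S k zs + (count_list zs x choose l)"
    using assms by (simp add: sum.distrib coll_def)
  finally show ?thesis by (simp add: l)
qed

lemma stat_snoc:
  assumes "x \<in> {1..n}" "0 < y"
  shows "stat n (zs @ [x]) y = stat n zs y + (if y = x then 1 else 0) + (if y > n then count_list zs x choose (y - n - 1) else 0)"
  using assms by (auto simp: stat_def coll_snoc)

text \<open>In round \<open>j\<close> register 16 holds \<open>c choose j\<close>, 17 the cell of
  order \<open>j + 1\<close>, 18 the rounds left and 19 the number \<open>j\<close>.\<close>

abbreviation binom_body :: "com list" where
  "binom_body \<equiv> [Load 20 17, Add 20 20 16, Store 17 20, Sub 21 15 19, Mul 16 16 21,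
     Add 19 19 2, Div 16 16 19, Add 17 17 2, Sub 18 18 2]"

definition binom_loop :: com where
  "binom_loop = While 18 (seqs binom_body)"

text \<open>The integer division is exact; for \<open>j \<ge> c\<close> the truncated difference
  gives the value 0, as it should.\<close>

lemma binomial_step: "(c choose j) * (c - j) div Suc j = (c choose Suc j)"
  by (simp only: binomial_Suc_times[symmetric] nonzero_mult_div_cancel_right[OF nat.simps(3)])

lemma wp_binom_loop:
  assumes R0: "R0 2 = 1" "R0 15 = c" "R0 16 = 1" "R0 17 = tb + 1" "R0 18 = J" "R0 19 = 0" and tb: "32 \<le> tb"
    and B: "\<And>j. j \<le> J \<Longrightarrow> (c choose j) < 2 ^ B" "\<And>j. j \<le> J \<Longrightarrow> (c choose j) * c < 2 ^ B"
      "\<And>j. j < J \<Longrightarrow> R0 (tb + 1 + j) + (c choose j) < 2 ^ B" "tb + J + 1 < 2 ^ B" "c < 2 ^ B"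
  shows "wp \<delta> B binom_loop (11 * J + 1) (\<lambda>(R, xs', bs', k'). xs' = xs \<and> bs' = bs \<and> k' = k \<and>
     (\<forall>a. a \<notin> {16..21} \<longrightarrow> R a = R0 a + (if tb < a \<and> a \<le> tb + J then c choose (a - tb - 1) else 0))) (R0, xs, bs, k)"
proof -
  define I where "I j = (\<lambda>(R, xs', bs', k'). xs' = xs \<and> bs' = bs \<and> k' = (k::nat) \<and>
     R 16 = (c choose j) \<and> R 17 = tb + 1 + j \<and> R 18 = J - j \<and> R 19 = j \<and>
     (\<forall>a. a \<notin> {16..21} \<longrightarrow> R a = R0 a + (if tb < a \<and> a \<le> tb + j then c choose (a - tb - 1) else 0)))"
    for j :: nat
  have "wp \<delta> B (While 18 (seqs binom_body)) (J * Suc 10 + 1) (I J) (R0, xs, bs, k)"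
  proof (rule wp_loop)
    fix j R xs' bs' k' assume j: "j < J" and I: "I j (R, xs', bs', k')"
    have fr: "\<And>a. a \<notin> {16..21} \<Longrightarrow> R a = R0 a + (if tb < a \<and> a \<le> tb + j then c choose (a - tb - 1) else 0)"
      and eqs: "xs' = xs" "bs' = bs" "k' = k" "R 16 = (c choose j)" "R 17 = tb + 1 + j" "R 18 = J - j" "R 19 = j"
      using I by (auto simp: I_def)
    \<comment> \<open>Table addresses start above 31, so a write to cell \<open>p\<close> cannot
      disturb a working register.\<close>
    define p where "p = tb + 1 + j"
    have p: "p > 31" "p \<noteq> 16" "p \<noteq> 17" "p \<noteq> 18" "p \<noteq> 19" "p \<noteq> 20" "p \<noteq> 21" "p \<noteq> 2" "p \<noteq> 15"
      using tb by (auto simp: p_def)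
    have rg: "R 2 = 1" "R 15 = c" "R 16 = (c choose j)" "R 17 = p" "R 18 = J - j" "R 19 = j" "R p = R0 p"
      using fr tb R0 eqs by (auto simp: p_def)
    have b: "(c choose j) < 2 ^ B" "(c choose j) * c < 2 ^ B" "R0 p + (c choose j) < 2 ^ B" "R0 p < 2 ^ B"
      "p < 2 ^ B" "c < 2 ^ B" "J - j < 2 ^ B" "j < 2 ^ B" "Suc j < 2 ^ B" "Suc 0 < 2 ^ B"
      using B(1,2)[of j] B(3)[OF j] B(4,5) j tb by (auto simp: p_def)
    have b': "(c choose j) * (c - j) < 2 ^ B" "c - j < 2 ^ B"
      using le_less_trans[OF mult_le_mono2[of "c - j" c] b(2)] b(6) by auto
    show "wp \<delta> B (seqs binom_body) 10 (I (Suc j)) (R, xs', bs', k')"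
    proof (rule wp_seqsI)
      show "all_fit B binom_body R"
        using p rg b b' by simp
      have fr': "\<And>a. a \<notin> {16..21} \<Longrightarrow> a \<noteq> p \<Longrightarrow>
          R a = R0 a + (if tb < a \<and> a \<le> tb + Suc j then c choose (a - tb - 1) else 0)"
        using fr by (auto simp: p_def)
      have pj: "p - tb - 1 = j" "tb < p" "p \<le> tb + Suc j" "p + 1 = tb + 1 + Suc j" by (auto simp: p_def)
      show "I (Suc j) (evs binom_body R, xs', bs', k')"
        unfolding I_def prod.case
      proof (intro conjI allI impI)
        fix a :: nat assume a: "a \<notin> {16..21}"
        then have a': "a \<noteq> 16" "a \<noteq> 17" "a \<noteq> 18" "a \<noteq> 19" "a \<noteq> 20" "a \<noteq> 21" by auto
        show "evs binom_body R a = R0 a + (if tb < a \<and> a \<le> tb + Suc j then c choose (a - tb - 1) else 0)"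
        proof (cases "a = p")
          case True
          have "evs binom_body R p = R0 p + (c choose j)" using p rg by simp
          moreover have "(if tb < p \<and> p \<le> tb + Suc j then c choose (p - tb - 1) else 0) = (c choose j)"
            using pj(2,3) by (simp only: pj(1) simp_thms if_True)
          ultimately show ?thesis by (simp only: True)
        next
          case False
          have "evs binom_body R a = R a" using p rg a' False by simp
          then show ?thesis using fr'[OF a False] by simp
        qed
      qed (use p rg eqs pj(4) binomial_step[of c j] in \<open>simp_all del: binomial_Suc_Suc\<close>)
    qed simp
  next
    fix j R xs' bs' k' assume j: "j < J" and I: "I j (R, xs', bs', k')"
    show "R 18 \<noteq> 0 \<and> R 18 < 2 ^ B" using I j B(4) by (auto simp: I_def)
  next
    fix R xs' bs' k' assume I: "I J (R, xs', bs', k')"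
    show "R 18 = 0" using I by (auto simp: I_def)
  next
    show "I 0 (R0, xs, bs, k)" using R0 by (auto simp: I_def)
  qed
  then show ?thesis unfolding binom_loop_def
    by (rule wp_mono) (auto simp: I_def)
qed

text \<open>Register 14 turns from the sample into the address of its count, 15 takes the old count,
  and 13 points at the cell just before that of order 1.\<close>

definition sample_body :: com where
  "sample_body = Seq (Sample 14) (Seq (seqs [Add 14 14 10, Load 15 14, Const 16 1, Add 17 13 2, Add 18 7 31, Const 19 0])
     (Seq binom_loop (seqs [Add 15 15 2, Store 14 15, Sub 12 12 2])))"

lemma coll_le: "n * s ^ k \<ge> coll {1..n} k zs" if "length zs \<le> s"
proof -
  have "coll {1..n} k zs \<le> (\<Sum>x\<in>{1..n}. s ^ k)" unfolding coll_def
  proof (intro sum_mono)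
    fix x
    have "count_list zs x \<le> s" using count_le_length[of zs x] that by linarith
    then have "count_list zs x ^ k \<le> s ^ k" by (intro power_mono) auto
    moreover have "(count_list zs x choose k) \<le> count_list zs x ^ k"
      by (cases "k \<le> count_list zs x") (auto simp: binomial_le_pow binomial_eq_0)
    ultimately show "(count_list zs x choose k) \<le> s ^ k" by linarith
  qed
  then show ?thesis by simp
qed

lemma binomial_le_power: "c \<le> s \<Longrightarrow> j \<le> J \<Longrightarrow> 1 \<le> s \<Longrightarrow> (c choose j) \<le> s ^ J"
proof -
  assume c: "c \<le> s" and j: "j \<le> J" and s: "1 \<le> s"
  have "(c choose j) \<le> c ^ j" by (cases "j \<le> c") (auto simp: binomial_le_pow binomial_eq_0)
  also have "\<dots> \<le> s ^ j" using c by (intro power_mono) auto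
  also have "\<dots> \<le> s ^ J" using j s by (intro power_increasing) auto
  finally show ?thesis .
qed

lemma wp_sample_loop:
  assumes R0: "R0 0 = n" "R0 2 = 1" "R0 7 = J" "R0 10 = b" "R0 13 = b + n" "R0 31 = 0" "R0 12 = s"
    and b: "32 \<le> b" and cells: "\<And>y. 1 \<le> y \<Longrightarrow> y \<le> n + J \<Longrightarrow> R0 (b + y) = 0"
    and ys: "length ys = s" "set ys \<subseteq> {1..n}" and s: "1 \<le> s"
    and B: "(n + 1) * s ^ (J + 1) < 2 ^ B" "b + n + J + 1 < 2 ^ B" "s + 1 < 2 ^ B"
  shows "wp \<delta> B (While 12 sample_body) (s * (11 * J + 14) + 1) (\<lambda>(R, xs', bs', k'). xs' = rest \<and> bs' = bs \<and> k' = k \<and>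
     (\<forall>a. a \<notin> insert 12 {14..21} \<longrightarrow> R a = R0 a + (if b < a \<and> a \<le> b + n + J then stat n ys (a - b) else 0))) (R0, ys @ rest, bs, k)"
proof -
  define I where "I i = (\<lambda>(R, xs', bs', k'). xs' = drop i ys @ rest \<and> bs' = bs \<and> k' = (k::nat) \<and> R 12 = s - i \<and>
     (\<forall>a. a \<notin> insert 12 {14..21} \<longrightarrow> R a = R0 a + (if b < a \<and> a \<le> b + n + J then stat n (take i ys) (a - b) else 0)))"
    for i :: nat
  have "wp \<delta> B (While 12 sample_body) (s * Suc (11 * J + 13) + 1) (I s) (R0, ys @ rest, bs, k)"
  proof (rule wp_loop)
    fix i R xs' bs' k' assume i: "i < s" and I: "I i (R, xs', bs', k')"
    define x where "x = ys ! i"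
    define zs where "zs = take i ys"
    define c where "c = count_list zs x"
    define p where "p = b + x"
    define tb where "tb = b + n"
    have x: "1 \<le> x" "x \<le> n" using subsetD[OF ys(2) nth_mem, of i] i ys(1) by (auto simp: x_def)
    have zs': "take (Suc i) ys = zs @ [x]" using i ys by (simp add: zs_def x_def take_Suc_conv_app_nth)
    have xs': "xs' = x # (drop (Suc i) ys @ rest)" and eqs: "bs' = bs" "k' = k" "R 12 = s - i"
      using I i ys by (auto simp: I_def x_def Cons_nth_drop_Suc simp flip: append_Cons)
    have fr: "\<And>a. a \<notin> insert 12 {14..21} \<Longrightarrow> R a = R0 a + (if b < a \<and> a \<le> b + n + J then stat n zs (a - b) else 0)"
      using I by (auto simp: I_def zs_def)
    have rg: "R 2 = 1" "R 7 = J" "R 10 = b" "R 13 = tb" "R 31 = 0" using fr R0 b by (auto simp: tb_def)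
    have p: "p \<ge> 33" using b x by (simp add: p_def)
    have Rp: "R p = c" using fr[of p] cells[of x] x b by (auto simp: p_def c_def stat_def)
    have lz: "length zs \<le> s" "count_list zs x \<le> s" using i ys count_le_length[of zs x] by (auto simp: zs_def)
    have c: "c \<le> s" using lz by (simp add: c_def)
    have sJ: "s ^ J * s < 2 ^ B" "s ^ J < 2 ^ B" "n * s ^ J + s ^ J < 2 ^ B"
    proof -
      have 1: "s ^ J * s \<le> (n + 1) * s ^ (J + 1)" by simp
      have 2: "s ^ J * 1 \<le> s ^ J * s" using s by (intro mult_le_mono) auto
      have 3: "(n + 1) * (s ^ J * 1) \<le> (n + 1) * (s ^ J * s)" using s by (intro mult_le_mono) auto
      show "s ^ J * s < 2 ^ B" "s ^ J < 2 ^ B" "n * s ^ J + s ^ J < 2 ^ B"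
        using 1 2 3 B(1) by (auto simp: algebra_simps)
    qed
    have xB: "x < 2 ^ B" "b < 2 ^ B" "p < 2 ^ B" "tb < 2 ^ B" "tb + J + 1 < 2 ^ B" "J < 2 ^ B" "c < 2 ^ B" "Suc c < 2 ^ B"
        "Suc 0 < 2 ^ B" "s - i < 2 ^ B" "(0::nat) < 2 ^ B"
      using B(2,3) x c s b by (auto simp: p_def tb_def)
    define R1 where "R1 = R(14 := p, 15 := c, 16 := 1, 17 := tb + 1, 18 := J, 19 := 0)"
    have pre: "evs [Add 14 14 10, Load 15 14, Const 16 1, Add 17 13 2, Add 18 7 31, Const 19 0] (R(14 := x)) = R1"
      using p rg Rp by (simp add: R1_def p_def add.commute)
    define P2 where "P2 = (\<lambda>(R', xs'', bs'', k''). xs'' = drop (Suc i) ys @ rest \<and> bs'' = bs \<and> k'' = k \<and>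
     (\<forall>a. a \<notin> {16..21} \<longrightarrow> R' a = R1 a + (if tb < a \<and> a \<le> tb + J then c choose (a - tb - 1) else 0)))"
    have R1: "R1 2 = 1" "R1 15 = c" "R1 16 = 1" "R1 17 = tb + 1" "R1 18 = J" "R1 19 = 0" "32 \<le> tb"
      using rg b by (auto simp: R1_def tb_def)
    have loop: "wp \<delta> B binom_loop (11 * J + 1) P2 (R1, drop (Suc i) ys @ rest, bs, k)"
      unfolding P2_def
    proof (rule wp_binom_loop[OF R1])
      show "(c choose j) < 2 ^ B" if "j \<le> J" for j
        using binomial_le_power[OF c that s] sJ by linarith
      show "(c choose j) * c < 2 ^ B" if "j \<le> J" for j
        using mult_le_mono[OF binomial_le_power[OF c that s] c] sJ by linarith
      show "R1 (tb + 1 + j) + (c choose j) < 2 ^ B" if "j < J" for j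
      proof -
        have "R1 (tb + 1 + j) = R (tb + 1 + j)" using \<open>32 \<le> tb\<close> by (simp add: R1_def)
        also have "\<dots> = coll {1..n} (Suc j) zs"
          using fr[of "tb + 1 + j"] cells[of "n + 1 + j"] that b by (auto simp: tb_def stat_def add.assoc)
        also have "\<dots> \<le> n * s ^ Suc j" by (rule coll_le[OF lz(1)])
        also have "\<dots> \<le> n * s ^ J" using that s by (intro mult_le_mono power_increasing) auto
        finally show ?thesis using binomial_le_power[OF c less_imp_le[OF that] s] sJ(3) by linarith
      qed
    qed (use xB in auto)
    have post: "wp \<delta> B (seqs [Add 15 15 2, Store 14 15, Sub 12 12 2]) 4 (I (Suc i)) \<tau>" if "P2 \<tau>" for \<tau>
    proof -
      obtain R' xs'' bs'' k'' where \<tau>: "\<tau> = (R', xs'', bs'', k'')" by (cases \<tau>)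
      have e: "xs'' = drop (Suc i) ys @ rest" "bs'' = bs" "k'' = k"
        and fr1: "\<And>a. a \<notin> {16..21} \<Longrightarrow> R' a = R1 a + (if tb < a \<and> a \<le> tb + J then c choose (a - tb - 1) else 0)"
        using that unfolding \<tau> P2_def by auto
      have r: "R' 2 = 1" "R' 12 = s - i" "R' 14 = p" "R' 15 = c"
        using fr1 R1 rg eqs p by (auto simp: R1_def)
      have ev: "evs [Add 15 15 2, Store 14 15, Sub 12 12 2] R' = R'(15 := Suc c, p := Suc c, 12 := s - Suc i)"
        using r p by simp
      show ?thesis unfolding \<tau>
      proof (rule wp_seqsI)
        show "all_fit B [Add 15 15 2, Store 14 15, Sub 12 12 2] R'" using r p xB by simp
        show "I (Suc i) (evs [Add 15 15 2, Store 14 15, Sub 12 12 2] R', xs'', bs'', k'')"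
          unfolding I_def prod.case ev
        proof (intro conjI allI impI)
          fix a :: nat assume a: "a \<notin> insert 12 {14..21}"
          show "(R'(15 := Suc c, p := Suc c, 12 := s - Suc i)) a =
             R0 a + (if b < a \<and> a \<le> b + n + J then stat n (take (Suc i) ys) (a - b) else 0)"
          proof (cases "a = p")
            case True
            have "stat n (take (Suc i) ys) x = Suc c" unfolding zs' using x by (simp add: stat_def c_def)
            then show ?thesis using True p cells[of x] x by (auto simp: p_def)
          next
            case False
            have "(R'(15 := Suc c, p := Suc c, 12 := s - Suc i)) a = R' a" using False a by auto
            also have "\<dots> = R1 a + (if tb < a \<and> a \<le> tb + J then c choose (a - tb - 1) else 0)"
              by (rule fr1) (use a in auto)
            also have "R1 a = R a" using a by (auto simp: R1_def)
            also have "R a = R0 a + (if b < a \<and> a \<le> b + n + J then stat n zs (a - b) else 0)"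
              by (rule fr[OF a])
            finally have eq: "(R'(15 := Suc c, p := Suc c, 12 := s - Suc i)) a = \<dots> + (if tb < a \<and> a \<le> tb + J then c choose (a - tb - 1) else 0)" .
            show ?thesis
            proof (cases "b < a \<and> a \<le> b + n + J")
              case True
              define y where "y = a - b"
              have y: "a = b + y" "0 < y" "y \<le> n + J" "y \<noteq> x" using True False by (auto simp: y_def p_def)
              have "stat n (zs @ [x]) y = stat n zs y + (if y > n then c choose (y - n - 1) else 0)"
                using stat_snoc[of x n y zs] x y by (simp add: c_def)
              then have "stat n (take (Suc i) ys) (a - b) = stat n zs (a - b) + (if tb < a \<and> a \<le> tb + J then c choose (a - tb - 1) else 0)"
                unfolding zs' using y by (auto simp: tb_def)
              then show ?thesis using True by (simp only: eq) simp
            next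
              case False
              then show ?thesis unfolding eq by (auto simp: tb_def)
            qed
          qed
        qed (use e p in auto)
      qed simp
    qed
    have "wp \<delta> B sample_body (1 + (7 + ((11 * J + 1) + 4))) (I (Suc i)) (R, xs', bs', k')"
      unfolding sample_body_def xs' eqs
    proof (intro wp_Seq wp_Sample wp_seqsI)
      show "all_fit B [Add 14 14 10, Load 15 14, Const 16 1, Add 17 13 2, Add 18 7 31, Const 19 0] (R(14 := x))"
        using p rg Rp xB by (simp add: p_def add.commute)
      show "wp \<delta> B binom_loop (11 * J + 1) (wp \<delta> B (seqs [Add 15 15 2, Store 14 15, Sub 12 12 2]) 4 (I (Suc i)))
        (evs [Add 14 14 10, Load 15 14, Const 16 1, Add 17 13 2, Add 18 7 31, Const 19 0] (R(14 := x)), drop (Suc i) ys @ rest, bs, k)"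
        unfolding pre by (rule wp_mono[OF loop]) (use post in auto)
    qed (use xB in auto)
    then show "wp \<delta> B sample_body (11 * J + 13) (I (Suc i)) (R, xs', bs', k')" by (simp add: add.commute)
  next
    fix i R xs' bs' k' assume "i < s" and I: "I i (R, xs', bs', k')"
    then show "R 12 \<noteq> 0 \<and> R 12 < 2 ^ B" using B(3) by (auto simp: I_def)
  next
    fix R xs' bs' k' assume "I s (R, xs', bs', k')"
    then show "R 12 = 0" by (auto simp: I_def)
  next
    show "I 0 (R0, ys @ rest, bs, k)" using R0 by (auto simp: I_def stat_Nil)
  qed
  then show ?thesis
    by (rule wp_mono) (use ys in \<open>auto simp: I_def\<close>)
qed

definition rows_body :: com where
  "rows_body = Seq (seqs [Add 12 5 31, Add 13 10 0]) (Seq (While 12 sample_body) (seqs [Add 10 10 8, Sub 11 11 2]))"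

lemma row_address_less:
  fixes W :: nat
  assumes "r' < r" "y < W" shows "b + r' * W + y < b + r * W"
proof -
  have "Suc r' * W \<le> r * W" using assms(1) by (intro mult_le_mono1) auto
  then show ?thesis using assms(2) by simp
qed

lemma wp_rows_loop:
  assumes R0: "R0 0 = n" "R0 2 = 1" "R0 5 = s" "R0 7 = J" "R0 8 = W" "R0 10 = 32" "R0 11 = N" "R0 31 = 0"
    and W: "W = n + J + 1" and zero: "\<And>a. 32 \<le> a \<Longrightarrow> R0 a = 0"
    and xs: "length xs = N * s" "set xs \<subseteq> {1..n}" and s: "1 \<le> s"
    and B: "(n + 1) * s ^ (J + 1) < 2 ^ B" "32 + N * W + W < 2 ^ B" "s + 1 < 2 ^ B" "N < 2 ^ B"
  shows "wp \<delta> B (While 11 rows_body) (N * (s * (11 * J + 14) + 8) + 1) (\<lambda>(R, xs', bs', k'). bs' = bs \<and> k' = k \<and>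
     (\<forall>a. a < 32 \<longrightarrow> a \<notin> {10..21} \<longrightarrow> R a = R0 a) \<and>
     (\<forall>r<N. \<forall>y\<in>{1..n + J}. R (32 + r * W + y) = stat n (block s r xs) y)) (R0, xs, bs, k)"
proof -
  \<comment> \<open>Cells from the current row on are still zero, which initializes the counters.
    The table is never cleared: only touched cells cost anything, so its width does not make the
    running time linear in \<open>n\<close>.\<close>
  define I where "I r = (\<lambda>(R, xs', bs', k'). xs' = drop (r * s) xs \<and> bs' = bs \<and> k' = (k::nat) \<and>
     R 10 = 32 + r * W \<and> R 11 = N - r \<and>
     (\<forall>a. a < 32 \<longrightarrow> a \<notin> {10..21} \<longrightarrow> R a = R0 a) \<and> (\<forall>a. 32 + r * W \<le> a \<longrightarrow> R a = 0) \<and>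
     (\<forall>r'<r. \<forall>y\<in>{1..n + J}. R (32 + r' * W + y) = stat n (block s r' xs) y))"
    for r :: nat
  have "wp \<delta> B (While 11 rows_body) (N * Suc (s * (11 * J + 14) + 7) + 1) (I N) (R0, xs, bs, k)"
  proof (rule wp_loop)
    fix r R xs' bs' k' assume r: "r < N" and I: "I r (R, xs', bs', k')"
    define b where "b = 32 + r * W"
    define ys where "ys = block s r xs"
    define rest where "rest = drop (Suc r * s) xs"
    have eqs: "bs' = bs" "k' = k" "R 10 = b" "R 11 = N - r" and xs'0: "xs' = drop (r * s) xs"
      and fr: "\<And>a. a < 32 \<Longrightarrow> a \<notin> {10..21} \<Longrightarrow> R a = R0 a" and z: "\<And>a. b \<le> a \<Longrightarrow> R a = 0"
      and old: "\<And>r' y. r' < r \<Longrightarrow> y \<in> {1..n + J} \<Longrightarrow> R (32 + r' * W + y) = stat n (block s r' xs) y"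
      using I by (auto simp: I_def b_def)
    have xs': "xs' = ys @ rest"
      unfolding xs'0 ys_def block_def rest_def by (metis append_take_drop_id drop_drop mult_Suc)
    have "Suc r * s \<le> N * s" using r by (intro mult_le_mono1) auto
    then have ys: "length ys = s" "set ys \<subseteq> {1..n}"
      using xs by (auto simp: ys_def block_def dest!: in_set_takeD in_set_dropD)
    have rg: "R 0 = n" "R 2 = 1" "R 5 = s" "R 7 = J" "R 8 = W" "R 31 = 0" using fr R0 by auto
    have bW: "b + W \<le> 32 + N * W + W" "b + W = 32 + Suc r * W"
      using mult_le_mono1[of r N W] r by (auto simp: b_def)
    have b32: "32 \<le> b" by (simp add: b_def)
    have lt: "n < 2 ^ B" "b < 2 ^ B" "W < 2 ^ B" "s < 2 ^ B" "N - r < 2 ^ B" "(0::nat) < 2 ^ B" "Suc 0 < 2 ^ B" "b + n + J + 1 < 2 ^ B"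
      using B bW W s by auto
    define R1 where "R1 = R(12 := s, 13 := b + n)"
    have pre: "evs [Add 12 5 31, Add 13 10 0] R = R1" using rg eqs by (simp add: R1_def)
    define P where "P = (\<lambda>(R, xs', bs', k'). xs' = rest \<and> bs' = bs \<and> k' = k \<and>
     (\<forall>a. a \<notin> insert 12 {14..21} \<longrightarrow> R a = R1 a + (if b < a \<and> a \<le> b + n + J then stat n ys (a - b) else 0)))"
    have loop: "wp \<delta> B (While 12 sample_body) (s * (11 * J + 14) + 1) P (R1, ys @ rest, bs, k)"
      unfolding P_def
      by (rule wp_sample_loop) (use rg eqs b32 z ys s B lt in \<open>auto simp: R1_def\<close>)
    have post: "wp \<delta> B (seqs [Add 10 10 8, Sub 11 11 2]) 3 (I (Suc r)) \<tau>" if "P \<tau>" for \<tau>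
    proof -
      obtain R' xs'' bs'' k'' where \<tau>: "\<tau> = (R', xs'', bs'', k'')" by (cases \<tau>)
      have e: "xs'' = rest" "bs'' = bs" "k'' = k"
        and fr1: "\<And>a. a \<notin> insert 12 {14..21} \<Longrightarrow> R' a = R1 a + (if b < a \<and> a \<le> b + n + J then stat n ys (a - b) else 0)"
        using that unfolding \<tau> P_def by auto
      have r': "R' 2 = 1" "R' 8 = W" "R' 10 = b" "R' 11 = N - r"
        using fr1 b32 rg eqs by (auto simp: R1_def)
      have ev: "evs [Add 10 10 8, Sub 11 11 2] R' = R'(10 := b + W, 11 := N - Suc r)" using r' by simp
      show ?thesis unfolding \<tau>
      proof (rule wp_seqsI)
        show "all_fit B [Add 10 10 8, Sub 11 11 2] R'" using r' lt by simp
        show "I (Suc r) (evs [Add 10 10 8, Sub 11 11 2] R', xs'', bs'', k'')"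
          unfolding I_def prod.case ev
        proof (intro conjI allI impI ballI)
          show "xs'' = drop (Suc r * s) xs" using e by (simp add: rest_def)
          show "(R'(10 := b + W, 11 := N - Suc r)) 10 = 32 + Suc r * W" using bW by simp
        next
          fix a :: nat assume a: "a < 32" "a \<notin> {10..21}"
          then show "(R'(10 := b + W, 11 := N - Suc r)) a = R0 a"
            using fr1[of a] b32 fr[of a] by (auto simp: R1_def)
        next
          fix a assume a: "32 + Suc r * W \<le> a"
          then have "b + W \<le> a" using bW by simp
          then show "(R'(10 := b + W, 11 := N - Suc r)) a = 0"
            using fr1[of a] b32 z[of a] W by (auto simp: R1_def)
        next
          fix r' y assume r': "r' < Suc r" and y: "y \<in> {1..n + J}"
          define a where "a = 32 + r' * W + y"
          have a32: "32 < a" using y by (simp add: a_def)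
          have "R' a = stat n (block s r' xs) y"
          proof (cases "r' = r")
            case True
            then have "a = b + y" by (simp add: a_def b_def)
            then show ?thesis using fr1[of a] a32 y z[of a] True b32 by (auto simp: R1_def ys_def)
          next
            case False
            then have r'r: "r' < r" using r' by simp
            have "a < b" unfolding a_def b_def by (rule row_address_less[OF r'r]) (use y W in auto)
            then show ?thesis using fr1[of a] a32 old[OF r'r y] by (auto simp: R1_def a_def)
          qed
          then show "(R'(10 := b + W, 11 := N - Suc r)) (32 + r' * W + y) = stat n (block s r' xs) y"
            using a32 by (simp add: a_def)
        qed (use e in auto)
      qed simp
    qed
    have "wp \<delta> B rows_body (3 + ((s * (11 * J + 14) + 1) + 3)) (I (Suc r)) (R, xs', bs', k')"
      unfolding rows_body_def xs' eqs
    proof (intro wp_Seq wp_seqsI)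
      show "all_fit B [Add 12 5 31, Add 13 10 0] R" using rg eqs lt by simp
      show "wp \<delta> B (While 12 sample_body) (s * (11 * J + 14) + 1) (wp \<delta> B (seqs [Add 10 10 8, Sub 11 11 2]) 3 (I (Suc r)))
        (evs [Add 12 5 31, Add 13 10 0] R, ys @ rest, bs, k)"
        unfolding pre by (rule wp_mono[OF loop]) (use post in auto)
    qed auto
    then show "wp \<delta> B rows_body (s * (11 * J + 14) + 7) (I (Suc r)) (R, xs', bs', k')" by (simp add: add.commute)
  next
    fix r R xs' bs' k' assume "r < N" "I r (R, xs', bs', k')"
    then show "R 11 \<noteq> 0 \<and> R 11 < 2 ^ B" using B(4) by (auto simp: I_def)
  next
    fix R xs' bs' k' assume "I N (R, xs', bs', k')"
    then show "R 11 = 0" by (auto simp: I_def)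
  next
    show "I 0 (R0, xs, bs, k)" using R0 zero by (auto simp: I_def)
  qed
  then show ?thesis
    by (rule wp_mono) (auto simp: I_def)
qed

section \<open>Votes over the blocks\<close>

text \<open>One of the two truncated differences is 0, so their sum is the absolute
  difference.\<close>

lemma rejects_nat: "rejects v c f x \<longleftrightarrow> f < ((v * x - c) + (c - v * x))\<^sup>2"
proof -
  have "\<bar>real v * real x - real c\<bar> = real ((v * x - c) + (c - v * x))"
    by (cases "c \<le> v * x") (auto simp: of_nat_diff abs_if simp flip: of_nat_mult)
  then have "(real v * real x - real c)\<^sup>2 = real (((v * x - c) + (c - v * x))\<^sup>2)"
    by (metis of_nat_power power2_abs)
  then show ?thesis by (simp only: rejects_def of_nat_less_iff)
qed

definition vote_loop :: com where
  "vote_loop = While 11 (Seq (seqs [Load 14 13, Mul 14 14 23, Sub 15 14 24, Sub 16 24 14, Add 15 15 16, Mul 15 15 15, Sub 15 15 25])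
     (Seq (If 15 (Add 12 12 2) Skip) (seqs [Add 13 13 8, Sub 11 11 2])))"

text \<open>Adds the truncated number \<open>2 M + 1 - N\<close> to register 22, where
  \<open>M\<close> of the \<open>N\<close> blocks reject; it is positive exactly if at least half of
  them do.\<close>

definition vote :: com where
  "vote = Seq (seqs [Const 12 0, Add 13 26 31, Add 11 6 31]) (Seq vote_loop
     (seqs [Add 12 12 12, Add 12 12 2, Sub 12 12 6, Add 22 22 12]))"

lemma wp_vote:
  assumes R0: "R0 2 = 1" "R0 6 = N" "R0 8 = W" "R0 23 = v" "R0 24 = c" "R0 25 = f" "R0 26 = y" "R0 31 = 0"
    and y: "32 \<le> y"
    and B: "\<And>r. r < N \<Longrightarrow> v * R0 (y + r * W) < 2 ^ B" "\<And>r. r < N \<Longrightarrow> R0 (y + r * W) < 2 ^ B"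
      "\<And>r. r < N \<Longrightarrow> ((v * R0 (y + r * W) - c) + (c - v * R0 (y + r * W)))\<^sup>2 < 2 ^ B"
      "y + N * W + W < 2 ^ B" "R0 22 + 2 * N + 1 < 2 ^ B" "c < 2 ^ B" "f < 2 ^ B" "v < 2 ^ B"
  defines "M \<equiv> card {r. r < N \<and> rejects v c f (R0 (y + r * W))}"
  shows "wp \<delta> B vote (14 * N + 10) (\<lambda>(R, xs', bs', k'). xs' = xs \<and> bs' = bs \<and> k' = k \<and>
     (\<forall>a. a \<notin> insert 22 {11..16} \<longrightarrow> R a = R0 a) \<and> R 22 = R0 22 + (2 * M + 1 - N)) (R0, xs, bs, k)"
proof -
  define T where "T i = card {r. r < i \<and> rejects v c f (R0 (y + r * W))}" for i
  have TS: "T (Suc i) = T i + (if rejects v c f (R0 (y + i * W)) then 1 else 0)" for i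
  proof -
    have "{r. r < Suc i \<and> rejects v c f (R0 (y + r * W))} =
      (if rejects v c f (R0 (y + i * W)) then insert i else id) {r. r < i \<and> rejects v c f (R0 (y + r * W))}"
      by (auto simp: less_Suc_eq)
    then show ?thesis by (auto simp: T_def)
  qed
  have Ti: "T i \<le> i" for i by (induction i) (auto simp: TS T_def[of 0])
  define I where "I i = (\<lambda>(R, xs', bs', k'). xs' = xs \<and> bs' = bs \<and> k' = (k::nat) \<and>
     R 11 = N - i \<and> R 12 = T i \<and> R 13 = y + i * W \<and> (\<forall>a. a \<notin> {11..16} \<longrightarrow> R a = R0 a))" for i :: nat
  have loop: "wp \<delta> B vote_loop (N * Suc 13 + 1) (I N) \<tau>" if "I 0 \<tau>" for \<tau>
    unfolding vote_loop_def
  proof (rule wp_loop)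
    fix i R xs' bs' k' assume i: "i < N" and I: "I i (R, xs', bs', k')"
    define p where "p = y + i * W"
    define x where "x = R0 p"
    define D where "D = (v * x - c) + (c - v * x)"
    have eqs: "xs' = xs" "bs' = bs" "k' = k" "R 11 = N - i" "R 12 = T i" "R 13 = p"
      and fr: "\<And>a. a \<notin> {11..16} \<Longrightarrow> R a = R0 a"
      using I by (auto simp: I_def p_def)
    have p32: "32 \<le> p" using y by (simp add: p_def)
    have rg: "R 2 = 1" "R 8 = W" "R 23 = v" "R 24 = c" "R 25 = f" "R p = x"
      using fr R0 p32 by (auto simp: x_def)
    have bx: "v * x < 2 ^ B" "x < 2 ^ B" "D\<^sup>2 < 2 ^ B" using B(1-3)[OF i] by (auto simp: x_def p_def D_def)
    have pW: "p + W \<le> y + N * W + W" using mult_le_mono1[of i N W] i by (simp add: p_def)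
    have D1: "D < 2 ^ B"
      using bx(3) by (rule le_less_trans[rotated]) (simp add: power2_eq_square le_square)
    have lt: "v * x - c < 2 ^ B" "c - v * x < 2 ^ B" "D * D < 2 ^ B" "p < 2 ^ B" "W < 2 ^ B" "Suc 0 < 2 ^ B" "N - i < 2 ^ B" "T i < 2 ^ B"
      using bx B pW Ti[of i] i y by (auto simp: power2_eq_square)
    define R1 where "R1 = R(14 := v * x, 15 := D * D - f, 16 := c - v * x)"
    have pre: "evs [Load 14 13, Mul 14 14 23, Sub 15 14 24, Sub 16 24 14, Add 15 15 16, Mul 15 15 15, Sub 15 15 25] R = R1"
      using rg eqs by (simp add: R1_def D_def mult.commute fun_upd_twist)
    have fit: "all_fit B [Load 14 13, Mul 14 14 23, Sub 15 14 24, Sub 16 24 14, Add 15 15 16, Mul 15 15 15, Sub 15 15 25] R"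
      using rg eqs bx lt D1 B(6-8) by (simp add: D_def mult.commute)
    have rej: "R1 15 \<noteq> 0 \<longleftrightarrow> rejects v c f x" by (simp add: R1_def rejects_nat D_def power2_eq_square not_le)
    define R2 where "R2 = R1(12 := T (Suc i))"
    have mid: "wp \<delta> B (If 15 (Add 12 12 2) Skip) 2 (\<lambda>\<sigma>. \<sigma> = (R2, xs, bs, k)) (R1, xs, bs, k)"
    proof -
      have "wp \<delta> B (if R1 15 \<noteq> 0 then Add 12 12 2 else Skip) 1 (\<lambda>\<sigma>. \<sigma> = (R2, xs, bs, k)) (R1, xs, bs, k)"
      proof (cases "rejects v c f x")
        case True
        have "wp \<delta> B (Add 12 12 2) 1 (\<lambda>\<sigma>. \<sigma> = (R2, xs, bs, k)) (R1, xs, bs, k)"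
          by (rule wp_arith) (use eqs rg lt True TS[of i] in \<open>auto simp: R1_def R2_def x_def p_def\<close>)
        then show ?thesis using True rej by simp
      next
        case False
        have "R1 12 = T (Suc i)" using False TS[of i] eqs by (simp add: R1_def x_def p_def)
        then have "R2 = R1" by (auto simp: R2_def fun_eq_iff)
        then show ?thesis using False rej wp_Skip[of "\<lambda>\<sigma>. \<sigma> = (R2, xs, bs, k)" "(R1, xs, bs, k)"] by simp
      qed
      moreover have "R1 15 < 2 ^ B" using lt(3) by (simp add: R1_def)
      ultimately have "wp \<delta> B (If 15 (Add 12 12 2) Skip) (Suc 1) (\<lambda>\<sigma>. \<sigma> = (R2, xs, bs, k)) (R1, xs, bs, k)"
        by (intro wp_If)
      then show ?thesis by (simp add: numeral_2_eq_2)
    qed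
    have post: "wp \<delta> B (seqs [Add 13 13 8, Sub 11 11 2]) 3 (I (Suc i)) (R2, xs, bs, k)"
    proof (rule wp_seqsI)
      show "all_fit B [Add 13 13 8, Sub 11 11 2] R2" using eqs rg lt by (simp add: R2_def R1_def)
      show "I (Suc i) (evs [Add 13 13 8, Sub 11 11 2] R2, xs, bs, k)"
        using eqs rg fr by (auto simp: I_def R2_def R1_def p_def)
    qed simp
    have "wp \<delta> B (Seq (seqs [Load 14 13, Mul 14 14 23, Sub 15 14 24, Sub 16 24 14, Add 15 15 16, Mul 15 15 15, Sub 15 15 25])
     (Seq (If 15 (Add 12 12 2) Skip) (seqs [Add 13 13 8, Sub 11 11 2]))) (8 + (2 + 3)) (I (Suc i)) (R, xs, bs, k)"
    proof (intro wp_Seq wp_seqsI[OF fit])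
      show "wp \<delta> B (If 15 (Add 12 12 2) Skip) 2 (wp \<delta> B (seqs [Add 13 13 8, Sub 11 11 2]) 3 (I (Suc i)))
       (evs [Load 14 13, Mul 14 14 23, Sub 15 14 24, Sub 16 24 14, Add 15 15 16, Mul 15 15 15, Sub 15 15 25] R, xs, bs, k)"
        unfolding pre by (rule wp_mono[OF mid]) (use post in auto)
    qed simp
    then show "wp \<delta> B (Seq (seqs [Load 14 13, Mul 14 14 23, Sub 15 14 24, Sub 16 24 14, Add 15 15 16, Mul 15 15 15, Sub 15 15 25])
     (Seq (If 15 (Add 12 12 2) Skip) (seqs [Add 13 13 8, Sub 11 11 2]))) 13 (I (Suc i)) (R, xs', bs', k')"
      by (simp only: eqs) simp
  next
    fix i R xs' bs' k' assume "i < N" "I i (R, xs', bs', k')"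
    then show "R 11 \<noteq> 0 \<and> R 11 < 2 ^ B" using B(5) by (auto simp: I_def)
  next
    fix R xs' bs' k' assume "I N (R, xs', bs', k')"
    then show "R 11 = 0" by (auto simp: I_def)
  qed (rule that)
  have N: "N < 2 ^ B" "y < 2 ^ B" "(0::nat) < 2 ^ B" using B(4,5) by auto
  let ?Q = "\<lambda>(R, xs', bs', k'). xs' = xs \<and> bs' = bs \<and> k' = k \<and>
     (\<forall>a. a \<notin> insert 22 {11..16} \<longrightarrow> R a = R0 a) \<and> R 22 = R0 22 + (2 * M + 1 - N)"
  have post: "wp \<delta> B (seqs [Add 12 12 12, Add 12 12 2, Sub 12 12 6, Add 22 22 12]) 5 ?Q \<tau>" if I: "I N \<tau>" for \<tau>
  proof -
    obtain R' xs'' bs'' k'' where \<tau>: "\<tau> = (R', xs'', bs'', k'')" by (cases \<tau>)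
    have e: "xs'' = xs" "bs'' = bs" "k'' = k" "R' 12 = M" and fr: "\<And>a. a \<notin> {11..16} \<Longrightarrow> R' a = R0 a"
      using I unfolding \<tau> I_def T_def M_def by auto
    have r: "R' 2 = 1" "R' 6 = N" "R' 22 = R0 22" using fr R0 by auto
    have MN: "M \<le> N" using Ti[of N] by (simp add: M_def T_def)
    have lt: "M < 2 ^ B" "M + M < 2 ^ B" "Suc (M + M) < 2 ^ B" "Suc (M + M) - N < 2 ^ B" "R0 22 < 2 ^ B" "Suc 0 < 2 ^ B"
      using MN B(5) by auto
    show ?thesis unfolding \<tau>
    proof (rule wp_seqsI)
      show "all_fit B [Add 12 12 12, Add 12 12 2, Sub 12 12 6, Add 22 22 12] R'" using r e lt N by simp
      show "?Q (evs [Add 12 12 12, Add 12 12 2, Sub 12 12 6, Add 22 22 12] R', xs'', bs'', k'')"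
        using r e fr by (auto simp: mult_2)
    qed simp
  qed
  have "wp \<delta> B vote (4 + ((N * Suc 13 + 1) + 5)) ?Q (R0, xs, bs, k)"
    unfolding vote_def
  proof (intro wp_Seq wp_seqsI)
    show "all_fit B [Const 12 0, Add 13 26 31, Add 11 6 31] R0" using R0 N by simp
    show "wp \<delta> B vote_loop (N * Suc 13 + 1) (wp \<delta> B (seqs [Add 12 12 12, Add 12 12 2, Sub 12 12 6, Add 22 22 12]) 5 ?Q)
      (evs [Const 12 0, Add 13 26 31, Add 11 6 31] R0, xs, bs, k)"
    proof (rule wp_mono[OF loop])
      show "I 0 (evs [Const 12 0, Add 13 26 31, Add 11 6 31] R0, xs, bs, k)"
        using R0 by (auto simp: I_def T_def)
    qed (use post in auto)
  qed simp
  then show ?thesis by (rule wp_mono) auto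
qed

definition elem_body :: com where
  "elem_body = Seq (seqs [Add 26 26 2]) (Seq vote (seqs [Sub 27 27 2]))"

lemma wp_elem_loop:
  assumes R0: "R0 2 = 1" "R0 6 = N" "R0 8 = W" "R0 23 = v" "R0 24 = c" "R0 25 = f" "R0 26 = y" "R0 27 = E" "R0 31 = 0"
    and y: "32 \<le> y"
    and B: "\<And>i r. i \<in> {1..E} \<Longrightarrow> r < N \<Longrightarrow> v * R0 (y + i + r * W) < 2 ^ B"
      "\<And>i r. i \<in> {1..E} \<Longrightarrow> r < N \<Longrightarrow> R0 (y + i + r * W) < 2 ^ B"
      "\<And>i r. i \<in> {1..E} \<Longrightarrow> r < N \<Longrightarrow> ((v * R0 (y + i + r * W) - c) + (c - v * R0 (y + i + r * W)))\<^sup>2 < 2 ^ B"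
      "y + E + N * W + W < 2 ^ B" "R0 22 + E * (N + 1) + 2 * N + 1 < 2 ^ B" "c < 2 ^ B" "f < 2 ^ B" "v < 2 ^ B"
  defines "M \<equiv> \<lambda>i. card {r. r < N \<and> rejects v c f (R0 (y + i + r * W))}"
  shows "wp \<delta> B (While 27 elem_body) (E * (14 * N + 15) + 1) (\<lambda>(R, xs', bs', k'). xs' = xs \<and> bs' = bs \<and> k' = k \<and>
     (\<forall>a. a \<notin> {11..16} \<union> {22, 26, 27} \<longrightarrow> R a = R0 a) \<and> R 22 = R0 22 + (\<Sum>i\<in>{1..E}. 2 * M i + 1 - N)) (R0, xs, bs, k)"
proof -
  have ME: "M i \<le> N" for i
    unfolding M_def by (rule order_trans[OF card_mono[of "{..<N}"]]) auto
  \<comment> \<open>A vote adds at most \<open>N + 1\<close> to the flag, so the flag never leaves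
    the bit bound.\<close>
  have flag: "(\<Sum>i\<in>{1..j}. 2 * M i + 1 - N) \<le> j * (N + 1)" for j
  proof -
    have "(\<Sum>i\<in>{1..j}. 2 * M i + 1 - N) \<le> (\<Sum>i\<in>{1..j}. N + 1)"
    proof (intro sum_mono)
      fix i
      show "2 * M i + 1 - N \<le> N + 1" using ME[of i] by linarith
    qed
    then show ?thesis by simp
  qed
  define I where "I i = (\<lambda>(R, xs', bs', k'). xs' = xs \<and> bs' = bs \<and> k' = (k::nat) \<and>
     R 26 = y + i \<and> R 27 = E - i \<and> (\<forall>a. a \<notin> {11..16} \<union> {22, 26, 27} \<longrightarrow> R a = R0 a) \<and>
     R 22 = R0 22 + (\<Sum>i'\<in>{1..i}. 2 * M i' + 1 - N))" for i :: nat
  have "wp \<delta> B (While 27 elem_body) (E * Suc (14 * N + 14) + 1) (I E) (R0, xs, bs, k)"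
  proof (rule wp_loop)
    fix i R xs' bs' k' assume i: "i < E" and I: "I i (R, xs', bs', k')"
    have eqs: "xs' = xs" "bs' = bs" "k' = k" "R 26 = y + i" "R 27 = E - i" "R 22 = R0 22 + (\<Sum>i'\<in>{1..i}. 2 * M i' + 1 - N)"
      and fr: "\<And>a. a \<notin> {11..16} \<union> {22, 26, 27} \<Longrightarrow> R a = R0 a"
      using I by (auto simp: I_def)
    have rg: "R 2 = 1" "R 6 = N" "R 8 = W" "R 23 = v" "R 24 = c" "R 25 = f" "R 31 = 0" using fr R0 by auto
    define R1 where "R1 = R(26 := y + Suc i)"
    have pre: "evs [Add 26 26 2] R = R1" using rg eqs by (simp add: R1_def)
    have cell: "R1 (y + Suc i + r * W) = R0 (y + Suc i + r * W)" for r
      using fr[of "y + Suc i + r * W"] y by (simp add: R1_def)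
    have iE: "Suc i \<in> {1..E}" using i by simp
    have R22: "R 22 \<le> R0 22 + E * (N + 1)"
      using eqs(6) flag[of i] mult_le_mono1[of i E "N + 1"] i by linarith
    have lt: "y + i < 2 ^ B" "E - i < 2 ^ B" "Suc 0 < 2 ^ B" "y + Suc i + N * W + W < 2 ^ B" "R 22 + 2 * N + 1 < 2 ^ B"
      using B(4,5) i y R22 by auto
    define P where "P = (\<lambda>(R, xs', bs', k'). xs' = xs \<and> bs' = bs \<and> k' = k \<and>
     (\<forall>a. a \<notin> insert 22 {11..16} \<longrightarrow> R a = R1 a) \<and> R 22 = R1 22 + (2 * M (Suc i) + 1 - N))"
    have Meq: "M (Suc i) = card {r. r < N \<and> rejects v c f (R1 (y + Suc i + r * W))}"
      unfolding M_def cell ..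
    have vt: "wp \<delta> B vote (14 * N + 10) P (R1, xs, bs, k)"
      unfolding P_def Meq
    proof (rule wp_vote)
      show "R1 26 = y + Suc i" by (simp add: R1_def)
      show "v * R1 (y + Suc i + r * W) < 2 ^ B" if "r < N" for r unfolding cell by (rule B(1)[OF iE that])
      show "R1 (y + Suc i + r * W) < 2 ^ B" if "r < N" for r unfolding cell by (rule B(2)[OF iE that])
      show "((v * R1 (y + Suc i + r * W) - c) + (c - v * R1 (y + Suc i + r * W)))\<^sup>2 < 2 ^ B" if "r < N" for r
        unfolding cell by (rule B(3)[OF iE that])
      show "R1 22 + 2 * N + 1 < 2 ^ B" using lt by (simp add: R1_def)
    qed (use rg lt y B in \<open>auto simp: R1_def\<close>)
    have post: "wp \<delta> B (seqs [Sub 27 27 2]) 2 (I (Suc i)) \<tau>" if P: "P \<tau>" for \<tau>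
    proof -
      obtain R' xs'' bs'' k'' where \<tau>: "\<tau> = (R', xs'', bs'', k'')" by (cases \<tau>)
      have e: "xs'' = xs" "bs'' = bs" "k'' = k" "R' 22 = R1 22 + (2 * M (Suc i) + 1 - N)"
        and fr1: "\<And>a. a \<notin> insert 22 {11..16} \<Longrightarrow> R' a = R1 a"
        using P unfolding \<tau> P_def by auto
      have r: "R' 2 = 1" "R' 27 = E - i" "R' 26 = y + Suc i" using fr1 rg eqs by (auto simp: R1_def)
      have R122: "R1 22 = R 22" by (simp add: R1_def)
      have fr2: "R' a = R0 a" if "a \<notin> {11..16} \<union> {22, 26, 27}" for a
        using fr1[of a] fr[OF that] that by (auto simp: R1_def)
      show ?thesis unfolding \<tau>
      proof (rule wp_seqsI)
        show "all_fit B [Sub 27 27 2] R'" using r lt by simp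
        show "I (Suc i) (evs [Sub 27 27 2] R', xs'', bs'', k'')"
          using r e fr2 eqs(6) by (auto simp: I_def R122)
      qed simp
    qed
    have "wp \<delta> B elem_body (2 + ((14 * N + 10) + 2)) (I (Suc i)) (R, xs, bs, k)"
      unfolding elem_body_def
    proof (intro wp_Seq wp_seqsI)
      show "all_fit B [Add 26 26 2] R" using rg eqs lt by simp
      show "wp \<delta> B vote (14 * N + 10) (wp \<delta> B (seqs [Sub 27 27 2]) 2 (I (Suc i))) (evs [Add 26 26 2] R, xs, bs, k)"
        unfolding pre by (rule wp_mono[OF vt]) (use post in auto)
    qed simp
    then show "wp \<delta> B elem_body (14 * N + 14) (I (Suc i)) (R, xs', bs', k')"
      by (simp add: eqs add.commute)
  next
    fix i R xs' bs' k' assume "i < E" "I i (R, xs', bs', k')"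
    then show "R 27 \<noteq> 0 \<and> R 27 < 2 ^ B" using B(4) by (auto simp: I_def)
  next
    fix R xs' bs' k' assume "I E (R, xs', bs', k')"
    then show "R 27 = 0" by (auto simp: I_def)
  next
    show "I 0 (R0, xs, bs, k)" using R0 by (auto simp: I_def)
  qed
  then show ?thesis by (rule wp_mono) (auto simp: I_def)
qed

text \<open>Round \<open>i\<close> (from 1) runs the test of order \<open>i + 1\<close>. Its
  parameters are updated incrementally: \<open>n ^ i\<close> by a multiplication, the binomial by
  the exact division above. Register 28 is multiplied by \<open>q\<close> only after the vote, which
  yields the exponent \<open>i - 1\<close>, that is order minus 2.\<close>

definition coll_body :: com where
  "coll_body = Seq (seqs [Add 26 26 2, Mul 23 23 0, Sub 11 5 30, Mul 24 24 11, Add 30 30 2, Div 24 24 30, Mul 25 28 24])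
     (Seq vote (seqs [Mul 28 28 29, Sub 27 27 2]))"

lemma wp_coll_loop:
  fixes n s q E :: nat
  defines "v \<equiv> \<lambda>i. n ^ i" and "c \<equiv> \<lambda>i. s choose Suc i" and "f \<equiv> \<lambda>i. 64 * n * q ^ (i - 1) * (s choose Suc i)"
  assumes R0: "R0 0 = n" "R0 2 = 1" "R0 5 = s" "R0 6 = N" "R0 8 = W" "R0 23 = 1" "R0 24 = s" "R0 26 = y" "R0 27 = E"
      "R0 28 = 64 * n" "R0 29 = q" "R0 30 = 1" "R0 31 = 0"
    and y: "32 \<le> y"
    and B: "\<And>i r. i \<in> {1..E} \<Longrightarrow> r < N \<Longrightarrow> v i * R0 (y + i + r * W) < 2 ^ B"
      "\<And>i r. i \<in> {1..E} \<Longrightarrow> r < N \<Longrightarrow> R0 (y + i + r * W) < 2 ^ B"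
      "\<And>i r. i \<in> {1..E} \<Longrightarrow> r < N \<Longrightarrow> ((v i * R0 (y + i + r * W) - c i) + (c i - v i * R0 (y + i + r * W)))\<^sup>2 < 2 ^ B"
      "y + E + N * W + W < 2 ^ B" "R0 22 + E * (N + 1) + 2 * N + 1 < 2 ^ B"
      "\<And>i. i \<le> E \<Longrightarrow> c i * s < 2 ^ B" "\<And>i. i \<le> E \<Longrightarrow> c i < 2 ^ B"
      "\<And>i. i \<in> {1..E} \<Longrightarrow> f i < 2 ^ B" "\<And>i. i \<le> E \<Longrightarrow> v i < 2 ^ B"
      "\<And>i. i < E \<Longrightarrow> 64 * n * q ^ i < 2 ^ B" "q < 2 ^ B" "s < 2 ^ B" "n < 2 ^ B"
  defines "M \<equiv> \<lambda>i. card {r. r < N \<and> rejects (v i) (c i) (f i) (R0 (y + i + r * W))}"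
  shows "wp \<delta> B (While 27 coll_body) (E * (14 * N + 22) + 1) (\<lambda>(R, xs', bs', k').
     R 2 = 1 \<and> R 22 = R0 22 + (\<Sum>i\<in>{1..E}. 2 * M i + 1 - N)) (R0, xs, bs, k)"
proof -
  have ME: "M i \<le> N" for i
    unfolding M_def by (rule order_trans[OF card_mono[of "{..<N}"]]) auto
  have flag: "(\<Sum>i\<in>{1..j}. 2 * M i + 1 - N) \<le> j * (N + 1)" for j
  proof -
    have "(\<Sum>i\<in>{1..j}. 2 * M i + 1 - N) \<le> (\<Sum>i\<in>{1..j}. N + 1)"
    proof (intro sum_mono)
      fix i
      show "2 * M i + 1 - N \<le> N + 1" using ME[of i] by linarith
    qed
    then show ?thesis by simp
  qed
  define X where "X = {11..16} \<union> {22..28} \<union> {30::nat}"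
  define I where "I i = (\<lambda>(R, xs'::nat list, bs'::bool list, k'::nat).
     R 23 = v i \<and> R 24 = c i \<and> R 28 = 64 * n * q ^ i \<and> R 30 = Suc i \<and>
     R 26 = y + i \<and> R 27 = E - i \<and> (\<forall>a. a \<notin> X \<longrightarrow> R a = R0 a) \<and>
     R 22 = R0 22 + (\<Sum>i'\<in>{1..i}. 2 * M i' + 1 - N))" for i :: nat
  have "wp \<delta> B (While 27 coll_body) (E * Suc (14 * N + 21) + 1) (I E) (R0, xs, bs, k)"
  proof (rule wp_loop)
    fix i R xs' bs' k' assume i: "i < E" and I: "I i (R, xs', bs', k')"
    have eqs: "R 23 = v i" "R 24 = c i" "R 28 = 64 * n * q ^ i" "R 30 = Suc i"
       "R 26 = y + i" "R 27 = E - i" "R 22 = R0 22 + (\<Sum>i'\<in>{1..i}. 2 * M i' + 1 - N)"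
      and fr: "\<And>a. a \<notin> X \<Longrightarrow> R a = R0 a"
      using I by (auto simp: I_def)
    have rg: "R 0 = n" "R 2 = 1" "R 5 = s" "R 6 = N" "R 8 = W" "R 29 = q" "R 31 = 0" using fr R0 by (auto simp: X_def)
    have cs: "c i * (s - Suc i) div Suc (Suc i) = c (Suc i)" unfolding c_def by (rule binomial_step)
    have vs: "v i * n = v (Suc i)" by (simp add: v_def)
    have fs: "64 * n * q ^ i * c (Suc i) = f (Suc i)" by (simp add: f_def c_def)
    define R1 where "R1 = R(11 := s - Suc i, 23 := v (Suc i), 24 := c (Suc i), 25 := f (Suc i), 26 := y + Suc i, 30 := Suc (Suc i))"
    have pre: "evs [Add 26 26 2, Mul 23 23 0, Sub 11 5 30, Mul 24 24 11, Add 30 30 2, Div 24 24 30, Mul 25 28 24] R = R1"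
      using rg eqs cs vs fs by (simp add: R1_def fun_upd_twist)
    have iE: "Suc i \<in> {1..E}" using i by simp
    have R22: "R 22 \<le> R0 22 + E * (N + 1)"
      using eqs(7) flag[of i] mult_le_mono1[of i E "N + 1"] i by linarith
    have lt: "y + i < 2 ^ B" "E - i < 2 ^ B" "Suc 0 < 2 ^ B" "y + Suc i + N * W + W < 2 ^ B" "R 22 + 2 * N + 1 < 2 ^ B"
        "Suc i < 2 ^ B" "Suc (Suc i) < 2 ^ B" "s - Suc i < 2 ^ B"
      using B(4,5,12) i y R22 by auto
    have cs': "c i * (s - Suc i) < 2 ^ B"
      using B(6)[of i] i by (intro le_less_trans[OF mult_le_mono2[of "s - Suc i" s "c i"]]) auto
    have fit: "all_fit B [Add 26 26 2, Mul 23 23 0, Sub 11 5 30, Mul 24 24 11, Add 30 30 2, Div 24 24 30, Mul 25 28 24] R"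
      using rg eqs lt cs cs' B(7)[of i] B(7)[of "Suc i"] B(9)[of i] B(10)[of i] B(12,13) i by simp
    have cell: "R1 (y + Suc i + r * W) = R0 (y + Suc i + r * W)" for r
      using fr[of "y + Suc i + r * W"] y by (simp add: R1_def X_def)
    define P where "P = (\<lambda>(R, xs''::nat list, bs''::bool list, k''::nat). xs'' = xs' \<and> bs'' = bs' \<and> k'' = k' \<and>
     (\<forall>a. a \<notin> insert 22 {11..16} \<longrightarrow> R a = R1 a) \<and> R 22 = R1 22 + (2 * M (Suc i) + 1 - N))"
    have Meq: "M (Suc i) = card {r. r < N \<and> rejects (v (Suc i)) (c (Suc i)) (f (Suc i)) (R1 (y + Suc i + r * W))}"
      unfolding M_def cell ..
    have vt: "wp \<delta> B vote (14 * N + 10) P (R1, xs', bs', k')"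
      unfolding P_def Meq
    proof (rule wp_vote)
      show "R1 26 = y + Suc i" "R1 23 = v (Suc i)" "R1 24 = c (Suc i)" "R1 25 = f (Suc i)" by (simp_all add: R1_def)
      show "v (Suc i) * R1 (y + Suc i + r * W) < 2 ^ B" if "r < N" for r unfolding cell by (rule B(1)[OF iE that])
      show "R1 (y + Suc i + r * W) < 2 ^ B" if "r < N" for r unfolding cell by (rule B(2)[OF iE that])
      show "((v (Suc i) * R1 (y + Suc i + r * W) - c (Suc i)) + (c (Suc i) - v (Suc i) * R1 (y + Suc i + r * W)))\<^sup>2 < 2 ^ B" if "r < N" for r
        unfolding cell by (rule B(3)[OF iE that])
      show "R1 22 + 2 * N + 1 < 2 ^ B" using lt by (simp add: R1_def)
      show "c (Suc i) < 2 ^ B" "f (Suc i) < 2 ^ B" "v (Suc i) < 2 ^ B" using B(7-9) i by auto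
      show "32 \<le> y + Suc i" "y + Suc i + N * W + W < 2 ^ B" using y lt by auto
      show "R1 2 = 1" "R1 6 = N" "R1 8 = W" "R1 31 = 0" using rg by (simp_all add: R1_def)
    qed
    have post: "wp \<delta> B (seqs [Mul 28 28 29, Sub 27 27 2]) 3 (I (Suc i)) \<tau>" if P: "P \<tau>" for \<tau>
    proof -
      obtain R' xs'' bs'' k'' where \<tau>: "\<tau> = (R', xs'', bs'', k'')" by (cases \<tau>)
      have e: "R' 22 = R1 22 + (2 * M (Suc i) + 1 - N)"
        and fr1: "\<And>a. a \<notin> insert 22 {11..16} \<Longrightarrow> R' a = R1 a"
        using P unfolding \<tau> P_def by auto
      have r: "R' 2 = 1" "R' 27 = E - i" "R' 26 = y + Suc i" "R' 28 = 64 * n * q ^ i" "R' 29 = q"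
         "R' 23 = v (Suc i)" "R' 24 = c (Suc i)" "R' 30 = Suc (Suc i)"
        using fr1 rg eqs by (auto simp: R1_def)
      have R122: "R1 22 = R 22" by (simp add: R1_def)
      have fr2: "R' a = R0 a" if "a \<notin> X" for a
        using fr1[of a] fr[OF that] that by (auto simp: R1_def X_def)
      have ev: "evs [Mul 28 28 29, Sub 27 27 2] R' = R'(28 := 64 * n * q ^ Suc i, 27 := E - Suc i)"
        using r by (simp add: mult_ac)
      show ?thesis unfolding \<tau>
      proof (rule wp_seqsI)
        show "all_fit B [Mul 28 28 29, Sub 27 27 2] R'" using r lt B(10)[OF i] B(11) by simp
        show "I (Suc i) (evs [Mul 28 28 29, Sub 27 27 2] R', xs'', bs'', k'')"
          unfolding ev I_def prod.case
        proof (intro conjI allI impI)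
          fix a assume "a \<notin> X"
          then show "(R'(28 := 64 * n * q ^ Suc i, 27 := E - Suc i)) a = R0 a"
            using fr2[of a] by (auto simp: X_def)
        qed (use r e eqs(7) R122 in simp_all)
      qed simp
    qed
    have "wp \<delta> B coll_body (8 + ((14 * N + 10) + 3)) (I (Suc i)) (R, xs', bs', k')"
      unfolding coll_body_def
    proof (intro wp_Seq wp_seqsI[OF fit])
      show "wp \<delta> B vote (14 * N + 10) (wp \<delta> B (seqs [Mul 28 28 29, Sub 27 27 2]) 3 (I (Suc i)))
         (evs [Add 26 26 2, Mul 23 23 0, Sub 11 5 30, Mul 24 24 11, Add 30 30 2, Div 24 24 30, Mul 25 28 24] R, xs', bs', k')"
        unfolding pre by (rule wp_mono[OF vt]) (use post in auto)
    qed simp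
    then show "wp \<delta> B coll_body (14 * N + 21) (I (Suc i)) (R, xs', bs', k')"
      by (simp add: add.commute)
  next
    fix i R xs' bs' k' assume "i < E" "I i (R, xs', bs', k')"
    then show "R 27 \<noteq> 0 \<and> R 27 < 2 ^ B" using B(4) by (auto simp: I_def)
  next
    fix R xs' bs' k' assume "I E (R, xs', bs', k')"
    then show "R 27 = 0" by (auto simp: I_def)
  next
    show "I 0 (R0, xs, bs, k)" using R0 by (auto simp: I_def v_def c_def)
  qed
  then show ?thesis by (rule wp_mono) (use R0 in \<open>auto simp: I_def X_def\<close>)
qed

section \<open>Reading the parameters\<close>

definition len_loop :: com where
  "len_loop = While 10 (seqs [Div 10 10 9, Add 3 3 2])"

lemma wp_len_loop:
  assumes R0: "R0 2 = 1" "R0 3 = 0" "R0 9 = 2" "R0 10 = m" and m: "1 \<le> m" "m < 2 ^ B" and B: "len m < 2 ^ B" "2 < (2::nat) ^ B"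
  shows "wp \<delta> B len_loop (len m * 4 + 1) (\<lambda>(R, xs', bs', k'). xs' = xs \<and> bs' = bs \<and> k' = k \<and>
     (\<forall>a. a \<notin> {3, 10} \<longrightarrow> R a = R0 a) \<and> R 3 = len m) (R0, xs, bs, k)"
proof -
  define I where "I i = (\<lambda>(R, xs', bs', k'). xs' = xs \<and> bs' = bs \<and> k' = (k::nat) \<and>
     R 10 = m div 2 ^ i \<and> R 3 = i \<and> (\<forall>a. a \<notin> {3, 10} \<longrightarrow> R a = R0 a))" for i :: nat
  have "wp \<delta> B len_loop (len m * Suc 3 + 1) (I (len m)) (R0, xs, bs, k)"
    unfolding len_loop_def
  proof (rule wp_loop)
    fix i R xs' bs' k' assume i: "i < len m" and I: "I i (R, xs', bs', k')"
    have eqs: "xs' = xs" "bs' = bs" "k' = k" "R 10 = m div 2 ^ i" "R 3 = i" and fr: "\<And>a. a \<notin> {3, 10} \<Longrightarrow> R a = R0 a"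
      using I by (auto simp: I_def)
    have rg: "R 2 = 1" "R 9 = 2" using fr R0 by auto
    have lt: "m div 2 ^ i < 2 ^ B" "i < 2 ^ B" "Suc 0 < 2 ^ B"
      using m(2) i B by (auto intro: le_less_trans[OF div_le_dividend])
    have dv: "m div 2 ^ i div 2 = m div 2 ^ Suc i" by (simp add: div_mult2_eq[symmetric] mult.commute)
    show "wp \<delta> B (seqs [Div 10 10 9, Add 3 3 2]) 3 (I (Suc i)) (R, xs', bs', k')"
    proof (rule wp_seqsI)
      show "all_fit B [Div 10 10 9, Add 3 3 2] R" using eqs rg lt B by simp
      show "I (Suc i) (evs [Div 10 10 9, Add 3 3 2] R, xs', bs', k')"
        using eqs rg fr dv by (auto simp: I_def)
    qed simp
  next
    fix i R xs' bs' k' assume i: "i < len m" and I: "I i (R, xs', bs', k')"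
    have "(2::nat) ^ i \<le> 2 ^ (len m - 1)" using i by (intro power_increasing) auto
    also have "\<dots> \<le> m" by (rule len_bounds(1)[OF m(1)])
    finally have "m div 2 ^ i \<noteq> 0" by (simp add: div_eq_0_iff)
    then show "R 10 \<noteq> 0 \<and> R 10 < 2 ^ B" using I m(2) by (auto simp: I_def intro: le_less_trans[OF div_le_dividend])
  next
    fix R xs' bs' k' assume "I (len m) (R, xs', bs', k')"
    then show "R 10 = 0" using len_bounds(2)[OF m(1)] by (auto simp: I_def)
  next
    show "I 0 (R0, xs, bs, k)" using R0 by (auto simp: I_def)
  qed
  then have "wp \<delta> B len_loop (len m * 4 + 1) (I (len m)) (R0, xs, bs, k)" by (simp add: numeral_eq_Suc)
  then show ?thesis by (rule wp_mono) (auto simp: I_def)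
qed

definition digit_loop :: com where
  "digit_loop = While 10 (Seq (Digit 11) (seqs [Add 4 4 2, Sub 10 2 11]))"

lemma wp_digit_loop:
  assumes R0: "R0 2 = 1" "R0 4 = 0" "R0 10 = 1" and d: "1 \<le> d" "digit \<delta> d = 1" "\<And>i. 1 \<le> i \<Longrightarrow> i < d \<Longrightarrow> digit \<delta> i = 0"
    and B: "d < 2 ^ B" "1 < (2::nat) ^ B"
  shows "wp \<delta> B digit_loop (d * 5 + 1) (\<lambda>(R, xs', bs', k'). xs' = xs \<and> bs' = bs \<and>
     (\<forall>a. a \<notin> {4, 10, 11} \<longrightarrow> R a = R0 a) \<and> R 4 = d) (R0, xs, bs, 0)"
proof -
  define I where "I i = (\<lambda>(R, xs', bs', k'). xs' = xs \<and> bs' = bs \<and> k' = i \<and>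
     R 10 = (if i < d then 1 else 0) \<and> R 4 = i \<and> (\<forall>a. a \<notin> {4, 10, 11} \<longrightarrow> R a = R0 a))" for i :: nat
  have "wp \<delta> B digit_loop (d * Suc 4 + 1) (I d) (R0, xs, bs, 0)"
    unfolding digit_loop_def
  proof (rule wp_loop)
    fix i R xs' bs' k' assume i: "i < d" and I: "I i (R, xs', bs', k')"
    have eqs: "xs' = xs" "bs' = bs" "k' = i" "R 4 = i" and fr: "\<And>a. a \<notin> {4, 10, 11} \<Longrightarrow> R a = R0 a"
      using I by (auto simp: I_def)
    have rg: "R 2 = 1" using fr R0 by auto
    define z where "z = digit \<delta> (Suc i)"
    have z: "z = (if Suc i < d then 0 else 1)"
    proof (cases "Suc i < d")
      case False
      then have "d = Suc i" using i by simp
      then show ?thesis using d(2) by (simp add: z_def)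
    qed (use d(3)[of "Suc i"] in \<open>simp add: z_def\<close>)
    have z1: "z \<le> 1" "z < 2 ^ B" "i < 2 ^ B" "Suc 0 < 2 ^ B" using z B i by auto
    have "wp \<delta> B (Seq (Digit 11) (seqs [Add 4 4 2, Sub 10 2 11])) (1 + 3) (I (Suc i)) (R, xs', bs', k')"
      unfolding eqs
    proof (intro wp_Seq wp_Digit wp_seqsI)
      show "all_fit B [Add 4 4 2, Sub 10 2 11] (R(11 := digit \<delta> (Suc i)))"
        using rg eqs z1 by (simp add: z_def[symmetric])
      show "I (Suc i) (evs [Add 4 4 2, Sub 10 2 11] (R(11 := digit \<delta> (Suc i))), xs, bs, Suc i)"
        using rg eqs fr z unfolding z_def[symmetric] by (auto simp: I_def)
    qed simp
    then show "wp \<delta> B (Seq (Digit 11) (seqs [Add 4 4 2, Sub 10 2 11])) 4 (I (Suc i)) (R, xs', bs', k')" by simp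
  next
    fix i R xs' bs' k' assume "i < d" "I i (R, xs', bs', k')"
    then show "R 10 \<noteq> 0 \<and> R 10 < 2 ^ B" using B by (auto simp: I_def)
  next
    fix R xs' bs' k' assume "I d (R, xs', bs', k')"
    then show "R 10 = 0" by (auto simp: I_def)
  next
    show "I 0 (R0, xs, bs, 0)" using R0 d by (auto simp: I_def)
  qed
  then have "wp \<delta> B digit_loop (d * 5 + 1) (I d) (R0, xs, bs, 0)" by (simp add: numeral_eq_Suc)
  then show ?thesis by (rule wp_mono) (auto simp: I_def)
qed

text \<open>The position of the first binary digit 1 of \<open>\<delta>\<close> determines
  \<open>\<delta>\<close> up to a factor 2. This is the only information about
  \<open>\<delta>\<close> that the tester uses, and it is found after about
  \<open>log 2 (1 / \<delta>)\<close> digits.\<close>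

lemma first_digit:
  assumes "0 < \<delta>" "\<delta> < 1"
  obtains d where "1 \<le> d" "digit \<delta> d = 1" "\<And>i. 1 \<le> i \<Longrightarrow> i < d \<Longrightarrow> digit \<delta> i = 0"
    "(1 / 2) ^ d \<le> \<delta>" "real d \<le> log 2 (1 / \<delta>) + 1"
proof -
  define d where "d = (LEAST d. 1 \<le> 2 ^ d * \<delta>)"
  obtain d0 where "1 / \<delta> < 2 ^ d0" using real_arch_pow[of 2 "1 / \<delta>"] by auto
  then have "1 \<le> 2 ^ d0 * \<delta>" using assms by (simp add: field_simps)
  then have d1: "1 \<le> 2 ^ d * \<delta>" unfolding d_def by (rule LeastI)
  have small: "2 ^ i * \<delta> < 1" if "i < d" for i
    using not_less_Least[OF that[unfolded d_def]] by simp
  have d0: "1 \<le> d" using d1 assms by (cases d) auto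
  then obtain e where e: "d = Suc e" by (cases d) auto
  have lt2: "2 ^ d * \<delta> < 2" using small[of e] by (simp add: e)
  show thesis
  proof
    show "1 \<le> d" by (rule d0)
    have "\<lfloor>2 ^ d * \<delta>\<rfloor> = 1" using d1 lt2 by (intro floor_unique) auto
    then show "digit \<delta> d = 1" by (simp add: digit_def)
    show "digit \<delta> i = 0" if "1 \<le> i" "i < d" for i
    proof -
      have "\<lfloor>2 ^ i * \<delta>\<rfloor> = 0" using small[OF that(2)] assms by (intro floor_unique) auto
      then show ?thesis by (simp add: digit_def)
    qed
    show "(1 / 2) ^ d \<le> \<delta>" using d1 by (simp add: power_divide field_simps)
    have "2 ^ e \<le> 1 / \<delta>" using small[of e] assms by (simp add: e field_simps)
    then have "log 2 (2 ^ e) \<le> log 2 (1 / \<delta>)" using assms by (subst log_le_cancel_iff) auto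
    then show "real d \<le> log 2 (1 / \<delta>) + 1" by (simp add: e log_nat_power)
  qed
qed

text \<open>Registers: 3 \<open>len m\<close>, 4 the number \<open>d\<close> of digits of \<open>\<delta>\<close> read, 5 block size, 6 number of blocks, 7
  largest collision order \<open>J\<close>, 8 width \<open>W\<close> of a row, 10 start of the current row, 22 nonzero once some
  test has rejected, 23 to 25 the parameters \<open>v\<close>, \<open>c\<close>, \<open>f\<close> of the current test, 26 the address of its
  statistic in the first row, 31 always zero. From address 32 on there is a row of \<open>W\<close> cells for every
  block; its cell \<open>y\<close> holds \<open>stat n (block s r xs) y\<close>.\<close>

definition tester :: com where
  "tester =
     Seq (seqs [Const 2 1, Const 9 2, Add 10 1 31]) (Seq len_loop
    (Seq (seqs [Const 10 1]) (Seq digit_loop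
    (Seq (seqs [Const 11 (2 ^ 47), Mul 5 11 1, Mul 5 5 3, Const 11 10, Mul 6 9 3, Add 6 6 4, Add 6 6 11,
           Const 11 16, Mul 7 11 3, Add 8 0 7, Add 8 8 2, Const 10 32, Add 11 6 31])
    (Seq (While 11 rows_body)
    (Seq (seqs [Const 26 32, Add 23 0 31, Add 24 5 31, Const 11 16, Mul 25 11 0, Mul 25 25 5,
           Const 11 512, Mul 11 11 1, Mul 11 11 1, Sub 12 0 11, Sub 27 0 12])
    (Seq (While 27 elem_body)
    (Seq (seqs [Const 11 33, Add 26 0 11, Const 23 1, Add 24 5 31, Const 11 64, Mul 28 11 0,
           Add 29 0 5, Add 29 29 29, Const 30 1, Sub 27 7 2])
    (Seq (While 27 coll_body) (seqs [Sub 0 2 22]))))))))))"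

text \<open>Dominates the addresses, the flag and the constants of the program. The other numbers
  handled are at most its power \<open>4 * J + 8\<close>; the largest exponent arises from the
  squared differences of the collision tests, which need \<open>4 * J + 2\<close>.\<close>

definition size_bound :: "nat \<Rightarrow> nat \<Rightarrow> nat \<Rightarrow> nat \<Rightarrow> nat \<Rightarrow> nat" where
  "size_bound n m s J N = 2 ^ 48 + 512 * m ^ 2 + 64 * (n + s + 1) + (N + 3) * (n + J + 41)"

definition bit_bound :: "nat \<Rightarrow> nat \<Rightarrow> nat \<Rightarrow> nat \<Rightarrow> nat \<Rightarrow> nat" where
  "bit_bound n m s J N = (4 * J + 8) * len (size_bound n m s J N)"

definition step_bound :: "nat \<Rightarrow> nat \<Rightarrow> nat \<Rightarrow> nat \<Rightarrow> nat \<Rightarrow> nat \<Rightarrow> nat" where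
  "step_bound n m s J N d = 4 + (len m * 4 + 1) + 2 + (d * 5 + 1) + 14 + (N * (s * (11 * J + 14) + 8) + 1) + 12
     + (min n (512 * m ^ 2) * (14 * N + 15) + 1) + 11 + ((J - 1) * (14 * N + 22) + 1) + 2"

lemma fits_power:
  assumes "x \<le> size_bound n m s J N ^ e" "e \<le> 4 * J + 8"
  shows "x < 2 ^ bit_bound n m s J N"
proof -
  let ?Z = "size_bound n m s J N"
  have Z: "1 \<le> ?Z" by (simp add: size_bound_def)
  have "x \<le> ?Z ^ (4 * J + 8)" using assms power_increasing[OF assms(2) Z] by linarith
  also have "\<dots> < (2 ^ len ?Z) ^ (4 * J + 8)" using len_bounds(2)[OF Z] by (intro power_strict_mono) auto
  also have "\<dots> = 2 ^ bit_bound n m s J N" by (simp add: bit_bound_def power_mult[symmetric] mult.commute)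
  finally show ?thesis .
qed

lemma dist_square_le:
  fixes a c X :: nat
  assumes "a \<le> X" "c \<le> X" shows "((a - c) + (c - a))\<^sup>2 \<le> X\<^sup>2"
  using assms by (intro power_mono) auto

lemma tester_correct:
  assumes n: "1 \<le> n" and m: "2 \<le> m"
    and d: "1 \<le> d" "digit \<delta> d = 1" "\<And>i. 1 \<le> i \<Longrightarrow> i < d \<Longrightarrow> digit \<delta> i = 0"
    and s: "s = 2 ^ 47 * m * len m" and J: "J = 16 * len m" and N: "N = 2 * len m + d + 10"
    and xs: "length xs = N * s" "set xs \<subseteq> {1..n}"
  shows "\<exists>t. run tester n m \<delta> xs bs t (accepts n m s N J xs) \<and>
     t \<le> step_bound n m s J N d * (2 * bit_bound n m s J N + 1)"
proof -
  define B where "B = bit_bound n m s J N"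
  define Z where "Z = size_bound n m s J N"
  define W where "W = n + J + 1"
  define E where "E = min n (512 * m ^ 2)"
  define q where "q = (n + s) + (n + s)"
  have fit: "x < 2 ^ B" if "x \<le> Z ^ e" "e \<le> 4 * J + 8" for x e
    using fits_power[of x n m s J N e] that by (simp add: B_def Z_def)
  have fit1: "x < 2 ^ B" if "x \<le> Z" for x using fit[of x 1] that by simp
  have l2: "2 \<le> len m" by (rule len_ge_2[OF m])
  have s1: "1 \<le> s" using m l2 by (simp add: s)
  have J2: "2 \<le> J" using l2 by (simp add: J)
  have ZW: "(N + 3) * (W + 40) \<le> Z" and Zc: "2 ^ 48 \<le> Z" "512 * m ^ 2 \<le> Z" "64 * (n + s + 1) \<le> Z"
    by (auto simp: Z_def size_bound_def W_def add_ac)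
  have Z1: "1 \<le> Z" using Zc by simp
  have ZZ: "N * W + 40 * N + 3 * W + 120 \<le> Z" using ZW by (simp add: algebra_simps)
  have NW: "N \<le> N * W" by (simp add: W_def)
  have mZ: "m \<le> Z" "512 * m \<le> Z" using Zc(2) m by (auto simp: power2_eq_square intro: order_trans[rotated])
  have ms: "2 ^ 47 * m \<le> s" using l2 by (simp add: s)
  have lt: "n < 2 ^ B" "m < 2 ^ B" "s < 2 ^ B" "J < 2 ^ B" "N < 2 ^ B" "W < 2 ^ B" "len m < 2 ^ B" "d < 2 ^ B"
     "n + s < 2 ^ B" "q < 2 ^ B" "n + J < 2 ^ B" "2 * len m < 2 ^ B" "2 * len m + d < 2 ^ B" "16 * n < 2 ^ B"
     "s + 1 < 2 ^ B" "32 + N * W + W < 2 ^ B" "512 * m < 2 ^ B" "512 * m * m < 2 ^ B" "2 ^ 47 * m < 2 ^ B" "64 * n < 2 ^ B"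
     "Suc 0 < 2 ^ B" "2 < (2::nat) ^ B" "2 ^ 47 < (2::nat) ^ B" "1 < (2::nat) ^ B"
  proof -
    have b: "d \<le> N" "2 * len m \<le> N" "2 * len m + d \<le> N" "n \<le> W" "J \<le> W" "n + J \<le> W" by (auto simp: N W_def)
    have c: "64 * n + 64 * s + 64 \<le> Z" "512 * (m * m) \<le> Z" "281474976710656 \<le> Z" "140737488355328 * m \<le> s"
      using Zc ms by (auto simp: power2_eq_square)
    show "n < 2 ^ B" "m < 2 ^ B" "s < 2 ^ B" "J < 2 ^ B" "N < 2 ^ B" "W < 2 ^ B" "len m < 2 ^ B" "d < 2 ^ B"
     "n + s < 2 ^ B" "q < 2 ^ B" "n + J < 2 ^ B" "2 * len m < 2 ^ B" "2 * len m + d < 2 ^ B" "16 * n < 2 ^ B"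
     "s + 1 < 2 ^ B" "32 + N * W + W < 2 ^ B" "512 * m < 2 ^ B" "512 * m * m < 2 ^ B" "2 ^ 47 * m < 2 ^ B" "64 * n < 2 ^ B"
     "Suc 0 < 2 ^ B" "2 < (2::nat) ^ B" "2 ^ 47 < (2::nat) ^ B" "1 < (2::nat) ^ B"
      unfolding q_def by (rule fit1, use b c ZZ mZ NW in \<open>simp add: mult.assoc\<close>)+
  qed
  have nZ: "n + 1 \<le> Z" "s \<le> Z" "64 * n \<le> Z" "q \<le> Z" "16 * n \<le> Z" using Zc(3) by (auto simp: q_def)
  have sJZ: "s ^ k \<le> Z ^ J" "n ^ k \<le> Z ^ J" "q ^ k \<le> Z ^ J" if "k \<le> J" for k
  proof -
    have "x ^ k \<le> Z ^ J" if "x \<le> Z" for x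
      using power_mono[OF that, of k] power_increasing[OF \<open>k \<le> J\<close> Z1] by simp
    then show "s ^ k \<le> Z ^ J" "n ^ k \<le> Z ^ J" "q ^ k \<le> Z ^ J" using nZ by auto
  qed
  define T1 where "T1 i = card {r. r < N \<and> elem_test n s i (block s r xs)}" for i
  define T2 where "T2 k = card {r. r < N \<and> coll_test n s k (block s r xs)}" for k
  define F1 where "F1 = (\<Sum>i\<in>{1..E}. 2 * T1 i + 1 - N)"
  define F where "F = F1 + (\<Sum>i\<in>{1..J - 1}. 2 * T2 (Suc i) + 1 - N)"
  have TN: "T1 i \<le> N" "T2 i \<le> N" for i
    unfolding T1_def T2_def by (rule order_trans[OF card_mono[of "{..<N}"]]; auto)+
  have "F1 \<le> (\<Sum>i\<in>{1..E}. N + 1)" unfolding F1_def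
  proof (intro sum_mono)
    fix i
    show "2 * T1 i + 1 - N \<le> N + 1" using TN(1)[of i] by linarith
  qed
  then have F1: "F1 \<le> E * (N + 1)" by simp
  have "(\<Sum>i\<in>{1..J - 1}. 2 * T2 (Suc i) + 1 - N) \<le> (\<Sum>i\<in>{1..J - 1}. N + 1)"
  proof (intro sum_mono)
    fix i
    show "2 * T2 (Suc i) + 1 - N \<le> N + 1" using TN(2)[of "Suc i"] by linarith
  qed
  then have F2: "F \<le> F1 + (J - 1) * (N + 1)" unfolding F_def by simp
  have EJ: "E * (N + 1) + (J - 1) * (N + 1) + 2 * N + 1 < 2 ^ B"
  proof (rule fit1)
    have "E + (J - 1) \<le> W" by (simp add: E_def W_def)
    then have "(E + (J - 1)) * (N + 1) \<le> W * (N + 1)" by (rule mult_le_mono1)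
    moreover have "(E + (J - 1)) * (N + 1) = E * (N + 1) + (J - 1) * (N + 1)" by (rule distrib_right)
    moreover have "W * (N + 1) = N * W + W" by simp
    ultimately show "E * (N + 1) + (J - 1) * (N + 1) + 2 * N + 1 \<le> Z" using ZZ by linarith
  qed
  have FB: "F < 2 ^ B" "F1 < 2 ^ B" using F1 F2 EJ by linarith+
  \<comment> \<open>\<open>F\<close> is the final flag. A truncated summand
    \<open>2 * T + 1 - N\<close> vanishes exactly if fewer than half of the blocks reject.\<close>
  have F0: "F = 0 \<longleftrightarrow> accepts n m s N J xs"
  proof -
    have "F1 = 0 \<longleftrightarrow> (\<forall>i\<in>{1..E}. 2 * T1 i < N)" unfolding F1_def by auto
    moreover have "(\<Sum>i\<in>{1..J - 1}. 2 * T2 (Suc i) + 1 - N) = 0 \<longleftrightarrow> (\<forall>k\<in>{2..J}. 2 * T2 k < N)"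
    proof -
      have "(\<Sum>i\<in>{1..J - 1}. 2 * T2 (Suc i) + 1 - N) = 0 \<longleftrightarrow> (\<forall>i\<in>{1..J - 1}. 2 * T2 (Suc i) < N)" by auto
      also have "\<dots> \<longleftrightarrow> (\<forall>k\<in>Suc ` {1..J - 1}. 2 * T2 k < N)" by blast
      also have "Suc ` {1..J - 1} = {2..J}" using J2 by (auto simp: image_Suc_atLeastAtMost)
      finally show ?thesis .
    qed
    ultimately show ?thesis by (simp add: F_def accepts_def E_def T1_def T2_def)
  qed
  define Q where "Q = (\<lambda>(R::nat \<Rightarrow> nat, _::nat list \<times> bool list \<times> nat). (R 0 \<noteq> 0) = accepts n m s N J xs)"
  define cells where "cells R \<longleftrightarrow> (\<forall>r<N. \<forall>y\<in>{1..n + J}. R (32 + r * W + y) = stat n (block s r xs) y)" for R :: "nat \<Rightarrow> nat"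
  have len_block: "length (block s r xs) \<le> s" for r by (simp add: block_def)

  \<comment> \<open>The program is verified from its last stage backwards, the remaining program
    serving as postcondition of each stage. The truncated \<open>1 - F\<close> is nonzero exactly
    for \<open>F = 0\<close>.\<close>
  have final: "wp \<delta> B (seqs [Sub 0 2 22]) 2 Q (R, xs', bs', k')" if "R 2 = 1" "R 22 = F" for R xs' bs' k'
  proof (rule wp_seqsI)
    show "Q (evs [Sub 0 2 22] R, xs', bs', k')" using that F0 by (simp add: Q_def)
  qed (use that lt FB in simp_all)

  define code4 :: "com list" where "code4 = [Const 11 33, Add 26 0 11, Const 23 1, Add 24 5 31, Const 11 64, Mul 28 11 0,
           Add 29 0 5, Add 29 29 29, Const 30 1, Sub 27 7 2]"
  have stage4: "wp \<delta> B (Seq (seqs code4) (Seq (While 27 coll_body) (seqs [Sub 0 2 22])))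
      (11 + (((J - 1) * (14 * N + 22) + 1) + 2)) Q (R, xs', bs', k')"
    if R: "R 0 = n" "R 2 = 1" "R 5 = s" "R 6 = N" "R 7 = J" "R 8 = W" "R 22 = F1" "R 31 = 0" and cl: "cells R"
    for R xs' bs' k'
  proof -
    define R1 where "R1 = evs code4 R"
    have r1: "R1 0 = n" "R1 2 = 1" "R1 5 = s" "R1 6 = N" "R1 8 = W" "R1 23 = 1" "R1 24 = s" "R1 26 = 33 + n" "R1 27 = J - 1"
      "R1 28 = 64 * n" "R1 29 = q" "R1 30 = 1" "R1 31 = 0" "R1 22 = F1"
      using R by (simp_all add: R1_def code4_def q_def)
    have fr: "R1 a = R a" if "32 \<le> a" for a using that by (simp add: R1_def code4_def)
    have cell: "R1 (33 + n + i + r * W) = coll {1..n} (Suc i) (block s r xs)" if "i \<in> {1..J - 1}" "r < N" for i r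
    proof -
      \<comment> \<open>The offset 33 in place of 32 skips the cell of order 1, so that round
        \<open>i\<close> reads order \<open>i + 1\<close>.\<close>
      have e: "33 + n + i + r * W = 32 + r * W + (n + Suc i)" by simp
      have "n + Suc i \<in> {1..n + J}" using that J2 by auto
      then have "R (32 + r * W + (n + Suc i)) = stat n (block s r xs) (n + Suc i)"
        using cl that unfolding cells_def by blast
      moreover have "R1 (33 + n + i + r * W) = R (33 + n + i + r * W)" by (rule fr) simp
      ultimately have "R1 (33 + n + i + r * W) = stat n (block s r xs) (n + Suc i)" by (simp only: e)
      then show ?thesis by (simp add: stat_def)
    qed
    have M: "card {r. r < N \<and> rejects (n ^ i) (s choose Suc i) (64 * n * q ^ (i - 1) * (s choose Suc i)) (R1 (33 + n + i + r * W))}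
        = T2 (Suc i)" if "i \<in> {1..J - 1}" for i
    proof -
      have "q = 2 * (n + s)" "Suc i - 1 = i" "Suc i - 2 = i - 1" by (simp_all add: q_def)
      then show ?thesis unfolding T2_def coll_test_def using cell[OF that] by (intro arg_cong[of _ _ card] Collect_cong) auto
    qed
    have collZ: "coll {1..n} (Suc i) (block s r xs) \<le> Z ^ (J + 1)" if "i \<in> {1..J - 1}" for i r
    proof -
      have "coll {1..n} (Suc i) (block s r xs) \<le> n * s ^ Suc i" by (rule coll_le[OF len_block])
      also have "\<dots> \<le> Z * Z ^ J" using sJZ(1)[of "Suc i"] nZ that by (intro mult_le_mono) auto
      finally show ?thesis by simp
    qed
    have chZ: "(s choose Suc i) \<le> Z ^ J" if "i \<le> J - 1" for i
    proof -
      have "(s choose Suc i) \<le> s ^ J" by (rule binomial_le_power) (use that J2 s1 in auto)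
      then show ?thesis using sJZ(1)[of J] by simp
    qed
    have prodZ: "n ^ i * coll {1..n} (Suc i) (block s r xs) \<le> Z ^ (2 * J + 1)" if "i \<in> {1..J - 1}" for i r
    proof -
      have "n ^ i * coll {1..n} (Suc i) (block s r xs) \<le> Z ^ J * Z ^ (J + 1)"
        using sJZ(2)[of i] collZ[OF that] that by (intro mult_le_mono) auto
      moreover have "2 * J + 1 = J + (J + 1)" by simp
      ultimately show ?thesis by (simp only: power_add)
    qed
    have sums: "(\<Sum>i\<in>{1..J - 1}. 2 * card {r. r < N \<and> rejects (n ^ i) (s choose Suc i)
         (64 * n * q ^ (i - 1) * (s choose Suc i)) (R1 (33 + n + i + r * W))} + 1 - N)
       = (\<Sum>i\<in>{1..J - 1}. 2 * T2 (Suc i) + 1 - N)" using M by simp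
    have loop: "wp \<delta> B (While 27 coll_body) ((J - 1) * (14 * N + 22) + 1) (\<lambda>(R, xs', bs', k'). R 2 = 1 \<and> R 22 = F) (R1, xs', bs', k')"
      unfolding F_def sums[symmetric] r1(14)[symmetric]
    proof (rule wp_coll_loop[where y = "33 + n" and s = s and n = n and q = q])
      fix i r assume i: "i \<in> {1..J - 1}" and r: "r < N"
      show "n ^ i * R1 (33 + n + i + r * W) < 2 ^ B"
        unfolding cell[OF i r] using prodZ[OF i] by (rule fit) simp
      show "R1 (33 + n + i + r * W) < 2 ^ B"
        unfolding cell[OF i r] using collZ[OF i] by (rule fit) simp
      have "Z ^ J \<le> Z ^ (2 * J + 1)" using Z1 by (intro power_increasing) auto
      then have "(s choose Suc i) \<le> Z ^ (2 * J + 1)" using chZ[of i] i by (auto intro: order_trans)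
      then have "((n ^ i * R1 (33 + n + i + r * W) - (s choose Suc i)) + ((s choose Suc i) - n ^ i * R1 (33 + n + i + r * W)))\<^sup>2 \<le> (Z ^ (2 * J + 1))\<^sup>2"
        unfolding cell[OF i r] using prodZ[OF i] by (intro dist_square_le)
      also have "\<dots> = Z ^ (4 * J + 2)"
      proof -
        have "4 * J + 2 = (2 * J + 1) * 2" by simp
        then show ?thesis by (simp only: power_mult)
      qed
      finally show "((n ^ i * R1 (33 + n + i + r * W) - (s choose Suc i)) + ((s choose Suc i) - n ^ i * R1 (33 + n + i + r * W)))\<^sup>2 < 2 ^ B"
        by (rule fit) simp
    next
      show "33 + n + (J - 1) + N * W + W < 2 ^ B"
        by (rule fit1) (use ZZ J2 in \<open>simp add: W_def\<close>)
      show "R1 22 + (J - 1) * (N + 1) + 2 * N + 1 < 2 ^ B" using r1(14) F1 EJ by linarith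
      show "(s choose Suc i) * s < 2 ^ B" if "i \<le> J - 1" for i
      proof (rule fit)
        show "(s choose Suc i) * s \<le> Z ^ (J + 1)" using mult_le_mono[OF chZ[OF that] nZ(2)] by (simp add: mult.commute)
      qed simp
      show "(s choose Suc i) < 2 ^ B" if "i \<le> J - 1" for i using chZ[OF that] by (rule fit) simp
      show "64 * n * q ^ (i - 1) * (s choose Suc i) < 2 ^ B" if i: "i \<in> {1..J - 1}" for i
      proof (rule fit)
        have "64 * n * q ^ (i - 1) * (s choose Suc i) \<le> Z * Z ^ J * Z ^ J"
          using i by (intro mult_le_mono nZ sJZ chZ) auto
        then show "64 * n * q ^ (i - 1) * (s choose Suc i) \<le> Z ^ (1 + J + J)" by (simp only: power_add power_one_right)
      qed simp
      show "n ^ i < 2 ^ B" if "i \<le> J - 1" for i by (rule fit[OF sJZ(2)]) (use that in auto)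
      show "64 * n * q ^ i < 2 ^ B" if "i < J - 1" for i
      proof (rule fit)
        have "64 * n * q ^ i \<le> Z * Z ^ J" using that by (intro mult_le_mono nZ sJZ) auto
        then show "64 * n * q ^ i \<le> Z ^ (1 + J)" by simp
      qed simp
    qed (use r1 lt in auto)
    show ?thesis
    proof (intro wp_Seq wp_seqsI)
      show "all_fit B code4 R" using R lt by (simp add: code4_def q_def)
      show "wp \<delta> B (While 27 coll_body) ((J - 1) * (14 * N + 22) + 1) (wp \<delta> B (seqs [Sub 0 2 22]) 2 Q) (evs code4 R, xs', bs', k')"
        unfolding R1_def[symmetric] by (rule wp_mono[OF loop]) (use final in auto)
    qed (simp add: code4_def)
  qed
  define code3 :: "com list" where "code3 = [Const 26 32, Add 23 0 31, Add 24 5 31, Const 11 16, Mul 25 11 0, Mul 25 25 5,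
           Const 11 512, Mul 11 11 1, Mul 11 11 1, Sub 12 0 11, Sub 27 0 12]"
  define rest4 where "rest4 = Seq (seqs code4) (Seq (While 27 coll_body) (seqs [Sub 0 2 22]))"
  have stage3: "wp \<delta> B (Seq (seqs code3) (Seq (While 27 elem_body) rest4))
      (12 + ((E * (14 * N + 15) + 1) + (11 + (((J - 1) * (14 * N + 22) + 1) + 2)))) Q (R, xs', bs', k')"
    if R: "R 0 = n" "R 1 = m" "R 2 = 1" "R 5 = s" "R 6 = N" "R 7 = J" "R 8 = W" "R 22 = 0" "R 31 = 0" and cl: "cells R"
    for R xs' bs' k'
  proof -
    define R1 where "R1 = evs code3 R"
    \<comment> \<open>Truncated subtraction applied twice computes the minimum of \<open>n\<close>
      and \<open>512 m^2\<close>.\<close>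
    have E': "n - (n - 512 * m * m) = E" by (simp add: E_def power2_eq_square)
    have r1: "R1 0 = n" "R1 2 = 1" "R1 5 = s" "R1 6 = N" "R1 7 = J" "R1 8 = W" "R1 23 = n" "R1 24 = s" "R1 25 = 16 * n * s"
      "R1 26 = 32" "R1 27 = E" "R1 22 = 0" "R1 31 = 0"
      using R E' by (simp_all add: R1_def code3_def)
    have fr: "R1 a = R a" if "32 \<le> a" for a using that by (simp add: R1_def code3_def)
    have cell: "R1 (32 + i + r * W) = count_list (block s r xs) i" if "i \<in> {1..E}" "r < N" for i r
    proof -
      have e: "32 + i + r * W = 32 + r * W + i" by simp
      have i: "i \<in> {1..n + J}" "i \<le> n" using that by (auto simp: E_def)
      then have "R (32 + r * W + i) = stat n (block s r xs) i"
        using cl that unfolding cells_def by blast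
      moreover have "R1 (32 + i + r * W) = R (32 + i + r * W)" by (rule fr) simp
      ultimately have "R1 (32 + i + r * W) = stat n (block s r xs) i" by (simp only: e)
      then show ?thesis using i by (simp add: stat_def)
    qed
    have M: "card {r. r < N \<and> rejects n s (16 * n * s) (R1 (32 + i + r * W))} = T1 i" if "i \<in> {1..E}" for i
      unfolding T1_def elem_test_def using cell[OF that] by (intro arg_cong[of _ _ card] Collect_cong) auto
    have cnt: "count_list (block s r xs) i \<le> Z" for r i
      using count_le_length[of "block s r xs" i] len_block[of r] nZ(2) by linarith
    have prodZ: "n * count_list (block s r xs) i \<le> Z ^ 2" for r i
      unfolding power2_eq_square using nZ by (intro mult_le_mono cnt) auto
    have ZZ2: "Z \<le> Z ^ 2" using Z1 by (simp add: power2_eq_square)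
    have loop: "wp \<delta> B (While 27 elem_body) (E * (14 * N + 15) + 1) (\<lambda>(R, xs'', bs'', k''). xs'' = xs' \<and> bs'' = bs' \<and> k'' = k' \<and>
     (\<forall>a. a \<notin> {11..16} \<union> {22, 26, 27} \<longrightarrow> R a = R1 a) \<and> R 22 = R1 22 +
       (\<Sum>i\<in>{1..E}. 2 * card {r. r < N \<and> rejects n s (16 * n * s) (R1 (32 + i + r * W))} + 1 - N)) (R1, xs', bs', k')"
    proof (rule wp_elem_loop)
      fix i r assume i: "i \<in> {1..E}" and r: "r < N"
      show "n * R1 (32 + i + r * W) < 2 ^ B" unfolding cell[OF i r] using prodZ by (rule fit) simp
      show "R1 (32 + i + r * W) < 2 ^ B" unfolding cell[OF i r] using cnt by (rule fit1)
      have "((n * R1 (32 + i + r * W) - s) + (s - n * R1 (32 + i + r * W)))\<^sup>2 \<le> (Z ^ 2)\<^sup>2"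
        unfolding cell[OF i r] using prodZ nZ(2) ZZ2 by (intro dist_square_le) auto
      also have "\<dots> = Z ^ 4" by (simp flip: power_mult)
      finally show "((n * R1 (32 + i + r * W) - s) + (s - n * R1 (32 + i + r * W)))\<^sup>2 < 2 ^ B" by (rule fit) simp
    next
      show "32 + E + N * W + W < 2 ^ B" by (rule fit1) (use ZZ in \<open>simp add: W_def E_def\<close>)
      show "R1 22 + E * (N + 1) + 2 * N + 1 < 2 ^ B" using r1(12) EJ by linarith
      show "16 * n * s < 2 ^ B"
      proof (rule fit)
        show "16 * n * s \<le> Z ^ 2" unfolding power2_eq_square by (intro mult_le_mono nZ)
      qed simp
    qed (use r1 lt in auto)
    have sums: "(\<Sum>i\<in>{1..E}. 2 * card {r. r < N \<and> rejects n s (16 * n * s) (R1 (32 + i + r * W))} + 1 - N) = F1"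
      unfolding F1_def using M by simp
    show ?thesis
    proof (intro wp_Seq wp_seqsI)
      show "all_fit B code3 R" using R lt E' by (simp add: code3_def)
      show "wp \<delta> B (While 27 elem_body) (E * (14 * N + 15) + 1) (wp \<delta> B rest4 (11 + (((J - 1) * (14 * N + 22) + 1) + 2)) Q) (evs code3 R, xs', bs', k')"
        unfolding R1_def[symmetric]
      proof (rule wp_mono[OF loop order_refl])
        fix \<tau> :: state assume "(\<lambda>(R, xs'', bs'', k''). xs'' = xs' \<and> bs'' = bs' \<and> k'' = k' \<and>
     (\<forall>a. a \<notin> {11..16} \<union> {22, 26, 27} \<longrightarrow> R a = R1 a) \<and> R 22 = R1 22 +
       (\<Sum>i\<in>{1..E}. 2 * card {r. r < N \<and> rejects n s (16 * n * s) (R1 (32 + i + r * W))} + 1 - N)) \<tau>"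
        then obtain R' where \<tau>: "\<tau> = (R', xs', bs', k')" and fr': "\<And>a. a \<notin> {11..16} \<union> {22, 26, 27} \<Longrightarrow> R' a = R1 a"
          and R22: "R' 22 = F1" unfolding sums r1(12) by (cases \<tau>) auto
        have "cells R'"
          unfolding cells_def
        proof (intro allI impI ballI)
          fix r y assume r: "r < N" and y: "y \<in> {1..n + J}"
          have "R' (32 + r * W + y) = R1 (32 + r * W + y)" by (rule fr') auto
          also have "\<dots> = R (32 + r * W + y)" by (rule fr) simp
          also have "\<dots> = stat n (block s r xs) y" using cl r y unfolding cells_def by blast
          finally show "R' (32 + r * W + y) = stat n (block s r xs) y" .
        qed
        then show "wp \<delta> B rest4 (11 + (((J - 1) * (14 * N + 22) + 1) + 2)) Q \<tau>"
          unfolding \<tau> rest4_def by (intro stage4 R22) (auto simp: fr' r1)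
      qed
    qed (simp add: code3_def)
  qed

  define code2 :: "com list" where "code2 = [Const 11 (2 ^ 47), Mul 5 11 1, Mul 5 5 3, Const 11 10, Mul 6 9 3, Add 6 6 4, Add 6 6 11,
           Const 11 16, Mul 7 11 3, Add 8 0 7, Add 8 8 2, Const 10 32, Add 11 6 31]"
  define rest3 where "rest3 = Seq (seqs code3) (Seq (While 27 elem_body) rest4)"
  define S3 where "S3 = 12 + ((E * (14 * N + 15) + 1) + (11 + (((J - 1) * (14 * N + 22) + 1) + 2)))"
  have stage2: "wp \<delta> B (Seq (seqs code2) (Seq (While 11 rows_body) rest3))
      (14 + ((N * (s * (11 * J + 14) + 8) + 1) + S3)) Q (R, xs, bs', k')"
    if R: "R 0 = n" "R 1 = m" "R 2 = 1" "R 3 = len m" "R 4 = d" "R 9 = 2" "R 22 = 0" "R 31 = 0"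
      and zero: "\<And>a. 32 \<le> a \<Longrightarrow> R a = 0" for R bs' k'
  proof -
    define R1 where "R1 = evs code2 R"
    have r1: "R1 0 = n" "R1 1 = m" "R1 2 = 1" "R1 5 = s" "R1 6 = N" "R1 7 = J" "R1 8 = W" "R1 10 = 32" "R1 11 = N" "R1 22 = 0" "R1 31 = 0"
      using R by (simp_all add: R1_def code2_def s N J W_def)
    have z1: "R1 a = 0" if "32 \<le> a" for a using that zero[OF that] by (simp add: R1_def code2_def)
    have loop: "wp \<delta> B (While 11 rows_body) (N * (s * (11 * J + 14) + 8) + 1) (\<lambda>(R, xs', bs'', k''). bs'' = bs' \<and> k'' = k' \<and>
     (\<forall>a. a < 32 \<longrightarrow> a \<notin> {10..21} \<longrightarrow> R a = R1 a) \<and> cells R) (R1, xs, bs', k')"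
      unfolding cells_def
    proof (rule wp_rows_loop)
      show "(n + 1) * s ^ (J + 1) < 2 ^ B"
      proof (rule fit)
        have "(n + 1) * (s ^ J * s) \<le> Z * (Z ^ J * Z)" by (intro mult_le_mono nZ sJZ order_refl)
        then show "(n + 1) * s ^ (J + 1) \<le> Z ^ (J + 2)" by (simp add: mult_ac)
      qed simp
    qed (use r1 z1 xs s1 lt in \<open>auto simp: W_def\<close>)
    show ?thesis
    proof (intro wp_Seq wp_seqsI)
      have "2 * len m + d + 10 < 2 ^ B" "2 ^ 47 * m * len m < 2 ^ B" "16 * len m < 2 ^ B" "n + 16 * len m < 2 ^ B"
        "n + 16 * len m + 1 < 2 ^ B" using lt by (auto simp: s N J W_def)
      then show "all_fit B code2 R" using R lt by (simp add: code2_def)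
      show "wp \<delta> B (While 11 rows_body) (N * (s * (11 * J + 14) + 8) + 1) (wp \<delta> B rest3 S3 Q) (evs code2 R, xs, bs', k')"
        unfolding R1_def[symmetric]
      proof (rule wp_mono[OF loop order_refl])
        fix \<tau> :: state assume "(\<lambda>(R, xs', bs'', k''). bs'' = bs' \<and> k'' = k' \<and>
     (\<forall>a. a < 32 \<longrightarrow> a \<notin> {10..21} \<longrightarrow> R a = R1 a) \<and> cells R) \<tau>"
        then obtain R' xs' where \<tau>: "\<tau> = (R', xs', bs', k')" and fr': "\<And>a. a < 32 \<Longrightarrow> a \<notin> {10..21} \<Longrightarrow> R' a = R1 a"
          and cl: "cells R'" by (cases \<tau>) auto
        show "wp \<delta> B rest3 S3 Q \<tau>"
          unfolding \<tau> rest3_def S3_def by (intro stage3 cl) (auto simp: fr' r1 r1(2)[unfolded One_nat_def])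
      qed
    qed (simp add: code2_def)
  qed

  define rest2 where "rest2 = Seq (seqs code2) (Seq (While 11 rows_body) rest3)"
  define S2 where "S2 = 14 + ((N * (s * (11 * J + 14) + 8) + 1) + S3)"
  define R0 :: "nat \<Rightarrow> nat" where "R0 = (\<lambda>_. 0)(0 := n, 1 := m)"
  define Ra where "Ra = evs [Const 2 1, Const 9 2, Add 10 1 31] R0"
  have ra: "Ra 0 = n" "Ra 1 = m" "Ra 2 = 1" "Ra 3 = 0" "Ra 4 = 0" "Ra 9 = 2" "Ra 10 = m" "Ra 22 = 0" "Ra 31 = 0"
    and za: "\<And>a. 32 \<le> a \<Longrightarrow> Ra a = 0"
    by (simp_all add: Ra_def R0_def)
  have m1: "1 \<le> m" using m by simp
  have stage1: "wp \<delta> B (Seq (seqs [Const 10 1]) (Seq digit_loop rest2)) (2 + ((d * 5 + 1) + S2)) Q (R, xs, bs, 0)"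
    if fr: "\<And>a. a \<notin> {3, 10} \<Longrightarrow> R a = Ra a" and R3: "R 3 = len m" for R
  proof (intro wp_Seq wp_seqsI)
    show "all_fit B [Const 10 1] R" using lt by simp
    have r: "(R(10 := 1)) 2 = 1" "(R(10 := 1)) 4 = 0" "(R(10 := 1)) 10 = 1" using fr ra by auto
    show "wp \<delta> B digit_loop (d * 5 + 1) (wp \<delta> B rest2 S2 Q) (evs [Const 10 1] R, xs, bs, 0)"
    proof -
      have "wp \<delta> B digit_loop (d * 5 + 1) (wp \<delta> B rest2 S2 Q) (R(10 := 1), xs, bs, 0)"
      proof (rule wp_mono[OF wp_digit_loop[OF r d lt(8) lt(24)] order_refl])
        fix \<tau> :: state assume "(\<lambda>(R', xs', bs', k'). xs' = xs \<and> bs' = bs \<and>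
           (\<forall>a. a \<notin> {4, 10, 11} \<longrightarrow> R' a = (R(10 := 1)) a) \<and> R' 4 = d) \<tau>"
        then obtain R' k' where \<tau>: "\<tau> = (R', xs, bs, k')" and fr': "\<And>a. a \<notin> {4, 10, 11} \<Longrightarrow> R' a = (R(10 := 1)) a"
          and R4: "R' 4 = d" by (cases \<tau>) auto
        show "wp \<delta> B rest2 S2 Q \<tau>"
          unfolding \<tau> rest2_def S2_def by (intro stage2 R4) (auto simp: fr' fr R3 ra ra(2)[unfolded One_nat_def] za)
      qed
      then show ?thesis by simp
    qed
  qed simp
  have "wp \<delta> B (Seq (seqs [Const 2 1, Const 9 2, Add 10 1 31]) (Seq len_loop (Seq (seqs [Const 10 1]) (Seq digit_loop rest2))))
      (4 + ((len m * 4 + 1) + (2 + ((d * 5 + 1) + S2)))) Q (R0, xs, bs, 0)"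
  proof (intro wp_Seq wp_seqsI)
    show "all_fit B [Const 2 1, Const 9 2, Add 10 1 31] R0" using lt by (simp add: R0_def)
    show "wp \<delta> B len_loop (len m * 4 + 1) (wp \<delta> B (Seq (seqs [Const 10 1]) (Seq digit_loop rest2)) (2 + ((d * 5 + 1) + S2)) Q)
      (evs [Const 2 1, Const 9 2, Add 10 1 31] R0, xs, bs, 0)"
      unfolding Ra_def[symmetric]
    proof (rule wp_mono[OF wp_len_loop[OF ra(3,4,6,7) m1 lt(2) lt(7) lt(22)] order_refl])
      fix \<tau> :: state assume "(\<lambda>(R, xs', bs', k'). xs' = xs \<and> bs' = bs \<and> k' = 0 \<and>
           (\<forall>a. a \<notin> {3, 10} \<longrightarrow> R a = Ra a) \<and> R 3 = len m) \<tau>"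
      then obtain R' where \<tau>: "\<tau> = (R', xs, bs, 0)" and "\<And>a. a \<notin> {3, 10} \<Longrightarrow> R' a = Ra a" "R' 3 = len m"
        by (cases \<tau>) auto
      then show "wp \<delta> B (Seq (seqs [Const 10 1]) (Seq digit_loop rest2)) (2 + ((d * 5 + 1) + S2)) Q \<tau>"
        unfolding \<tau> by (intro stage1)
    qed
  qed simp
  then have "wp \<delta> B tester (step_bound n m s J N d) Q ((\<lambda>_. 0)(0 := n, 1 := m), xs, bs, 0)"
    unfolding tester_def rest2_def rest3_def rest4_def code2_def code3_def code4_def S2_def S3_def step_bound_def R0_def E_def
    by (rule wp_mono) simp_all
  from run_wpI[OF this[unfolded Q_def]] show ?thesis unfolding B_def .
qed

section \<open>Sample size and running time\<close>

lemma len_le_self: "len x \<le> x"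
  by (rule len_le) (rule less_exp)

lemma len_mult_le: "len (a * b) \<le> len a + len b"
proof (cases "a = 0 \<or> b = 0")
  case False
  then have "a < 2 ^ len a" "b < 2 ^ len b" using len_bounds(2) by auto
  then have "a * b < 2 ^ len a * 2 ^ len b" by (intro mult_strict_mono) auto
  then show ?thesis by (intro len_le) (simp add: power_add)
qed (auto simp: floorlog_def)

lemma len_le_log: "1 \<le> n \<Longrightarrow> real (len n) \<le> log 2 (real n) + 1"
proof -
  assume n: "1 \<le> n"
  have "real (2 ^ (len n - 1)) \<le> real n" using len_bounds(1)[OF n] by (rule of_nat_mono)
  then have "log 2 (2 ^ (len n - 1)) \<le> log 2 (real n)" using n by (subst log_le_cancel_iff) auto
  moreover have "1 \<le> len n" using len_bounds(2)[OF n] n by (cases "len n") auto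
  ultimately show ?thesis by (simp add: log_nat_power of_nat_diff)
qed

lemma log2_le_ln: "1 \<le> x \<Longrightarrow> log 2 x \<le> 3 / 2 * ln x"
proof -
  assume x: "1 \<le> (x::real)"
  have "2 / 3 * log 2 x \<le> ln 2 * log 2 x" using ln2_ge_two_thirds x by (intro mult_right_mono) auto
  also have "\<dots> = ln x" using x by (simp add: log_def)
  finally show ?thesis by simp
qed

text \<open>The number of blocks is of order \<open>ln (m / \<delta>)\<close>, and the factor
  \<open>len m\<close> of the block size is at most \<open>3 * ln m\<close>, hence at most
  \<open>9 / 2 * (ln m)^2\<close>, because \<open>ln m \<ge> 2 / 3\<close>.\<close>

lemma sample_size_le:
  assumes m: "2 \<le> m" and \<delta>: "0 < \<delta>" "\<delta> < 1" and d: "real d \<le> log 2 (1 / \<delta>) + 1"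
  shows "real ((2 * len m + d + 10) * (2 ^ 47 * m * len m)) \<le> 2 ^ 54 * real m * (ln (real m))\<^sup>2 * ln (real m / \<delta>)"
proof -
  define a where "a = ln (real m)"
  define b where "b = ln (1 / \<delta>)"
  have "ln 2 \<le> a" unfolding a_def using m by (subst ln_le_cancel_iff) auto
  then have a: "2 / 3 \<le> a" using ln2_ge_two_thirds by linarith
  have b: "0 \<le> b" unfolding b_def using \<delta> by (intro ln_ge_zero) auto
  have ab: "ln (real m / \<delta>) = a + b"
    using m \<delta> by (simp add: a_def b_def ln_div)
  have "real (len m) \<le> 3 / 2 * a + 1"
    using len_le_log[of m] log2_le_ln[of "real m"] m by (simp add: a_def)
  then have l: "real (len m) \<le> 3 * a" using a by linarith
  have aa: "2 / 3 * a \<le> a * a" using a by (intro mult_right_mono) auto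
  have l2: "real (len m) \<le> 9 / 2 * a\<^sup>2" using l aa unfolding power2_eq_square by linarith
  have "real d \<le> 3 / 2 * b + 1" using d log2_le_ln[of "1 / \<delta>"] \<delta> by (simp add: b_def)
  then have N: "real (2 * len m + d + 10) \<le> 24 * (a + b)" using l a b by simp
  have "real ((2 * len m + d + 10) * (2 ^ 47 * m * len m)) = real (2 * len m + d + 10) * (2 ^ 47 * real m * real (len m))"
    by simp
  also have "\<dots> \<le> 24 * (a + b) * (2 ^ 47 * real m * (9 / 2 * a\<^sup>2))"
    using N l2 a b by (intro mult_mono) auto
  also have "\<dots> = 108 * 2 ^ 47 * (real m * a\<^sup>2 * (a + b))" by simp
  also have "\<dots> \<le> 2 ^ 54 * (real m * a\<^sup>2 * (a + b))" using a b by (intro mult_right_mono) auto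
  finally show ?thesis by (simp add: ab a_def mult.assoc)
qed

text \<open>A factor \<open>n\<close> is split off so that \<open>n\<close> enters through
  \<open>len n\<close> only. For the cofactor the crude \<open>len x \<le> x\<close> is enough, as
  the running time may be polynomial in \<open>m\<close> and
  \<open>log 2 (1 / \<delta>)\<close>.\<close>

lemma size_bound_len_le:
  assumes n: "1 \<le> n"
  shows "len (size_bound n m s J N) \<le> len n + (2 ^ 48 + 512 * m ^ 2 + 64 * (s + 2) + (N + 3) * (J + 42))"
proof -
  let ?G = "2 ^ 48 + 512 * m ^ 2 + 64 * (s + 2) + (N + 3) * (J + 42)"
  have "size_bound n m s J N \<le> n * ?G"
  proof -
    have 1: "x \<le> n * x" for x using n by simp
    have "n + s + 1 \<le> n * (s + 2)" using 1[of "s + 1"] by (simp add: algebra_simps)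
    moreover have "n + J + 41 \<le> n * (J + 42)" using 1[of "J + 41"] by (simp add: algebra_simps)
    then have "(N + 3) * (n + J + 41) \<le> (N + 3) * (n * (J + 42))" by (rule mult_le_mono2)
    moreover have "n * ?G = n * 2 ^ 48 + n * (512 * m ^ 2) + 64 * (n * (s + 2)) + (N + 3) * (n * (J + 42))"
      by (simp add: algebra_simps)
    moreover have "2 ^ 48 + 512 * m ^ 2 + 64 * (n + s + 1) + (N + 3) * (n + J + 41) \<le>
        n * 2 ^ 48 + n * (512 * m ^ 2) + 64 * (n * (s + 2)) + (N + 3) * (n * (J + 42))"
      by (intro add_mono 1 mult_le_mono2) (use calculation in auto)
    ultimately show ?thesis unfolding size_bound_def by linarith
  qed
  then have "len (size_bound n m s J N) \<le> len (n * ?G)" by (rule floorlog_mono)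
  also have "\<dots> \<le> len n + len ?G" by (rule len_mult_le)
  also have "\<dots> \<le> len n + ?G" by (intro add_left_mono len_le_self)
  finally show ?thesis .
qed

text \<open>With \<open>s\<close> quadratic and \<open>J\<close>, \<open>N\<close> linear in
  \<open>Y\<close>, filling the table dominates the step count with order \<open>N * s * J\<close>,
  that is \<open>Y ^ 4\<close>; bit lengths are \<open>J\<close> times a quadratic, that is
  \<open>Y ^ 3\<close>.\<close>

lemma cost_le:
  assumes n: "1 \<le> n" and m: "2 \<le> m" and \<delta>: "0 < \<delta>" "\<delta> < 1" and d: "real d \<le> log 2 (1 / \<delta>) + 1"
    and s: "s = 2 ^ 47 * m * len m" and J: "J = 16 * len m" and N: "N = 2 * len m + d + 10"
    and Y: "Y = real m + log 2 (real n) + log 2 (1 / \<delta>)"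
  shows "real (step_bound n m s J N d * (2 * bit_bound n m s J N + 1)) \<le> 2 ^ 200 * Y ^ 7"
proof -
  have ln: "0 \<le> log 2 (real n)" and ld: "0 \<le> log 2 (1 / \<delta>)" using n \<delta> by simp_all
  have Ym: "real m \<le> Y" using ln ld by (simp add: Y)
  have Y2: "2 \<le> Y" using Ym m by linarith
  have Y1: "1 \<le> Y" using Y2 by simp
  have pw: "Y ^ i \<le> Y ^ j" if "i \<le> j" for i j using that Y1 by (rule power_increasing)
  have l: "real (len m) \<le> Y" using Ym len_le_self[of m] by (meson of_nat_le_iff order_trans)
  have dY: "real d \<le> 2 * Y" using d ln ld Y2 by (simp add: Y)
  have lnY: "real (len n) \<le> 2 * Y" using len_le_log[OF n] ln ld Y2 by (simp add: Y)
  have JY: "real J \<le> 16 * Y" using l by (simp add: J)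
  have NY: "real N \<le> 9 * Y" using l dY Y2 by (simp add: N)
  have sY: "real s \<le> 2 ^ 47 * Y ^ 2"
  proof -
    have "real m * real (len m) \<le> Y * Y" using Ym l Y1 by (intro mult_mono) auto
    then show ?thesis by (simp add: s power2_eq_square)
  qed
  have mY: "real (512 * m ^ 2) \<le> 512 * Y ^ 2" using Ym by (simp add: power_mono)
  have prod: "real (a * b) \<le> (A * B) * Y ^ (i + j)" if "real a \<le> A * Y ^ i" "real b \<le> B * Y ^ j" "0 \<le> A" for a b A B i j
  proof -
    have "real a * real b \<le> (A * Y ^ i) * (B * Y ^ j)" using that Y1 by (intro mult_mono) auto
    then show ?thesis by (simp add: power_add mult_ac)
  qed
  have up: "A * Y ^ i \<le> A * Y ^ j" if "i \<le> j" "0 \<le> A" for A i j using pw[OF that(1)] that(2) by (rule mult_left_mono)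
  have J1: "real (11 * J + 14) \<le> 183 * Y ^ 1" using JY Y2 by simp
  have sJ: "real (s * (11 * J + 14)) \<le> (2 ^ 47 * 183) * Y ^ (2 + 1)" by (rule prod[OF sY J1]) simp
  have Y3: "1 \<le> Y ^ 3" using Y1 by simp
  have sJ8: "real (s * (11 * J + 14) + 8) \<le> 2 ^ 55 * Y ^ 3" using sJ Y3 by simp
  have N1: "real N \<le> 9 * Y ^ 1" using NY by simp
  have rows: "real (N * (s * (11 * J + 14) + 8)) \<le> (9 * 2 ^ 55) * Y ^ (1 + 3)" by (rule prod[OF N1 sJ8]) simp
  have E: "real (min n (512 * m ^ 2)) \<le> 512 * Y ^ 2" 
    using order_trans[OF of_nat_mono[OF min.cobounded2] mY] .
  have N15: "real (14 * N + 15) \<le> 134 * Y ^ 1" using NY Y2 by simp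
  have elems: "real (min n (512 * m ^ 2) * (14 * N + 15)) \<le> (512 * 134) * Y ^ (2 + 1)" by (rule prod[OF E N15]) simp
  have N22: "real (14 * N + 22) \<le> 137 * Y ^ 1" using NY Y2 by simp
  have J1': "real (J - 1) \<le> 16 * Y ^ 1" using JY by simp
  have colls: "real ((J - 1) * (14 * N + 22)) \<le> (16 * 137) * Y ^ (1 + 1)" by (rule prod[OF J1' N22]) simp
  have Y4: "1 \<le> Y ^ 4" "Y \<le> Y ^ 4" "Y ^ 2 \<le> Y ^ 4" "Y ^ 3 \<le> Y ^ 4"
    using pw[of 0 4] pw[of 1 4] pw[of 2 4] pw[of 3 4] by auto
  have step: "real (step_bound n m s J N d) \<le> 2 ^ 60 * Y ^ 4"
  proof -
    have "real (step_bound n m s J N d) = 50 + 4 * real (len m) + 5 * real d + real (N * (s * (11 * J + 14) + 8))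
       + real (min n (512 * m ^ 2) * (14 * N + 15)) + real ((J - 1) * (14 * N + 22))"
      unfolding step_bound_def by (simp only: of_nat_add of_nat_mult of_nat_numeral of_nat_1)
    also have "\<dots> \<le> 50 + 4 * Y + 10 * Y + (9 * 2 ^ 55) * Y ^ 4 + (512 * 134) * Y ^ 3 + (16 * 137) * Y ^ 2"
    proof (intro add_mono)
      show "real (N * (s * (11 * J + 14) + 8)) \<le> (9 * 2 ^ 55) * Y ^ 4" using rows by simp
      show "real (min n (512 * m ^ 2) * (14 * N + 15)) \<le> (512 * 134) * Y ^ 3" using elems by simp
      show "real ((J - 1) * (14 * N + 22)) \<le> (16 * 137) * Y ^ 2" using colls by (simp add: numeral_2_eq_2)
    qed (use l dY in auto)
    also have "\<dots> \<le> 2 ^ 60 * Y ^ 4" using Y4 by simp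
    finally show ?thesis .
  qed
  have lenZ: "real (len (size_bound n m s J N)) \<le> 2 ^ 60 * Y ^ 2"
  proof -
    have N3: "real (N + 3) \<le> 11 * Y ^ 1" using NY Y2 by simp
    have J42: "real (J + 42) \<le> 37 * Y ^ 1" using JY Y2 by simp
    have NJ: "real ((N + 3) * (J + 42)) \<le> (11 * 37) * Y ^ (1 + 1)" by (rule prod[OF N3 J42]) simp
    have "len (size_bound n m s J N) \<le> len n + (2 ^ 48 + 512 * m ^ 2 + 64 * (s + 2) + (N + 3) * (J + 42))"
      by (rule size_bound_len_le[OF n])
    then have "real (len (size_bound n m s J N)) \<le> real (len n + (2 ^ 48 + 512 * m ^ 2 + 64 * (s + 2) + (N + 3) * (J + 42)))"
      by (rule of_nat_mono)
    also have "\<dots> = real (len n) + 2 ^ 48 + real (512 * m ^ 2) + 64 * real s + 128 + real ((N + 3) * (J + 42))"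
      by simp
    also have "\<dots> \<le> 2 * Y + 2 ^ 48 + 512 * Y ^ 2 + 64 * (2 ^ 47 * Y ^ 2) + 128 + (11 * 37) * Y ^ 2"
    proof (intro add_mono mult_left_mono sY mY lnY order_refl)
      show "real ((N + 3) * (J + 42)) \<le> (11 * 37) * Y ^ 2" using NJ by (simp add: numeral_2_eq_2)
    qed auto
    also have "\<dots> \<le> 2 ^ 60 * Y ^ 2"
      using pw[of 0 2] pw[of 1 2] by simp
    finally show ?thesis .
  qed
  have bits: "real (2 * bit_bound n m s J N + 1) \<le> 2 ^ 70 * Y ^ 3"
  proof -
    have J8: "real (4 * J + 8) \<le> 68 * Y ^ 1" using JY Y2 by simp
    have "real (bit_bound n m s J N) \<le> (68 * 2 ^ 60) * Y ^ (1 + 2)"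
      unfolding bit_bound_def by (rule prod[OF J8 lenZ]) simp
    then have "real (bit_bound n m s J N) \<le> (68 * 2 ^ 60) * Y ^ 3" by (simp add: power3_eq_cube)
    then show ?thesis using Y3 by simp
  qed
  have "real (step_bound n m s J N d * (2 * bit_bound n m s J N + 1)) \<le> (2 ^ 60 * 2 ^ 70) * Y ^ (4 + 3)"
    by (rule prod[OF step bits]) simp
  also have "\<dots> \<le> 2 ^ 200 * Y ^ 7" using Y1 by (simp add: mult_right_mono)
  finally show ?thesis .
qed

section \<open>Output probabilities and the tester's guarantee\<close>

lemma prob_output_no_coins:
  "prob_output c n m \<delta> m' 0 p b = measure_pmf.prob (replicate_pmf m' p) {xs. \<exists>t. run c n m \<delta> xs [] t b}"
  by (simp add: prob_output_def pair_return_pmf2 vimage_def)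

lemma prob_output_ge:
  assumes "\<And>xs. xs \<in> set_pmf (replicate_pmf m' p) \<Longrightarrow> P xs \<Longrightarrow> \<exists>t. run c n m \<delta> xs [] t b"
  shows "measure_pmf.prob (replicate_pmf m' p) {xs. P xs} \<le> prob_output c n m \<delta> m' 0 p b"
proof -
  let ?M = "replicate_pmf m' p"
  have "measure_pmf.prob ?M {xs. P xs} = measure_pmf.prob ?M ({xs. P xs} \<inter> set_pmf ?M)"
    by (simp add: measure_Int_set_pmf)
  also have "\<dots> \<le> measure_pmf.prob ?M {xs. \<exists>t. run c n m \<delta> xs [] t b}"
    using assms by (intro measure_pmf.finite_measure_mono) auto
  finally show ?thesis by (simp only: prob_output_no_coins)
qed

theorem theorem6p1:
  shows "\<exists>C::real. C > 0 \<and>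
    (\<exists>(tester :: com) (q :: real poly).
      \<forall>(n::nat) (m::nat) (\<delta>::real). n \<ge> 1 \<and> m \<ge> 2 \<and> 0 < \<delta> \<and> \<delta> < 1 \<longrightarrow>
        (\<exists>(m'::nat) (r::nat).
          real m' \<le> C * real m * (ln (real m))\<^sup>2 * ln (real m / \<delta>) \<and>
          halts_within tester n m \<delta> m' r (poly q (real m + log 2 (real n) + log 2 (1 / \<delta>))) \<and>
          (\<forall>p \<in> dists n.
            (p = unif n \<longrightarrow> prob_output tester n m \<delta> m' r p True \<ge> 1 - \<delta>) \<and>
            (p \<noteq> unif n \<and> opt n p \<le> enat m \<longrightarrow>
               prob_output tester n m \<delta> m' r p False \<ge> 1 - \<delta>))))"
\<comment> \<open>The constant comes from \<open>sample_size_le\<close> and the polynomial from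
  \<open>cost_le\<close>.\<close>
proof (intro exI[of _ "2 ^ 54 :: real"] conjI exI[of _ tester] exI[of _ "monom (2 ^ 200) 7 :: real poly"] allI impI)
  show "(0::real) < 2 ^ 54" by simp
  fix n m :: nat and \<delta> :: real
  assume "n \<ge> 1 \<and> m \<ge> 2 \<and> 0 < \<delta> \<and> \<delta> < 1"
  then have n: "1 \<le> n" and m: "2 \<le> m" and \<delta>: "0 < \<delta>" "\<delta> < 1" by auto
  obtain d where d: "1 \<le> d" "digit \<delta> d = 1" "\<And>i. 1 \<le> i \<Longrightarrow> i < d \<Longrightarrow> digit \<delta> i = 0"
    and d\<delta>: "(1 / 2) ^ d \<le> \<delta>" and dlog: "real d \<le> log 2 (1 / \<delta>) + 1"
    using first_digit[OF \<delta>] by blast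
  define s where "s = 2 ^ 47 * m * len m"
  define J where "J = 16 * len m"
  define N where "N = 2 * len m + d + 10"
  have run: "\<exists>t. run tester n m \<delta> xs bs t (accepts n m s N J xs) \<and>
      t \<le> step_bound n m s J N d * (2 * bit_bound n m s J N + 1)"
    if "length xs = N * s" "set xs \<subseteq> {1..n}" for xs bs
    by (rule tester_correct[OF n m d s_def J_def N_def that])
  have out: "\<exists>t. run tester n m \<delta> xs [] t (accepts n m s N J xs)"
    if "p \<in> dists n" "xs \<in> set_pmf (replicate_pmf (N * s) p)" for p xs
    using run[of xs "[]"] that by (auto simp: dists_def set_replicate_pmf lists_eq_set)
  show "\<exists>m' r. real m' \<le> 2 ^ 54 * real m * (ln (real m))\<^sup>2 * ln (real m / \<delta>) \<and>
          halts_within tester n m \<delta> m' r (poly (monom (2 ^ 200) 7) (real m + log 2 (real n) + log 2 (1 / \<delta>))) \<and>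
          (\<forall>p \<in> dists n.
            (p = unif n \<longrightarrow> prob_output tester n m \<delta> m' r p True \<ge> 1 - \<delta>) \<and>
            (p \<noteq> unif n \<and> opt n p \<le> enat m \<longrightarrow>
               prob_output tester n m \<delta> m' r p False \<ge> 1 - \<delta>))"
  \<comment> \<open>The tester is deterministic, so the coin tape has length 0 and all randomness
    comes from the samples.\<close>
  proof (rule exI[of _ "N * s"], rule exI[of _ 0], intro conjI ballI impI)
    show "real (N * s) \<le> 2 ^ 54 * real m * (ln (real m))\<^sup>2 * ln (real m / \<delta>)"
      unfolding N_def s_def by (rule sample_size_le[OF m \<delta> dlog])
    show "halts_within tester n m \<delta> (N * s) 0 (poly (monom (2 ^ 200) 7) (real m + log 2 (real n) + log 2 (1 / \<delta>)))"
      unfolding halts_within_def poly_monom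
    proof (intro allI impI)
      fix xs and bs :: "bool list" assume "length xs = N * s \<and> set xs \<subseteq> {1..n} \<and> length bs = 0"
      then obtain t where t: "run tester n m \<delta> xs bs t (accepts n m s N J xs)"
        "t \<le> step_bound n m s J N d * (2 * bit_bound n m s J N + 1)" using run[of xs bs] by blast
      have "real t \<le> real (step_bound n m s J N d * (2 * bit_bound n m s J N + 1))"
        using t(2) by (rule of_nat_mono)
      also have "\<dots> \<le> 2 ^ 200 * (real m + log 2 (real n) + log 2 (1 / \<delta>)) ^ 7"
        by (rule cost_le[OF n m \<delta> dlog s_def J_def N_def refl])
      finally show "\<exists>t b. run tester n m \<delta> xs bs t b \<and> real t \<le> 2 ^ 200 * (real m + log 2 (real n) + log 2 (1 / \<delta>)) ^ 7"
        using t(1) by blast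
    qed
  next
    fix p assume p: "p \<in> dists n" "p = unif n"
    have "1 - \<delta> \<le> 1 - (1 / 2) ^ d" using d\<delta> by simp
    also have "\<dots> \<le> measure_pmf.prob (replicate_pmf (N * s) p) {xs. accepts n m s N J xs}"
      unfolding p(2) by (rule prob_accepts_unif[OF n m s_def J_def N_def])
    also have "\<dots> \<le> prob_output tester n m \<delta> (N * s) 0 p True"
      by (rule prob_output_ge) (use out[OF p(1)] in metis)
    finally show "1 - \<delta> \<le> prob_output tester n m \<delta> (N * s) 0 p True" .
  next
    fix p assume p: "p \<in> dists n" and "p \<noteq> unif n \<and> opt n p \<le> enat m"
    then have opt: "opt n p \<le> enat m" by simp
    have "1 - \<delta> \<le> 1 - (1 / 2) ^ d" using d\<delta> by simp
    also have "\<dots> \<le> measure_pmf.prob (replicate_pmf (N * s) p) {xs. \<not> accepts n m s N J xs}"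
      by (rule prob_accepts_far[OF n m p opt s_def J_def N_def])
    also have "\<dots> \<le> prob_output tester n m \<delta> (N * s) 0 p False"
      by (rule prob_output_ge) (use out[OF p] in metis)
    finally show "1 - \<delta> \<le> prob_output tester n m \<delta> (N * s) 0 p False" .
  qed
qed

end
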